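(* Let $n,k,\ell$ be positive integers and $q$ a prime power. For each matrix $\Delta\in \mathrm{M}_n(\mathbb{F}_q)$, we have $\psi_{k,\ell}(\Delta)=\langle F_\Delta,G(n,k,\ell)\rangle$, where $$G(n,k,\ell)=q^{-nk}\sum_{\substack{\mu\vdash n \\ \ell(\mu)\leq \ell }} (-1)^{n-\mu_1}(q-1)^{\mu_1}q^{\sum_{j\geq 1}\binom{\mu_j}{2}}{k \brack \mu_1}_q [\mu_1]_q!\, \widetilde{W}_{\mu}(x;q).$$
   Context: Krylov subspaces: for $S=\{v_1,\ldots,v_k\}\subseteq\mathbb{F}_q^n$, the truncated Krylov subspace of order $\ell$ is $\mathrm{Kry}(\Delta,S,\ell)=\{\sum_{i=1}^kf_i(\Delta)v_i: f_i\in\mathbb{F}_q[x],\ \deg f_i<\ell\}$. Define $$\psi_{k,\ell}(\Delta)=\frac1{q^{nk}}\big|\{(v_1,\ldots,v_k)\in(\mathbb{F}_q^n)^k:\mathrm{Kry}(\Delta,\{v_1,\ldots,v_k\},\ell)=\mathbb{F}_q^n\}\big|.$$ Invariant flag generating function: for a weak composition $\alpha=(\alpha_1,\ldots,\alpha_s)$ of $n$ (a finite sequence of nonnegative integers with sum $n$, trailing zeros ignored), $X_\alpha(\Delta)$ is the number of flags $(0)=W_0\subseteq W_1\subseteq\cdots\subseteq W_s=\mathbb{F}_q^n$ of $\Delta$-invariant subspaces with $\dim W_i/W_{i-1}=\alpha_i$ for $1\le i\le s$. $F_\Delta(x)=\sum_\alpha X_\alpha(\Delta)x^\alpha$, sum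 over all weak compositions of $n$ up to trailing zeros; it is a symmetric function in $x=(x_1,x_2,\ldots)$. Notation: $\mu\vdash n$ means $\mu$ is a partition of $n$; $\ell(\mu)$ is its number of nonzero parts. $[m]_q!=[1]_q\cdots[m]_q$ with $[i]_q=1+q+\cdots+q^{i-1}$; ${k\brack m}_q$ is the Gaussian binomial coefficient, zero if $m>k$. $\langle\cdot,\cdot\rangle$ is the Hall scalar product (monomial functions $m_\lambda$ dual to complete homogeneous $h_\lambda$); $\omega$ is the involution with $\omega e_\lambda=h_\lambda$. $P_\lambda(x;t)$ are the Hall-Littlewood symmetric functions (Macdonald's normalization, coefficient of $m_\lambda$ equal to $1$), $H_\lambda(x;t)$ the basis dual to $P_\lambda(x;t)$, $W_\lambda(x;t)=\omega H_{\lambda'}(x;t)$ the $q$-Whittaker functions ($\lambda'$ the conjugate partition), and $\widetilde W_\lambda(x;t)$ the basis dual to $W_\lambda(x;t)$; equivalently $\widetilde W_\lambda(x;t)=\omega P_{\lambda'}(x;t)$. $\widetilde W_\mu(x;q)$ is the specialization $t=q$. *)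

theory Defs
  imports
    "HOL-Analysis.Analysis"
    "HOL-Library.Poly_Mapping"
    "HOL-Combinatorics.Permutations"
    "HOL-Computational_Algebra.Polynomial"
    "HOL-Computational_Algebra.Fraction_Field"
begin

section \<open>Weak compositions and partitions\<close>

text \<open>
  A finitely supported map \<open>nat \<Rightarrow>\<^sub>0 nat\<close> is a weak composition up to trailing zeros, and
  equally an exponent vector of a monomial.  Indices start at 0: \<open>lookup \<alpha> i\<close> is the entry
  usually written \<open>\<alpha>_(i+1)\<close>, and the variables are \<open>x_0, x_1, ...\<close>.  Partitions are the weakly
  decreasing ones.
\<close>

abbreviation lookup :: "('a \<Rightarrow>\<^sub>0 'b::zero) \<Rightarrow> 'a \<Rightarrow> 'b"
  where "lookup \<equiv> Poly_Mapping.lookup"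

abbreviation keys :: "('a \<Rightarrow>\<^sub>0 'b::zero) \<Rightarrow> 'a set"
  where "keys \<equiv> Poly_Mapping.keys"

definition weight :: "(nat \<Rightarrow>\<^sub>0 nat) \<Rightarrow> nat"
  where "weight \<alpha> = (\<Sum>i\<in>keys \<alpha>. lookup \<alpha> i)"

definition is_partition :: "(nat \<Rightarrow>\<^sub>0 nat) \<Rightarrow> bool"
  where "is_partition \<mu> \<longleftrightarrow> antimono (lookup \<mu>)"

definition partitions_of :: "nat \<Rightarrow> (nat \<Rightarrow>\<^sub>0 nat) set"
  where "partitions_of n = {\<mu>. is_partition \<mu> \<and> weight \<mu> = n}"

definition num_parts :: "(nat \<Rightarrow>\<^sub>0 nat) \<Rightarrow> nat"
  where "num_parts \<mu> = card (keys \<mu>)"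

lemma finite_lookup_greater: "finite {i. j < lookup (\<mu> :: nat \<Rightarrow>\<^sub>0 nat) i}"
  by (rule finite_subset[OF _ finite_keys[of \<mu>]]) (auto simp: in_keys_iff)

lift_definition conjugate :: "(nat \<Rightarrow>\<^sub>0 nat) \<Rightarrow> (nat \<Rightarrow>\<^sub>0 nat)"
  is "\<lambda>\<mu> j. card {i. j < \<mu> i}"
proof -
  fix \<mu> :: "nat \<Rightarrow> nat"
  assume fin: "finite {i. \<mu> i \<noteq> 0}"
  have "{j. card {i. j < \<mu> i} \<noteq> 0} \<subseteq> (\<Union>i\<in>{i. \<mu> i \<noteq> 0}. {..<\<mu> i})"
  proof
    fix j assume "j \<in> {j. card {i. j < \<mu> i} \<noteq> 0}"
    then have "{i. j < \<mu> i} \<noteq> {}" by force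
    then obtain i where "j < \<mu> i" by blast
    then show "j \<in> (\<Union>i\<in>{i. \<mu> i \<noteq> 0}. {..<\<mu> i})" by (intro UN_I[of i]) auto
  qed
  then show "finite {j. card {i. j < \<mu> i} \<noteq> 0}"
    by (rule finite_subset) (use fin in auto)
qed

lemma weight_superset:
  "finite A \<Longrightarrow> keys \<alpha> \<subseteq> A \<Longrightarrow> weight \<alpha> = (\<Sum>i\<in>A. lookup \<alpha> i)"
  unfolding weight_def by (intro sum.mono_neutral_left) (auto simp: in_keys_iff)

lemma weight_add: "weight (\<alpha> + \<beta>) = weight \<alpha> + weight \<beta>"
proof -
  let ?A = "keys \<alpha> \<union> keys \<beta>"
  have "weight (\<alpha> + \<beta>) = (\<Sum>i\<in>?A. lookup (\<alpha> + \<beta>) i)"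
    by (rule weight_superset) (auto simp: in_keys_iff lookup_add)
  also have "\<dots> = (\<Sum>i\<in>?A. lookup \<alpha> i) + (\<Sum>i\<in>?A. lookup \<beta> i)"
    by (simp add: lookup_add sum.distrib)
  also have "\<dots> = weight \<alpha> + weight \<beta>"
    by (simp add: weight_superset[of ?A \<alpha>] weight_superset[of ?A \<beta>])
  finally show ?thesis .
qed

lemma lookup_le_weight: "lookup \<alpha> i \<le> weight \<alpha>"
proof (cases "i \<in> keys \<alpha>")
  case True
  then show ?thesis unfolding weight_def by (intro member_le_sum) auto
qed (simp add: in_keys_iff)

lemma finite_bounded_exponents:
  assumes "finite A"
  shows "finite {\<alpha>. keys \<alpha> \<subseteq> A \<and> weight \<alpha> \<le> d}"
proof -
  let ?F = "{f :: nat \<Rightarrow> nat. \<forall>i. (i \<in> A \<longrightarrow> f i \<in> {..d}) \<and> (i \<notin> A \<longrightarrow> f i = 0)}"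
  have "finite ?F" using assms by (intro finite_set_of_finite_funs) auto
  moreover have "lookup ` {\<alpha>. keys \<alpha> \<subseteq> A \<and> weight \<alpha> \<le> d} \<subseteq> ?F"
  proof (intro image_subsetI CollectI allI conjI impI)
    fix \<alpha> i assume \<alpha>: "\<alpha> \<in> {\<alpha>. keys \<alpha> \<subseteq> A \<and> weight \<alpha> \<le> d}"
    show "lookup \<alpha> i \<in> {..d}"
      using \<alpha> lookup_le_weight[of \<alpha> i] by simp
    show "lookup \<alpha> i = 0" if "i \<notin> A"
      using \<alpha> that in_keys_iff[of i \<alpha>] by blast
  qed
  ultimately have "finite (lookup ` {\<alpha>. keys \<alpha> \<subseteq> A \<and> weight \<alpha> \<le> d})"
    by (rule rev_finite_subset)
  then show ?thesis by (rule finite_imageD) (simp add: inj_on_def poly_mapping_eqI)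
qed

definition splits :: "(nat \<Rightarrow>\<^sub>0 nat) \<Rightarrow> ((nat \<Rightarrow>\<^sub>0 nat) \<times> (nat \<Rightarrow>\<^sub>0 nat)) set"
  where "splits \<alpha> = {(\<beta>, \<gamma>). \<beta> + \<gamma> = \<alpha>}"

lemma finite_splits: "finite (splits \<alpha>)"
proof -
  let ?A = "{\<beta>. keys \<beta> \<subseteq> keys \<alpha> \<and> weight \<beta> \<le> weight \<alpha>}"
  have "finite (?A \<times> ?A)" by (intro finite_cartesian_product finite_bounded_exponents) auto
  moreover have "splits \<alpha> \<subseteq> ?A \<times> ?A"
    unfolding splits_def by (auto simp: weight_add in_keys_iff lookup_add)
  ultimately show ?thesis by (rule rev_finite_subset)
qed

lemma keys_map_key_inv:
  "bij \<pi> \<Longrightarrow> keys (Poly_Mapping.map_key \<pi> \<alpha>) = inv \<pi> ` keys \<alpha>"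
  by (simp add: keys_map_key bij_is_inj bij_vimage_eq_inv_image)

lemma map_key_inv:
  assumes "bij \<pi>"
  shows "Poly_Mapping.map_key \<pi> (Poly_Mapping.map_key (inv \<pi>) \<alpha>) = \<alpha>"
    and "Poly_Mapping.map_key (inv \<pi>) (Poly_Mapping.map_key \<pi> \<alpha>) = \<alpha>"
  using assms
  by (auto intro!: poly_mapping_eqI
      simp: map_key.rep_eq bij_is_inj bij_is_surj bij_imp_bij_inv surj_f_inv_f)

lemma weight_map_key:
  assumes "bij \<pi>"
  shows "weight (Poly_Mapping.map_key \<pi> \<alpha>) = weight \<alpha>"
proof -
  have "weight \<alpha> = (\<Sum>i\<in>\<pi> ` (\<pi> -` keys \<alpha>). lookup \<alpha> i)"
    using assms by (simp add: weight_def bij_is_surj)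
  also have "\<dots> = (\<Sum>i\<in>\<pi> -` keys \<alpha>. lookup \<alpha> (\<pi> i))"
    by (subst sum.reindex) (use assms in \<open>auto intro: inj_on_subset[OF bij_is_inj]\<close>)
  also have "\<dots> = weight (Poly_Mapping.map_key \<pi> \<alpha>)"
    using assms by (simp add: weight_def keys_map_key map_key.rep_eq bij_is_inj)
  finally show ?thesis ..
qed

section \<open>The ring of symmetric functions over the reals\<close>

text \<open>
  A symmetric function is a formal power series of bounded degree in \<open>x_0, x_1, ...\<close>, given by
  its coefficient function, that is invariant under permutations of the variables.
\<close>

definition bounded_degree :: "((nat \<Rightarrow>\<^sub>0 nat) \<Rightarrow> real) \<Rightarrow> bool"
  where "bounded_degree f \<longleftrightarrow> (\<exists>d. \<forall>\<alpha>. f \<alpha> \<noteq> 0 \<longrightarrow> weight \<alpha> \<le> d)"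

definition symmetric_series :: "((nat \<Rightarrow>\<^sub>0 nat) \<Rightarrow> real) \<Rightarrow> bool"
  where "symmetric_series f \<longleftrightarrow> (\<forall>\<pi>. bij \<pi> \<longrightarrow> (\<forall>\<alpha>. f (Poly_Mapping.map_key \<pi> \<alpha>) = f \<alpha>))"

typedef symfun = "{f. bounded_degree f \<and> symmetric_series f}"
  morphisms sf_coeff Abs_symfun
  by (rule exI[of _ "\<lambda>_. 0"]) (auto simp: bounded_degree_def symmetric_series_def)

setup_lifting type_definition_symfun

lemma symfun_eqI: "(\<And>\<alpha>. sf_coeff f \<alpha> = sf_coeff g \<alpha>) \<Longrightarrow> f = g"
  by (metis ext sf_coeff_inject)

lemma symmetric_convolution:
  assumes f: "symmetric_series f" and g: "symmetric_series g"
  shows "symmetric_series (\<lambda>\<alpha>. \<Sum>(\<beta>, \<gamma>)\<in>splits \<alpha>. f \<beta> * g \<gamma>)"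
  unfolding symmetric_series_def
proof (intro allI impI)
  fix \<pi> :: "nat \<Rightarrow> nat" and \<alpha>
  assume \<pi>: "bij \<pi>"
  let ?m = "Poly_Mapping.map_key \<pi>" and ?n = "Poly_Mapping.map_key (inv \<pi>)"
  have i: "inj \<pi>" "inj (inv \<pi>)" using \<pi> by (auto simp: bij_is_inj bij_imp_bij_inv)
  have mn: "?m (?n x) = x" "?n (?m x) = x" for x :: "nat \<Rightarrow>\<^sub>0 nat"
    using map_key_inv[OF \<pi>] by auto
  show "(\<Sum>(\<beta>, \<gamma>)\<in>splits (?m \<alpha>). f \<beta> * g \<gamma>) = (\<Sum>(\<beta>, \<gamma>)\<in>splits \<alpha>. f \<beta> * g \<gamma>)"
  proof (rule sum.reindex_bij_witness[where i = "map_prod ?m ?m" and j = "map_prod ?n ?n"])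
    fix p assume "p \<in> splits (?m \<alpha>)"
    then show "map_prod ?n ?n p \<in> splits \<alpha>"
      using i mn(2)[of \<alpha>] by (auto simp: splits_def map_key_plus[symmetric])
  next
    fix p assume "p \<in> splits \<alpha>"
    then show "map_prod ?m ?m p \<in> splits (?m \<alpha>)"
      using i by (auto simp: splits_def map_key_plus[symmetric])
  next
    fix p
    show "(case map_prod ?n ?n p of (\<beta>, \<gamma>) \<Rightarrow> f \<beta> * g \<gamma>) = (case p of (\<beta>, \<gamma>) \<Rightarrow> f \<beta> * g \<gamma>)"
      using f g \<pi> by (auto simp: symmetric_series_def bij_imp_bij_inv split: prod.split)
  qed (use mn in \<open>auto simp: map_prod_def split: prod.split\<close>)
qed

lemma bounded_convolution:
  assumes f: "bounded_degree f" and g: "bounded_degree g"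
  shows "bounded_degree (\<lambda>\<alpha>. \<Sum>(\<beta>, \<gamma>)\<in>splits \<alpha>. f \<beta> * g \<gamma>)"
proof -
  obtain d e where d: "\<And>\<alpha>. f \<alpha> \<noteq> 0 \<Longrightarrow> weight \<alpha> \<le> d" and e: "\<And>\<alpha>. g \<alpha> \<noteq> 0 \<Longrightarrow> weight \<alpha> \<le> e"
    using f g unfolding bounded_degree_def by metis
  have "weight \<alpha> \<le> d + e" if nz: "(\<Sum>(\<beta>, \<gamma>)\<in>splits \<alpha>. f \<beta> * g \<gamma>) \<noteq> 0" for \<alpha>
  proof -
    obtain p where "p \<in> splits \<alpha>" "(case p of (\<beta>, \<gamma>) \<Rightarrow> f \<beta> * g \<gamma>) \<noteq> 0"
      using sum.not_neutral_contains_not_neutral[OF nz] by blast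
    then obtain \<beta> \<gamma> where "\<beta> + \<gamma> = \<alpha>" "f \<beta> \<noteq> 0" "g \<gamma> \<noteq> 0"
      by (auto simp: splits_def split: prod.splits)
    then show ?thesis using d[of \<beta>] e[of \<gamma>] by (auto simp: weight_add)
  qed
  then show ?thesis unfolding bounded_degree_def by blast
qed

instantiation symfun :: comm_ring_1
begin

lift_definition zero_symfun :: symfun is "\<lambda>_. 0"
  by (auto simp: bounded_degree_def symmetric_series_def)

lift_definition one_symfun :: symfun is "\<lambda>\<alpha>. of_bool (\<alpha> = 0)"
proof
  show "bounded_degree (\<lambda>\<alpha>. of_bool (\<alpha> = 0))"
    by (auto simp: bounded_degree_def weight_def intro!: exI[of _ 0])
  have "Poly_Mapping.map_key \<pi> \<alpha> = 0 \<longleftrightarrow> \<alpha> = 0" if "bij \<pi>" for \<pi> :: "nat \<Rightarrow> nat" and \<alpha> :: "nat \<Rightarrow>\<^sub>0 nat"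
    using keys_map_key_inv[OF that, of \<alpha>] by (metis image_is_empty keys_eq_empty)
  then show "symmetric_series (\<lambda>\<alpha>. of_bool (\<alpha> = 0))"
    by (simp add: symmetric_series_def)
qed

lift_definition plus_symfun :: "symfun \<Rightarrow> symfun \<Rightarrow> symfun" is "\<lambda>f g \<alpha>. f \<alpha> + g \<alpha>"
proof
  fix f g assume "bounded_degree f \<and> symmetric_series f" "bounded_degree g \<and> symmetric_series g"
  then obtain d e where "\<And>\<alpha>. f \<alpha> \<noteq> 0 \<Longrightarrow> weight \<alpha> \<le> d" "\<And>\<alpha>. g \<alpha> \<noteq> 0 \<Longrightarrow> weight \<alpha> \<le> e"
    unfolding bounded_degree_def by metis
  then have "f \<alpha> + g \<alpha> \<noteq> 0 \<Longrightarrow> weight \<alpha> \<le> max d e" for \<alpha>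
    by (cases "f \<alpha> = 0") (auto simp: le_max_iff_disj)
  then show "bounded_degree (\<lambda>\<alpha>. f \<alpha> + g \<alpha>)" unfolding bounded_degree_def by blast
qed (auto simp: symmetric_series_def)

lift_definition uminus_symfun :: "symfun \<Rightarrow> symfun" is "\<lambda>f \<alpha>. - f \<alpha>"
  by (auto simp: bounded_degree_def symmetric_series_def)

definition minus_symfun :: "symfun \<Rightarrow> symfun \<Rightarrow> symfun"
  where "minus_symfun f g = f + - g"

lift_definition times_symfun :: "symfun \<Rightarrow> symfun \<Rightarrow> symfun"
  is "\<lambda>f g \<alpha>. \<Sum>(\<beta>, \<gamma>)\<in>splits \<alpha>. f \<beta> * g \<gamma>"
  using bounded_convolution symmetric_convolution by blast

instance
proof
  fix f g h :: symfun
  show "f + g + h = f + (g + h)" by transfer (simp add: add.assoc)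
  show "f + g = g + f" by transfer (simp add: add.commute)
  show "0 + f = f" by transfer simp
  show "- f + f = 0" by transfer simp
  show "f - g = f + - g" by (simp add: minus_symfun_def)
  show "f * g = g * f"
  proof (rule symfun_eqI)
    fix \<alpha>
    show "sf_coeff (f * g) \<alpha> = sf_coeff (g * f) \<alpha>"
      unfolding times_symfun.rep_eq
      by (rule sum.reindex_bij_witness[where i = prod.swap and j = prod.swap])
         (auto simp: splits_def add.commute mult.commute)
  qed
  show "(f + g) * h = f * h + g * h"
    by (rule symfun_eqI)
       (simp add: times_symfun.rep_eq plus_symfun.rep_eq distrib_right sum.distrib case_prod_unfold)
  show "1 * f = f"
  proof (rule symfun_eqI)
    fix \<alpha>
    have "sf_coeff (1 * f) \<alpha> = (\<Sum>(\<beta>, \<gamma>)\<in>{(0 :: nat \<Rightarrow>\<^sub>0 nat, \<alpha>)}. of_bool (\<beta> = 0) * sf_coeff f \<gamma>)"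
      unfolding times_symfun.rep_eq one_symfun.rep_eq
      by (intro sum.mono_neutral_right) (use finite_splits[of \<alpha>] in \<open>auto simp: splits_def\<close>)
    then show "sf_coeff (1 * f) \<alpha> = sf_coeff f \<alpha>" by simp
  qed
  show "f * g * h = f * (g * h)"
  proof (rule symfun_eqI)
    fix \<alpha>
    let ?f = "sf_coeff f" and ?g = "sf_coeff g" and ?h = "sf_coeff h"
    have "sf_coeff (f * g * h) \<alpha>
        = (\<Sum>p\<in>splits \<alpha>. \<Sum>r\<in>splits (fst p). ?f (fst r) * ?g (snd r) * ?h (snd p))"
      by (simp add: times_symfun.rep_eq case_prod_unfold sum_distrib_right)
    also have "\<dots> = (\<Sum>(p, r)\<in>Sigma (splits \<alpha>) (\<lambda>p. splits (fst p)).
        ?f (fst r) * ?g (snd r) * ?h (snd p))"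
      by (rule sum.Sigma) (auto simp: finite_splits)
    also have "\<dots> = (\<Sum>(p, r)\<in>Sigma (splits \<alpha>) (\<lambda>p. splits (snd p)).
        ?f (fst p) * (?g (fst r) * ?h (snd r)))"
      by (rule sum.reindex_bij_witness[where
            i = "\<lambda>((a, _), (b, c)). ((a + b, c), (a, b))" and
            j = "\<lambda>((_, c), (a, b)). ((a, b + c), (b, c))"])
         (auto simp: splits_def add.assoc)
    also have "\<dots> = (\<Sum>p\<in>splits \<alpha>. \<Sum>r\<in>splits (snd p). ?f (fst p) * (?g (fst r) * ?h (snd r)))"
      by (rule sum.Sigma[symmetric]) (auto simp: finite_splits)
    also have "\<dots> = sf_coeff (f * (g * h)) \<alpha>"
      by (simp add: times_symfun.rep_eq case_prod_unfold sum_distrib_left)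
    finally show "sf_coeff (f * g * h) \<alpha> = sf_coeff (f * (g * h)) \<alpha>" .
  qed
  show "(0::symfun) \<noteq> 1"
    by (metis of_bool_eq(2) one_symfun.rep_eq zero_neq_one zero_symfun.rep_eq)
qed

end

instantiation symfun :: real_algebra_1
begin

lift_definition scaleR_symfun :: "real \<Rightarrow> symfun \<Rightarrow> symfun" is "\<lambda>c f \<alpha>. c * f \<alpha>"
  by (auto simp: bounded_degree_def symmetric_series_def)

instance
proof
  fix a b :: real and f g :: symfun
  show "a *\<^sub>R (f + g) = a *\<^sub>R f + a *\<^sub>R g" by transfer (simp add: distrib_left)
  show "(a + b) *\<^sub>R f = a *\<^sub>R f + b *\<^sub>R f" by transfer (simp add: distrib_right)
  show "a *\<^sub>R b *\<^sub>R f = (a * b) *\<^sub>R f" by transfer (simp add: mult.assoc)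
  show "1 *\<^sub>R f = f" by transfer simp
  show "a *\<^sub>R f * g = a *\<^sub>R (f * g)"
    by transfer (simp add: sum_distrib_left case_prod_unfold mult.assoc)
  show "f * a *\<^sub>R g = a *\<^sub>R (f * g)"
    by transfer (simp add: sum_distrib_left case_prod_unfold mult_ac)
qed

end

section \<open>Classical bases, the Hall scalar product and the involution\<close>

lift_definition complete_sf :: "nat \<Rightarrow> symfun" is "\<lambda>r \<alpha>. of_bool (weight \<alpha> = r)"
  by (auto simp: bounded_degree_def symmetric_series_def weight_map_key)

lift_definition elementary_sf :: "nat \<Rightarrow> symfun"
  is "\<lambda>r \<alpha>. of_bool (weight \<alpha> = r \<and> (\<forall>i. lookup \<alpha> i \<le> 1))"
proof
  fix r
  show "bounded_degree (\<lambda>\<alpha>. of_bool (weight \<alpha> = r \<and> (\<forall>i. lookup \<alpha> i \<le> 1)))"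
    by (auto simp: bounded_degree_def)
  have *: "(\<forall>i. lookup (Poly_Mapping.map_key \<pi> \<alpha>) i \<le> 1) \<longleftrightarrow> (\<forall>i. lookup \<alpha> i \<le> 1)"
    if "bij \<pi>" for \<pi> :: "nat \<Rightarrow> nat" and \<alpha> :: "nat \<Rightarrow>\<^sub>0 nat"
    using that by (simp add: map_key.rep_eq bij_is_inj) (metis bij_pointE)
  show "symmetric_series (\<lambda>\<alpha>. of_bool (weight \<alpha> = r \<and> (\<forall>i. lookup \<alpha> i \<le> 1)))"
    unfolding symmetric_series_def by (intro allI impI) (simp only: weight_map_key *)
qed

definition h_basis :: "(nat \<Rightarrow>\<^sub>0 nat) \<Rightarrow> symfun"
  where "h_basis \<mu> = (\<Prod>i\<in>keys \<mu>. complete_sf (lookup \<mu> i))"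

definition e_basis :: "(nat \<Rightarrow>\<^sub>0 nat) \<Rightarrow> symfun"
  where "e_basis \<mu> = (\<Prod>i\<in>keys \<mu>. elementary_sf (lookup \<mu> i))"

lift_definition m_basis :: "(nat \<Rightarrow>\<^sub>0 nat) \<Rightarrow> symfun"
  is "\<lambda>\<mu> \<alpha>. of_bool (\<exists>\<pi>. bij \<pi> \<and> \<alpha> = Poly_Mapping.map_key \<pi> \<mu>)"
proof
  fix \<mu> :: "nat \<Rightarrow>\<^sub>0 nat"
  show "bounded_degree (\<lambda>\<alpha>. of_bool (\<exists>\<pi>. bij \<pi> \<and> \<alpha> = Poly_Mapping.map_key \<pi> \<mu>))"
    by (auto simp: bounded_degree_def weight_map_key intro!: exI[of _ "weight \<mu>"])
  have "(\<exists>\<pi>. bij \<pi> \<and> Poly_Mapping.map_key \<sigma> \<alpha> = Poly_Mapping.map_key \<pi> \<mu>)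
      \<longleftrightarrow> (\<exists>\<pi>. bij \<pi> \<and> \<alpha> = Poly_Mapping.map_key \<pi> \<mu>)" (is "?l \<longleftrightarrow> ?r") if \<sigma>: "bij \<sigma>"
    for \<sigma> :: "nat \<Rightarrow> nat" and \<alpha> :: "nat \<Rightarrow>\<^sub>0 nat"
  proof
    assume ?l
    then obtain \<pi> where \<pi>: "bij \<pi>" "Poly_Mapping.map_key \<sigma> \<alpha> = Poly_Mapping.map_key \<pi> \<mu>" by blast
    have "\<alpha> = Poly_Mapping.map_key (inv \<sigma>) (Poly_Mapping.map_key \<sigma> \<alpha>)"
      by (rule map_key_inv(2)[OF \<sigma>, symmetric])
    also have "\<dots> = Poly_Mapping.map_key (\<pi> \<circ> inv \<sigma>) \<mu>"
      using \<sigma> \<pi> by (simp add: map_key_compose bij_is_inj bij_imp_bij_inv)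
    finally show ?r using \<sigma> \<pi> bij_comp bij_imp_bij_inv by blast
  next
    assume ?r
    then obtain \<pi> where \<pi>: "bij \<pi>" "\<alpha> = Poly_Mapping.map_key \<pi> \<mu>" by blast
    then have "Poly_Mapping.map_key \<sigma> \<alpha> = Poly_Mapping.map_key (\<pi> \<circ> \<sigma>) \<mu>"
      using \<sigma> by (simp add: map_key_compose bij_is_inj)
    then show ?l using \<sigma> \<pi> bij_comp by blast
  qed
  then show "symmetric_series (\<lambda>\<alpha>. of_bool (\<exists>\<pi>. bij \<pi> \<and> \<alpha> = Poly_Mapping.map_key \<pi> \<mu>))"
    by (simp add: symmetric_series_def)
qed

definition hall :: "symfun \<Rightarrow> symfun \<Rightarrow> real"
  where "hall = (THE B. bilinear B \<and>
    (\<forall>\<nu> \<mu>. is_partition \<nu> \<longrightarrow> is_partition \<mu> \<longrightarrow> B (m_basis \<nu>) (h_basis \<mu>) = of_bool (\<nu> = \<mu>)))"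

definition omega :: "symfun \<Rightarrow> symfun"
  where "omega = (THE w. linear w \<and> (\<forall>\<mu>. is_partition \<mu> \<longrightarrow> w (e_basis \<mu>) = h_basis \<mu>))"

definition dual_basis :: "((nat \<Rightarrow>\<^sub>0 nat) \<Rightarrow> symfun) \<Rightarrow> (nat \<Rightarrow>\<^sub>0 nat) \<Rightarrow> symfun"
  where "dual_basis b \<nu> = (THE f. \<forall>\<mu>. is_partition \<mu> \<longrightarrow> hall f (b \<mu>) = of_bool (\<nu> = \<mu>))"

section \<open>Quantum integers\<close>

definition q_int :: "real \<Rightarrow> nat \<Rightarrow> real"
  where "q_int q i = (\<Sum>j<i. q ^ j)"

definition q_fact :: "real \<Rightarrow> nat \<Rightarrow> real"
  where "q_fact q m = (\<Prod>i=1..m. q_int q i)"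

definition q_binomial :: "real \<Rightarrow> nat \<Rightarrow> nat \<Rightarrow> real"
  where "q_binomial q k m =
    (if m \<le> k then q_fact q k / (q_fact q m * q_fact q (k - m)) else 0)"

section \<open>Hall--Littlewood and q-Whittaker functions\<close>

type_synonym mpoly = "(nat \<Rightarrow>\<^sub>0 nat) \<Rightarrow>\<^sub>0 real"

definition to_frac :: "mpoly \<Rightarrow> mpoly fract"
  where "to_frac p = Fract p 1"

definition const_frac :: "real \<Rightarrow> mpoly fract"
  where "const_frac c = to_frac (Poly_Mapping.single 0 c)"

definition var_frac :: "nat \<Rightarrow> mpoly fract"
  where "var_frac i = to_frac (Poly_Mapping.single (Poly_Mapping.single i 1) 1)"

text \<open>
  Macdonald's normalising factor \<open>v_\<nu>(t)\<close> for \<open>N\<close> variables: the product over \<open>i \<ge> 0\<close> of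
  \<open>v_(m_i)(t)\<close>, where \<open>v_m(t)\<close> is the product of \<open>(1 - t^i)/(1 - t)\<close> for \<open>1 \<le> i \<le> m\<close>, i.e.
  \<open>[m]_t!\<close>, and \<open>m_i\<close> is the number of entries equal to \<open>i\<close> among the first \<open>N\<close> (so zeros
  are counted).
\<close>

definition hl_norm :: "nat \<Rightarrow> (nat \<Rightarrow>\<^sub>0 nat) \<Rightarrow> real \<Rightarrow> real"
  where "hl_norm N \<nu> t = (\<Prod>i\<in>lookup \<nu> ` {..<N}. q_fact t (card {j. j < N \<and> lookup \<nu> j = i}))"

definition hl_finite :: "nat \<Rightarrow> (nat \<Rightarrow>\<^sub>0 nat) \<Rightarrow> real \<Rightarrow> mpoly fract"
  where "hl_finite N \<nu> t = const_frac (1 / hl_norm N \<nu> t) *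
    (\<Sum>w | w permutes {..<N}.
      (\<Prod>i<N. var_frac (w i) ^ lookup \<nu> i) *
      (\<Prod>(i, j) | i < j \<and> j < N.
         (var_frac (w i) - const_frac t * var_frac (w j)) / (var_frac (w i) - var_frac (w j))))"

text \<open>Setting all variables except \<open>x_0, ..., x_(N-1)\<close> to zero.\<close>

lift_definition restrict_vars :: "nat \<Rightarrow> symfun \<Rightarrow> mpoly"
  is "\<lambda>N f \<alpha>. if keys \<alpha> \<subseteq> {..<N} then f \<alpha> else 0"
proof -
  fix N f assume "bounded_degree f \<and> symmetric_series f"
  then obtain d where "\<And>\<alpha>. f \<alpha> \<noteq> 0 \<Longrightarrow> weight \<alpha> \<le> d"
    unfolding bounded_degree_def by blast
  then show "finite {\<alpha>. (if keys \<alpha> \<subseteq> {..<N} then f \<alpha> else 0) \<noteq> 0}"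
    by (intro finite_subset[OF _ finite_bounded_exponents[of "{..<N}" d]]) auto
qed

text \<open>
  Here \<open>t\<close> is a number rather than an indeterminate.  This is the specialisation of the
  functions with coefficients in the polynomials in \<open>t\<close> as long as \<open>hl_norm\<close> does not
  vanish, which holds for every \<open>t > 0\<close>.
\<close>

definition hall_littlewood_P :: "(nat \<Rightarrow>\<^sub>0 nat) \<Rightarrow> real \<Rightarrow> symfun"
  where "hall_littlewood_P \<nu> t =
    (THE f. \<forall>N\<ge>num_parts \<nu>. to_frac (restrict_vars N f) = hl_finite N \<nu> t)"

definition hall_littlewood_H :: "(nat \<Rightarrow>\<^sub>0 nat) \<Rightarrow> real \<Rightarrow> symfun"
  where "hall_littlewood_H \<nu> t = dual_basis (\<lambda>\<mu>. hall_littlewood_P \<mu> t) \<nu>"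

definition q_whittaker :: "(nat \<Rightarrow>\<^sub>0 nat) \<Rightarrow> real \<Rightarrow> symfun"
  where "q_whittaker \<nu> t = omega (hall_littlewood_H (conjugate \<nu>) t)"

definition dual_q_whittaker :: "(nat \<Rightarrow>\<^sub>0 nat) \<Rightarrow> real \<Rightarrow> symfun"
  where "dual_q_whittaker \<nu> t = dual_basis (\<lambda>\<mu>. q_whittaker \<mu> t) \<nu>"

section \<open>Invariant flags and Krylov subspaces\<close>

definition invariant_subspace :: "'a::field^'n^'n \<Rightarrow> ('a^'n) set \<Rightarrow> bool"
  where "invariant_subspace \<Delta> W \<longleftrightarrow> vec.subspace W \<and> (\<forall>w\<in>W. \<Delta> *v w \<in> W)"

definition invariant_flags :: "'a::field^'n^'n \<Rightarrow> nat list \<Rightarrow> ('a^'n) set list set"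
  where "invariant_flags \<Delta> \<alpha> = {W. length W = Suc (length \<alpha>) \<and>
    W ! 0 = {0} \<and> W ! length \<alpha> = UNIV \<and>
    (\<forall>i\<le>length \<alpha>. invariant_subspace \<Delta> (W ! i)) \<and>
    (\<forall>i<length \<alpha>. W ! i \<subseteq> W ! Suc i \<and> vec.dim (W ! Suc i) = vec.dim (W ! i) + \<alpha> ! i)}"

definition X_flags :: "'a::field^'n^'n \<Rightarrow> nat list \<Rightarrow> nat"
  where "X_flags \<Delta> \<alpha> = card (invariant_flags \<Delta> \<alpha>)"

text \<open>
  \<open>Poly_Mapping.degree \<alpha>\<close> is the length of \<open>\<alpha>\<close> after its trailing zeros have been removed.
  That the series below is symmetric, i.e. lies in the domain of \<^const>\<open>Abs_symfun\<close>, is a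
  theorem about \<open>\<Delta>\<close>.
\<close>

definition flag_gf :: "'a::field^'n^'n \<Rightarrow> symfun"
  where "flag_gf \<Delta> = Abs_symfun (\<lambda>\<alpha>. if weight \<alpha> = CARD('n)
    then real (X_flags \<Delta> (map (lookup \<alpha>) [0..<Poly_Mapping.degree \<alpha>])) else 0)"

text \<open>The vector \<open>f(\<Delta>) v\<close>.\<close>

definition poly_act :: "'a::field poly \<Rightarrow> 'a^'n^'n \<Rightarrow> 'a^'n \<Rightarrow> 'a^'n"
  where "poly_act f \<Delta> v = (\<Sum>j\<le>degree f. coeff f j *s (((*v) \<Delta> ^^ j) v))"

definition krylov :: "'a::field^'n^'n \<Rightarrow> ('a^'n) set \<Rightarrow> nat \<Rightarrow> ('a^'n) set"
  where "krylov \<Delta> S l =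
    {(\<Sum>v\<in>S. poly_act (f v) \<Delta> v) | f. \<forall>v\<in>S. f v = 0 \<or> degree (f v) < l}"

definition krylov_prob :: "nat \<Rightarrow> nat \<Rightarrow> 'a::{field,finite}^'n^'n \<Rightarrow> real"
  where "krylov_prob k l \<Delta> =
    real (card {vs :: ('a^'n) list. length vs = k \<and> krylov \<Delta> (set vs) l = UNIV})
      / real (CARD('a) ^ (CARD('n) * k))"

definition krylov_G :: "real \<Rightarrow> nat \<Rightarrow> nat \<Rightarrow> nat \<Rightarrow> symfun"
  where "krylov_G q n k l = (1 / q ^ (n * k)) *\<^sub>R
    (\<Sum>\<mu> | \<mu> \<in> partitions_of n \<and> num_parts \<mu> \<le> l.
      ((-1) ^ (n - lookup \<mu> 0) * (q - 1) ^ lookup \<mu> 0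
        * q ^ (\<Sum>j\<in>keys \<mu>. lookup \<mu> j choose 2)
        * q_binomial q k (lookup \<mu> 0) * q_fact q (lookup \<mu> 0))
      *\<^sub>R dual_q_whittaker \<mu> q)"

end

theory Submission
  imports Defs "HOL-Combinatorics.Multiset_Permutations"
begin

text \<open>
  The profile of a subspace \<open>W\<close> is the partition \<open>\<mu>\<close> with
  \<open>\<mu>_1 + ... + \<mu>_j = dim (W + \<Delta>W + ... + \<Delta>^(j-1)W)\<close>.  A tuple is Krylov generating of order \<open>l\<close>
  iff its span \<open>W\<close> has a profile of size \<open>n\<close> with at most \<open>l\<close> parts, so the theorem amounts to
  \<open>\<langle>F, W~_\<mu>\<rangle> = (-1)^(n - \<mu>_1) q^(- sum_(j>1) binom(\<mu>_j,2)) s_\<mu>\<close>, where \<open>s_\<mu>\<close> counts the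
  subspaces with profile \<open>\<mu>\<close>.

  Since \<open>W~_\<mu> = \<omega> P_\<mu>'\<close>, the functional \<open>f \<mapsto> \<langle>F, \<omega> f\<rangle>\<close> has to take these values at the
  Hall--Littlewood functions and the values \<open>X_\<alpha>\<close> at the products \<open>e_\<alpha>\<close>.  Both fit together
  by the Pieri rule for \<open>e_r P_\<kappa>\<close> and the identity \<open>whittaker_coeff_pieri\<close>, which expresses the
  profile counts of smaller size through those of size \<open>n\<close> with the same Pieri coefficients; as
  \<open>e_\<alpha>\<close> does not depend on the order of \<open>\<alpha>\<close>, this also shows that \<open>F\<close> is symmetric.  The
  identity follows from the vanishing of the sum of
  \<open>(-1)^(dim W) q^(binom(dim W,2) - \<theta>\<cdot>profile(W))\<close> over all subspaces \<open>W\<close>, for every partition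
  \<open>\<theta>\<close> of size less than \<open>n\<close>.
\<close>

section \<open>Quantum integers\<close>

text \<open>The coefficient of \<open>krylov_G\<close> at \<mu> is built to cancel the value of the
  pairing: what remains is (q-1)^d q^(binom(d,2)) times the q-binomial of k over d times [d]!, with
  d = \<mu>_1, and this is the number of k-tuples spanning a fixed d-dimensional space.

  The profile counts of size below n are compared with those of size n without computing either. The
  vanishing sums for all \<theta> with |\<theta>| < n form a square system in the unknowns of size
  below n, and its matrix q^(- \<theta>\<cdot>\<nu>) is shown to be nonsingular q-adically; hence
  the care for rational entries.

  Since \<open>flag_gf\<close> can be evaluated only once its series is known to be symmetric, the
  functional is defined on the Hall--Littlewood basis and not as a pairing with F. Moreover
  \<open>hall\<close>, \<open>omega\<close>, \<open>dual_basis\<close> and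
  \<open>hall_littlewood_P\<close> are definite descriptions, so existence and uniqueness of each
  has to be established. Hall--Littlewood functions are labelled by the conjugate partition
  throughout, so that the label is the profile itself.\<close>

lemma q_int_mult: "(q - 1) * q_int q i = q ^ i - 1"
  by (simp add: q_int_def power_diff_1_eq)

lemma q_int_pos: "q > 0 \<Longrightarrow> i > 0 \<Longrightarrow> q_int q i > 0"
  unfolding q_int_def by (intro sum_pos) auto

lemma q_int_add: "q_int q (a + b) = q_int q a + q ^ a * q_int q b"
  unfolding q_int_def by (induction b) (simp_all add: power_add algebra_simps)

lemma q_fact_0 [simp]: "q_fact q 0 = 1"
  by (simp add: q_fact_def)

lemma q_fact_Suc: "q_fact q (Suc m) = q_fact q m * q_int q (Suc m)"
  by (simp add: q_fact_def)

lemma q_fact_pos: "q > 0 \<Longrightarrow> q_fact q m > 0"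
  by (induction m) (simp_all add: q_fact_Suc q_int_pos)

lemma q_fact_neq_0: "q > 0 \<Longrightarrow> q_fact q m \<noteq> 0"
  using q_fact_pos[of q m] by simp

lemma q_binomial_0 [simp]: "q > 0 \<Longrightarrow> q_binomial q k 0 = 1"
  by (simp add: q_binomial_def q_fact_neq_0)

lemma q_binomial_self [simp]: "q > 0 \<Longrightarrow> q_binomial q k k = 1"
  by (simp add: q_binomial_def q_fact_neq_0)

lemma q_binomial_eq_0 [simp]: "k < m \<Longrightarrow> q_binomial q k m = 0"
  by (simp add: q_binomial_def)

text \<open>The q-Pascal rule. For k = m + d + 1 the three coefficients have a common denominator
  and the claim reduces to [k+1] = [m+1] + q^(m+1) [d+1]; the cases k \<le> m are boundary
  values.\<close>

lemma q_binomial_Suc_Suc: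
  assumes "q > 0"
  shows "q_binomial q (Suc k) (Suc m) = q_binomial q k m + q ^ Suc m * q_binomial q k (Suc m)"
proof -
  consider "k < m" | "k = m" | d where "k = Suc (m + d)"
    using less_natE linorder_less_linear by metis
  then show ?thesis
  proof cases
    case 3
    have nz: "q_fact q j \<noteq> 0" "q_int q (Suc j) \<noteq> 0" for j
      using assms by (simp_all add: q_fact_neq_0 order_less_imp_not_eq2 q_int_pos)
    have eq: "q_int q (Suc k) = q_int q (Suc m) + q ^ Suc m * q_int q (Suc d)"
      using q_int_add[of q "Suc m" "Suc d"] 3 by simp
    have l: "q_binomial q (Suc k) (Suc m)
        = q_fact q k * q_int q (Suc k) / (q_fact q m * q_int q (Suc m) * (q_fact q d * q_int q (Suc d)))"
      using 3 by (simp add: q_binomial_def q_fact_Suc)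
    have r1: "q_binomial q k m = q_fact q k / (q_fact q m * (q_fact q d * q_int q (Suc d)))"
      using 3 by (simp add: q_binomial_def q_fact_Suc Suc_diff_le)
    have r2: "q_binomial q k (Suc m) = q_fact q k / (q_fact q m * q_int q (Suc m) * q_fact q d)"
      using 3 by (simp add: q_binomial_def q_fact_Suc)
    show ?thesis unfolding l r1 r2 eq using nz by (simp add: field_simps)
  qed (use assms in simp_all)
qed

lemma q_binomial_Suc_Suc_mult:
  assumes "q > 0" "m \<le> k"
  shows "q_int q (Suc m) * q_binomial q (Suc k) (Suc m) = q_int q (Suc k) * q_binomial q k m"
  using assms q_int_pos[of q "Suc m"] q_fact_neq_0[of q]
  by (simp add: q_binomial_def q_fact_Suc field_simps)

lemma choose_two_Suc: "Suc v choose 2 = (v choose 2) + v"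
  by (simp add: numeral_2_eq_2)

text \<open>By the q-Pascal rule the sum for m + 1 at z is (1 - z) times the sum for m at z q: the
  factor i = 0 splits off and the others shift. Hence z is generalised in the induction.\<close>

lemma q_binomial_theorem:
  assumes "q > 0"
  shows "(\<Sum>u\<le>m. (-1) ^ u * q ^ (u choose 2) * q_binomial q m u * z ^ u) = (\<Prod>i<m. 1 - z * q ^ i)"
proof (induction m arbitrary: z)
  case (Suc m)
  let ?f = "\<lambda>m z u. (-1) ^ u * q ^ (u choose 2) * q_binomial q m u * z ^ u"
  have "(\<Sum>u\<le>Suc m. ?f (Suc m) z u) = 1 + (\<Sum>u\<le>m. ?f (Suc m) z (Suc u))"
    using assms by (subst sum.atMost_Suc_shift) (simp add: numeral_2_eq_2)
  also have "(\<Sum>u\<le>m. ?f (Suc m) z (Suc u)) = (\<Sum>u\<le>m. ?f m (z * q) (Suc u)) - z * (\<Sum>u\<le>m. ?f m (z * q) u)"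
    unfolding sum_distrib_left sum_subtractf[symmetric]
    by (rule sum.cong[OF refl])
       (use assms in \<open>simp add: q_binomial_Suc_Suc choose_two_Suc power_add power_mult_distrib algebra_simps\<close>)
  also have "1 + ((\<Sum>u\<le>m. ?f m (z * q) (Suc u)) - z * (\<Sum>u\<le>m. ?f m (z * q) u))
      = (\<Sum>u\<le>Suc m. ?f m (z * q) u) - z * (\<Sum>u\<le>m. ?f m (z * q) u)"
    using assms by (subst sum.atMost_Suc_shift) (simp add: numeral_2_eq_2)
  also have "\<dots> = (1 - z) * (\<Sum>u\<le>m. ?f m (z * q) u)"
    by (simp add: algebra_simps)
  also have "\<dots> = (\<Prod>i<Suc m. 1 - z * q ^ i)"
    unfolding Suc prod.lessThan_Suc_shift by (simp add: mult_ac)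
  finally show ?case .
qed (use assms in \<open>simp add: numeral_2_eq_2\<close>)

text \<open>Rationality is tracked for q-binomials, Pieri coefficients and profile counts because
  \<open>exp_pairing_injective\<close> argues by divisibility by powers of q.\<close>

lemma Rats_q_binomial: "q \<in> \<rat> \<Longrightarrow> q_binomial q k m \<in> \<rat>"
  unfolding q_binomial_def q_fact_def q_int_def by (auto intro!: Rats_divide Rats_mult Rats_prod Rats_sum)

section \<open>Partitions\<close>

lemma is_partitionD: "is_partition \<mu> \<Longrightarrow> i \<le> j \<Longrightarrow> lookup \<mu> j \<le> lookup \<mu> i"
  unfolding is_partition_def by (rule antimonoD)

lemma is_partitionI: "(\<And>i. lookup \<mu> (Suc i) \<le> lookup \<mu> i) \<Longrightarrow> is_partition \<mu>"
  unfolding is_partition_def by (simp add: antimono_iff_le_Suc)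

lemma keys_partition:
  assumes "is_partition \<mu>"
  shows "keys \<mu> = {..<num_parts \<mu>}"
proof -
  obtain n where n: "keys \<mu> \<subseteq> {..<n}"
    using finite_nat_bounded[OF finite_keys] by metis
  have down: "i \<in> keys \<mu>" if "j \<in> keys \<mu>" "i \<le> j" for i j
    using is_partitionD[OF assms that(2)] that(1) by (auto simp: in_keys_iff)
  define m where "m = (LEAST m. m \<notin> keys \<mu>)"
  have "n \<notin> keys \<mu>" using n by auto
  then have "m \<notin> keys \<mu>" unfolding m_def by (rule LeastI)
  moreover have "i \<in> keys \<mu>" if "i < m" for i
    using not_less_Least that unfolding m_def by blast
  ultimately have "keys \<mu> = {..<m}" using down by (meson lessThan_iff not_less subsetI subset_antisym)
  then show ?thesis by (simp add: num_parts_def)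
qed

lemma lookup_eq_0_partition: "is_partition \<mu> \<Longrightarrow> lookup \<mu> i = 0 \<longleftrightarrow> num_parts \<mu> \<le> i"
  using keys_partition[of \<mu>] by (metis in_keys_iff lessThan_iff not_less)

lemma weight_sum: "keys \<alpha> \<subseteq> {..<n} \<Longrightarrow> weight \<alpha> = (\<Sum>i<n. lookup \<alpha> i)"
  by (rule weight_superset) auto

lemma weight_eq_0 [simp]: "weight \<alpha> = 0 \<longleftrightarrow> \<alpha> = 0"
  by (auto simp: weight_def in_keys_iff intro!: poly_mapping_eqI)

lemma weight_0 [simp]: "weight 0 = 0"
  by simp

lemma is_partition_0 [simp]: "is_partition 0"
  by (rule is_partitionI) simp

lemma num_parts_le_weight: "num_parts \<mu> \<le> weight \<mu>"
proof -
  have "(\<Sum>i\<in>keys \<mu>. 1) \<le> (\<Sum>i\<in>keys \<mu>. lookup \<mu> i)"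
    by (intro sum_mono) (auto simp: in_keys_iff)
  then show ?thesis by (simp add: num_parts_def weight_def)
qed

lemma finite_partitions_le: "finite {\<mu>. is_partition \<mu> \<and> weight \<mu> \<le> n}"
proof (rule finite_subset[OF _ finite_bounded_exponents[of "{..<n}" n]])
  show "{\<mu>. is_partition \<mu> \<and> weight \<mu> \<le> n} \<subseteq> {\<alpha>. keys \<alpha> \<subseteq> {..<n} \<and> weight \<alpha> \<le> n}"
  proof safe
    fix \<mu> i assume "is_partition \<mu>" "weight \<mu> \<le> n" "i \<in> keys \<mu>"
    then show "i < n" using num_parts_le_weight[of \<mu>] by (simp add: keys_partition)
  qed
qed simp

lemma finite_partitions_of: "finite (partitions_of n)"
  by (rule finite_subset[OF _ finite_partitions_le[of n]]) (auto simp: partitions_of_def)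

lemma lookup_conjugate: "lookup (conjugate \<alpha>) j = card {i. j < lookup \<alpha> i}"
  by (simp add: conjugate.rep_eq)

text \<open>For an arbitrary composition, \<open>conjugate\<close> depends only on the multiset of
  nonzero entries. It thus labels the orbit under permutations of the variables, and
  \<open>conjugate (conjugate \<alpha>)\<close> is the sorted rearrangement of \<alpha>.\<close>

lemma is_partition_conjugate [simp]: "is_partition (conjugate \<alpha>)"
  by (rule is_partitionI) (auto simp: lookup_conjugate intro!: card_mono finite_lookup_greater)

text \<open>Both sides count the cells (i, j) with j < \<alpha>_i.\<close>

lemma weight_conjugate [simp]: "weight (conjugate \<alpha>) = weight \<alpha>"
proof -
  let ?N = "weight \<alpha>"
  have fin: "finite {i. j < lookup \<alpha> i}" for j by (rule finite_lookup_greater)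
  have "{i. j < lookup \<alpha> i} = {}" if "\<not> j < ?N" for j
    using lookup_le_weight[of \<alpha>] that by (metis (no_types, lifting) Collect_empty_eq order_less_le_trans)
  then have "keys (conjugate \<alpha>) \<subseteq> {..<?N}"
    by (metis card.empty in_keys_iff lessThan_iff lookup_conjugate subsetI)
  then have "weight (conjugate \<alpha>) = (\<Sum>j<?N. card {i. j < lookup \<alpha> i})"
    by (simp add: weight_sum lookup_conjugate)
  also have "\<dots> = (\<Sum>j<?N. \<Sum>i\<in>keys \<alpha>. of_bool (j < lookup \<alpha> i))"
  proof (rule sum.cong[OF refl])
    fix j
    have "(\<Sum>i\<in>keys \<alpha>. of_bool (j < lookup \<alpha> i)) = card (keys \<alpha> \<inter> {i. j < lookup \<alpha> i})"
      by simp
    also have "keys \<alpha> \<inter> {i. j < lookup \<alpha> i} = {i. j < lookup \<alpha> i}"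
      by (auto simp: in_keys_iff)
    finally show "card {i. j < lookup \<alpha> i} = (\<Sum>i\<in>keys \<alpha>. of_bool (j < lookup \<alpha> i))" by simp
  qed
  also have "\<dots> = (\<Sum>i\<in>keys \<alpha>. \<Sum>j<?N. of_bool (j < lookup \<alpha> i))"
    by (rule sum.swap)
  also have "\<dots> = (\<Sum>i\<in>keys \<alpha>. lookup \<alpha> i)"
  proof (rule sum.cong[OF refl])
    fix i
    have "{..<?N} \<inter> {j. j < lookup \<alpha> i} = {..<lookup \<alpha> i}"
      using lookup_le_weight[of \<alpha> i] by auto
    then show "(\<Sum>j<?N. of_bool (j < lookup \<alpha> i)) = lookup \<alpha> i" by simp
  qed
  finally show ?thesis by (simp add: weight_def)
qed

lemma conjugate_conjugate [simp]:
  assumes "is_partition \<mu>"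
  shows "conjugate (conjugate \<mu>) = \<mu>"
proof (rule poly_mapping_eqI)
  fix j
  \<comment> \<open>Level sets of a decreasing sequence are initial segments, so membership is
    comparison with the cardinality and the two indices can exchange their roles.\<close>
  have *: "{i. k < lookup \<mu> i} = {..<card {i. k < lookup \<mu> i}}" for k
  proof -
    let ?S = "{i. k < lookup \<mu> i}"
    have down: "i \<in> ?S" if "j \<in> ?S" "i \<le> j" for i j
      using is_partitionD[OF assms that(2)] that(1) by auto
    define m where "m = (LEAST m. m \<notin> ?S)"
    have "\<exists>m. m \<notin> ?S" using finite_lookup_greater[of k \<mu>] ex_new_if_finite infinite_UNIV_nat by blast
    then have "m \<notin> ?S" unfolding m_def by (rule LeastI_ex)
    moreover have "i \<in> ?S" if "i < m" for i using not_less_Least that unfolding m_def by blast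
    ultimately have "?S = {..<m}" using down by (meson lessThan_iff not_less subsetI subset_antisym)
    then show ?thesis by simp
  qed
  have "{i. j < card {k. i < lookup \<mu> k}} = {i. i < lookup \<mu> j}"
    using * by (metis lessThan_iff mem_Collect_eq)
  then show "lookup (conjugate (conjugate \<mu>)) j = lookup \<mu> j"
    by (simp add: lookup_conjugate)
qed

lemma conjugate_in_partitions_of: "\<mu> \<in> partitions_of n \<Longrightarrow> conjugate \<mu> \<in> partitions_of n"
  by (simp add: partitions_of_def)

text \<open>Deletion of the largest part. Among the partitions interlacing with \<mu> this is the
  smallest one, and its \<open>choose_weight\<close> is the exponent of q in
  \<open>whittaker_coeff\<close>.\<close>

lift_definition pm_tail :: "(nat \<Rightarrow>\<^sub>0 nat) \<Rightarrow> (nat \<Rightarrow>\<^sub>0 nat)" is "\<lambda>\<mu> i. \<mu> (Suc i)"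
proof -
  fix \<mu> :: "nat \<Rightarrow> nat" assume "finite {i. \<mu> i \<noteq> 0}"
  then have "finite (Suc -` {i. \<mu> i \<noteq> 0})" by (rule finite_vimageI) simp
  then show "finite {i. \<mu> (Suc i) \<noteq> 0}" by (simp add: vimage_def)
qed

lemma lookup_pm_tail [simp]: "lookup (pm_tail \<mu>) i = lookup \<mu> (Suc i)"
  by (simp add: pm_tail.rep_eq)

lemma is_partition_pm_tail: "is_partition \<mu> \<Longrightarrow> is_partition (pm_tail \<mu>)"
  by (rule is_partitionI) (simp add: is_partitionD)

lemma weight_pm_tail: "weight \<mu> = lookup \<mu> 0 + weight (pm_tail \<mu>)"
proof -
  obtain n where n: "keys \<mu> \<subseteq> {..<n}"
    using finite_nat_bounded[OF finite_keys] by metis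
  then have "keys \<mu> \<subseteq> {..<Suc n}" "keys (pm_tail \<mu>) \<subseteq> {..<n}"
    by (auto simp: in_keys_iff subset_iff intro: less_SucI Suc_lessD)
  then show ?thesis by (simp only: weight_sum sum.lessThan_Suc_shift lookup_pm_tail)
qed

lemma finite_mem_pm: "\<exists>n. \<forall>i\<ge>n. lookup (\<mu> :: nat \<Rightarrow>\<^sub>0 nat) i = 0"
  using finite_nat_bounded[OF finite_keys[of \<mu>]] by (meson in_keys_iff lessThan_iff not_less subsetD)

section \<open>Pieri coefficients\<close>

text \<open>
  The coefficient of \<open>P_\<kappa>(x;q)\<close> in \<open>e_r P_\<lambda>(x;q)\<close>, where \<open>\<mu>\<close> and \<open>\<nu>\<close> are the conjugates of
  \<open>\<kappa>\<close> and \<open>\<lambda>\<close>.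
\<close>

definition interlaces :: "(nat \<Rightarrow>\<^sub>0 nat) \<Rightarrow> (nat \<Rightarrow>\<^sub>0 nat) \<Rightarrow> bool"
  where "interlaces \<mu> \<nu> \<longleftrightarrow> (\<forall>j. lookup \<nu> j \<le> lookup \<mu> j \<and> lookup \<mu> (Suc j) \<le> lookup \<nu> j)"

definition pieri :: "real \<Rightarrow> (nat \<Rightarrow>\<^sub>0 nat) \<Rightarrow> (nat \<Rightarrow>\<^sub>0 nat) \<Rightarrow> real"
  where "pieri q \<mu> \<nu> = (if interlaces \<mu> \<nu>
    then \<Prod>j\<in>keys \<mu>. q_binomial q (lookup \<mu> j - lookup \<mu> (Suc j)) (lookup \<mu> j - lookup \<nu> j) else 0)"

lemma pieri_superset:
  assumes "q > 0" "interlaces \<mu> \<nu>" "finite A" "keys \<mu> \<subseteq> A"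
  shows "pieri q \<mu> \<nu> = (\<Prod>j\<in>A. q_binomial q (lookup \<mu> j - lookup \<mu> (Suc j)) (lookup \<mu> j - lookup \<nu> j))"
  using assms unfolding pieri_def
  by (auto intro!: prod.mono_neutral_left simp: in_keys_iff)

lemma interlaces_keys: "interlaces \<mu> \<nu> \<Longrightarrow> keys \<nu> \<subseteq> keys \<mu>"
  unfolding interlaces_def by (metis in_keys_iff le_zero_eq subsetI)

lemma interlaces_partition: "interlaces \<mu> \<nu> \<Longrightarrow> is_partition \<nu>"
  unfolding interlaces_def by (intro is_partitionI) (meson order_trans)

lemma interlaces_weight: "interlaces \<mu> \<nu> \<Longrightarrow> weight \<nu> \<le> weight \<mu>"
  using interlaces_keys[of \<mu> \<nu>]
  by (simp add: weight_superset[of "keys \<mu>"] interlaces_def sum_mono)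

lemma interlaces_weight_eq:
  assumes "interlaces \<mu> \<nu>" "weight \<mu> = weight \<nu>"
  shows "\<nu> = \<mu>"
proof (rule poly_mapping_eqI)
  have le: "lookup \<nu> j \<le> lookup \<mu> j" for j using assms(1) by (simp add: interlaces_def)
  have eq: "(\<Sum>j\<in>keys \<mu>. lookup \<nu> j) = (\<Sum>j\<in>keys \<mu>. lookup \<mu> j)"
    using assms interlaces_keys[OF assms(1)] by (simp add: weight_superset[of "keys \<mu>"])
  fix j
  show "lookup \<nu> j = lookup \<mu> j"
  proof (cases "j \<in> keys \<mu>")
    case True
    then show ?thesis using sum_mono_inv[OF eq] le by auto
  qed (use le[of j] in \<open>simp add: in_keys_iff\<close>)
qed

lemma pieri_self: "q > 0 \<Longrightarrow> is_partition \<mu> \<Longrightarrow> pieri q \<mu> \<mu> = 1"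
  by (simp add: pieri_def interlaces_def is_partitionD)

lemma interlaces_pm_tail: "is_partition \<mu> \<Longrightarrow> interlaces \<mu> (pm_tail \<mu>)"
  by (simp add: interlaces_def is_partitionD)

text \<open>At this extreme every q-binomial has equal entries. The value 1 is what allows the Pieri
  rule to be solved for the function with label \<mu>.\<close>

lemma pieri_pm_tail: "q > 0 \<Longrightarrow> is_partition \<mu> \<Longrightarrow> pieri q \<mu> (pm_tail \<mu>) = 1"
  by (simp add: pieri_def interlaces_pm_tail)

text \<open>Interlacing bounds every later part of \<kappa> by that of \<mu>, so for equal sizes the
  first part can only grow, and it stays the same only if nothing changes. The Pieri rule at
  \<open>pm_tail \<mu>\<close> is therefore triangular in the first part.\<close>

lemma interlaces_pm_tail_first:
  assumes "interlaces \<kappa> (pm_tail \<mu>)" "weight \<kappa> = weight \<mu>"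
  shows "lookup \<mu> 0 \<le> lookup \<kappa> 0" "lookup \<kappa> 0 = lookup \<mu> 0 \<Longrightarrow> \<kappa> = \<mu>"
proof -
  have le: "lookup \<kappa> (Suc j) \<le> lookup \<mu> (Suc j)" for j
    using assms(1) by (simp add: interlaces_def)
  obtain n where "\<forall>i\<ge>n. lookup \<mu> i = 0" using finite_mem_pm by blast
  then have k: "keys (pm_tail \<kappa>) \<subseteq> {..<n}" "keys (pm_tail \<mu>) \<subseteq> {..<n}"
    using le by (auto simp: in_keys_iff) (metis le_SucI not_le le_zero_eq neq0_conv)+
  then have w: "weight (pm_tail \<kappa>) \<le> weight (pm_tail \<mu>)"
    using le by (simp add: weight_sum sum_mono)
  show "lookup \<mu> 0 \<le> lookup \<kappa> 0"
    using w assms(2) weight_pm_tail[of \<kappa>] weight_pm_tail[of \<mu>] by simp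
  assume e: "lookup \<kappa> 0 = lookup \<mu> 0"
  then have "(\<Sum>i<n. lookup \<kappa> (Suc i)) = (\<Sum>i<n. lookup \<mu> (Suc i))"
    using assms(2) weight_pm_tail[of \<kappa>] weight_pm_tail[of \<mu>] k by (simp add: weight_sum)
  then have "lookup \<kappa> (Suc i) = lookup \<mu> (Suc i)" if "i < n" for i
    using sum_mono_inv[of "\<lambda>i. lookup \<kappa> (Suc i)" "{..<n}" "\<lambda>i. lookup \<mu> (Suc i)" i] le that by auto
  moreover have "lookup \<kappa> (Suc i) = lookup \<mu> (Suc i)" if "\<not> i < n" for i
    using k that by (metis in_keys_iff lessThan_iff lookup_pm_tail subsetD)
  ultimately have "lookup \<kappa> i = lookup \<mu> i" for i using e by (cases i) auto
  then show "\<kappa> = \<mu>" by (rule poly_mapping_eqI)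
qed

lemma Rats_pieri: "q \<in> \<rat> \<Longrightarrow> pieri q \<mu> \<nu> \<in> \<rat>"
  unfolding pieri_def by (auto intro!: Rats_prod Rats_q_binomial)

section \<open>Alternating sums over interlacing partitions\<close>

lemma choose_two_diff:
  assumes "u \<le> m"
  shows "(m - u choose 2) + u * m = (m choose 2) + (u choose 2) + u"
  using assms
proof (induction u)
  case (Suc u)
  then obtain d where d: "m = Suc u + d" using le_Suc_ex by blast
  have "Suc d choose 2 = (d choose 2) + d" "Suc u choose 2 = (u choose 2) + u"
    by (rule choose_two_Suc)+
  then show ?case using Suc d by simp
qed (simp add: numeral_2_eq_2)

text \<open>The substitution v = a - u turns the sum into the q-binomial theorem at z = q^(l + 1 -
  a). The factor with i = a - 1 - l is 1 - q^0, and b \<le> l < a puts this index into the range i <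
  a - b.\<close>

lemma alternating_column_sum:
  assumes q: "q > (0::real)" and "b \<le> l" "l < a"
  shows "(\<Sum>v=b..a. q_binomial q (a - b) (a - v) * ((-1) ^ v * q ^ (v choose 2) / q ^ (l * v))) = 0"
proof -
  let ?z = "q ^ Suc l / q ^ a"
  have summand: "(-1) ^ (a - u) * q ^ (a - u choose 2) / q ^ (l * (a - u))
      = (-1) ^ a * q ^ (a choose 2) / q ^ (l * a) * ((-1) ^ u * q ^ (u choose 2) * ?z ^ u)"
    if u: "u \<le> a" for u
  proof -
    have "q ^ (a - u choose 2) * q ^ (u * a) = q ^ (a choose 2) * q ^ (u choose 2) * q ^ u"
      unfolding power_add[symmetric] choose_two_diff[OF u] ..
    moreover have "q ^ (l * a) = q ^ (l * (a - u)) * q ^ (l * u)"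
      using u by (simp flip: power_add distrib_left)
    moreover have "(-1::real) ^ a = (-1) ^ (a - u) * (-1) ^ u"
      using u by (simp flip: power_add)
    ultimately show ?thesis
      using q by (simp add: field_simps power_mult[symmetric] power_add)
  qed
  have "(\<Sum>v=b..a. q_binomial q (a - b) (a - v) * ((-1) ^ v * q ^ (v choose 2) / q ^ (l * v)))
      = (\<Sum>u\<le>a - b. q_binomial q (a - b) u * ((-1) ^ (a - u) * q ^ (a - u choose 2) / q ^ (l * (a - u))))"
    by (rule sum.reindex_bij_witness[of _ "\<lambda>u. a - u" "\<lambda>v. a - v"]) (use assms in auto)
  also have "\<dots> = (-1) ^ a * q ^ (a choose 2) / q ^ (l * a)
      * (\<Sum>u\<le>a - b. (-1) ^ u * q ^ (u choose 2) * q_binomial q (a - b) u * ?z ^ u)"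
    unfolding sum_distrib_left by (rule sum.cong[OF refl]) (simp add: summand)
  also have "(\<Sum>u\<le>a - b. (-1) ^ u * q ^ (u choose 2) * q_binomial q (a - b) u * ?z ^ u)
      = (\<Prod>i<a - b. 1 - ?z * q ^ i)"
    by (rule q_binomial_theorem[OF q])
  also have "\<dots> = 0"
  proof (rule prod_zero)
    have "q ^ Suc l * q ^ (a - Suc l) = q ^ a"
      unfolding power_add[symmetric] using assms by simp
    then have "?z * q ^ (a - Suc l) = 1" using q by (simp only: times_divide_eq_left) simp
    then show "\<exists>i\<in>{..<a - b}. 1 - ?z * q ^ i = 0"
      using assms by (intro bexI[of _ "a - Suc l"]) auto
  qed simp
  finally show ?thesis by simp
qed

text \<open>The last j with \<theta>_j < \<mu>_j works, because \<mu>_(j+1) \<le> \<theta>_(j+1)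
  \<le> \<theta>_j; some such j exists as |\<theta>| < |\<mu>|. The two inequalities are what
  \<open>alternating_column_sum\<close> requires.\<close>

lemma partition_column_exists:
  assumes "is_partition \<theta>" "is_partition \<mu>" "weight \<theta> < weight \<mu>"
  obtains j where "lookup \<mu> (Suc j) \<le> lookup \<theta> j" "lookup \<theta> j < lookup \<mu> j"
proof -
  let ?S = "{j. lookup \<theta> j < lookup \<mu> j}"
  have fin: "finite ?S"
    by (rule finite_subset[OF _ finite_keys[of \<mu>]]) (auto simp: in_keys_iff)
  have "?S \<noteq> {}"
  proof
    assume "?S = {}"
    then have le: "lookup \<mu> j \<le> lookup \<theta> j" for j by (meson Collect_empty_eq not_less)
    let ?K = "keys \<mu> \<union> keys \<theta>"
    have "weight \<mu> = (\<Sum>j\<in>?K. lookup \<mu> j)" "weight \<theta> = (\<Sum>j\<in>?K. lookup \<theta> j)"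
      by (rule weight_superset; simp)+
    then have "weight \<mu> \<le> weight \<theta>" using le by (simp add: sum_mono)
    then show False using assms by simp
  qed
  define j where "j = Max ?S"
  have j: "j \<in> ?S" unfolding j_def using fin \<open>?S \<noteq> {}\<close> by (rule Max_in)
  have "Suc j \<notin> ?S" using Max_ge[OF fin, of "Suc j"] unfolding j_def by auto
  then have "lookup \<mu> (Suc j) \<le> lookup \<theta> j"
    using is_partitionD[OF assms(1), of j "Suc j"] by simp
  with j show ?thesis using that by blast
qed

definition pairing :: "(nat \<Rightarrow>\<^sub>0 nat) \<Rightarrow> (nat \<Rightarrow>\<^sub>0 nat) \<Rightarrow> nat"
  where "pairing \<theta> \<nu> = (\<Sum>j\<in>keys \<nu>. lookup \<theta> j * lookup \<nu> j)"

lemma pairing_superset: "finite A \<Longrightarrow> keys \<nu> \<subseteq> A \<Longrightarrow> pairing \<theta> \<nu> = (\<Sum>j\<in>A. lookup \<theta> j * lookup \<nu> j)"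
  unfolding pairing_def by (intro sum.mono_neutral_left) (auto simp: in_keys_iff)

text \<open>Macdonald's statistic n of the conjugate partition; it is the exponent of q in
  \<open>krylov_G\<close>.\<close>

definition choose_weight :: "(nat \<Rightarrow>\<^sub>0 nat) \<Rightarrow> nat"
  where "choose_weight \<nu> = (\<Sum>j\<in>keys \<nu>. lookup \<nu> j choose 2)"

lemma choose_weight_superset: "finite A \<Longrightarrow> keys \<nu> \<subseteq> A \<Longrightarrow> choose_weight \<nu> = (\<Sum>j\<in>A. lookup \<nu> j choose 2)"
  unfolding choose_weight_def by (intro sum.mono_neutral_left) (auto simp: in_keys_iff numeral_2_eq_2)

text \<open>Interlacing confines each \<nu>_j to the interval from \<mu>_(j+1) to \<mu>_j
  independently of the other entries, and every factor of the summand is a product over columns. So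
  the sum is a product of column sums, one of which vanishes.\<close>

lemma alternating_pieri_sum:
  assumes q: "q > (0::real)" and \<theta>: "is_partition \<theta>" and \<mu>: "is_partition \<mu>"
    and less: "weight \<theta> < weight \<mu>"
    and A: "finite A" "{\<nu>. interlaces \<mu> \<nu>} \<subseteq> A"
  shows "(\<Sum>\<nu>\<in>A. pieri q \<mu> \<nu> * ((-1) ^ weight \<nu> * q ^ choose_weight \<nu> / q ^ pairing \<theta> \<nu>)) = 0"
proof -
  obtain M where M: "keys \<mu> \<subseteq> {..<M}"
    using finite_nat_bounded[OF finite_keys] by metis
  let ?R = "\<lambda>j. {lookup \<mu> (Suc j)..lookup \<mu> j}"
  let ?f = "\<lambda>j v. q_binomial q (lookup \<mu> j - lookup \<mu> (Suc j)) (lookup \<mu> j - v) *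
      ((-1) ^ v * q ^ (v choose 2) / q ^ (lookup \<theta> j * v))"
  let ?g = "\<lambda>\<nu>. pieri q \<mu> \<nu> * ((-1) ^ weight \<nu> * q ^ choose_weight \<nu> / q ^ pairing \<theta> \<nu>)"
  have "(\<Sum>\<nu>\<in>A. ?g \<nu>) = (\<Sum>\<nu>\<in>{\<nu>. interlaces \<mu> \<nu>}. ?g \<nu>)"
    by (rule sum.mono_neutral_right) (use A in \<open>auto simp: pieri_def\<close>)
  also have "\<dots> = (\<Sum>\<rho>\<in>PiE {..<M} ?R. \<Prod>j<M. ?f j (\<rho> j))"
  proof (rule sum.reindex_bij_witness[where
        i = "\<lambda>\<rho>. Abs_poly_mapping (\<lambda>j. if j < M then \<rho> j else 0)" and
        j = "\<lambda>\<nu>. restrict (lookup \<nu>) {..<M}"])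
    have out: "lookup \<mu> j = 0" if "\<not> j < M" for j
      using M that by (meson in_keys_iff lessThan_iff subsetD)
    have fin: "finite {j. (if j < M then \<rho> j else 0) \<noteq> 0}" for \<rho> :: "nat \<Rightarrow> nat"
      by (rule finite_subset[of _ "{..<M}"]) auto
    {
      fix \<nu> assume "\<nu> \<in> {\<nu>. interlaces \<mu> \<nu>}"
      then have \<nu>: "interlaces \<mu> \<nu>" by simp
      then have K: "keys \<nu> \<subseteq> {..<M}" using M interlaces_keys by blast
      then have out': "lookup \<nu> j = 0" if "\<not> j < M" for j
        using that by (meson in_keys_iff lessThan_iff subsetD)
      show "Abs_poly_mapping (\<lambda>j. if j < M then restrict (lookup \<nu>) {..<M} j else 0) = \<nu>"
        using out' by (intro poly_mapping_eqI) (auto simp: Abs_poly_mapping_inverse fin)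
      show "restrict (lookup \<nu>) {..<M} \<in> PiE {..<M} ?R"
        using \<nu> by (auto simp: interlaces_def)
      have "?g \<nu> = (\<Prod>j<M. q_binomial q (lookup \<mu> j - lookup \<mu> (Suc j)) (lookup \<mu> j - lookup \<nu> j)) *
          ((\<Prod>j<M. (-1) ^ lookup \<nu> j) * (\<Prod>j<M. q ^ (lookup \<nu> j choose 2)) / (\<Prod>j<M. q ^ (lookup \<theta> j * lookup \<nu> j)))"
        using pieri_superset[OF q \<nu> finite_lessThan M] K
        by (simp add: weight_sum choose_weight_superset[of "{..<M}"] pairing_superset[of "{..<M}"] power_sum)
      then show "(\<Prod>j<M. ?f j (restrict (lookup \<nu>) {..<M} j)) = ?g \<nu>"
        by (simp add: prod.distrib prod_dividef)
    }
    fix \<rho> assume \<rho>: "\<rho> \<in> PiE {..<M} ?R"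
    show "restrict (lookup (Abs_poly_mapping (\<lambda>j. if j < M then \<rho> j else 0))) {..<M} = \<rho>"
      using PiE_arb[OF \<rho>] by (auto simp: Abs_poly_mapping_inverse fin)
    have "lookup \<mu> (Suc j) = 0" if "\<not> j < M" for j using that out[of "Suc j"] by simp
    then show "Abs_poly_mapping (\<lambda>j. if j < M then \<rho> j else 0) \<in> {\<nu>. interlaces \<mu> \<nu>}"
      using \<rho> by (auto simp: interlaces_def Abs_poly_mapping_inverse fin PiE_iff)
  qed
  also have "\<dots> = (\<Prod>j<M. \<Sum>v\<in>?R j. ?f j v)"
    by (rule prod_sum_PiE[symmetric]) auto
  also have "\<dots> = 0"
  proof -
    obtain j where j: "lookup \<mu> (Suc j) \<le> lookup \<theta> j" "lookup \<theta> j < lookup \<mu> j"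
      using partition_column_exists[OF \<theta> \<mu> less] .
    then have "j \<in> keys \<mu>" by (simp add: in_keys_iff)
    then have "j \<in> {..<M}" using M by blast
    moreover have "(\<Sum>v\<in>?R j. ?f j v) = 0" by (rule alternating_column_sum[OF q j])
    ultimately show ?thesis by (intro prod_zero) auto
  qed
  finally show ?thesis .
qed

text \<open>
  The matrix with entries \<open>q^(- \<theta>\<cdot>\<nu>)\<close> is \<open>q\<close>-adically dominated by its diagonal after scaling
  with \<open>q^(|\<theta>|\<^sup>2/2 + |\<nu>|\<^sup>2/2)\<close>.
\<close>

lemma exp_pairing_injective_int:
  fixes d :: "(nat \<Rightarrow>\<^sub>0 nat) \<Rightarrow> int" and q :: nat
  assumes q: "q \<ge> 2" and A: "finite A"
    and zero: "\<And>\<theta>. \<theta> \<in> A \<Longrightarrow> (\<Sum>\<nu>\<in>A. real_of_int (d \<nu>) / real q ^ pairing \<theta> \<nu>) = 0"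
    and "\<nu> \<in> A"
  shows "d \<nu> = 0"
proof (rule ccontr)
  assume "d \<nu> \<noteq> 0"
  let ?v = "\<lambda>\<nu>. multiplicity (int q) (d \<nu>)"
  let ?B = "{\<nu>\<in>A. d \<nu> \<noteq> 0}"
  \<comment> \<open>Up to a factor 2 this is the order of d_\<nu> after rescaling by q^(-
    \<nu>\<cdot>\<nu>/2). In the row \<theta> where it is minimal, |\<theta> - \<nu>|^2 > 0 shows
    that every off-diagonal term is divisible by a higher power of q than the diagonal one.\<close>
  let ?w = "\<lambda>\<nu>. 2 * int (?v \<nu>) - int (pairing \<nu> \<nu>)"
  have B: "finite ?B" "?B \<noteq> {}" using A \<open>\<nu> \<in> A\<close> \<open>d \<nu> \<noteq> 0\<close> by auto
  obtain \<theta> where \<theta>: "\<theta> \<in> ?B" "\<And>\<nu>. \<nu> \<in> ?B \<Longrightarrow> ?w \<theta> \<le> ?w \<nu>"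
  proof -
    have "Min (?w ` ?B) \<in> ?w ` ?B" using B by (intro Min_in) auto
    then obtain \<theta> where "\<theta> \<in> ?B" "?w \<theta> = Min (?w ` ?B)" by force
    then show ?thesis using that[of \<theta>] B(1) Min_le[of "?w ` ?B"] by simp
  qed
  \<comment> \<open>A common exponent that clears the denominators of row \<theta>.\<close>
  define C where "C = (\<Sum>\<nu>\<in>A. pairing \<theta> \<nu>)"
  have leC: "pairing \<theta> \<nu> \<le> C" if "\<nu> \<in> A" for \<nu>
    unfolding C_def using A that by (intro member_le_sum) auto
  have "real q ^ C * (\<Sum>\<nu>\<in>A. real_of_int (d \<nu>) / real q ^ pairing \<theta> \<nu>)
      = real_of_int (\<Sum>\<nu>\<in>A. d \<nu> * int q ^ (C - pairing \<theta> \<nu>))"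
    unfolding sum_distrib_left of_int_sum
  proof (rule sum.cong[OF refl])
    fix \<nu> assume "\<nu> \<in> A"
    then have "real q ^ (C - pairing \<theta> \<nu>) = real q ^ C / real q ^ pairing \<theta> \<nu>"
      using q leC by (intro power_diff) auto
    then show "real q ^ C * (real_of_int (d \<nu>) / real q ^ pairing \<theta> \<nu>)
        = real_of_int (d \<nu> * int q ^ (C - pairing \<theta> \<nu>))" by simp
  qed
  then have "(\<Sum>\<nu>\<in>A. d \<nu> * int q ^ (C - pairing \<theta> \<nu>)) = 0"
    using zero[of \<theta>] \<theta>(1) by (metis (mono_tags, lifting) mem_Collect_eq mult_zero_right of_int_eq_0_iff)
  then have s: "d \<theta> * int q ^ (C - pairing \<theta> \<theta>) = - (\<Sum>\<nu>\<in>A - {\<theta>}. d \<nu> * int q ^ (C - pairing \<theta> \<nu>))"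
    using \<theta>(1) A by (simp add: sum.remove[of A \<theta>])
  have nu: "\<not> is_unit (int q)" using q by auto
  let ?e = "?v \<theta> + (C - pairing \<theta> \<theta>)"
  have "int q ^ Suc ?e dvd d \<nu> * int q ^ (C - pairing \<theta> \<nu>)" if \<nu>: "\<nu> \<in> A - {\<theta>}" for \<nu>
  proof (cases "d \<nu> = 0")
    case False
    let ?K = "keys \<theta> \<union> keys \<nu>"
    obtain j where j: "lookup \<theta> j \<noteq> lookup \<nu> j" using \<nu> poly_mapping_eqI[of \<nu> \<theta>] by fastforce
    then have "j \<in> ?K" by (auto simp: in_keys_iff)
    then have "0 < (\<Sum>j\<in>?K. (int (lookup \<theta> j) - int (lookup \<nu> j))\<^sup>2)"
      using j by (intro sum_pos2[of _ j]) auto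
    also have "\<dots> = int (pairing \<theta> \<theta>) + int (pairing \<nu> \<nu>) - 2 * int (pairing \<theta> \<nu>)"
      by (simp add: pairing_superset[of ?K] power2_eq_square algebra_simps sum.distrib sum_subtractf
          sum_distrib_left)
    finally have "2 * int (pairing \<theta> \<nu>) < int (pairing \<theta> \<theta>) + int (pairing \<nu> \<nu>)" by simp
    moreover have "?w \<theta> \<le> ?w \<nu>" using \<theta>(2) \<nu> False by auto
    moreover have "pairing \<theta> \<nu> \<le> C" "pairing \<theta> \<theta> \<le> C" using leC \<theta>(1) \<nu> by auto
    ultimately have "Suc ?e \<le> ?v \<nu> + (C - pairing \<theta> \<nu>)" by linarith
    then have "int q ^ Suc ?e dvd int q ^ (?v \<nu> + (C - pairing \<theta> \<nu>))" by (rule le_imp_power_dvd)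
    also have "\<dots> dvd d \<nu> * int q ^ (C - pairing \<theta> \<nu>)"
      unfolding power_add by (intro mult_dvd_mono multiplicity_dvd dvd_refl)
    finally show ?thesis .
  qed simp
  then have "int q ^ Suc ?e dvd d \<theta> * int q ^ (C - pairing \<theta> \<theta>)"
    unfolding s by (intro dvd_minus_iff[THEN iffD2] dvd_sum) auto
  \<comment> \<open>As q may be composite, orders need not add up under multiplication; the argument
    only cancels a power of q and contradicts the maximality in the order of d_\<theta>.\<close>
  then have "int q ^ Suc (?v \<theta>) dvd d \<theta>"
    using q by (simp add: power_add mult_ac)
  moreover have "\<not> int q ^ Suc (?v \<theta>) dvd d \<theta>"
    using \<theta>(1) nu by (simp add: power_dvd_iff_le_multiplicity del: power_Suc)
  ultimately show False by blast
qed

text \<open>The relations are homogeneous, so multiplication by a common denominator of the finitely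
  many unknowns reduces to the integral case.\<close>

lemma exp_pairing_injective:
  fixes d :: "(nat \<Rightarrow>\<^sub>0 nat) \<Rightarrow> real" and q :: nat
  assumes q: "q \<ge> 2" and A: "finite A" and rat: "\<And>\<nu>. \<nu> \<in> A \<Longrightarrow> d \<nu> \<in> \<rat>"
    and zero: "\<And>\<theta>. \<theta> \<in> A \<Longrightarrow> (\<Sum>\<nu>\<in>A. d \<nu> / real q ^ pairing \<theta> \<nu>) = 0"
    and "\<nu> \<in> A"
  shows "d \<nu> = 0"
proof -
  have "\<exists>m::int. m \<noteq> 0 \<and> (\<forall>\<nu>\<in>A. of_int m * d \<nu> \<in> \<int>)"
    using A rat
  proof (induction A rule: finite_induct)
    case (insert x A)
    then obtain m :: int where m: "m \<noteq> 0" "\<forall>\<nu>\<in>A. of_int m * d \<nu> \<in> \<int>" by auto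
    obtain a b where ab: "b > 0" "d x = of_int a / of_int b"
      using insert.prems[of x] by (metis Rats_cases' insertI1)
    have "of_int (m * b) * d \<nu> \<in> \<int>" if "\<nu> \<in> insert x A" for \<nu>
    proof (cases "\<nu> = x")
      case True
      then have "of_int (m * b) * d \<nu> = of_int (m * a)" using ab by simp
      then show ?thesis by (metis Ints_of_int)
    next
      case False
      then have "of_int m * d \<nu> \<in> \<int>" using m that by blast
      then have "of_int b * (of_int m * d \<nu>) \<in> \<int>" by (rule Ints_mult[OF Ints_of_int])
      moreover have "of_int (m * b) * d \<nu> = of_int b * (of_int m * d \<nu>)" by simp
      ultimately show ?thesis by metis
    qed
    moreover have "m * b \<noteq> 0" using m(1) ab(1) by simp
    ultimately show ?case by blast
  qed (auto intro: exI[of _ 1])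
  then obtain m :: int where m: "m \<noteq> 0" "\<And>\<nu>. \<nu> \<in> A \<Longrightarrow> of_int m * d \<nu> \<in> \<int>" by blast
  define e where "e \<nu> = \<lfloor>of_int m * d \<nu>\<rfloor>" for \<nu>
  have e: "of_int (e \<nu>) = of_int m * d \<nu>" if "\<nu> \<in> A" for \<nu>
    using m(2)[OF that] by (auto simp: e_def elim: Ints_cases)
  have "e \<nu> = 0"
  proof (rule exp_pairing_injective_int[OF q A _ \<open>\<nu> \<in> A\<close>])
    fix \<theta> assume "\<theta> \<in> A"
    have "(\<Sum>\<nu>\<in>A. real_of_int (e \<nu>) / real q ^ pairing \<theta> \<nu>)
        = of_int m * (\<Sum>\<nu>\<in>A. d \<nu> / real q ^ pairing \<theta> \<nu>)"
      unfolding sum_distrib_left by (rule sum.cong) (simp_all add: e)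
    then show "(\<Sum>\<nu>\<in>A. real_of_int (e \<nu>) / real q ^ pairing \<theta> \<nu>) = 0"
      using zero[OF \<open>\<theta> \<in> A\<close>] by simp
  qed
  then show ?thesis using e[OF \<open>\<nu> \<in> A\<close>] m(1) by simp
qed

section \<open>Counting subspaces over a finite field\<close>

text \<open>For a prime power q the left side counts the independent d-tuples in an n-dimensional
  space; the right side has the shape of the coefficient in \<open>krylov_G\<close>. If d > n, both
  sides vanish, on the left through the factor i = n.\<close>

lemma prod_power_diff:
  assumes "q > (0::real)"
  shows "(\<Prod>i<d. q ^ n - q ^ i) = (q - 1) ^ d * q ^ (d choose 2) * q_binomial q n d * q_fact q d"
proof (cases "d \<le> n")
  case True
  \<comment> \<open>Multiplying by [n - d]! keeps quotients out of the induction.\<close>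
  have "(\<Prod>i<d. q ^ n - q ^ i) * q_fact q (n - d) = (q - 1) ^ d * q ^ (d choose 2) * q_fact q n"
    using True
  proof (induction d)
    case (Suc d)
    have "q ^ n - q ^ d = q ^ d * (q ^ (n - d) - 1)"
      using Suc.prems by (simp add: right_diff_distrib flip: power_add)
    also have "\<dots> = q ^ d * (q - 1) * q_int q (n - d)"
      by (simp flip: q_int_mult)
    finally have "(\<Prod>i<Suc d. q ^ n - q ^ i) * q_fact q (n - Suc d)
        = (\<Prod>i<d. q ^ n - q ^ i) * (q_fact q (n - Suc d) * q_int q (n - d)) * (q ^ d * (q - 1))"
      by simp
    also have "q_fact q (n - Suc d) * q_int q (n - d) = q_fact q (n - d)"
      using Suc.prems q_fact_Suc[of q "n - Suc d"] by (simp add: Suc_diff_Suc)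
    finally show ?case using Suc by (simp add: choose_two_Suc power_add)
  qed (simp add: numeral_2_eq_2)
  then show ?thesis
    using True q_fact_neq_0[OF assms] by (simp add: q_binomial_def field_simps)
next
  case False
  then have "(\<Prod>i<d. q ^ n - q ^ i) = 0" by (intro prod_zero) (auto intro!: bexI[of _ n])
  with False show ?thesis by simp
qed

text \<open>For a prime power q this sorts the k-tuples of a d-dimensional space by the dimension of
  their span. The proof is algebraic, by the q-Pascal rule, because
  \<open>card_spanning_lists\<close> derives that count from the identity.\<close>

lemma sum_q_binomial_prod_power_diff:
  assumes "q > (0::real)"
  shows "(\<Sum>j\<le>d. q_binomial q d j * (\<Prod>i<j. q ^ k - q ^ i)) = q ^ (k * d)"
proof (induction d)
  case (Suc d)
  let ?a = "\<lambda>j. \<Prod>i<j. q ^ k - q ^ i"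
  have "(\<Sum>j\<le>Suc d. q_binomial q (Suc d) j * ?a j)
      = 1 + (\<Sum>j\<le>d. q_binomial q (Suc d) (Suc j) * ?a (Suc j))"
    using assms by (subst sum.atMost_Suc_shift) simp
  also have "(\<Sum>j\<le>d. q_binomial q (Suc d) (Suc j) * ?a (Suc j))
      = (\<Sum>j\<le>d. q_binomial q d j * ?a (Suc j)) + (\<Sum>j\<le>d. q ^ Suc j * q_binomial q d (Suc j) * ?a (Suc j))"
    using assms by (simp add: q_binomial_Suc_Suc distrib_right sum.distrib del: prod.lessThan_Suc power_Suc)
  also have "1 + (\<dots>) = (\<Sum>j\<le>d. q_binomial q d j * ?a (Suc j)) + (\<Sum>j\<le>Suc d. q ^ j * q_binomial q d j * ?a j)"
    using assms sum.atMost_Suc_shift[of "\<lambda>j. q ^ j * q_binomial q d j * ?a j" d] by simp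
  \<comment> \<open>The last factor of \<open>?a (Suc j)\<close> is q^k - q^j, so
    \<open>?a (Suc j) + q ^ j * ?a j = q ^ k * ?a j\<close>; the term with j = d + 1 carries a zero
    binomial.\<close>
  also have "\<dots> = (\<Sum>j\<le>d. q_binomial q d j * ?a j * q ^ k)"
    by (simp add: sum.distrib[symmetric] algebra_simps)
  finally show ?case by (simp add: Suc power_add flip: sum_distrib_right)
qed (use assms in simp)

section \<open>Ordered independent tuples and counts of subspaces\<close>

lemma card_span_insert:
  fixes b :: "'a::{field,finite}^'n"
  assumes "b \<notin> vec.span S"
  shows "card (vec.span (insert b S)) = CARD('a) * card (vec.span S)"
proof -
  let ?f = "\<lambda>(k, y). k *s b + y"
  have "inj_on ?f (UNIV \<times> vec.span S)"
  proof (rule inj_onI, clarify)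
    fix k y k' y' assume y: "y \<in> vec.span S" "y' \<in> vec.span S" and eq: "k *s b + y = k' *s b + y'"
    have "(k - k') *s b = y' - y" using eq by (simp add: vec.scale_left_diff_distrib algebra_simps)
    then have "(k - k') *s b \<in> vec.span S" using y by (simp add: vec.span_diff)
    then have "inverse (k - k') *s ((k - k') *s b) \<in> vec.span S" by (rule vec.span_scale)
    then have "k = k'" using assms by (cases "k = k'") (simp_all only: vec.scale_scale
        left_inverse right_minus_eq vec.scale_one simp_thms not_False_eq_True)
    then show "k = k' \<and> y = y'" using eq by simp
  qed
  moreover have "?f ` (UNIV \<times> vec.span S) = vec.span (insert b S)"
  proof safe
    fix k y assume "y \<in> vec.span S"
    then show "k *s b + y \<in> vec.span (insert b S)"
      by (auto simp: vec.span_insert intro!: exI[of _ k])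
  next
    fix x assume "x \<in> vec.span (insert b S)"
    then obtain k where "x - k *s b \<in> vec.span S" by (auto simp: vec.span_insert)
    then show "x \<in> ?f ` (UNIV \<times> vec.span S)" by (intro image_eqI[of _ _ "(k, x - k *s b)"]) auto
  qed
  ultimately have "card (vec.span (insert b S)) = card ((UNIV :: 'a set) \<times> vec.span S)"
    using card_image by metis
  then show ?thesis by (simp add: card_cartesian_product)
qed

text \<open>Ordered independent tuples. The recursion enforces distinctness and makes prepending a
  vector outside the span the only way to extend a tuple, which is the form needed for
  counting.\<close>

fun indep_list :: "('a::field^'n) list \<Rightarrow> bool"
  where "indep_list [] \<longleftrightarrow> True"
  | "indep_list (v # vs) \<longleftrightarrow> v \<notin> vec.span (set vs) \<and> indep_list vs"

lemma card_span_indep_list: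
  "indep_list vs \<Longrightarrow> card (vec.span (set vs)) = CARD('a) ^ length (vs :: ('a::{field,finite}^'n) list)"
  by (induction vs) (simp_all add: card_span_insert)

lemma independent_indep_list: "indep_list vs \<Longrightarrow> vec.independent (set vs)"
  by (induction vs) (simp_all add: vec.independent_empty vec.independent_insertI)

lemma dim_indep_list: "indep_list vs \<Longrightarrow> vec.dim (set vs) = length vs"
proof (induction vs)
  case (Cons v vs)
  then show ?case by (simp add: vec.dim_insert)
qed simp

lemma indep_list_basis:
  fixes U :: "('a::field^'n) set"
  assumes "vec.subspace U"
  obtains vs where "indep_list vs" "vec.span (set vs) = U" "length vs = vec.dim U"
proof -
  obtain B where B: "B \<subseteq> U" "vec.independent B" "U \<subseteq> vec.span B" "card B = vec.dim U"
    using vec.basis_exists by metis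
  have fin: "finite B" using B(2) vec.independent_bound_general by blast
  have "\<exists>vs. set vs = B \<and> indep_list vs" using fin B(2)
  proof (induction B rule: finite_induct)
    case (insert x F)
    then obtain vs where "set vs = F" "indep_list vs"
      using vec.independent_mono by (metis subset_insertI)
    with insert show ?case
      by (intro exI[of _ "x # vs"]) (auto simp: vec.independent_insert)
  qed simp
  then obtain vs where vs: "set vs = B" "indep_list vs" by blast
  have "vec.span B = U" using B assms by (simp add: vec.span_minimal subset_antisym)
  then show ?thesis using that[of vs] vs dim_indep_list[OF vs(2)] by (metis vec.dim_span)
qed

lemma card_subspace:
  "vec.subspace U \<Longrightarrow> card (U :: ('a::{field,finite}^'n) set) = CARD('a) ^ vec.dim U"
  by (metis indep_list_basis card_span_indep_list)

lemma subspace_eqI_dim: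
  fixes U W :: "('a::field^'n) set"
  shows "vec.subspace U \<Longrightarrow> vec.subspace W \<Longrightarrow> U \<subseteq> W \<Longrightarrow> vec.dim U = vec.dim W \<Longrightarrow> U = W"
  by (simp add: vec.subspace_dim_equal)

definition indep_lists :: "('a::field^'n) set \<Rightarrow> nat \<Rightarrow> ('a^'n) list set"
  where "indep_lists U d = {vs. indep_list vs \<and> set vs \<subseteq> U \<and> length vs = d}"

definition subspaces :: "('a::field^'n) set \<Rightarrow> ('a^'n) set set"
  where "subspaces U = {W. vec.subspace W \<and> W \<subseteq> U}"

lemma finite_lists_of_length: "finite {vs :: 'a::finite list. length vs = d \<and> P vs}"
  by (rule finite_subset[OF _ finite_lists_length_eq[of UNIV d]]) auto

lemma finite_indep_lists: "finite (indep_lists (U :: ('a::{field,finite}^'n) set) d)"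
  unfolding indep_lists_def
  by (rule finite_subset[OF _ finite_lists_of_length[of d "\<lambda>_. True"]]) auto

lemma card_indep_lists:
  fixes U :: "('a::{field,finite}^'n) set"
  assumes U: "vec.subspace U"
  shows "real (card (indep_lists U d)) = (\<Prod>i<d. real CARD('a) ^ vec.dim U - real CARD('a) ^ i)"
proof (induction d)
  case 0
  have "indep_lists U 0 = {[]}" by (auto simp: indep_lists_def)
  then show ?case by simp
next
  case (Suc d)
  let ?S = "Sigma (indep_lists U d) (\<lambda>vs. U - vec.span (set vs))"
  have "indep_lists U (Suc d) = (\<lambda>(vs, v). v # vs) ` ?S"
    by (force simp: indep_lists_def length_Suc_conv image_iff)
  then have "card (indep_lists U (Suc d)) = card ?S"
    by (simp add: card_image inj_on_def case_prod_unfold prod_eq_iff)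
  also have "\<dots> = (\<Sum>vs\<in>indep_lists U d. card (U - vec.span (set vs)))"
    by (simp add: finite_indep_lists)
  also have "real \<dots> = (\<Sum>vs\<in>indep_lists U d. real CARD('a) ^ vec.dim U - real CARD('a) ^ d)"
    unfolding of_nat_sum
  proof (rule sum.cong[OF refl])
    fix vs assume vs: "vs \<in> indep_lists U d"
    then have sub: "vec.span (set vs) \<subseteq> U"
      using U by (auto simp: indep_lists_def intro: vec.span_minimal[THEN subsetD])
    then have "real (card (U - vec.span (set vs))) = real (card U) - real (card (vec.span (set vs)))"
      by (simp add: card_Diff_subset card_mono of_nat_diff)
    then show "real (card (U - vec.span (set vs))) = real CARD('a) ^ vec.dim U - real CARD('a) ^ d"
      using vs U by (simp add: indep_lists_def card_subspace dim_indep_list)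
  qed
  finally show ?case by (simp add: Suc)
qed

lemma indep_lists_span:
  fixes W :: "('a::field^'n) set"
  assumes "vec.subspace W" "vs \<in> indep_lists W (vec.dim W)"
  shows "vec.span (set vs) = W"
  using assms by (intro subspace_eqI_dim) (auto simp: indep_lists_def dim_indep_list
      intro: vec.span_minimal[THEN subsetD])

lemma card_ge_2_field: "CARD('a::{field,finite}) \<ge> 2"
proof -
  have "card {0, 1 :: 'a} \<le> CARD('a)" by (rule card_mono) auto
  then show ?thesis by simp
qed

lemma card_field_gt_1: "real CARD('a::{field,finite}) > 1"
  using card_ge_2_field[where 'a='a] by linarith

text \<open>Each independent d-tuple of U spans exactly one subspace of dimension d, and each such
  subspace has the same number of independent d-tuples. The common factors of the two counts in
  \<open>prod_power_diff\<close> cancel.\<close>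

lemma card_subspaces_dim:
  fixes U :: "('a::{field,finite}^'n) set"
  assumes U: "vec.subspace U"
  shows "real (card {W \<in> subspaces U. vec.dim W = d}) = q_binomial (real CARD('a)) (vec.dim U) d"
proof -
  let ?q = "real CARD('a)" and ?A = "{W \<in> subspaces U. vec.dim W = d}"
  have q: "?q > 0" "?q - 1 \<noteq> 0" using card_field_gt_1[where 'a='a] by auto
  have "indep_lists U d = (\<Union>W\<in>?A. indep_lists W d)"
  proof safe
    fix vs assume vs: "vs \<in> indep_lists U d"
    then have "vec.span (set vs) \<in> ?A"
      using U by (auto simp: indep_lists_def subspaces_def dim_indep_list intro: vec.span_minimal[THEN subsetD])
    moreover have "vs \<in> indep_lists (vec.span (set vs)) d"
      using vs by (auto simp: indep_lists_def vec.span_base)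
    ultimately show "vs \<in> (\<Union>W\<in>?A. indep_lists W d)" by blast
  qed (auto simp: indep_lists_def subspaces_def)
  then have "card (indep_lists U d) = card (\<Union>W\<in>?A. indep_lists W d)" by simp
  also have "\<dots> = (\<Sum>W\<in>?A. card (indep_lists W d))"
  proof (rule card_UN_disjoint)
    show "\<forall>W\<in>?A. \<forall>W'\<in>?A. W \<noteq> W' \<longrightarrow> indep_lists W d \<inter> indep_lists W' d = {}"
    proof (intro ballI impI, rule ccontr)
      fix W W' assume W: "W \<in> ?A" "W' \<in> ?A" and ne: "W \<noteq> W'"
        and "indep_lists W d \<inter> indep_lists W' d \<noteq> {}"
      then obtain vs where "vs \<in> indep_lists W d" "vs \<in> indep_lists W' d" by blast
      then have "vec.span (set vs) = W" "vec.span (set vs) = W'"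
        using W indep_lists_span[of W vs] indep_lists_span[of W' vs] by (auto simp: subspaces_def)
      with ne show False by simp
    qed
  qed (auto simp: finite_indep_lists)
  finally have "real (card (indep_lists U d)) = (\<Sum>W\<in>?A. real (card (indep_lists W d)))"
    by simp
  also have "\<dots> = (\<Sum>W\<in>?A. \<Prod>i<d. ?q ^ d - ?q ^ i)"
    by (rule sum.cong) (auto simp: card_indep_lists subspaces_def)
  finally have "(\<Prod>i<d. ?q ^ vec.dim U - ?q ^ i) = real (card ?A) * (\<Prod>i<d. ?q ^ d - ?q ^ i)"
    by (simp add: card_indep_lists[OF U])
  then show ?thesis
    unfolding prod_power_diff[OF q(1)] using q q_fact_neq_0[OF q(1), of d] by simp
qed

lemma sum_subspaces_dim:
  fixes U :: "('a::{field,finite}^'n) set" and f :: "nat \<Rightarrow> real"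
  assumes U: "vec.subspace U"
  shows "(\<Sum>W\<in>subspaces U. f (vec.dim W)) = (\<Sum>d\<le>vec.dim U. q_binomial (real CARD('a)) (vec.dim U) d * f d)"
proof -
  have "vec.dim W \<le> vec.dim U" if "W \<in> subspaces U" for W
    using that unfolding subspaces_def by (intro vec.dim_subset) blast
  then have "(\<Sum>d\<le>vec.dim U. \<Sum>W | W \<in> subspaces U \<and> vec.dim W = d. f (vec.dim W)) = (\<Sum>W\<in>subspaces U. f (vec.dim W))"
    by (intro sum.group) auto
  then show ?thesis by (simp add: card_subspaces_dim[OF U] flip: sum_distrib_right)
qed

text \<open>The q-binomial theorem at z = 1, where the factor i = 0 vanishes. The summand is the
  Moebius function of the subspace lattice, so this is its defining relation on the interval from
  the zero space to U.\<close>

lemma alternating_sum_subspaces: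
  fixes U :: "('a::{field,finite}^'n) set"
  assumes U: "vec.subspace U" and "vec.dim U > 0"
  shows "(\<Sum>W\<in>subspaces U. (-1) ^ vec.dim W * real CARD('a) ^ (vec.dim W choose 2)) = 0"
proof -
  let ?q = "real CARD('a)"
  have "(\<Sum>W\<in>subspaces U. (-1) ^ vec.dim W * ?q ^ (vec.dim W choose 2))
      = (\<Sum>d\<le>vec.dim U. (-1) ^ d * ?q ^ (d choose 2) * q_binomial ?q (vec.dim U) d * 1 ^ d)"
    by (subst sum_subspaces_dim[OF U, of "\<lambda>d. (-1) ^ d * ?q ^ (d choose 2)"]) (simp add: mult_ac)
  also have "\<dots> = (\<Prod>i<vec.dim U. 1 - 1 * ?q ^ i)"
    using card_field_gt_1[where 'a='a] by (intro q_binomial_theorem) linarith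
  also have "\<dots> = 0" using assms(2) by (intro prod_zero) (auto intro!: bexI[of _ 0])
  finally show ?thesis .
qed

text \<open>Every k-tuple in W spans exactly one subspace of W, so the counts sum to q^(k dim W)
  over all subspaces. The claimed values have the same sum by
  \<open>sum_q_binomial_prod_power_diff\<close>; as they agree on proper subspaces by induction,
  they agree on W.\<close>

lemma card_spanning_lists:
  fixes W :: "('a::{field,finite}^'n) set"
  assumes "vec.subspace W"
  shows "real (card {vs. length vs = k \<and> vec.span (set vs) = W})
    = (\<Prod>i<vec.dim W. real CARD('a) ^ k - real CARD('a) ^ i)"
  using assms
proof (induction "vec.dim W" arbitrary: W rule: less_induct)
  case less
  let ?q = "real CARD('a)"
  let ?L = "\<lambda>W. {vs. length vs = k \<and> vec.span (set vs) = W}"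
  let ?a = "\<lambda>d. \<Prod>i<d. ?q ^ k - ?q ^ i"
  have q: "?q > 0" using card_field_gt_1[where 'a='a] by linarith
  have "{vs. length vs = k \<and> set vs \<subseteq> W} = (\<Union>W'\<in>subspaces W. ?L W')"
  proof safe
    fix vs assume "set vs \<subseteq> W" "k = length vs"
    then show "vs \<in> (\<Union>W'\<in>subspaces W. {us. length us = length vs \<and> vec.span (set us) = W'})"
      using less.prems vec.span_minimal[of "set vs" W] by (auto simp: subspaces_def)
  next
    fix vs x assume "vec.span (set vs) \<in> subspaces W" "x \<in> set vs"
    then show "x \<in> W" using vec.span_base[of x "set vs"] by (auto simp: subspaces_def)
  qed
  then have "card W ^ k = card (\<Union>W'\<in>subspaces W. ?L W')"
    by (metis (no_types, lifting) Collect_cong card_lists_length_eq finite)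
  also have "\<dots> = (\<Sum>W'\<in>subspaces W. card (?L W'))"
    by (rule card_UN_disjoint) (auto simp: finite_lists_of_length)
  finally have "?q ^ (k * vec.dim W) = (\<Sum>W'\<in>subspaces W. real (card (?L W')))"
    by (simp add: card_subspace[OF less.prems] power_mult[symmetric] mult.commute flip: of_nat_power of_nat_sum)
  moreover have "?q ^ (k * vec.dim W) = (\<Sum>W'\<in>subspaces W. ?a (vec.dim W'))"
    using sum_subspaces_dim[OF less.prems, of ?a] sum_q_binomial_prod_power_diff[OF q, of "vec.dim W" k] by simp
  moreover have "W \<in> subspaces W" using less.prems by (simp add: subspaces_def)
  moreover have "real (card (?L W')) = ?a (vec.dim W')" if "W' \<in> subspaces W - {W}" for W'
  proof (rule less.hyps)
    have W': "vec.subspace W'" "W' \<subseteq> W" "W' \<noteq> W" using that by (auto simp: subspaces_def)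
    then have "vec.dim W' \<noteq> vec.dim W" using subspace_eqI_dim less.prems by blast
    then show "vec.dim W' < vec.dim W" using vec.dim_subset[OF W'(2)] by simp
    show "vec.subspace W'" by (rule W')
  qed
  ultimately show ?case by (simp add: sum.remove[of _ W])
qed

section \<open>Annihilators\<close>

text \<open>Functionals are represented by coordinate vectors, so that they range over a finite type
  and random functionals can be counted.\<close>

definition dual_pair :: "'a::field^'n \<Rightarrow> 'a^'n \<Rightarrow> 'a"
  where "dual_pair \<phi> w = (\<Sum>i\<in>UNIV. \<phi> $ i * w $ i)"

lemma dual_pair_add_left: "dual_pair (\<phi> + \<psi>) w = dual_pair \<phi> w + dual_pair \<psi> w"
  by (simp add: dual_pair_def distrib_right sum.distrib)

lemma dual_pair_scale_left: "dual_pair (c *s \<phi>) w = c * dual_pair \<phi> w"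
  by (simp add: dual_pair_def sum_distrib_left mult_ac)

lemma dual_pair_diff_left: "dual_pair (\<phi> - \<psi>) w = dual_pair \<phi> w - dual_pair \<psi> w"
  by (simp add: dual_pair_def left_diff_distrib sum_subtractf)

lemma dual_pair_add_right: "dual_pair \<phi> (v + w) = dual_pair \<phi> v + dual_pair \<phi> w"
  by (simp add: dual_pair_def distrib_left sum.distrib)

lemma dual_pair_scale_right: "dual_pair \<phi> (c *s w) = c * dual_pair \<phi> w"
  by (simp add: dual_pair_def sum_distrib_left mult_ac)

lemma dual_pair_0_right [simp]: "dual_pair \<phi> 0 = 0"
  by (simp add: dual_pair_def)

definition annihilator :: "('a::field^'n) set \<Rightarrow> ('a^'n) set"
  where "annihilator S = {\<phi>. \<forall>w\<in>S. dual_pair \<phi> w = 0}"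

lemma annihilator_span: "annihilator (vec.span S) = annihilator S"
proof -
  have "dual_pair \<phi> w = 0" if "w \<in> vec.span S" "\<forall>w\<in>S. dual_pair \<phi> w = 0" for \<phi> w
    using that(1) by (induction rule: vec.span_induct_alt)
      (simp_all add: dual_pair_add_right dual_pair_scale_right that(2))
  then show ?thesis by (auto simp: annihilator_def vec.span_base)
qed

text \<open>A functional that is 1 at v and 0 on the remaining list spans a complement of the
  smaller annihilator in the larger one, so each further vector divides the cardinality by
  |F_q|.\<close>

lemma card_annihilator_indep_list:
  "indep_list vs \<Longrightarrow> card (annihilator (set vs)) * CARD('a) ^ length vs
    = CARD('a) ^ CARD('n)" for vs :: "('a::{field,finite}^'n) list"
proof (induction vs)
  case Nil
  have "annihilator ({} :: ('a^'n) set) = UNIV" by (simp add: annihilator_def)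
  then show ?case by simp
next
  case (Cons v vs)
  let ?P = "annihilator (set vs)" and ?Q = "annihilator (set (v # vs))"
  obtain k :: 'n where True by simp
  obtain g where g: "Vector_Spaces.linear (*s) (*s) g"
    "\<forall>w\<in>set (v # vs). g w = (if w = v then axis k 1 else 0 :: 'a^'n)"
    using vec.linear_independent_extend[OF independent_indep_list[OF Cons.prems],
        of "\<lambda>w. if w = v then axis k 1 else 0"] by blast
  define \<phi> where "\<phi> = row k (matrix g)"
  have \<phi>: "dual_pair \<phi> w = g w $ k" for w
  proof -
    have "dual_pair \<phi> w = (matrix g *v w) $ k"
      by (simp add: dual_pair_def \<phi>_def row_def matrix_vector_mult_def)
    then show ?thesis by (simp add: matrix_works[OF g(1)])
  qed
  have "v \<notin> set vs" using Cons.prems by (auto simp: vec.span_base)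
  then have \<phi>P: "dual_pair \<phi> w = 0" if "w \<in> set vs" for w using that g(2) by (auto simp: \<phi>)
  have \<phi>v: "dual_pair \<phi> v = 1" using g(2) by (simp add: \<phi>)
  let ?f = "\<lambda>(c, \<psi>). c *s \<phi> + \<psi>"
  have "bij_betw ?f (UNIV \<times> ?Q) ?P"
    by (rule bij_betw_byWitness[where f' = "\<lambda>\<psi>. (dual_pair \<psi> v, \<psi> - dual_pair \<psi> v *s \<phi>)"])
       (auto simp: annihilator_def dual_pair_add_left dual_pair_scale_left dual_pair_diff_left \<phi>v \<phi>P)
  then have "card ?P = CARD('a) * card ?Q"
    by (metis bij_betw_same_card card_cartesian_product)
  then show ?case using Cons by (simp add: mult_ac)
qed

lemma card_annihilator:
  fixes W :: "('a::{field,finite}^'n) set"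
  assumes "vec.subspace W"
  shows "real (card (annihilator W)) = real CARD('a) ^ CARD('n) / real CARD('a) ^ vec.dim W"
proof -
  obtain vs where vs: "indep_list vs" "vec.span (set vs) = W" "length vs = vec.dim W"
    using indep_list_basis[OF assms] .
  have "card (annihilator W) * CARD('a) ^ vec.dim W = CARD('a) ^ CARD('n)"
    using card_annihilator_indep_list[OF vs(1)] vs annihilator_span[of "set vs"] by simp
  then have "real (card (annihilator W)) * real CARD('a) ^ vec.dim W = real CARD('a) ^ CARD('n)"
    by (metis of_nat_mult of_nat_power)
  then show ?thesis by (simp add: field_simps)
qed

section \<open>Krylov subspaces and profiles\<close>

definition krylov_span :: "'a::field^'n^'n \<Rightarrow> ('a^'n) set \<Rightarrow> nat \<Rightarrow> ('a^'n) set"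
  where "krylov_span \<Delta> W j = vec.span (\<Union>i<j. ((*v) \<Delta> ^^ i) ` W)"

lemma subspace_krylov_span: "vec.subspace (krylov_span \<Delta> W j)"
  by (simp add: krylov_span_def)

lemma krylov_span_0 [simp]: "krylov_span \<Delta> W 0 = {0}"
  by (simp add: krylov_span_def)

lemma krylov_span_Suc: "krylov_span (\<Delta> :: 'a::field^'n^'n) W (Suc j) = vec.span (W \<union> (*v) \<Delta> ` krylov_span \<Delta> W j)"
proof -
  let ?X = "\<Union>i<j. ((*v) \<Delta> ^^ i) ` W"
  have "(\<Union>i<Suc j. ((*v) \<Delta> ^^ i) ` W) = W \<union> (*v) \<Delta> ` ?X"
    by (auto simp: lessThan_Suc_eq_insert_0 image_iff)
  moreover have "(*v) \<Delta> ` vec.span ?X = vec.span ((*v) \<Delta> ` ?X)"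
    by (rule vec.linear_span_image[OF vec.linear_axioms, symmetric])
  moreover have "vec.span (A \<union> vec.span B) = vec.span (A \<union> B)" for A B :: "('a^'n) set"
  proof (rule subset_antisym)
    show "vec.span (A \<union> vec.span B) \<subseteq> vec.span (A \<union> B)"
      by (rule vec.span_minimal) (auto intro: vec.span_base vec.span_mono[THEN subsetD, of B])
    show "vec.span (A \<union> B) \<subseteq> vec.span (A \<union> vec.span B)"
      by (rule vec.span_mono) (auto intro: vec.span_base)
  qed
  ultimately show ?thesis by (simp only: krylov_span_def)
qed

lemma dim_le_CARD: "vec.dim (S :: ('a::field^'n) set) \<le> CARD('n)"
  using vec.dim_subset[of S UNIV] unfolding vec_dim_card by simp

lemma krylov_span_mono: "i \<le> j \<Longrightarrow> krylov_span \<Delta> W i \<subseteq> krylov_span \<Delta> W j"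
  unfolding krylov_span_def by (intro vec.span_mono UN_mono) auto

lemma krylov_span_1: "vec.subspace W \<Longrightarrow> krylov_span \<Delta> W 1 = W"
  by (simp add: krylov_span_def lessThan_Suc vec.span_eq_iff[THEN iffD2])

lemma funpow_invariant:
  "invariant_subspace \<Delta> U \<Longrightarrow> w \<in> U \<Longrightarrow> ((*v) \<Delta> ^^ i) w \<in> U"
  by (induction i) (auto simp: invariant_subspace_def)

lemma krylov_span_subset:
  assumes "invariant_subspace \<Delta> U" "W \<subseteq> U"
  shows "krylov_span \<Delta> W j \<subseteq> U"
  unfolding krylov_span_def using assms funpow_invariant[OF assms(1)]
  by (intro vec.span_minimal) (auto simp: invariant_subspace_def)

text \<open>As \<Delta> maps C into B, it induces a map of B/C onto (B + \<Delta>B)/B. A basis of B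
  adapted to C takes the place of the quotients: only images of basis vectors outside C can be
  new.\<close>

lemma dim_span_Un_image_le:
  fixes B C :: "('a::field^'n) set"
  assumes B: "vec.subspace B" and C: "vec.subspace C" and "C \<subseteq> B" and T: "(*v) \<Delta> ` C \<subseteq> B"
  shows "vec.dim (vec.span (B \<union> (*v) \<Delta> ` B)) + vec.dim C \<le> 2 * vec.dim B"
proof -
  obtain X where X: "X \<subseteq> C" "vec.independent X" "C \<subseteq> vec.span X" "card X = vec.dim C"
    using vec.basis_exists by metis
  obtain Y where Y: "X \<subseteq> Y" "Y \<subseteq> B" "vec.independent Y" "B \<subseteq> vec.span Y"
    using vec.maximal_independent_subset_extend[of X B] X(1,2) \<open>C \<subseteq> B\<close> by (metis order_trans)
  have fin: "finite Y" using Y(3) vec.independent_bound_general by blast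
  have cY: "card Y = vec.dim B" using Y by (simp add: vec.basis_card_eq_dim)
  let ?D = "Y - X" and ?T = "(*v) \<Delta>"
  have cD: "card ?D = vec.dim B - vec.dim C"
    using Y(1) fin cY X(4) by (simp add: card_Diff_subset finite_subset)
  have "?T ` Y \<subseteq> vec.span (Y \<union> ?T ` ?D)"
  proof
    fix y assume "y \<in> ?T ` Y"
    then obtain x where x: "x \<in> Y" "y = ?T x" by blast
    show "y \<in> vec.span (Y \<union> ?T ` ?D)"
    proof (cases "x \<in> X")
      case True
      then have "y \<in> B" using x X T by blast
      then show ?thesis using Y(4) vec.span_mono[of Y "Y \<union> ?T ` ?D"] by blast
    qed (use x in \<open>auto intro: vec.span_base\<close>)
  qed
  then have "vec.span (?T ` Y) \<subseteq> vec.span (Y \<union> ?T ` ?D)"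
    by (simp add: vec.span_minimal)
  then have "?T ` vec.span Y \<subseteq> vec.span (Y \<union> ?T ` ?D)"
    by (simp add: vec.linear_span_image[OF vec.linear_axioms])
  moreover have "B = vec.span Y" using Y B by (simp add: vec.span_minimal subset_antisym)
  ultimately have "B \<union> ?T ` B \<subseteq> vec.span (Y \<union> ?T ` ?D)"
    using vec.span_mono[of Y "Y \<union> ?T ` ?D"] by blast
  then have "vec.dim (B \<union> ?T ` B) \<le> card (Y \<union> ?T ` ?D)"
    using fin by (intro vec.dim_le_card) auto
  also have "\<dots> \<le> card Y + card (?T ` ?D)" by (rule card_Un_le)
  also have "\<dots> \<le> card Y + card ?D" using card_image_le[of ?D ?T] fin by auto
  finally have "vec.dim (B \<union> ?T ` B) \<le> vec.dim B + (vec.dim B - vec.dim C)"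
    unfolding cY cD .
  moreover have "vec.dim C \<le> vec.dim B" by (rule vec.dim_subset[OF \<open>C \<subseteq> B\<close>])
  ultimately show ?thesis by simp
qed

section \<open>Profiles as increments of Krylov dimensions\<close>

definition krylov_dims :: "'a::field^'n^'n \<Rightarrow> ('a^'n) set \<Rightarrow> nat \<Rightarrow> nat"
  where "krylov_dims \<Delta> W j = vec.dim (krylov_span \<Delta> W (Suc j)) - vec.dim (krylov_span \<Delta> W j)"

lemma dim_krylov_span_mono: "i \<le> j \<Longrightarrow> vec.dim (krylov_span \<Delta> W i) \<le> vec.dim (krylov_span \<Delta> W j)"
  by (intro vec.dim_subset krylov_span_mono)

text \<open>The dimensions of the Krylov spaces W_j are concave in j: this is
  \<open>dim_span_Un_image_le\<close> for W_j inside W_(j+1), since \<Delta> maps W_j into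
  W_(j+1).\<close>

lemma krylov_dims_Suc_le: "krylov_dims \<Delta> W (Suc j) \<le> krylov_dims \<Delta> W j"
proof -
  let ?K = "krylov_span \<Delta> W"
  have "W \<subseteq> ?K (Suc j)" by (auto simp: krylov_span_Suc intro: vec.span_base)
  then have "?K (Suc (Suc j)) \<subseteq> vec.span (?K (Suc j) \<union> (*v) \<Delta> ` ?K (Suc j))"
    unfolding krylov_span_Suc[of \<Delta> W "Suc j"] by (intro vec.span_mono) blast
  then have "vec.dim (?K (Suc (Suc j))) \<le> vec.dim (vec.span (?K (Suc j) \<union> (*v) \<Delta> ` ?K (Suc j)))"
    by (rule vec.dim_subset)
  moreover have "(*v) \<Delta> ` ?K j \<subseteq> ?K (Suc j)"
    by (auto simp: krylov_span_Suc intro: vec.span_base)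
  then have "vec.dim (vec.span (?K (Suc j) \<union> (*v) \<Delta> ` ?K (Suc j))) + vec.dim (?K j) \<le> 2 * vec.dim (?K (Suc j))"
    by (intro dim_span_Un_image_le subspace_krylov_span krylov_span_mono) auto
  moreover have "vec.dim (?K j) \<le> vec.dim (?K (Suc j))" by (rule dim_krylov_span_mono) simp
  moreover have "vec.dim (?K (Suc j)) \<le> vec.dim (?K (Suc (Suc j)))" by (rule dim_krylov_span_mono) simp
  ultimately show ?thesis unfolding krylov_dims_def by linarith
qed

lemma sum_krylov_dims: "(\<Sum>j<m. krylov_dims \<Delta> W j) = vec.dim (krylov_span \<Delta> W m)"
proof (induction m)
  case (Suc m)
  then show ?case using dim_krylov_span_mono[of m "Suc m" \<Delta> W] by (simp add: krylov_dims_def)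
qed simp

text \<open>A nonzero increment at j would, by monotonicity, force j + 1 increments of at least 1 in
  a space of dimension n. Hence profiles have finite support, and stage \<open>CARD('n)\<close> of
  the chain is stable.\<close>

lemma krylov_dims_eq_0:
  assumes "CARD('n) \<le> j"
  shows "krylov_dims (\<Delta> :: 'a::field^'n^'n) W j = 0"
proof (rule ccontr)
  assume "krylov_dims \<Delta> W j \<noteq> 0"
  have anti: "krylov_dims \<Delta> W j \<le> krylov_dims \<Delta> W i" if "i \<le> j" for i
    using that krylov_dims_Suc_le by (rule lift_Suc_antimono_le[rotated])
  have "Suc j = (\<Sum>i<Suc j. 1)" by simp
  also have "\<dots> \<le> (\<Sum>i<Suc j. krylov_dims \<Delta> W i)"
  proof (rule sum_mono)
    fix i assume "i \<in> {..<Suc j}"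
    then show "1 \<le> krylov_dims \<Delta> W i" using anti[of i] \<open>krylov_dims \<Delta> W j \<noteq> 0\<close> by simp
  qed
  also have "\<dots> \<le> CARD('n)"
    unfolding sum_krylov_dims by (rule dim_le_CARD)
  finally show False using assms by simp
qed

definition profile :: "'a::field^'n^'n \<Rightarrow> ('a^'n) set \<Rightarrow> (nat \<Rightarrow>\<^sub>0 nat)"
  where "profile \<Delta> W = Abs_poly_mapping (krylov_dims \<Delta> W)"

lemma lookup_profile [simp]:
  "lookup (profile (\<Delta> :: 'a::field^'n^'n) W) j = krylov_dims \<Delta> W j"
proof -
  have "j < CARD('n)" if "krylov_dims \<Delta> W j \<noteq> 0" for j
    using that krylov_dims_eq_0[of j \<Delta> W] by (meson not_less)
  then have "{j. krylov_dims \<Delta> W j \<noteq> 0} \<subseteq> {..<CARD('n)}" by auto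
  then have "finite {j. krylov_dims \<Delta> W j \<noteq> 0}" by (rule finite_subset) simp
  then show ?thesis by (simp add: profile_def Abs_poly_mapping_inverse)
qed

lemma is_partition_profile: "is_partition (profile \<Delta> W)"
  by (rule is_partitionI) (simp add: krylov_dims_Suc_le)

text \<open>Since the chain is stable at stage \<open>CARD('n)\<close>, the size of the profile is
  the dimension of the invariant subspace generated by W.\<close>

lemma weight_profile: "weight (profile (\<Delta> :: 'a::field^'n^'n) W) = vec.dim (krylov_span \<Delta> W CARD('n))"
proof -
  have "keys (profile \<Delta> W) \<subseteq> {..<CARD('n)}"
    using krylov_dims_eq_0[of _ \<Delta> W] by (metis in_keys_iff lessThan_iff linorder_not_less lookup_profile subsetI)
  then show ?thesis by (simp add: weight_sum sum_krylov_dims)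
qed

lemma krylov_dims_0: "vec.subspace W \<Longrightarrow> krylov_dims \<Delta> W 0 = vec.dim W"
  using krylov_span_1[of W \<Delta>] by (simp add: krylov_dims_def)

lemma krylov_span_num_parts:
  assumes "num_parts (profile \<Delta> W) \<le> l"
  shows "vec.dim (krylov_span \<Delta> W l) = weight (profile \<Delta> W)"
proof -
  have "keys (profile \<Delta> W) \<subseteq> {..<l}"
    using assms keys_partition[OF is_partition_profile, of \<Delta> W] by auto
  then show ?thesis by (simp add: weight_sum sum_krylov_dims)
qed

lemma dim_krylov_span_le_weight: "vec.dim (krylov_span \<Delta> W l) \<le> weight (profile \<Delta> W)"
proof -
  let ?A = "{..<l} \<union> keys (profile \<Delta> W)"
  have "weight (profile \<Delta> W) = (\<Sum>j\<in>?A. lookup (profile \<Delta> W) j)"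
    by (rule weight_superset) auto
  moreover have "(\<Sum>j<l. krylov_dims \<Delta> W j) \<le> (\<Sum>j\<in>?A. krylov_dims \<Delta> W j)"
    by (rule sum_mono2) auto
  ultimately show ?thesis by (simp add: sum_krylov_dims)
qed

text \<open>Once W_l is the whole space, the increment with index l is zero, and since the profile
  decreases this bounds its number of parts. Conversely, a profile with at most l parts has reached
  its full size at stage l.\<close>

lemma krylov_span_eq_UNIV_iff:
  fixes \<Delta> :: "'a::field^'n^'n"
  shows "krylov_span \<Delta> W l = UNIV \<longleftrightarrow> weight (profile \<Delta> W) = CARD('n) \<and> num_parts (profile \<Delta> W) \<le> l"
    (is "?L \<longleftrightarrow> ?R")
proof
  assume L: ?L
  have le: "weight (profile \<Delta> W) \<le> CARD('n)"
    unfolding weight_profile by (rule dim_le_CARD)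
  have d: "vec.dim (krylov_span \<Delta> W l) = CARD('n)" unfolding L by (rule vec_dim_card)
  have "krylov_span \<Delta> W (Suc l) = UNIV" using krylov_span_mono[of l "Suc l" \<Delta> W] L by auto
  then have "krylov_dims \<Delta> W l = 0" by (simp only: krylov_dims_def L diff_self_eq_0)
  then have "num_parts (profile \<Delta> W) \<le> l"
    using lookup_eq_0_partition[OF is_partition_profile, of \<Delta> W l] by simp
  then show ?R using le d dim_krylov_span_le_weight[of \<Delta> W l] by simp
next
  assume ?R
  then have "vec.dim (krylov_span \<Delta> W l) = vec.dim (UNIV :: ('a^'n) set)"
    unfolding vec_dim_card by (simp add: krylov_span_num_parts)
  then show ?L by (intro subspace_eqI_dim subspace_krylov_span vec.subspace_UNIV) auto
qed

lemma weight_profile_le: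
  assumes "invariant_subspace \<Delta> U" "W \<subseteq> U"
  shows "weight (profile \<Delta> W) \<le> vec.dim U"
  unfolding weight_profile by (intro vec.dim_subset krylov_span_subset assms)

lemma linear_funpow: "Vector_Spaces.linear (*s) (*s) ((*v) (\<Delta> :: 'a::field^'n^'n) ^^ i)"
proof (induction i)
  case 0
  then show ?case by (simp add: Vector_Spaces.linear_iff id_def vec.vector_space_pair_axioms vec.vector_space_axioms)
next
  case (Suc i)
  then show ?case using Vector_Spaces.linear_compose[OF Suc vec.linear_axioms, of \<Delta>] by (simp add: comp_def)
qed

text \<open>
  Expanding \<open>q^(- dim W_l)\<close> as the probability that a random functional annihilates \<open>W_l\<close> turns the
  sum into alternating sums over all subspaces of the common kernel of fewer than \<open>dim U\<close>
  functionals.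
\<close>

lemma alternating_krylov_sum:
  fixes \<Delta> :: "'a::{field,finite}^'n^'n" and h :: "nat \<Rightarrow> nat"
  assumes U: "vec.subspace U" and less: "(\<Sum>i<m. h i) < vec.dim U"
  shows "(\<Sum>W\<in>subspaces U. (-1) ^ vec.dim W * real CARD('a) ^ (vec.dim W choose 2)
      / real CARD('a) ^ (\<Sum>i<m. vec.dim (krylov_span \<Delta> W (h i)))) = 0"
proof -
  let ?q = "real CARD('a)" and ?T = "\<lambda>i. (*v) \<Delta> ^^ i"
  let ?s = "\<lambda>W. (-1) ^ vec.dim W * ?q ^ (vec.dim W choose 2)"
  let ?F = "PiE {..<m} (\<lambda>_. UNIV :: ('a^'n) set)"
  \<comment> \<open>The common kernel on U of the functionals \<Phi>_i composed with \<Delta>^j for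
    j < h i, of which there are fewer than dim U.\<close>
  define ker where "ker \<Phi> = {u \<in> U. \<forall>i<m. \<forall>j<h i. dual_pair (\<Phi> i) (?T j u) = 0}" for \<Phi>
  have q: "?q > 0" using card_field_gt_1[where 'a='a] by linarith
  have finF: "finite ?F" by (intro finite_PiE) auto
  have lin: "?T j (u + v) = ?T j u + ?T j v" "?T j (c *s u) = c *s ?T j u" for j u v c
    using linear_funpow[where \<Delta> = \<Delta> and i = j] by (simp_all add: Vector_Spaces.linear_iff)
  have sub: "vec.subspace (ker \<Phi>)" for \<Phi>
    unfolding ker_def using U lin(2)[of _ 0 0]
    by (auto simp: vec.subspace_def lin dual_pair_add_right dual_pair_scale_right)
  have pos: "vec.dim (ker \<Phi>) > 0" for \<Phi>
  proof -
    \<comment> \<open>Evaluating all these functionals maps U to a set with fewer elements than U,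
      so two vectors collide and their difference lies in the kernel.\<close>
    let ?I = "Sigma {..<m} (\<lambda>i. {..<h i})"
    let ?f = "\<lambda>u. restrict (\<lambda>(i, j). dual_pair (\<Phi> i) (?T j u)) ?I"
    have "?f ` U \<subseteq> PiE ?I (\<lambda>_. UNIV)"
      by (intro image_subsetI) (simp only: restrict_PiE_iff UNIV_I, blast)
    then have "card (?f ` U) \<le> card (PiE ?I (\<lambda>_. UNIV :: 'a set))"
      by (intro card_mono finite_PiE) auto
    also have "\<dots> = CARD('a) ^ (\<Sum>i<m. h i)" by (simp add: card_PiE)
    also have "\<dots> < card U"
      unfolding card_subspace[OF U] using less card_ge_2_field[where 'a='a] by (intro power_strict_increasing) auto
    finally have "\<not> inj_on ?f U" by (rule pigeonhole)
    then obtain u v where uv: "u \<in> U" "v \<in> U" "u \<noteq> v" "?f u = ?f v" by (auto simp: inj_on_def)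
    have "u - v \<in> ker \<Phi>"
    proof -
      have "dual_pair (\<Phi> i) (?T j (u - v)) = 0" if "i < m" "j < h i" for i j
      proof -
        have "?T j u = ?T j (u - v) + ?T j v" using lin(1)[of j "u - v" v] by simp
        moreover have "dual_pair (\<Phi> i) (?T j u) = dual_pair (\<Phi> i) (?T j v)"
          using fun_cong[OF uv(4), of "(i, j)"] that by simp
        ultimately show ?thesis by (simp add: dual_pair_add_right)
      qed
      then show ?thesis using uv U by (simp add: ker_def vec.subspace_diff)
    qed
    then have "\<not> ker \<Phi> \<subseteq> {0}" using uv(3) by auto
    then show ?thesis using vec.dim_eq_0 by fastforce
  qed
  have ann: "\<Phi> i \<in> annihilator (krylov_span \<Delta> W (h i)) \<longleftrightarrow> (\<forall>j<h i. \<forall>w\<in>W. dual_pair (\<Phi> i) (?T j w) = 0)"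
    for \<Phi> i W
    unfolding krylov_span_def annihilator_span by (auto simp: annihilator_def)
  \<comment> \<open>The i-th functional annihilates the Krylov space of order h i with probability
    q^(- dim), independently of the others. For W inside U all of them do so exactly when W lies in
    \<open>ker \<Phi>\<close>.\<close>
  have weight: "1 / ?q ^ (\<Sum>i<m. vec.dim (krylov_span \<Delta> W (h i)))
      = (\<Sum>\<Phi>\<in>?F. of_bool (W \<subseteq> ker \<Phi>)) / ?q ^ (CARD('n) * m)" if "W \<in> subspaces U" for W
  proof -
    have "(\<Sum>\<Phi>\<in>?F. of_bool (W \<subseteq> ker \<Phi>)) = real (card (?F \<inter> {\<Phi>. W \<subseteq> ker \<Phi>}))"
      using finF by (simp add: sum.If_cases of_bool_def)
    also have "?F \<inter> {\<Phi>. W \<subseteq> ker \<Phi>} = PiE {..<m} (\<lambda>i. annihilator (krylov_span \<Delta> W (h i)))"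
      using that unfolding subspaces_def ker_def by (auto simp: PiE_iff ann subset_eq)
    also have "real (card \<dots>) = (\<Prod>i<m. ?q ^ CARD('n) / ?q ^ vec.dim (krylov_span \<Delta> W (h i)))"
      by (simp add: card_PiE card_annihilator[OF subspace_krylov_span])
    also have "\<dots> = ?q ^ (CARD('n) * m) / ?q ^ (\<Sum>i<m. vec.dim (krylov_span \<Delta> W (h i)))"
      by (simp add: prod_dividef power_sum power_mult)
    finally show ?thesis using q by simp
  qed
  have "(\<Sum>W\<in>subspaces U. ?s W / ?q ^ (\<Sum>i<m. vec.dim (krylov_span \<Delta> W (h i))))
      = (\<Sum>W\<in>subspaces U. \<Sum>\<Phi>\<in>?F. ?s W * of_bool (W \<subseteq> ker \<Phi>) / ?q ^ (CARD('n) * m))"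
  proof (rule sum.cong[OF refl])
    fix W assume "W \<in> subspaces U"
    have "?s W / ?q ^ (\<Sum>i<m. vec.dim (krylov_span \<Delta> W (h i)))
        = ?s W * (1 / ?q ^ (\<Sum>i<m. vec.dim (krylov_span \<Delta> W (h i))))" by simp
    then show "?s W / ?q ^ (\<Sum>i<m. vec.dim (krylov_span \<Delta> W (h i)))
        = (\<Sum>\<Phi>\<in>?F. ?s W * of_bool (W \<subseteq> ker \<Phi>) / ?q ^ (CARD('n) * m))"
      unfolding weight[OF \<open>W \<in> subspaces U\<close>] by (simp add: sum_distrib_left sum_divide_distrib)
  qed
  also have "\<dots> = (\<Sum>\<Phi>\<in>?F. \<Sum>W\<in>subspaces U. ?s W * of_bool (W \<subseteq> ker \<Phi>) / ?q ^ (CARD('n) * m))"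
    by (rule sum.swap)
  also have "\<dots> = 0"
  proof (rule sum.neutral, rule ballI)
    fix \<Phi>
    have "{W \<in> subspaces U. W \<subseteq> ker \<Phi>} = subspaces (ker \<Phi>)"
      by (auto simp: subspaces_def ker_def)
    then have "(\<Sum>W\<in>subspaces U. ?s W * of_bool (W \<subseteq> ker \<Phi>)) = (\<Sum>W\<in>subspaces (ker \<Phi>). ?s W)"
      by (simp add: of_bool_def sum.inter_filter[symmetric] if_distrib cong: if_cong)
    also have "\<dots> = 0" by (rule alternating_sum_subspaces[OF sub pos])
    finally show "(\<Sum>W\<in>subspaces U. ?s W * of_bool (W \<subseteq> ker \<Phi>) / ?q ^ (CARD('n) * m)) = 0"
      by (simp flip: sum_divide_distrib)
  qed
  finally show ?thesis .
qed

section \<open>Relations between the numbers of subspaces with given profile\<close>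

definition profile_count :: "'a::field^'n^'n \<Rightarrow> (nat \<Rightarrow>\<^sub>0 nat) \<Rightarrow> ('a^'n) set \<Rightarrow> nat"
  where "profile_count \<Delta> \<nu> U = card {W \<in> subspaces U. profile \<Delta> W = \<nu>}"

text \<open>The coefficient of the q-Whittaker function \<open>W_\<nu>\<close> in the flag generating function.\<close>

definition whittaker_coeff :: "'a::field^'n^'n \<Rightarrow> (nat \<Rightarrow>\<^sub>0 nat) \<Rightarrow> ('a^'n) set \<Rightarrow> real"
  where "whittaker_coeff \<Delta> \<nu> U = (-1) ^ (weight \<nu> - lookup \<nu> 0)
    / real CARD('a) ^ choose_weight (pm_tail \<nu>) * real (profile_count \<Delta> \<nu> U)"

lemma choose_weight_pm_tail: "choose_weight \<nu> = (lookup \<nu> 0 choose 2) + choose_weight (pm_tail \<nu>)"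
proof -
  obtain n where "\<forall>i\<ge>n. lookup \<nu> i = 0" using finite_mem_pm by blast
  then have "keys \<nu> \<subseteq> {..<Suc n}" "keys (pm_tail \<nu>) \<subseteq> {..<n}"
    by (auto simp: in_keys_iff) (metis le_SucI not_le neq0_conv less_Suc_eq_le)+
  then show ?thesis
    by (simp only: choose_weight_superset[OF finite_lessThan] sum.lessThan_Suc_shift lookup_pm_tail)
qed

text \<open>Both sides sum the increments over the cells of \<theta>, by columns and by rows. Thus
  q^(- \<theta>\<cdot>profile(W)) has the shape handled by \<open>alternating_krylov_sum\<close>,
  with h the conjugate of \<theta>.\<close>

lemma sum_dims_conjugate:
  assumes \<theta>: "is_partition \<theta>"
  shows "(\<Sum>i<lookup \<theta> 0. vec.dim (krylov_span \<Delta> W (lookup (conjugate \<theta>) i))) = pairing \<theta> (profile \<Delta> W)"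
proof -
  let ?h = "lookup (conjugate \<theta>)" and ?a = "krylov_dims \<Delta> W"
  obtain N where N: "\<forall>j\<ge>N. lookup \<theta> j = 0" using finite_mem_pm by blast
  have hN: "?h i \<le> N" for i
  proof -
    have "k < N" if "i < lookup \<theta> k" for k using that N by (cases "k < N") auto
    then have "{k. i < lookup \<theta> k} \<subseteq> {..<N}" by auto
    then show ?thesis using card_mono[OF finite_lessThan, of _ N] by (simp add: lookup_conjugate)
  qed
  have count: "card {i. i < lookup \<theta> 0 \<and> j < ?h i} = lookup \<theta> j" for j
  proof -
    have "?h i = 0" if "\<not> i < lookup \<theta> 0" for i
    proof -
      have "\<not> i < lookup \<theta> k" for k using that is_partitionD[OF \<theta>, of 0 k] by simp
      then show ?thesis by (simp add: lookup_conjugate)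
    qed
    then have "{i. i < lookup \<theta> 0 \<and> j < ?h i} = {i. j < ?h i}" by (auto intro: ccontr)
    then show ?thesis using lookup_conjugate[of "conjugate \<theta>" j] \<theta> by simp
  qed
  have "(\<Sum>i<lookup \<theta> 0. vec.dim (krylov_span \<Delta> W (?h i))) = (\<Sum>i<lookup \<theta> 0. \<Sum>j<?h i. ?a j)"
    by (simp add: sum_krylov_dims)
  also have "\<dots> = (\<Sum>i<lookup \<theta> 0. \<Sum>j<N. of_bool (j < ?h i) * ?a j)"
  proof (rule sum.cong[OF refl])
    fix i
    have "{..<N} \<inter> {j. j < ?h i} = {..<?h i}" using hN[of i] by auto
    then show "(\<Sum>j<?h i. ?a j) = (\<Sum>j<N. of_bool (j < ?h i) * ?a j)" by simp
  qed
  also have "\<dots> = (\<Sum>j<N. \<Sum>i<lookup \<theta> 0. of_bool (j < ?h i) * ?a j)" by (rule sum.swap)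
  also have "\<dots> = (\<Sum>j<N. lookup \<theta> j * ?a j)"
  proof (rule sum.cong[OF refl])
    fix j
    have "(\<Sum>i<lookup \<theta> 0. of_bool (j < ?h i)) = lookup \<theta> j"
      using count[of j] by (simp add: Collect_conj_eq lessThan_def)
    then show "(\<Sum>i<lookup \<theta> 0. of_bool (j < ?h i) * ?a j) = lookup \<theta> j * ?a j"
      by (simp flip: sum_distrib_right)
  qed
  also have "\<dots> = (\<Sum>j\<in>{..<N} \<union> keys (profile \<Delta> W). lookup \<theta> j * ?a j)"
    using N by (intro sum.mono_neutral_left) (auto simp: not_less)
  also have "\<dots> = pairing \<theta> (profile \<Delta> W)"
    by (simp add: pairing_superset[of "{..<N} \<union> keys (profile \<Delta> W)"])
  finally show ?thesis .
qed

text \<open>This is \<open>alternating_krylov_sum\<close> with the subspaces grouped by profile. The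
  weight at \<nu> turns the sign and power of q in \<open>whittaker_coeff\<close> into
  (-1)^(\<nu>_1) q^(binom(\<nu>_1,2)), and \<nu>_1 is the dimension of W.\<close>

lemma sum_whittaker_coeff_eq_0:
  fixes \<Delta> :: "'a::{field,finite}^'n^'n"
  assumes U: "invariant_subspace \<Delta> U" and \<theta>: "is_partition \<theta>" and less: "weight \<theta> < vec.dim U"
  shows "(\<Sum>\<nu> | is_partition \<nu> \<and> weight \<nu> \<le> vec.dim U. whittaker_coeff \<Delta> \<nu> U *
      ((-1) ^ weight \<nu> * real CARD('a) ^ choose_weight \<nu> / real CARD('a) ^ pairing \<theta> \<nu>)) = 0"
proof -
  let ?q = "real CARD('a)" and ?A = "{\<nu>. is_partition \<nu> \<and> weight \<nu> \<le> vec.dim U}"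
  have q: "?q > 0" using card_field_gt_1[where 'a='a] by linarith
  have sub: "vec.subspace U" using U by (simp add: invariant_subspace_def)
  let ?f = "\<lambda>\<nu>. (-1) ^ lookup \<nu> 0 * ?q ^ (lookup \<nu> 0 choose 2) / ?q ^ pairing \<theta> \<nu>"
  have "0 = (\<Sum>W\<in>subspaces U. (-1) ^ vec.dim W * ?q ^ (vec.dim W choose 2)
      / ?q ^ (\<Sum>i<lookup \<theta> 0. vec.dim (krylov_span \<Delta> W (lookup (conjugate \<theta>) i))))"
  proof (rule alternating_krylov_sum[OF sub, symmetric])
    have "(\<Sum>i<lookup \<theta> 0. lookup (conjugate \<theta>) i) \<le> weight (conjugate \<theta>)"
      by (subst weight_superset[of "{..<lookup \<theta> 0} \<union> keys (conjugate \<theta>)"]) (auto intro: sum_mono2)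
    then show "(\<Sum>i<lookup \<theta> 0. lookup (conjugate \<theta>) i) < vec.dim U" using less by simp
  qed
  also have "\<dots> = (\<Sum>W\<in>subspaces U. ?f (profile \<Delta> W))"
    by (rule sum.cong) (auto simp: sum_dims_conjugate[OF \<theta>] krylov_dims_0 subspaces_def)
  also have "\<dots> = (\<Sum>\<nu>\<in>?A. \<Sum>W | W \<in> subspaces U \<and> profile \<Delta> W = \<nu>. ?f (profile \<Delta> W))"
  proof (rule sum.group[symmetric])
    show "finite ?A" by (rule finite_partitions_le)
    show "profile \<Delta> ` subspaces U \<subseteq> ?A"
      using weight_profile_le[OF U] by (auto simp: is_partition_profile subspaces_def)
  qed simp
  also have "\<dots> = (\<Sum>\<nu>\<in>?A. real (profile_count \<Delta> \<nu> U) * ?f \<nu>)"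
    by (simp add: profile_count_def)
  also have "\<dots> = (\<Sum>\<nu>\<in>?A. whittaker_coeff \<Delta> \<nu> U *
      ((-1) ^ weight \<nu> * ?q ^ choose_weight \<nu> / ?q ^ pairing \<theta> \<nu>))"
  proof (rule sum.cong[OF refl])
    fix \<nu>
    obtain d where d: "weight \<nu> = lookup \<nu> 0 + d"
      using lookup_le_weight[of \<nu> 0] le_Suc_ex by blast
    have "(-1::real) ^ (weight \<nu> - lookup \<nu> 0) * (-1) ^ weight \<nu> = (-1) ^ lookup \<nu> 0 * ((-1) * (-1)) ^ d"
      unfolding d power_add power_mult_distrib by simp
    then have "(-1::real) ^ (weight \<nu> - lookup \<nu> 0) * (-1) ^ weight \<nu> = (-1) ^ lookup \<nu> 0"
      by simp
    then show "real (profile_count \<Delta> \<nu> U) * ?f \<nu> = whittaker_coeff \<Delta> \<nu> U *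
      ((-1) ^ weight \<nu> * ?q ^ choose_weight \<nu> / ?q ^ pairing \<theta> \<nu>)"
      using q by (simp add: whittaker_coeff_def choose_weight_pm_tail[of \<nu>] power_add field_simps)
  qed
  finally show ?thesis ..
qed

lemma Rats_whittaker_coeff: "whittaker_coeff \<Delta> \<nu> U \<in> \<rat>"
  unfolding whittaker_coeff_def by auto

text \<open>
  Both sides satisfy the same linear relations, by \<open>alternating_krylov_sum\<close> and
  \<open>alternating_pieri_sum\<close>, and these determine the values at partitions of size less
  than \<open>dim U\<close>.
\<close>

lemma whittaker_coeff_pieri:
  fixes \<Delta> :: "'a::{field,finite}^'n^'n"
  assumes U: "invariant_subspace \<Delta> U" and \<nu>: "is_partition \<nu>" "weight \<nu> \<le> vec.dim U"
  shows "whittaker_coeff \<Delta> \<nu> U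
    = (\<Sum>\<mu>\<in>partitions_of (vec.dim U). pieri (real CARD('a)) \<mu> \<nu> * whittaker_coeff \<Delta> \<mu> U)"
proof -
  let ?q = "real CARD('a)" and ?n = "vec.dim U"
  let ?A = "{\<nu>. is_partition \<nu> \<and> weight \<nu> \<le> ?n}" and ?B = "{\<nu>. is_partition \<nu> \<and> weight \<nu> < ?n}"
  let ?S = "\<lambda>\<nu>. whittaker_coeff \<Delta> \<nu> U"
  let ?T = "\<lambda>\<nu>. \<Sum>\<mu>\<in>partitions_of ?n. pieri ?q \<mu> \<nu> * ?S \<mu>"
  have q: "?q > 0" using card_field_gt_1[where 'a='a] by linarith
  have finA: "finite ?A" by (rule finite_partitions_le)
  then have finB: "finite ?B" by (rule rev_finite_subset) auto
  \<comment> \<open>Among partitions of size n only \<nu> itself interlaces with \<nu>, so the claim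
    is trivial in top size; these values serve as the known part of the linear system.\<close>
  have top: "?S \<nu> = ?T \<nu>" if "is_partition \<nu>" "weight \<nu> = ?n" for \<nu>
  proof -
    have "pieri ?q \<mu> \<nu> = 0" if "\<mu> \<in> partitions_of ?n - {\<nu>}" for \<mu>
      using interlaces_weight_eq[of \<mu> \<nu>] that \<open>weight \<nu> = ?n\<close> by (auto simp: pieri_def partitions_of_def)
    then have "?T \<nu> = pieri ?q \<nu> \<nu> * ?S \<nu>"
      using that finite_partitions_of by (subst sum.remove[of _ \<nu>]) (auto simp: partitions_of_def)
    then show ?thesis using pieri_self[OF q that(1)] by simp
  qed
  show ?thesis
  proof (cases "weight \<nu> = ?n")
    case False
    let ?w = "\<lambda>\<nu>. (-1) ^ weight \<nu> * ?q ^ choose_weight \<nu>"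
    have "(?S \<nu> - ?T \<nu>) * ?w \<nu> = 0"
    proof (rule exp_pairing_injective[OF card_ge_2_field finB])
      show "(?S \<nu> - ?T \<nu>) * ?w \<nu> \<in> \<rat>" for \<nu>
        by (auto intro!: Rats_mult Rats_diff Rats_sum Rats_whittaker_coeff Rats_pieri)
      show "\<nu> \<in> ?B" using \<nu> False by simp
    next
      fix \<theta> assume \<theta>: "\<theta> \<in> ?B"
      have 1: "(\<Sum>\<nu>\<in>?A. ?S \<nu> * (?w \<nu> / ?q ^ pairing \<theta> \<nu>)) = 0"
        using sum_whittaker_coeff_eq_0[OF U] \<theta> by simp
      have "(\<Sum>\<nu>\<in>?A. ?T \<nu> * (?w \<nu> / ?q ^ pairing \<theta> \<nu>))
          = (\<Sum>\<nu>\<in>?A. \<Sum>\<mu>\<in>partitions_of ?n. ?S \<mu> * (pieri ?q \<mu> \<nu> * (?w \<nu> / ?q ^ pairing \<theta> \<nu>)))"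
        by (simp only: sum_distrib_right) (simp add: mult_ac)
      also have "\<dots> = (\<Sum>\<mu>\<in>partitions_of ?n. \<Sum>\<nu>\<in>?A. ?S \<mu> * (pieri ?q \<mu> \<nu> * (?w \<nu> / ?q ^ pairing \<theta> \<nu>)))"
        by (rule sum.swap)
      also have "\<dots> = 0"
      proof (rule sum.neutral, rule ballI)
        fix \<mu> assume \<mu>: "\<mu> \<in> partitions_of ?n"
        then have "{\<nu>. interlaces \<mu> \<nu>} \<subseteq> ?A"
          using interlaces_partition interlaces_weight by (fastforce simp: partitions_of_def)
        then have "(\<Sum>\<nu>\<in>?A. pieri ?q \<mu> \<nu> * (?w \<nu> / ?q ^ pairing \<theta> \<nu>)) = 0"
          using \<mu> \<theta> finA q by (intro alternating_pieri_sum) (auto simp: partitions_of_def)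
        then show "(\<Sum>\<nu>\<in>?A. ?S \<mu> * (pieri ?q \<mu> \<nu> * (?w \<nu> / ?q ^ pairing \<theta> \<nu>))) = 0"
          unfolding sum_distrib_left[symmetric] by simp
      qed
      finally have 2: "(\<Sum>\<nu>\<in>?A. ?T \<nu> * (?w \<nu> / ?q ^ pairing \<theta> \<nu>)) = 0" .
      \<comment> \<open>The relations run over all sizes up to n. By \<open>top\<close> the
        differences vanish in size n, which leaves a square system indexed by
        \<open>?B\<close>.\<close>
      have "(\<Sum>\<nu>\<in>?B. (?S \<nu> - ?T \<nu>) * ?w \<nu> / ?q ^ pairing \<theta> \<nu>)
          = (\<Sum>\<nu>\<in>?A. (?S \<nu> - ?T \<nu>) * ?w \<nu> / ?q ^ pairing \<theta> \<nu>)"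
      proof (rule sum.mono_neutral_left[OF finA])
        show "\<forall>\<nu>\<in>?A - ?B. (?S \<nu> - ?T \<nu>) * ?w \<nu> / ?q ^ pairing \<theta> \<nu> = 0"
        proof
          fix \<nu> assume "\<nu> \<in> ?A - ?B"
          then show "(?S \<nu> - ?T \<nu>) * ?w \<nu> / ?q ^ pairing \<theta> \<nu> = 0" using top[of \<nu>] by auto
        qed
      qed auto
      also have "\<dots> = 0"
        using 1 2 by (simp only: left_diff_distrib diff_divide_distrib times_divide_eq_right sum_subtractf diff_self)
      finally show "(\<Sum>\<nu>\<in>?B. (?S \<nu> - ?T \<nu>) * ?w \<nu> / ?q ^ pairing \<theta> \<nu>) = 0" .
    qed
    then show ?thesis using q by simp
  qed (use top \<nu> in simp)
qed

lemma invariant_krylov_span: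
  fixes \<Delta> :: "'a::field^'n^'n"
  shows "invariant_subspace \<Delta> (krylov_span \<Delta> W CARD('n))"
proof -
  let ?K = "krylov_span \<Delta> W"
  have "vec.dim (?K CARD('n)) = vec.dim (?K (Suc CARD('n)))"
    using krylov_dims_eq_0[of "CARD('n)" \<Delta> W] dim_krylov_span_mono[of "CARD('n)" "Suc CARD('n)" \<Delta> W]
    by (simp add: krylov_dims_def)
  then have "?K CARD('n) = ?K (Suc CARD('n))"
    by (intro subspace_eqI_dim subspace_krylov_span krylov_span_mono) auto
  moreover have "\<Delta> *v w \<in> ?K (Suc CARD('n))" if "w \<in> ?K CARD('n)" for w
    using that by (auto simp: krylov_span_Suc intro: vec.span_base)
  ultimately show ?thesis by (simp add: invariant_subspace_def subspace_krylov_span)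
qed

definition invariant_subspaces :: "'a::field^'n^'n \<Rightarrow> ('a^'n) set \<Rightarrow> nat \<Rightarrow> ('a^'n) set set"
  where "invariant_subspaces \<Delta> U d = {U'. invariant_subspace \<Delta> U' \<and> U' \<subseteq> U \<and> vec.dim U' = d}"

text \<open>A subspace with profile \<nu> generates exactly one invariant subspace, and the
  dimension of the latter is |\<nu>|; so the subspaces of U are sorted by what they
  generate.\<close>

lemma profile_count_split:
  fixes \<Delta> :: "'a::{field,finite}^'n^'n"
  assumes U: "invariant_subspace \<Delta> U"
  shows "profile_count \<Delta> \<nu> U = (\<Sum>U'\<in>invariant_subspaces \<Delta> U (weight \<nu>). profile_count \<Delta> \<nu> U')"
proof -
  let ?C = "\<lambda>U. {W \<in> subspaces U. profile \<Delta> W = \<nu>}"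
  let ?g = "\<lambda>W. krylov_span \<Delta> W CARD('n)"
  have gen: "?g W = U'" if W: "W \<in> ?C U'" and U': "U' \<in> invariant_subspaces \<Delta> U (weight \<nu>)" for W U'
  proof (rule subspace_eqI_dim)
    show "?g W \<subseteq> U'"
      using W U' by (intro krylov_span_subset) (auto simp: subspaces_def invariant_subspaces_def)
    show "vec.dim (?g W) = vec.dim U'"
      using W U' weight_profile[of \<Delta> W] by (simp add: invariant_subspaces_def)
  qed (use U' in \<open>auto simp: subspace_krylov_span invariant_subspaces_def invariant_subspace_def\<close>)
  have "?C U = (\<Union>U'\<in>invariant_subspaces \<Delta> U (weight \<nu>). ?C U')"
  proof (rule subset_antisym; rule subsetI)
    fix W assume W: "W \<in> ?C U"
    then have "?g W \<in> invariant_subspaces \<Delta> U (weight \<nu>)"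
      using invariant_krylov_span[of \<Delta> W] krylov_span_subset[OF U, of W] weight_profile[of \<Delta> W]
      by (auto simp: invariant_subspaces_def subspaces_def)
    moreover have "W \<subseteq> krylov_span \<Delta> W 1" by (auto simp: krylov_span_Suc intro: vec.span_base)
    then have "W \<subseteq> ?g W" using krylov_span_mono[of 1 "CARD('n)" \<Delta> W] by (auto simp: Suc_le_eq)
    ultimately show "W \<in> (\<Union>U'\<in>invariant_subspaces \<Delta> U (weight \<nu>). ?C U')"
      using W by (auto simp: subspaces_def)
  qed (auto simp: subspaces_def invariant_subspaces_def)
  then have "profile_count \<Delta> \<nu> U = card (\<Union>U'\<in>invariant_subspaces \<Delta> U (weight \<nu>). ?C U')"
    unfolding profile_count_def by (rule arg_cong)
  also have "\<dots> = (\<Sum>U'\<in>invariant_subspaces \<Delta> U (weight \<nu>). card (?C U'))"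
  proof (rule card_UN_disjoint)
    show "\<forall>A\<in>invariant_subspaces \<Delta> U (weight \<nu>). \<forall>B\<in>invariant_subspaces \<Delta> U (weight \<nu>).
        A \<noteq> B \<longrightarrow> ?C A \<inter> ?C B = {}"
      using gen by blast
  qed auto
  finally show ?thesis by (simp only: profile_count_def)
qed

lemma whittaker_coeff_split:
  fixes \<Delta> :: "'a::{field,finite}^'n^'n"
  assumes "invariant_subspace \<Delta> U"
  shows "(\<Sum>U'\<in>invariant_subspaces \<Delta> U (weight \<nu>). whittaker_coeff \<Delta> \<nu> U') = whittaker_coeff \<Delta> \<nu> U"
  unfolding whittaker_coeff_def profile_count_split[OF assms] by (simp add: sum_distrib_left)

section \<open>Invariant flags\<close>

text \<open>Flags of U in place of the whole space, so that the last step of a flag can be removed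
  recursively.\<close>

definition flags_to :: "'a::field^'n^'n \<Rightarrow> ('a^'n) set \<Rightarrow> nat list \<Rightarrow> ('a^'n) set list set"
  where "flags_to \<Delta> U \<alpha> = {W. length W = Suc (length \<alpha>) \<and>
    W ! 0 = {0} \<and> W ! length \<alpha> = U \<and>
    (\<forall>i\<le>length \<alpha>. invariant_subspace \<Delta> (W ! i)) \<and>
    (\<forall>i<length \<alpha>. W ! i \<subseteq> W ! Suc i \<and> vec.dim (W ! Suc i) = vec.dim (W ! i) + \<alpha> ! i)}"

lemma X_flags_eq: "X_flags \<Delta> \<alpha> = card (flags_to \<Delta> UNIV \<alpha>)"
  by (simp add: X_flags_def invariant_flags_def flags_to_def)

lemma invariant_subspace_zero: "invariant_subspace \<Delta> {0}"
  by (simp add: invariant_subspace_def)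

lemma card_flags_to_Nil: "card (flags_to \<Delta> U []) = of_bool (U = {0})"
proof -
  have "W \<in> flags_to \<Delta> U [] \<longleftrightarrow> W = [{0}] \<and> U = {0}" for W
  proof (cases "length W = 1")
    case True
    then obtain A where "W = [A]" by (auto simp: length_Suc_conv)
    then show ?thesis by (simp add: flags_to_def) (metis invariant_subspace_zero)
  qed (auto simp: flags_to_def)
  then have "flags_to \<Delta> U [] = (if U = {0} then {[{0}]} else {})"
    by (intro set_eqI) simp
  then show ?thesis by simp
qed

lemma finite_flags_to: "finite (flags_to (\<Delta> :: 'a::{field,finite}^'n^'n) U \<alpha>)"
  unfolding flags_to_def by (rule finite_lists_of_length)

lemma card_flags_to_snoc:
  fixes \<Delta> :: "'a::{field,finite}^'n^'n"
  assumes U: "invariant_subspace \<Delta> U"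
  shows "card (flags_to \<Delta> U (\<alpha> @ [r]))
    = (\<Sum>U' | invariant_subspace \<Delta> U' \<and> U' \<subseteq> U \<and> vec.dim U = vec.dim U' + r. card (flags_to \<Delta> U' \<alpha>))"
proof -
  let ?I = "{U'. invariant_subspace \<Delta> U' \<and> U' \<subseteq> U \<and> vec.dim U = vec.dim U' + r}"
  have nth: "(V @ [U]) ! i = V ! i" if "length V = Suc n" "i \<le> n" for V n i
    using that by (simp add: nth_append)
  have "flags_to \<Delta> U (\<alpha> @ [r]) = (\<lambda>V. V @ [U]) ` (\<Union>U'\<in>?I. flags_to \<Delta> U' \<alpha>)"
  proof (rule subset_antisym; rule subsetI)
    fix W assume W: "W \<in> flags_to \<Delta> U (\<alpha> @ [r])"
    define V where "V = butlast W"
    have len: "length W = Suc (Suc (length \<alpha>))" and last: "W ! Suc (length \<alpha>) = U"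
      using W by (auto simp: flags_to_def)
    have "last W = U" using len last by (subst last_conv_nth) auto
    moreover have "W \<noteq> []" using len by auto
    ultimately have WV: "W = V @ [U]" using append_butlast_last_id[of W] by (simp add: V_def)
    have lV: "length V = Suc (length \<alpha>)" using len by (simp add: V_def)
    have Vi: "V ! i = W ! i" if "i \<le> length \<alpha>" for i
      using nth[OF lV that] WV by simp
    have "V \<in> flags_to \<Delta> (V ! length \<alpha>) \<alpha>"
      using W unfolding flags_to_def by (auto simp: lV Vi nth_append less_Suc_eq_le)
    moreover have "V ! length \<alpha> \<in> ?I"
    proof -
      have "W ! length \<alpha> \<subseteq> W ! Suc (length \<alpha>) \<and>
          vec.dim (W ! Suc (length \<alpha>)) = vec.dim (W ! length \<alpha>) + (\<alpha> @ [r]) ! length \<alpha>"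
        "invariant_subspace \<Delta> (W ! length \<alpha>)"
        using W by (auto simp: flags_to_def)
      then show ?thesis by (simp add: Vi last)
    qed
    ultimately show "W \<in> (\<lambda>V. V @ [U]) ` (\<Union>U'\<in>?I. flags_to \<Delta> U' \<alpha>)" using WV by blast
  next
    fix W assume "W \<in> (\<lambda>V. V @ [U]) ` (\<Union>U'\<in>?I. flags_to \<Delta> U' \<alpha>)"
    then obtain U' V where U': "U' \<in> ?I" and V: "V \<in> flags_to \<Delta> U' \<alpha>" and WV: "W = V @ [U]" by blast
    have lV: "length V = Suc (length \<alpha>)" using V by (simp add: flags_to_def)
    have "W ! i \<subseteq> W ! Suc i \<and> vec.dim (W ! Suc i) = vec.dim (W ! i) + (\<alpha> @ [r]) ! i"
      if "i < length (\<alpha> @ [r])" for i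
    proof (cases "i < length \<alpha>")
      case True
      then show ?thesis using V lV by (auto simp: WV nth_append flags_to_def)
    next
      case False
      then have "i = length \<alpha>" using that by simp
      then show ?thesis using V U' lV by (auto simp: WV nth_append flags_to_def)
    qed
    moreover have "invariant_subspace \<Delta> (W ! i)" if "i \<le> length (\<alpha> @ [r])" for i
      using V U lV that by (cases "i \<le> length \<alpha>") (auto simp: WV nth_append flags_to_def le_Suc_eq)
    ultimately show "W \<in> flags_to \<Delta> U (\<alpha> @ [r])"
      using V lV by (auto simp: flags_to_def WV nth_append)
  qed
  then have "card (flags_to \<Delta> U (\<alpha> @ [r])) = card (\<Union>U'\<in>?I. flags_to \<Delta> U' \<alpha>)"
    by (simp add: card_image inj_on_def)
  also have "\<dots> = (\<Sum>U'\<in>?I. card (flags_to \<Delta> U' \<alpha>))"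
  proof (rule card_UN_disjoint)
    show "\<forall>A\<in>?I. \<forall>B\<in>?I. A \<noteq> B \<longrightarrow> flags_to \<Delta> A \<alpha> \<inter> flags_to \<Delta> B \<alpha> = {}"
      unfolding flags_to_def by blast
  qed (auto simp: finite_flags_to)
  finally show ?thesis .
qed

section \<open>Counting spanning tuples\<close>

lemma poly_act_eq:
  assumes "f = 0 \<or> degree f < l"
  shows "poly_act f \<Delta> v = (\<Sum>j<l. coeff f j *s (((*v) \<Delta> ^^ j) v))"
proof (cases "f = 0")
  case False
  then show ?thesis
    unfolding poly_act_def using assms
    by (intro sum.mono_neutral_left) (auto simp: coeff_eq_0 not_le)
qed (simp add: poly_act_def)

lemma subspace_krylov:
  fixes \<Delta> :: "'a::field^'n^'n"
  assumes "l > 0"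
  shows "vec.subspace (krylov \<Delta> S l)"
proof (rule vec.subspaceI)
  have "(\<Sum>v\<in>S. poly_act 0 \<Delta> v) = 0" by (simp add: poly_act_def)
  then show "0 \<in> krylov \<Delta> S l" unfolding krylov_def by (force intro!: exI[of _ "\<lambda>_. 0"])
next
  fix x y assume "x \<in> krylov \<Delta> S l" "y \<in> krylov \<Delta> S l"
  then obtain f g where f: "\<forall>v\<in>S. f v = 0 \<or> degree (f v) < l" "x = (\<Sum>v\<in>S. poly_act (f v) \<Delta> v)"
    and g: "\<forall>v\<in>S. g v = 0 \<or> degree (g v) < l" "y = (\<Sum>v\<in>S. poly_act (g v) \<Delta> v)"
    unfolding krylov_def by blast
  have deg: "\<forall>v\<in>S. f v + g v = 0 \<or> degree (f v + g v) < l"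
    using f(1) g(1) assms by (metis add.right_neutral add_0 degree_add_less)
  have "poly_act (f v + g v) \<Delta> v = poly_act (f v) \<Delta> v + poly_act (g v) \<Delta> v" if "v \<in> S" for v
    using f(1) g(1) deg that
    by (simp add: poly_act_eq[of _ l] sum.distrib vec.scale_left_distrib)
  then have "x + y = (\<Sum>v\<in>S. poly_act (f v + g v) \<Delta> v)" by (simp add: f(2) g(2) sum.distrib)
  with deg show "x + y \<in> krylov \<Delta> S l" unfolding krylov_def by (force intro!: exI[of _ "\<lambda>v. f v + g v"])
next
  fix x c assume "x \<in> krylov \<Delta> S l"
  then obtain f where f: "\<forall>v\<in>S. f v = 0 \<or> degree (f v) < l" "x = (\<Sum>v\<in>S. poly_act (f v) \<Delta> v)"
    unfolding krylov_def by blast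
  have deg: "\<forall>v\<in>S. smult c (f v) = 0 \<or> degree (smult c (f v)) < l"
    using f(1) assms by auto
  have "poly_act (smult c (f v)) \<Delta> v = c *s poly_act (f v) \<Delta> v" if "v \<in> S" for v
    using f(1) deg that by (simp add: poly_act_eq[of _ l] vec.scale_sum_right vec.scale_scale)
  then have "c *s x = (\<Sum>v\<in>S. poly_act (smult c (f v)) \<Delta> v)" by (simp add: f(2) vec.scale_sum_right)
  with deg show "c *s x \<in> krylov \<Delta> S l" unfolding krylov_def by (force intro!: exI[of _ "\<lambda>v. smult c (f v)"])
qed

text \<open>Shows that a Krylov subspace depends only on the span of its generators, which allows
  tuples to be sorted by span. The vectors \<Delta>^j v are obtained from the monomial x^j at v and
  the zero polynomial elsewhere.\<close>

lemma krylov_eq_krylov_span: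
  fixes \<Delta> :: "'a::field^'n^'n"
  assumes "l > 0" "finite S"
  shows "krylov \<Delta> S l = krylov_span \<Delta> (vec.span S) l"
proof (rule subset_antisym)
  show "krylov \<Delta> S l \<subseteq> krylov_span \<Delta> (vec.span S) l"
  proof
    fix x assume "x \<in> krylov \<Delta> S l"
    then obtain f where f: "\<forall>v\<in>S. f v = 0 \<or> degree (f v) < l" "x = (\<Sum>v\<in>S. poly_act (f v) \<Delta> v)"
      unfolding krylov_def by blast
    show "x \<in> krylov_span \<Delta> (vec.span S) l"
      unfolding f(2)
    proof (rule vec.subspace_sum[OF subspace_krylov_span])
      fix v assume v: "v \<in> S"
      have "((*v) \<Delta> ^^ j) v \<in> krylov_span \<Delta> (vec.span S) l" if "j < l" for j
        using that v unfolding krylov_span_def by (intro vec.span_base) (auto intro: vec.span_base)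
      then show "poly_act (f v) \<Delta> v \<in> krylov_span \<Delta> (vec.span S) l"
        using f(1) v by (auto simp: poly_act_eq[of _ l]
            intro!: vec.subspace_sum[OF subspace_krylov_span] vec.subspace_scale[OF subspace_krylov_span])
    qed
  qed
  have base: "((*v) \<Delta> ^^ j) v \<in> krylov \<Delta> S l" if "v \<in> S" "j < l" for v j
  proof -
    let ?f = "\<lambda>u. if u = v then monom 1 j else (0 :: 'a poly)"
    have deg: "\<forall>u\<in>S. ?f u = 0 \<or> degree (?f u) < l"
      using that degree_monom_le[of "1::'a" j] by (auto intro: order_le_less_trans)
    have "(\<Sum>u\<in>S. poly_act (?f u) \<Delta> u) = (\<Sum>u\<in>S. if u = v then ((*v) \<Delta> ^^ j) v else 0)"
    proof (rule sum.cong[OF refl])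
      fix u assume "u \<in> S"
      have "(\<Sum>i<l. coeff (monom 1 j) i *s ((*v) \<Delta> ^^ i) v) = (\<Sum>i<l. if i = j then ((*v) \<Delta> ^^ j) v else 0)"
        by (rule sum.cong) auto
      then show "poly_act (?f u) \<Delta> u = (if u = v then ((*v) \<Delta> ^^ j) v else 0)"
        using deg \<open>u \<in> S\<close> that by (subst poly_act_eq[of _ l]) (auto split: if_splits)
    qed
    also have "\<dots> = ((*v) \<Delta> ^^ j) v" using that assms by simp
    finally show ?thesis
      unfolding krylov_def using deg by (intro CollectI exI[of _ ?f] conjI) (rule sym)
  qed
  show "krylov_span \<Delta> (vec.span S) l \<subseteq> krylov \<Delta> S l"
    unfolding krylov_span_def
  proof (rule vec.span_minimal[OF _ subspace_krylov[OF assms(1)]], safe)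
    fix j v assume j: "j < l" and v: "v \<in> vec.span S"
    have "((*v) \<Delta> ^^ j) ` vec.span S = vec.span (((*v) \<Delta> ^^ j) ` S)"
      by (rule vec.linear_span_image[OF linear_funpow, symmetric])
    also have "\<dots> \<subseteq> krylov \<Delta> S l"
      using base j by (intro vec.span_minimal subspace_krylov assms) auto
    finally show "((*v) \<Delta> ^^ j) v \<in> krylov \<Delta> S l" using v by blast
  qed
qed

text \<open>The generating tuples are sorted by their span W and the spaces W by their profile; the
  number of tuples spanning W depends only on dim W, the first entry of the profile.\<close>

lemma krylov_prob_eq:
  fixes \<Delta> :: "'a::{field,finite}^'n^'n"
  assumes "l > 0"
  shows "krylov_prob k l \<Delta> = 1 / real CARD('a) ^ (CARD('n) * k) *
    (\<Sum>\<mu> | \<mu> \<in> partitions_of CARD('n) \<and> num_parts \<mu> \<le> l.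
      real (profile_count \<Delta> \<mu> UNIV) * (\<Prod>i<lookup \<mu> 0. real CARD('a) ^ k - real CARD('a) ^ i))"
proof -
  let ?q = "real CARD('a)" and ?M = "{\<mu>. \<mu> \<in> partitions_of CARD('n) \<and> num_parts \<mu> \<le> l}"
  let ?S = "{W \<in> subspaces UNIV. krylov_span \<Delta> W l = UNIV}"
  let ?L = "\<lambda>W. {vs :: ('a^'n) list. length vs = k \<and> vec.span (set vs) = W}"
  have "{vs :: ('a^'n) list. length vs = k \<and> krylov \<Delta> (set vs) l = UNIV} = (\<Union>W\<in>?S. ?L W)"
    by (auto simp: krylov_eq_krylov_span[OF assms] subspaces_def)
  then have "card {vs :: ('a^'n) list. length vs = k \<and> krylov \<Delta> (set vs) l = UNIV} = card (\<Union>W\<in>?S. ?L W)"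
    by (rule arg_cong)
  also have "\<dots> = (\<Sum>W\<in>?S. card (?L W))"
    by (rule card_UN_disjoint) (auto simp: finite_lists_of_length)
  also have "real \<dots> = (\<Sum>W\<in>?S. \<Prod>i<lookup (profile \<Delta> W) 0. ?q ^ k - ?q ^ i)"
    unfolding of_nat_sum
    by (rule sum.cong) (auto simp: card_spanning_lists krylov_dims_0 subspaces_def)
  also have "\<dots> = (\<Sum>\<mu>\<in>?M. \<Sum>W | W \<in> ?S \<and> profile \<Delta> W = \<mu>. \<Prod>i<lookup (profile \<Delta> W) 0. ?q ^ k - ?q ^ i)"
  proof (rule sum.group[symmetric])
    show "finite ?M" by (rule finite_subset[OF _ finite_partitions_of]) auto
    show "profile \<Delta> ` ?S \<subseteq> ?M"
      by (auto simp: krylov_span_eq_UNIV_iff partitions_of_def is_partition_profile)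
  qed simp
  also have "\<dots> = (\<Sum>\<mu>\<in>?M. real (profile_count \<Delta> \<mu> UNIV) * (\<Prod>i<lookup \<mu> 0. ?q ^ k - ?q ^ i))"
  proof (rule sum.cong[OF refl])
    fix \<mu> assume \<mu>: "\<mu> \<in> ?M"
    then have "{W. W \<in> ?S \<and> profile \<Delta> W = \<mu>} = {W \<in> subspaces UNIV. profile \<Delta> W = \<mu>}"
      by (auto simp: krylov_span_eq_UNIV_iff partitions_of_def)
    then show "(\<Sum>W | W \<in> ?S \<and> profile \<Delta> W = \<mu>. \<Prod>i<lookup (profile \<Delta> W) 0. ?q ^ k - ?q ^ i)
        = real (profile_count \<Delta> \<mu> UNIV) * (\<Prod>i<lookup \<mu> 0. ?q ^ k - ?q ^ i)"
      by (simp add: profile_count_def)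
  qed
  finally show ?thesis by (simp add: krylov_prob_def)
qed

section \<open>Subset sums of Hall--Littlewood factors\<close>

text \<open>The elementary symmetric polynomial e_s in the variables indexed by L.\<close>

definition elem_sum :: "(nat \<Rightarrow> 'f::comm_ring_1) \<Rightarrow> nat set \<Rightarrow> nat \<Rightarrow> 'f"
  where "elem_sum x L s = (\<Sum>B | B \<subseteq> L \<and> card B = s. \<Prod>b\<in>B. x b)"

lemma finite_subsets_card: "finite L \<Longrightarrow> finite {B. B \<subseteq> L \<and> P B}"
  by (rule finite_subset[of _ "Pow L"]) auto

lemma subsets_card_0: "finite L \<Longrightarrow> {B. B \<subseteq> L \<and> card B = 0} = {{}}"
proof -
  assume L: "finite L"
  have "B = {}" if "B \<subseteq> L" "card B = 0" for B
    using that finite_subset[OF that(1) L] by simp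
  then show ?thesis by auto
qed

lemma elem_sum_0 [simp]: "finite L \<Longrightarrow> elem_sum x L 0 = 1"
  unfolding elem_sum_def subsets_card_0 by simp

lemma elem_sum_top: "finite L \<Longrightarrow> elem_sum x L (card L) = (\<Prod>b\<in>L. x b)"
proof -
  assume "finite L"
  then have "{B. B \<subseteq> L \<and> card B = card L} = {L}" using card_subset_eq by auto
  then show ?thesis by (simp add: elem_sum_def)
qed

lemma elem_sum_insert:
  assumes "finite L" "a \<notin> L"
  shows "elem_sum x (insert a L) (Suc s) = elem_sum x L (Suc s) + x a * elem_sum x L s"
proof -
  let ?A = "{B. B \<subseteq> L \<and> card B = Suc s}" and ?C = "{B. B \<subseteq> L \<and> card B = s}"
  have fin: "finite ?A" "finite (insert a ` ?C)" using assms by (simp_all add: finite_subsets_card)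
  have set: "{B. B \<subseteq> insert a L \<and> card B = Suc s} = ?A \<union> insert a ` ?C"
  proof (rule subset_antisym; rule subsetI)
    fix B assume B: "B \<in> {B. B \<subseteq> insert a L \<and> card B = Suc s}"
    show "B \<in> ?A \<union> insert a ` ?C"
    proof (cases "a \<in> B")
      case True
      then have "B = insert a (B - {a})" "card (B - {a}) = s" using B by auto
      then show ?thesis using B by blast
    qed (use B in auto)
  next
    fix B assume "B \<in> ?A \<union> insert a ` ?C"
    then show "B \<in> {B. B \<subseteq> insert a L \<and> card B = Suc s}"
      using assms finite_subset[of _ L] by (auto simp: card_insert_if)
  qed
  have inj: "inj_on (insert a) ?C" using assms(2)
    by (intro inj_onI) (metis (no_types, lifting) insert_ident mem_Collect_eq subsetD)
  have "(\<Prod>b\<in>insert a B. x b) = x a * (\<Prod>b\<in>B. x b)" if "B \<in> ?C" for B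
    using that assms finite_subset[of B L] by (subst prod.insert) auto
  then have "(\<Sum>B\<in>insert a ` ?C. \<Prod>b\<in>B. x b) = x a * elem_sum x L s"
    by (simp add: sum.reindex[OF inj] elem_sum_def sum_distrib_left)
  moreover have "?A \<inter> insert a ` ?C = {}" using assms by blast
  ultimately show ?thesis
    unfolding elem_sum_def[of x "insert a L"] set using fin
    by (subst sum.union_disjoint) (simp_all add: elem_sum_def)
qed

lemma coeff_prod_linear:
  assumes "finite L"
  shows "coeff (\<Prod>b\<in>L. [:1, x b:]) s = elem_sum x L s"
  using assms
proof (induction L arbitrary: s rule: finite_induct)
  case empty
  have e: "{B. B \<subseteq> {} \<and> card B = s} = (if s = 0 then {{}} else {})" by auto
  show ?case unfolding elem_sum_def e by (cases s) simp_all
next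
  case (insert a L)
  then show ?case by (cases s) (simp_all add: elem_sum_insert)
qed

lemma elem_sum_scale: "elem_sum (\<lambda>i. t * x i) L s = t ^ s * elem_sum x L s"
  unfolding elem_sum_def sum_distrib_left by (rule sum.cong) (auto simp: prod.distrib)

text \<open>Each pair separated by the cut of L into B and its complement contributes a factor. With
  \<open>hl_factor\<close> for c this is a symmetrisation over the cosets of a Young subgroup with
  two blocks.\<close>

definition cut_sum :: "(nat \<Rightarrow> nat \<Rightarrow> 'f::comm_ring_1) \<Rightarrow> (nat \<Rightarrow> 'f) \<Rightarrow> nat set \<Rightarrow> nat \<Rightarrow> 'f"
  where "cut_sum c y L s = (\<Sum>B | B \<subseteq> L \<and> card B = s. (\<Prod>i\<in>B. y i) * (\<Prod>i\<in>B. \<Prod>j\<in>L - B. c i j))"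

lemma cut_sum_1: "cut_sum (\<lambda>_ _. 1) y L s = elem_sum y L s"
  by (simp add: cut_sum_def elem_sum_def)

lemma cut_sum_0 [simp]: "finite L \<Longrightarrow> cut_sum c y L 0 = 1"
  unfolding cut_sum_def subsets_card_0 by simp

lemma cut_sum_empty_range: "finite L \<Longrightarrow> card L < s \<Longrightarrow> cut_sum c y L s = 0"
proof -
  assume L: "finite L" "card L < s"
  have "card B \<noteq> s" if "B \<subseteq> L" for B using card_mono[OF L(1) that] L(2) by simp
  then have e: "{B. B \<subseteq> L \<and> card B = s} = {}" by blast
  show ?thesis unfolding cut_sum_def e by simp
qed

text \<open>Exchanging B with its complement reverses the direction of every separated pair.\<close>

lemma cut_sum_complement:
  assumes "finite L" "s \<le> card L"
  shows "cut_sum (\<lambda>i j. c j i) (\<lambda>_. 1) L s = cut_sum c (\<lambda>_. 1) L (card L - s)"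
  unfolding cut_sum_def
proof (rule sum.reindex_bij_witness[of _ "\<lambda>B. L - B" "\<lambda>B. L - B"])
  fix B assume B: "B \<in> {B. B \<subseteq> L \<and> card B = s}"
  then show "L - (L - B) = B" by auto
  show "L - B \<in> {B. B \<subseteq> L \<and> card B = card L - s}"
    using B assms finite_subset[of B L] by (auto simp: card_Diff_subset)
  have "(\<Prod>i\<in>L - B. \<Prod>j\<in>L - (L - B). c i j) = (\<Prod>j\<in>B. \<Prod>i\<in>L - B. c i j)"
    using B by (subst prod.swap) (simp add: double_diff)
  then show "(\<Prod>i\<in>L - B. 1) * (\<Prod>i\<in>L - B. \<Prod>j\<in>L - (L - B). c i j)
      = (\<Prod>i\<in>B. 1) * (\<Prod>i\<in>B. \<Prod>j\<in>L - B. c j i)" by simp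
next
  fix B assume B: "B \<in> {B. B \<subseteq> L \<and> card B = card L - s}"
  then show "L - (L - B) = B" by auto
  show "L - B \<in> {B. B \<subseteq> L \<and> card B = s}"
    using B assms finite_subset[of B L] by (auto simp: card_Diff_subset)
qed

text \<open>
  A subset \<open>B\<close> of \<open>A\<close> with prescribed numbers of elements in each level of \<open>\<alpha>\<close> is a family of
  subsets of the levels.
\<close>

lemma level_cut_sum:
  fixes \<alpha> :: "nat \<Rightarrow> nat"
  assumes A: "finite A" and C: "finite C" "\<alpha> ` A \<subseteq> C"
  shows "(\<Sum>B | B \<subseteq> A \<and> (\<forall>v\<in>C. card {i \<in> B. \<alpha> i = v} = u v).
      (\<Prod>i\<in>B. y i) * (\<Prod>i\<in>B. \<Prod>j | j \<in> A - B \<and> \<alpha> j = \<alpha> i. c i j))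
    = (\<Prod>v\<in>C. cut_sum c y {i \<in> A. \<alpha> i = v} (u v))"
proof -
  let ?L = "\<lambda>v. {i \<in> A. \<alpha> i = v}"
  let ?S = "\<lambda>v. {B. B \<subseteq> ?L v \<and> card B = u v}"
  let ?h = "\<lambda>v B. (\<Prod>i\<in>B. y i) * (\<Prod>i\<in>B. \<Prod>j\<in>?L v - B. c i j)"
  let ?g = "\<lambda>B. (\<Prod>i\<in>B. y i) * (\<Prod>i\<in>B. \<Prod>j | j \<in> A - B \<and> \<alpha> j = \<alpha> i. c i j)"
  let ?T = "{B. B \<subseteq> A \<and> (\<forall>v\<in>C. card {i \<in> B. \<alpha> i = v} = u v)}"
  have "(\<Prod>v\<in>C. cut_sum c y (?L v) (u v)) = (\<Prod>v\<in>C. \<Sum>B\<in>?S v. ?h v B)"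
    by (simp add: cut_sum_def)
  also have "\<dots> = (\<Sum>\<rho>\<in>PiE C ?S. \<Prod>v\<in>C. ?h v (\<rho> v))"
    using A C by (intro prod_sum_PiE) (auto simp: finite_subsets_card)
  also have "\<dots> = (\<Sum>B\<in>?T. ?g B)"
  proof (rule sum.reindex_bij_witness[of _ "\<lambda>B. restrict (\<lambda>v. {i \<in> B. \<alpha> i = v}) C" "\<lambda>\<rho>. \<Union>v\<in>C. \<rho> v"])
    fix \<rho> assume \<rho>: "\<rho> \<in> PiE C ?S"
    have sub: "\<rho> v \<subseteq> ?L v" if "v \<in> C" for v using \<rho> that by (auto simp: PiE_iff)
    have lev: "{i \<in> \<Union>v\<in>C. \<rho> v. \<alpha> i = v} = \<rho> v" if "v \<in> C" for v
      using sub that by blast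
    show "restrict (\<lambda>v. {i \<in> \<Union>v\<in>C. \<rho> v. \<alpha> i = v}) C = \<rho>"
      using \<rho> lev by (intro extensionalityI[of _ C]) (auto simp: PiE_iff)
    show "(\<Union>v\<in>C. \<rho> v) \<in> ?T"
      using \<rho> sub lev by (auto simp: PiE_iff)
    define B where "B = (\<Union>v\<in>C. \<rho> v)"
    have B: "finite B" "\<alpha> ` B \<subseteq> C" "B \<subseteq> A"
      using sub A C finite_subset[of B A] unfolding B_def by auto
    have split: "(\<Prod>i\<in>B. f i) = (\<Prod>v\<in>C. \<Prod>i\<in>\<rho> v. f i)" for f :: "nat \<Rightarrow> 'a"
    proof -
      have "(\<Prod>i\<in>B. f i) = (\<Prod>v\<in>C. \<Prod>i | i \<in> B \<and> \<alpha> i = v. f i)"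
        using B C by (intro prod.group[symmetric]) auto
      then show ?thesis using lev unfolding B_def by (simp cong: prod.cong)
    qed
    have "(\<Prod>v\<in>C. ?h v (\<rho> v)) = (\<Prod>v\<in>C. \<Prod>i\<in>\<rho> v. y i) * (\<Prod>v\<in>C. \<Prod>i\<in>\<rho> v. \<Prod>j\<in>?L v - \<rho> v. c i j)"
      by (rule prod.distrib)
    also have "(\<Prod>v\<in>C. \<Prod>i\<in>\<rho> v. \<Prod>j\<in>?L v - \<rho> v. c i j)
        = (\<Prod>v\<in>C. \<Prod>i\<in>\<rho> v. \<Prod>j | j \<in> A - B \<and> \<alpha> j = \<alpha> i. c i j)"
    proof (intro prod.cong refl)
      fix v i assume v: "v \<in> C" "i \<in> \<rho> v"
      then have "\<alpha> i = v" using sub by blast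
      moreover have "j \<in> \<rho> v \<longleftrightarrow> j \<in> B \<and> \<alpha> j = v" for j
        using eqset_imp_iff[OF lev[OF v(1)], of j] unfolding B_def by simp
      ultimately show "?L v - \<rho> v = {j. j \<in> A - B \<and> \<alpha> j = \<alpha> i}"
        by auto
    qed
    finally show "?g (\<Union>v\<in>C. \<rho> v) = (\<Prod>v\<in>C. ?h v (\<rho> v))"
      unfolding B_def[symmetric] by (simp add: split)
  next
    fix B assume B: "B \<in> ?T"
    then show "(\<Union>v\<in>C. restrict (\<lambda>v. {i \<in> B. \<alpha> i = v}) C v) = B" using C by auto
    show "restrict (\<lambda>v. {i \<in> B. \<alpha> i = v}) C \<in> PiE C ?S" using B by auto
  qed
  finally show ?thesis ..
qed

text \<open>Isolates the properties used of the field of rational functions: distinct nonzero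
  variables and a ring homomorphism from the reals. The bound q > 1 keeps q - 1 and all q-integers
  of positive index invertible.\<close>

locale hl_field =
  fixes x :: "nat \<Rightarrow> 'f::field" and emb :: "real \<Rightarrow> 'f" and q :: real
  assumes inj_x: "inj x" and x_neq_0: "x i \<noteq> 0"
    and emb_add: "emb (a + b) = emb a + emb b"
    and emb_mult: "emb (a * b) = emb a * emb b"
    and emb_1: "emb 1 = 1"
    and q_gt_1: "q > 1"
begin

lemma q_pos: "q > 0"
  using q_gt_1 by simp

lemma emb_0 [simp]: "emb 0 = 0"
  using emb_add[of 0 0] by (metis add_0 add_cancel_right_right)

lemma emb_eq_0 [simp]: "emb a = 0 \<longleftrightarrow> a = 0"
proof
  assume "emb a = 0"
  then have "emb (a * (1 / a)) = 0" by (simp only: emb_mult mult_zero_left)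
  then show "a = 0" using emb_1 by (cases "a = 0") auto
qed simp

lemma emb_diff: "emb (a - b) = emb a - emb b"
  using emb_add[of "a - b" b] by simp

lemma emb_power: "emb (a ^ n) = emb a ^ n"
  by (induction n) (simp_all add: emb_1 emb_mult)

lemma emb_prod: "emb (\<Prod>i\<in>A. f i) = (\<Prod>i\<in>A. emb (f i))"
  by (induction A rule: infinite_finite_induct) (simp_all add: emb_1 emb_mult)

lemma emb_q_int: "(emb q - 1) * emb (q_int q n) = emb q ^ n - 1"
  using arg_cong[OF q_int_mult[of q n], of emb] by (simp add: emb_mult emb_diff emb_1 emb_power)

lemma emb_q_neq_1: "emb q - 1 \<noteq> 0"
  using emb_eq_0[of "q - 1"] q_gt_1 by (simp add: emb_diff emb_1)

definition hl_factor :: "nat \<Rightarrow> nat \<Rightarrow> 'f"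
  where "hl_factor i j = (x i - emb q * x j) / (x i - x j)"

text \<open>
  Both sides are coefficients of polynomials in \<open>z\<close> of degree at most \<open>card L\<close> that agree at \<open>0\<close>
  and at the points \<open>-1/x_a\<close>.
\<close>

lemma sum_hl_factor_elem_sum:
  assumes L: "finite L"
  shows "(\<Sum>a\<in>L. x a * (\<Prod>b\<in>L - {a}. hl_factor a b) * elem_sum x (L - {a}) s)
    = emb (q_int q (Suc s)) * elem_sum x L (Suc s)"
proof -
  let ?t = "emb q"
  let ?E = "\<lambda>L. \<Prod>b\<in>L. [:1, x b:]"
  let ?w = "\<lambda>a. x a * (\<Prod>b\<in>L - {a}. hl_factor a b)"
  \<comment> \<open>With E(z) the product of all 1 + x_b z, \<open>r\<close> is E(t z) - E(z) and
    \<open>p\<close> is its interpolation form. The coefficients of z^(s+1) give the claim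
    multiplied by t - 1.\<close>
  define p where "p = [:0, ?t - 1:] * (\<Sum>a\<in>L. smult (?w a) (?E (L - {a})))"
  define r where "r = (\<Prod>b\<in>L. [:1, ?t * x b:]) - ?E L"
  have degE: "degree (\<Prod>b\<in>M. [:1, f b:]) \<le> card M" if "finite M" for M and f :: "nat \<Rightarrow> 'f"
  proof -
    have "degree (\<Prod>b\<in>M. [:1, f b:]) \<le> (\<Sum>b\<in>M. degree [:1, f b:])"
      using degree_prod_sum_le[OF that, of "\<lambda>b. [:1, f b:]"] by (simp add: comp_def)
    also have "\<dots> \<le> (\<Sum>b\<in>M. 1)" by (rule sum_mono) auto
    finally show ?thesis by simp
  qed
  have "p = r"
  proof (rule poly_eqI_degree)
    let ?A = "insert 0 ((\<lambda>a. - 1 / x a) ` L)"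
    have inj: "inj_on (\<lambda>a. - 1 / x a) L"
      using inj_x x_neq_0 by (auto simp: inj_on_def field_simps)
    have "0 \<notin> (\<lambda>a. - 1 / x a) ` L" using x_neq_0 by auto
    then have card: "card ?A = Suc (card L)" using L inj by (simp add: card_image)
    show "degree r < card ?A"
      unfolding card r_def using degE[OF L] by (intro le_imp_less_Suc degree_diff_le) auto
    show "degree p < card ?A"
    proof (cases "L = {}")
      case False
      have "degree (\<Sum>a\<in>L. smult (?w a) (?E (L - {a}))) \<le> card L - 1"
      proof (rule degree_sum_le[OF L])
        fix a assume "a \<in> L"
        then show "degree (smult (?w a) (?E (L - {a}))) \<le> card L - 1"
          using degE[of "L - {a}" x] L degree_smult_le order_trans by (fastforce simp: card_Diff_singleton)
      qed
      moreover have "degree p \<le> 1 + degree (\<Sum>a\<in>L. smult (?w a) (?E (L - {a})))"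
        unfolding p_def using degree_mult_le[of "[:0, ?t - 1:]"] by (rule order_trans) simp
      moreover have "card L > 0" using False L by (simp add: card_gt_0_iff)
      ultimately show ?thesis unfolding card by linarith
    qed (simp add: p_def)
    fix z assume "z \<in> ?A"
    then consider "z = 0" | a where "a \<in> L" "z = - 1 / x a" by blast
    then show "poly p z = poly r z"
    proof cases
      case 1
      then show ?thesis by (simp add: p_def r_def poly_prod)
    next
      case (2 a)
      \<comment> \<open>At z = -1/x_a the factor of a vanishes, so only the summand from which a was
        removed survives; the values of its other factors cancel the denominators of
        \<open>hl_factor\<close>.\<close>
      have z: "1 + z * x b = (x a - x b) / x a" "1 + z * (?t * x b) = (x a - ?t * x b) / x a" for b
        unfolding 2(2) using x_neq_0[of a] by (simp_all add: field_simps)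
      have E0: "poly (?E M) z = 0" if "finite M" "a \<in> M" for M
        using that z[of a] unfolding poly_prod by (intro prod_zero) auto
      have "poly (\<Sum>b\<in>L. smult (?w b) (?E (L - {b}))) z = (\<Sum>b\<in>L. ?w b * poly (?E (L - {b})) z)"
        by (simp add: poly_sum)
      also have "\<dots> = ?w a * poly (?E (L - {a})) z"
        using L 2 E0 by (subst sum.remove[of _ a]) (auto intro!: sum.neutral)
      also have "\<dots> = x a * ((\<Prod>b\<in>L - {a}. hl_factor a b) * (\<Prod>b\<in>L - {a}. (x a - x b) / x a))"
        unfolding poly_prod by (simp add: z mult.commute[of _ z])
      also have "(\<Prod>b\<in>L - {a}. hl_factor a b) * (\<Prod>b\<in>L - {a}. (x a - x b) / x a)
          = (\<Prod>b\<in>L - {a}. (x a - ?t * x b) / x a)"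
        unfolding prod.distrib[symmetric]
      proof (rule prod.cong[OF refl])
        fix b assume "b \<in> L - {a}"
        then have "x a - x b \<noteq> 0" using inj_x by (auto simp: inj_def)
        then show "hl_factor a b * ((x a - x b) / x a) = (x a - ?t * x b) / x a"
          by (simp add: hl_factor_def)
      qed
      finally have "poly p z = z * (?t - 1) * (x a * (\<Prod>b\<in>L - {a}. (x a - ?t * x b) / x a))"
        by (simp add: p_def)
      also have "\<dots> = (z * x a) * ((?t - 1) * (\<Prod>b\<in>L - {a}. (x a - ?t * x b) / x a))"
        by (simp only: mult_ac)
      also have "z * x a = - 1" using 2 x_neq_0[of a] by simp
      also have "- 1 * ((?t - 1) * (\<Prod>b\<in>L - {a}. (x a - ?t * x b) / x a))
          = (1 - ?t) * (\<Prod>b\<in>L - {a}. (x a - ?t * x b) / x a)"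
        by (simp add: left_diff_distrib)
      also have "\<dots> = (\<Prod>b\<in>L. (x a - ?t * x b) / x a)"
        using L 2 x_neq_0[of a] by (subst prod.remove[of L a]) (auto simp: field_simps)
      also have "\<dots> = poly r z"
        using E0[OF L 2(1)] unfolding r_def poly_diff by (simp add: poly_prod z mult.commute[of _ z])
      finally show ?thesis .
    qed
  qed
  then have "coeff p (Suc s) = coeff r (Suc s)" by simp
  moreover have "coeff p (Suc s) = (?t - 1) * (\<Sum>a\<in>L. ?w a * elem_sum x (L - {a}) s)"
    using L by (simp add: p_def coeff_sum coeff_prod_linear)
  moreover have "coeff r (Suc s) = (?t ^ Suc s - 1) * elem_sum x L (Suc s)"
    using L by (simp add: r_def coeff_prod_linear elem_sum_scale left_diff_distrib del: power_Suc)
  moreover have "?t ^ Suc s - 1 = (?t - 1) * emb (q_int q (Suc s))"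
    by (rule emb_q_int[symmetric])
  ultimately show ?thesis using emb_q_neq_1 by (simp add: mult.assoc del: power_Suc)
qed

text \<open>The case s + 1 = |L| of \<open>sum_hl_factor_elem_sum\<close>: each summand there
  contains the product of all variables, which is cancelled.\<close>

lemma sum_hl_factor:
  assumes L: "finite L"
  shows "(\<Sum>a\<in>L. \<Prod>b\<in>L - {a}. hl_factor a b) = emb (q_int q (card L))"
proof (cases "L = {}")
  case False
  then obtain s where s: "card L = Suc s" using L by (metis card_eq_0_iff not0_implies_Suc)
  have "(\<Prod>b\<in>L. x b) * (\<Sum>a\<in>L. \<Prod>b\<in>L - {a}. hl_factor a b)
      = (\<Sum>a\<in>L. x a * (\<Prod>b\<in>L - {a}. hl_factor a b) * elem_sum x (L - {a}) s)"
    unfolding sum_distrib_left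
  proof (rule sum.cong[OF refl])
    fix a assume a: "a \<in> L"
    then have "elem_sum x (L - {a}) s = (\<Prod>b\<in>L - {a}. x b)"
      using elem_sum_top[of "L - {a}" x] L s by simp
    then show "(\<Prod>b\<in>L. x b) * (\<Prod>b\<in>L - {a}. hl_factor a b)
        = x a * (\<Prod>b\<in>L - {a}. hl_factor a b) * elem_sum x (L - {a}) s"
      using L a by (simp add: prod.remove)
  qed
  also have "\<dots> = (\<Prod>b\<in>L. x b) * emb (q_int q (card L))"
    unfolding sum_hl_factor_elem_sum[OF L] using elem_sum_top[OF L, of x] s by simp
  finally show ?thesis using L x_neq_0 by simp
qed (simp add: q_int_def)

text \<open>Double counting of pairs (B, a) with a in B. For fixed B, inserting the factors from a
  to the rest of B and summing over a gives [s+1]; for fixed a, these factors join those from a to L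
  - B to form the product over L - {a}.\<close>

lemma cut_sum_Suc:
  assumes L: "finite L"
  shows "emb (q_int q (Suc s)) * cut_sum hl_factor y L (Suc s)
    = (\<Sum>a\<in>L. y a * (\<Prod>b\<in>L - {a}. hl_factor a b) * cut_sum hl_factor y (L - {a}) s)"
proof -
  let ?c = hl_factor
  let ?g = "\<lambda>L B. (\<Prod>i\<in>B. y i) * (\<Prod>i\<in>B. \<Prod>j\<in>L - B. ?c i j)"
  let ?S = "{B. B \<subseteq> L \<and> card B = Suc s}" and ?T = "\<lambda>a. {B. B \<subseteq> L - {a} \<and> card B = s}"
  have fin: "finite B" if "B \<subseteq> L" for B using that L finite_subset by blast
  have "emb (q_int q (Suc s)) * cut_sum ?c y L (Suc s)
      = (\<Sum>B\<in>?S. \<Sum>a\<in>B. (\<Prod>b\<in>B - {a}. ?c a b) * ?g L B)"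
    unfolding cut_sum_def sum_distrib_left
  proof (rule sum.cong[OF refl])
    fix B assume "B \<in> ?S"
    then show "emb (q_int q (Suc s)) * ?g L B = (\<Sum>a\<in>B. (\<Prod>b\<in>B - {a}. ?c a b) * ?g L B)"
      using sum_hl_factor[OF fin, of B] by (simp flip: sum_distrib_right)
  qed
  also have "\<dots> = (\<Sum>(B, a)\<in>Sigma ?S (\<lambda>B. B). (\<Prod>b\<in>B - {a}. ?c a b) * ?g L B)"
    using L fin by (intro sum.Sigma) (auto simp: finite_subsets_card)
  also have "\<dots> = (\<Sum>(a, B)\<in>Sigma L ?T. y a * (\<Prod>b\<in>L - {a}. ?c a b) * ?g (L - {a}) B)"
  proof (rule sum.reindex_bij_witness[of _ "\<lambda>(a, B). (insert a B, a)" "\<lambda>(B, a). (a, B - {a})"], safe)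
    fix B a assume B: "B \<subseteq> L" "card B = Suc s" "a \<in> B"
    then have fB: "finite B" using fin by simp
    show "card (B - {a}) = s" using B by simp
    have L': "L - {a} - (B - {a}) = L - B" using B by auto
    have "(\<Prod>b\<in>L - {a}. ?c a b) = (\<Prod>b\<in>B - {a}. ?c a b) * (\<Prod>b\<in>L - B. ?c a b)"
      using prod.subset_diff[of "B - {a}" "L - {a}" "?c a"] L B unfolding L'
      by (simp add: Diff_mono mult.commute)
    moreover have "(\<Prod>i\<in>B. y i) = y a * (\<Prod>i\<in>B - {a}. y i)"
      using fB B by (simp add: prod.remove)
    moreover have "(\<Prod>i\<in>B. \<Prod>j\<in>L - B. ?c i j)
        = (\<Prod>j\<in>L - B. ?c a j) * (\<Prod>i\<in>B - {a}. \<Prod>j\<in>L - B. ?c i j)"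
      using fB B by (simp add: prod.remove)
    ultimately show "y a * (\<Prod>b\<in>L - {a}. ?c a b) * ?g (L - {a}) (B - {a})
        = (\<Prod>b\<in>B - {a}. ?c a b) * ?g L B"
      unfolding L' by simp
  next
    fix a B assume "a \<in> L" "B \<subseteq> L - {a}"
    then show "card (insert a B) = Suc (card B)" using L finite_subset[of B L] by (subst card_insert_disjoint) auto
  qed auto
  also have "\<dots> = (\<Sum>a\<in>L. \<Sum>B\<in>?T a. y a * (\<Prod>b\<in>L - {a}. ?c a b) * ?g (L - {a}) B)"
    using L by (intro sum.Sigma[symmetric]) (auto simp: finite_subsets_card)
  finally show ?thesis by (simp add: cut_sum_def sum_distrib_left)
qed

lemma emb_q_int_neq_0: "emb (q_int q (Suc s)) \<noteq> 0"
  using q_int_pos[OF q_pos, of "Suc s"] by simp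

text \<open>By \<open>cut_sum_Suc\<close> and \<open>sum_hl_factor_elem_sum\<close> both sides obey
  the same recursion in s, so the Hall--Littlewood factors may be inserted into e_s without changing
  it.\<close>

lemma cut_sum_elem_sum: "finite L \<Longrightarrow> cut_sum hl_factor x L s = elem_sum x L s"
proof (induction s arbitrary: L)
  case (Suc s)
  then have "emb (q_int q (Suc s)) * cut_sum hl_factor x L (Suc s) = emb (q_int q (Suc s)) * elem_sum x L (Suc s)"
    unfolding cut_sum_Suc[OF Suc.prems] sum_hl_factor_elem_sum[OF Suc.prems, symmetric] by simp
  then show ?case using emb_q_int_neq_0 by simp
qed simp

lemma cut_sum_binomial: "finite L \<Longrightarrow> cut_sum hl_factor (\<lambda>_. 1) L s = emb (q_binomial q (card L) s)"
proof (induction s arbitrary: L)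
  case (Suc s)
  show ?case
  proof (cases "s < card L")
    case True
    then obtain m where m: "card L = Suc m" "s \<le> m" by (cases "card L") auto
    have "emb (q_int q (Suc s)) * cut_sum hl_factor (\<lambda>_. 1) L (Suc s)
        = (\<Sum>a\<in>L. \<Prod>b\<in>L - {a}. hl_factor a b) * emb (q_binomial q m s)"
      unfolding cut_sum_Suc[OF Suc.prems] sum_distrib_right using Suc m by (intro sum.cong) auto
    also have "\<dots> = emb (q_int q (Suc s) * q_binomial q (card L) (Suc s))"
      unfolding sum_hl_factor[OF Suc.prems] m(1) q_binomial_Suc_Suc_mult[OF q_pos m(2)] emb_mult ..
    finally show ?thesis using emb_q_int_neq_0 by (simp add: emb_mult)
  qed (use Suc.prems cut_sum_empty_range[of L "Suc s"] in simp)
qed (simp add: q_pos emb_1)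

lemma q_binomial_symmetric: "m \<le> k \<Longrightarrow> q_binomial q k (k - m) = q_binomial q k m"
  by (simp add: q_binomial_def mult.commute)

lemma cut_sum_binomial_flipped:
  assumes "finite L"
  shows "cut_sum (\<lambda>i j. hl_factor j i) (\<lambda>_. 1) L s = emb (q_binomial q (card L) s)"
proof (cases "s \<le> card L")
  case True
  then show ?thesis
    unfolding cut_sum_complement[OF assms True, of hl_factor]
    using assms by (simp add: cut_sum_binomial q_binomial_symmetric)
qed (use assms in \<open>simp add: cut_sum_empty_range\<close>)

end

section \<open>The Pieri rule for multiplication by e_r\<close>

definition pm_indicator :: "nat set \<Rightarrow> (nat \<Rightarrow>\<^sub>0 nat)"
  where "pm_indicator B = Abs_poly_mapping (\<lambda>i. of_bool (i \<in> B))"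

lemma lookup_pm_indicator [simp]: "finite B \<Longrightarrow> lookup (pm_indicator B) i = of_bool (i \<in> B)"
  by (simp add: pm_indicator_def Abs_poly_mapping_inverse)

lemma keys_pm_indicator: "finite B \<Longrightarrow> keys (pm_indicator B) = B"
  by (auto simp: in_keys_iff)

lemma weight_pm_indicator: "finite B \<Longrightarrow> weight (pm_indicator B) = card B"
  by (simp add: weight_def keys_pm_indicator)

lemma pm_indicator_diff_add:
  assumes "finite B" "\<forall>i\<in>B. 1 \<le> lookup \<beta> i"
  shows "\<beta> - pm_indicator B + pm_indicator B = \<beta>"
  using assms by (intro poly_mapping_eqI) (auto simp: lookup_add lookup_minus)

text \<open>Lowering the entries in B by one removes from the level set above j exactly the members
  of B with entry j + 1.\<close>

lemma lookup_conjugate_diff_indicator: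
  assumes B: "finite B" "\<forall>i\<in>B. 1 \<le> lookup \<beta> i"
  shows "lookup (conjugate (\<beta> - pm_indicator B)) j + card {i \<in> B. lookup \<beta> i = Suc j} = lookup (conjugate \<beta>) j"
proof -
  let ?S = "{i. j < lookup (\<beta> - pm_indicator B) i}"
  have "{i. j < lookup \<beta> i} = ?S \<union> {i \<in> B. lookup \<beta> i = Suc j}"
    using B by (auto simp: lookup_minus split: if_splits)
  moreover have "?S \<inter> {i \<in> B. lookup \<beta> i = Suc j} = {}"
    using B by (auto simp: lookup_minus)
  ultimately show ?thesis
    using B(1) finite_lookup_greater[of j "\<beta> - pm_indicator B"]
    by (simp add: lookup_conjugate card_Un_disjoint)
qed

context hl_field
begin

text \<open>The term of one rearrangement \<alpha> in Macdonald's coset form of the Hall--Littlewood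
  polynomial: only pairs with strictly different exponents carry a factor, the sum over the
  stabiliser having been carried out.\<close>

definition hl_weight :: "nat set \<Rightarrow> (nat \<Rightarrow>\<^sub>0 nat) \<Rightarrow> 'f"
  where "hl_weight A \<alpha> = (\<Prod>i\<in>A. x i ^ lookup \<alpha> i)
    * (\<Prod>i\<in>A. \<Prod>j\<in>A. if lookup \<alpha> j < lookup \<alpha> i then hl_factor i j else 1)"

definition exponents :: "nat set \<Rightarrow> (nat \<Rightarrow>\<^sub>0 nat) \<Rightarrow> (nat \<Rightarrow>\<^sub>0 nat) set"
  where "exponents A \<mu> = {\<alpha>. keys \<alpha> \<subseteq> A \<and> conjugate \<alpha> = \<mu>}"

text \<open>The Hall--Littlewood polynomial \<open>P_\<kappa>\<close> in the variables \<open>x_i\<close>, \<open>i \<in> A\<close>, where \<open>\<mu>\<close> is the conjugate of \<open>\<kappa>\<close>.\<close>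

definition hl_sum :: "nat set \<Rightarrow> (nat \<Rightarrow>\<^sub>0 nat) \<Rightarrow> 'f"
  where "hl_sum A \<mu> = (\<Sum>\<alpha>\<in>exponents A \<mu>. hl_weight A \<alpha>)"

lemma finite_exponents: "finite A \<Longrightarrow> finite (exponents A \<mu>)"
  by (rule finite_subset[OF _ finite_bounded_exponents[of A "weight \<mu>"]])
     (auto simp: exponents_def)

lemma prod_cut:
  assumes A: "finite A" "B \<subseteq> A"
  shows "(\<Prod>i\<in>B. \<Prod>j | j \<in> A - B \<and> P i j. f i j)
    = (\<Prod>i\<in>A. \<Prod>j\<in>A. if i \<in> B \<and> j \<notin> B \<and> P i j then f i j else (1 :: 'f))"
proof -
  have "(\<Prod>i\<in>B. \<Prod>j | j \<in> A - B \<and> P i j. f i j)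
      = (\<Prod>i\<in>B. \<Prod>j\<in>A. if i \<in> B \<and> j \<notin> B \<and> P i j then f i j else 1)"
  proof (rule prod.cong[OF refl])
    fix i assume "i \<in> B"
    have "(\<Prod>j\<in>A. if j \<notin> B \<and> P i j then f i j else 1) = (\<Prod>j | j \<in> A \<and> (j \<notin> B \<and> P i j). f i j)"
      using A by (simp add: prod.inter_filter)
    then show "(\<Prod>j | j \<in> A - B \<and> P i j. f i j) = (\<Prod>j\<in>A. if i \<in> B \<and> j \<notin> B \<and> P i j then f i j else 1)"
      using \<open>i \<in> B\<close> by (simp add: conj_assoc)
  qed
  also have "\<dots> = (\<Prod>i\<in>A. \<Prod>j\<in>A. if i \<in> B \<and> j \<notin> B \<and> P i j then f i j else 1)"
    using A by (intro prod.mono_neutral_left) auto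
  finally show ?thesis .
qed

text \<open>Grouping the subsets by their number of elements in each level of \<alpha> makes both
  expressions sums of products of cut sums, with factors 1 and \<open>hl_factor\<close>. These agree
  level by level by \<open>cut_sum_elem_sum\<close>.\<close>

lemma elem_sum_levels:
  fixes \<alpha> :: "nat \<Rightarrow> nat"
  assumes A: "finite A"
  shows "elem_sum x A r = (\<Sum>B | B \<subseteq> A \<and> card B = r.
    (\<Prod>i\<in>B. x i) * (\<Prod>i\<in>B. \<Prod>j | j \<in> A - B \<and> \<alpha> j = \<alpha> i. hl_factor i j))"
proof -
  let ?S = "{B. B \<subseteq> A \<and> card B = r}" and ?C = "\<alpha> ` A"
  let ?s = "\<lambda>B. restrict (\<lambda>v. card {i \<in> B. \<alpha> i = v}) ?C"
  let ?G = "\<lambda>c B. (\<Prod>i\<in>B. x i) * (\<Prod>i\<in>B. \<Prod>j | j \<in> A - B \<and> \<alpha> j = \<alpha> i. c i j :: 'f)"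
  have finS: "finite ?S" by (rule finite_subsets_card[OF A])
  have grp: "(\<Sum>B\<in>?S. ?G c B) = (\<Sum>u\<in>?s ` ?S. \<Prod>v\<in>?C. cut_sum c x {i \<in> A. \<alpha> i = v} (u v))" for c
  proof -
    have "(\<Sum>B\<in>?S. ?G c B) = (\<Sum>u\<in>?s ` ?S. \<Sum>B | B \<in> ?S \<and> ?s B = u. ?G c B)"
      by (rule sum.group[symmetric]) (use finS in auto)
    also have "\<dots> = (\<Sum>u\<in>?s ` ?S. \<Prod>v\<in>?C. cut_sum c x {i \<in> A. \<alpha> i = v} (u v))"
    proof (rule sum.cong[OF refl])
      fix u assume "u \<in> ?s ` ?S"
      then obtain B0 where B0: "B0 \<in> ?S" "u = ?s B0" by blast
      have total: "card B = (\<Sum>v\<in>?C. card {i \<in> B. \<alpha> i = v})" if "B \<subseteq> A" for B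
      proof -
        have "finite B" using that A finite_subset by blast
        then have "(\<Sum>v\<in>?C. \<Sum>i | i \<in> B \<and> \<alpha> i = v. 1::nat) = (\<Sum>i\<in>B. 1)"
          using that A by (intro sum.group) auto
        then show ?thesis by simp
      qed
      have "{B. B \<in> ?S \<and> ?s B = u} = {B. B \<subseteq> A \<and> (\<forall>v\<in>?C. card {i \<in> B. \<alpha> i = v} = u v)}"
      proof (rule set_eqI)
        fix B
        have "?s B = u \<longleftrightarrow> (\<forall>v\<in>?C. card {i \<in> B. \<alpha> i = v} = u v)"
          using B0(2) by (auto simp: restrict_def fun_eq_iff)
        moreover have "card B = r" if "B \<subseteq> A" "\<forall>v\<in>?C. card {i \<in> B. \<alpha> i = v} = u v"
          using total[OF that(1)] total[of B0] that(2) B0 by simp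
        ultimately show "B \<in> {B. B \<in> ?S \<and> ?s B = u}
            \<longleftrightarrow> B \<in> {B. B \<subseteq> A \<and> (\<forall>v\<in>?C. card {i \<in> B. \<alpha> i = v} = u v)}"
          by blast
      qed
      then show "(\<Sum>B | B \<in> ?S \<and> ?s B = u. ?G c B) = (\<Prod>v\<in>?C. cut_sum c x {i \<in> A. \<alpha> i = v} (u v))"
        using level_cut_sum[OF A, where C = ?C and \<alpha> = \<alpha> and u = u and y = x and c = c] A by simp
    qed
    finally show ?thesis .
  qed
  have "elem_sum x A r = (\<Sum>B\<in>?S. ?G (\<lambda>_ _. 1) B)" by (simp add: elem_sum_def)
  also have "\<dots> = (\<Sum>B\<in>?S. ?G hl_factor B)"
    unfolding grp using A by (simp add: cut_sum_1 cut_sum_elem_sum)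
  finally show ?thesis .
qed

text \<open>Adding the indicator of B changes the comparison of a pair in two ways: a tie with only
  i in B becomes strict, and a strict pair with only j in B may become a tie. The extra factors on
  the two sides account for exactly these pairs.\<close>

lemma hl_weight_add_indicator:
  assumes A: "finite A" "B \<subseteq> A"
  shows "hl_weight A \<alpha> * ((\<Prod>i\<in>B. x i) * (\<Prod>i\<in>B. \<Prod>j | j \<in> A - B \<and> lookup \<alpha> j = lookup \<alpha> i. hl_factor i j))
    = hl_weight A (\<alpha> + pm_indicator B)
      * (\<Prod>i\<in>B. \<Prod>j | j \<in> A - B \<and> lookup (\<alpha> + pm_indicator B) j = lookup (\<alpha> + pm_indicator B) i. hl_factor j i)"
proof -
  have fin: "finite B" using A finite_subset by blast
  define \<beta> where "\<beta> = \<alpha> + pm_indicator B"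
  have \<beta>: "lookup \<beta> i = lookup \<alpha> i + of_bool (i \<in> B)" for i
    using fin by (simp add: \<beta>_def lookup_add)
  have "(\<Prod>i\<in>B. x i) = (\<Prod>i\<in>A. x i ^ of_bool (i \<in> B))"
    using A by (intro prod.mono_neutral_cong_left) auto
  then have X: "(\<Prod>i\<in>A. x i ^ lookup \<alpha> i) * (\<Prod>i\<in>B. x i) = (\<Prod>i\<in>A. x i ^ lookup \<beta> i)"
    by (simp add: \<beta> power_add prod.distrib)
  have R: "(\<Prod>i\<in>B. \<Prod>j | j \<in> A - B \<and> lookup \<beta> j = lookup \<beta> i. hl_factor j i)
      = (\<Prod>i\<in>A. \<Prod>j\<in>A. if j \<in> B \<and> i \<notin> B \<and> lookup \<beta> i = lookup \<beta> j then hl_factor i j else 1)"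
    unfolding prod_cut[OF A] by (rule prod.swap)
  have pair: "(if lookup \<alpha> j < lookup \<alpha> i then hl_factor i j else 1)
        * (if i \<in> B \<and> j \<notin> B \<and> lookup \<alpha> j = lookup \<alpha> i then hl_factor i j else 1)
      = (if lookup \<beta> j < lookup \<beta> i then hl_factor i j else 1)
        * (if j \<in> B \<and> i \<notin> B \<and> lookup \<beta> i = lookup \<beta> j then hl_factor i j else 1)" for i j
    by (cases "i \<in> B"; cases "j \<in> B") (auto simp: \<beta>)
  have "(\<Prod>i\<in>A. \<Prod>j\<in>A. if lookup \<alpha> j < lookup \<alpha> i then hl_factor i j else 1)
      * (\<Prod>i\<in>B. \<Prod>j | j \<in> A - B \<and> lookup \<alpha> j = lookup \<alpha> i. hl_factor i j)
      = (\<Prod>i\<in>A. \<Prod>j\<in>A. if lookup \<beta> j < lookup \<beta> i then hl_factor i j else 1)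
      * (\<Prod>i\<in>B. \<Prod>j | j \<in> A - B \<and> lookup \<beta> j = lookup \<beta> i. hl_factor j i)"
    unfolding R prod_cut[OF A] prod.distrib[symmetric] pair ..
  then show ?thesis unfolding \<beta>_def[symmetric] hl_weight_def X[symmetric] by (simp add: mult_ac)
qed

text \<open>With \<mu> the conjugate of \<beta>, the condition prescribes how many elements B has in
  each level: \<mu>_j - \<nu>_j of the \<mu>_j - \<mu>_(j+1) entries equal to j + 1, with j counted
  from 0. So the sum is a product of cut sums, each of which is a q-binomial.\<close>

lemma pieri_sum_indicator:
  assumes A: "finite A" "keys \<beta> \<subseteq> A" and w: "weight \<beta> = weight \<nu> + r"
  shows "(\<Sum>B | B \<subseteq> A \<and> card B = r \<and> (\<forall>i\<in>B. 1 \<le> lookup \<beta> i) \<and> conjugate (\<beta> - pm_indicator B) = \<nu>.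
      \<Prod>i\<in>B. \<Prod>j | j \<in> A - B \<and> lookup \<beta> j = lookup \<beta> i. hl_factor j i) = emb (pieri q (conjugate \<beta>) \<nu>)"
proof -
  let ?\<mu> = "conjugate \<beta>"
  let ?Q = "{B. B \<subseteq> A \<and> card B = r \<and> (\<forall>i\<in>B. 1 \<le> lookup \<beta> i) \<and> conjugate (\<beta> - pm_indicator B) = \<nu>}"
  have finB: "finite B" if "B \<subseteq> A" for B using that A finite_subset by blast
  show ?thesis
  proof (cases "\<forall>j. lookup \<nu> j \<le> lookup ?\<mu> j")
    case False
    then obtain j where j: "\<not> lookup \<nu> j \<le> lookup ?\<mu> j" by blast
    have "?Q = {}"
    proof (rule equals0I)
      fix B assume B: "B \<in> ?Q"
      then have "lookup \<nu> j + card {i \<in> B. lookup \<beta> i = Suc j} = lookup ?\<mu> j"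
        using lookup_conjugate_diff_indicator[of B \<beta> j] finB by auto
      then show False using j by simp
    qed
    moreover have "\<not> interlaces ?\<mu> \<nu>" using j by (auto simp: interlaces_def)
    ultimately show ?thesis by (simp only: pieri_def sum.empty if_False emb_0)
  next
    case True
    obtain N where N: "keys ?\<mu> \<subseteq> {..<N}" using finite_nat_bounded[OF finite_keys] by metis
    have muN: "lookup ?\<mu> j = 0" if "N \<le> j" for j using that N by (force simp: in_keys_iff)
    then have nuN: "lookup \<nu> j = 0" if "N \<le> j" for j using that True[rule_format, of j] by simp
    have betaN: "lookup \<beta> i \<le> N" for i
    proof -
      have "{i. N < lookup \<beta> i} = {}" using muN[of N] finite_lookup_greater[of N \<beta>] by (simp add: lookup_conjugate)
      then show ?thesis by (metis (no_types, lifting) Collect_empty_eq not_le)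
    qed
    \<comment> \<open>The prescribed level counts. Entries equal to 0 must not be chosen, since the
      subtraction of the indicator would truncate there.\<close>
    define u where "u v = (case v of 0 \<Rightarrow> 0 | Suc j \<Rightarrow> lookup ?\<mu> j - lookup \<nu> j)" for v
    let ?C = "{..N}"
    have Q: "?Q = {B. B \<subseteq> A \<and> (\<forall>v\<in>?C. card {i \<in> B. lookup \<beta> i = v} = u v)}"
    proof (rule set_eqI, rule iffI)
      fix B assume B: "B \<in> ?Q"
      have "card {i \<in> B. lookup \<beta> i = v} = u v" for v
      proof (cases v)
        case 0
        have "{i \<in> B. lookup \<beta> i = 0} = {}" using B by force
        then show ?thesis unfolding 0 u_def by (simp only: card.empty nat.case)
      next
        case (Suc j)
        then show ?thesis
          using B lookup_conjugate_diff_indicator[of B \<beta> j] finB by (auto simp: u_def)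
      qed
      then show "B \<in> {B. B \<subseteq> A \<and> (\<forall>v\<in>?C. card {i \<in> B. lookup \<beta> i = v} = u v)}" using B by auto
    next
      fix B assume B: "B \<in> {B. B \<subseteq> A \<and> (\<forall>v\<in>?C. card {i \<in> B. lookup \<beta> i = v} = u v)}"
      then have fB: "finite B" using finB by simp
      have "card {i \<in> B. lookup \<beta> i = 0} = 0" using B by (auto simp: u_def)
      then have ge: "\<forall>i\<in>B. 1 \<le> lookup \<beta> i" using fB by (auto simp: Suc_le_eq)
      have conj: "conjugate (\<beta> - pm_indicator B) = \<nu>"
      proof (rule poly_mapping_eqI)
        fix j
        have eq: "lookup (conjugate (\<beta> - pm_indicator B)) j + card {i \<in> B. lookup \<beta> i = Suc j} = lookup ?\<mu> j"
          by (rule lookup_conjugate_diff_indicator[OF fB ge])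
        show "lookup (conjugate (\<beta> - pm_indicator B)) j = lookup \<nu> j"
        proof (cases "Suc j \<le> N")
          case T: True
          then have "card {i \<in> B. lookup \<beta> i = Suc j} = lookup ?\<mu> j - lookup \<nu> j"
            using B by (auto simp: u_def)
          then show ?thesis using eq True[rule_format, of j] by simp
        qed (use eq muN[of j] nuN[of j] in simp)
      qed
      have "weight \<beta> = weight (\<beta> - pm_indicator B) + card B"
        using arg_cong[OF pm_indicator_diff_add[OF fB ge], of weight] by (simp add: weight_add weight_pm_indicator[OF fB])
      moreover have "weight (\<beta> - pm_indicator B) = weight \<nu>"
        using conj weight_conjugate by metis
      ultimately show "B \<in> ?Q" using B ge conj w by simp
    qed
    have im: "lookup \<beta> ` A \<subseteq> ?C" using betaN by auto
    have "(\<Sum>B\<in>?Q. \<Prod>i\<in>B. \<Prod>j | j \<in> A - B \<and> lookup \<beta> j = lookup \<beta> i. hl_factor j i)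
        = (\<Prod>v\<in>?C. cut_sum (\<lambda>i j. hl_factor j i) (\<lambda>_. 1) {i \<in> A. lookup \<beta> i = v} (u v))"
      unfolding Q using level_cut_sum[OF A(1) finite_atMost im, where u = u
          and y = "\<lambda>_. 1" and c = "\<lambda>i j. hl_factor j i"] by simp
    also have "\<dots> = (\<Prod>v\<in>?C. emb (q_binomial q (card {i \<in> A. lookup \<beta> i = v}) (u v)))"
      using A by (simp add: cut_sum_binomial_flipped)
    also have "\<dots> = emb (\<Prod>j<N. q_binomial q (card {i \<in> A. lookup \<beta> i = Suc j}) (lookup ?\<mu> j - lookup \<nu> j))"
      unfolding lessThan_Suc_atMost[symmetric] prod.lessThan_Suc_shift emb_prod
      by (simp add: u_def q_pos emb_1)
    also have "(\<Prod>j<N. q_binomial q (card {i \<in> A. lookup \<beta> i = Suc j}) (lookup ?\<mu> j - lookup \<nu> j))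
        = (\<Prod>j<N. q_binomial q (lookup ?\<mu> j - lookup ?\<mu> (Suc j)) (lookup ?\<mu> j - lookup \<nu> j))"
    proof (rule prod.cong[OF refl])
      fix j
      have "{i. j < lookup \<beta> i} = {i. Suc j < lookup \<beta> i} \<union> {i \<in> A. lookup \<beta> i = Suc j}"
        using A(2) by (auto simp: in_keys_iff subset_iff)
      moreover have "{i. Suc j < lookup \<beta> i} \<inter> {i \<in> A. lookup \<beta> i = Suc j} = {}" by auto
      ultimately have "lookup ?\<mu> j = lookup ?\<mu> (Suc j) + card {i \<in> A. lookup \<beta> i = Suc j}"
        using A(1) by (simp add: lookup_conjugate card_Un_disjoint finite_lookup_greater)
      then show "q_binomial q (card {i \<in> A. lookup \<beta> i = Suc j}) (lookup ?\<mu> j - lookup \<nu> j)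
          = q_binomial q (lookup ?\<mu> j - lookup ?\<mu> (Suc j)) (lookup ?\<mu> j - lookup \<nu> j)" by simp
    qed
    also have "\<dots> = pieri q ?\<mu> \<nu>"
    proof (cases "interlaces ?\<mu> \<nu>")
      case T: True
      then show ?thesis using pieri_superset[OF q_pos T finite_lessThan N] by simp
    next
      \<comment> \<open>Here \<nu> \<le> \<mu> holds and the other half of interlacing fails at some
        j. More entries equal to j + 1 would have to be lowered than there are, so the q-binomial of
        that level is zero.\<close>
      case F: False
      then obtain j where j: "lookup \<nu> j < lookup ?\<mu> (Suc j)" using True by (auto simp: interlaces_def not_le)
      moreover have "lookup ?\<mu> (Suc j) \<le> lookup ?\<mu> j" by (rule is_partitionD) auto
      ultimately have "j < N" "lookup ?\<mu> j - lookup ?\<mu> (Suc j) < lookup ?\<mu> j - lookup \<nu> j"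
        using muN[of j] by (auto simp: not_le[symmetric])
      then have "(\<Prod>j<N. q_binomial q (lookup ?\<mu> j - lookup ?\<mu> (Suc j)) (lookup ?\<mu> j - lookup \<nu> j)) = 0"
        by (intro prod_zero) (auto intro!: bexI[of _ j])
      then show ?thesis using F by (simp add: pieri_def)
    qed
    finally show ?thesis .
  qed
qed

text \<open>For each \<alpha> the polynomial e_r is expanded with factors adapted to the ties of
  that \<alpha>. The pairs (\<alpha>, B) are then collected by \<beta> = \<alpha> + 1_B, where the
  weight depends on \<beta> alone and the sum over B is the Pieri coefficient.\<close>

theorem hl_sum_pieri:
  assumes A: "finite A"
  shows "elem_sum x A r * hl_sum A \<nu> = (\<Sum>\<mu>\<in>partitions_of (weight \<nu> + r). emb (pieri q \<mu> \<nu>) * hl_sum A \<mu>)"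
proof -
  let ?D = "{\<beta>. keys \<beta> \<subseteq> A \<and> weight \<beta> = weight \<nu> + r}"
  let ?S = "{B. B \<subseteq> A \<and> card B = r}"
  let ?Q = "\<lambda>\<beta>. {B. B \<subseteq> A \<and> card B = r \<and> (\<forall>i\<in>B. 1 \<le> lookup \<beta> i) \<and> conjugate (\<beta> - pm_indicator B) = \<nu>}"
  let ?R = "\<lambda>\<beta> B. \<Prod>i\<in>B. \<Prod>j | j \<in> A - B \<and> lookup \<beta> j = lookup \<beta> i. hl_factor j i"
  have finD: "finite ?D"
    by (rule finite_subset[OF _ finite_bounded_exponents[OF A, of "weight \<nu> + r"]]) auto
  have fB: "finite B" if "B \<subseteq> A" for B using that A finite_subset by blast
  have "elem_sum x A r * hl_sum A \<nu> = (\<Sum>\<alpha>\<in>exponents A \<nu>. \<Sum>B\<in>?S. hl_weight A (\<alpha> + pm_indicator B) * ?R (\<alpha> + pm_indicator B) B)"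
    unfolding hl_sum_def sum_distrib_left
  proof (rule sum.cong[OF refl])
    fix \<alpha>
    have "elem_sum x A r * hl_weight A \<alpha> = (\<Sum>B\<in>?S. hl_weight A \<alpha> *
        ((\<Prod>i\<in>B. x i) * (\<Prod>i\<in>B. \<Prod>j | j \<in> A - B \<and> lookup \<alpha> j = lookup \<alpha> i. hl_factor i j)))"
      unfolding elem_sum_levels[OF A, of r "lookup \<alpha>"] sum_distrib_left[symmetric] by (rule mult.commute)
    also have "\<dots> = (\<Sum>B\<in>?S. hl_weight A (\<alpha> + pm_indicator B) * ?R (\<alpha> + pm_indicator B) B)"
      by (rule sum.cong[OF refl], rule hl_weight_add_indicator[OF A]) simp
    finally show "elem_sum x A r * hl_weight A \<alpha>
        = (\<Sum>B\<in>?S. hl_weight A (\<alpha> + pm_indicator B) * ?R (\<alpha> + pm_indicator B) B)" .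
  qed
  also have "\<dots> = (\<Sum>(\<alpha>, B)\<in>exponents A \<nu> \<times> ?S. hl_weight A (\<alpha> + pm_indicator B) * ?R (\<alpha> + pm_indicator B) B)"
    by (rule sum.cartesian_product)
  also have "\<dots> = (\<Sum>(\<beta>, B)\<in>Sigma ?D ?Q. hl_weight A \<beta> * ?R \<beta> B)"
  proof (rule sum.reindex_bij_witness[of _ "\<lambda>(\<beta>, B). (\<beta> - pm_indicator B, B)" "\<lambda>(\<alpha>, B). (\<alpha> + pm_indicator B, B)"])
    fix p assume p: "p \<in> exponents A \<nu> \<times> ?S"
    obtain \<alpha> B where pe: "p = (\<alpha>, B)" by (cases p)
    have \<alpha>: "keys \<alpha> \<subseteq> A" "conjugate \<alpha> = \<nu>" and B: "B \<subseteq> A" "card B = r"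
      using p by (auto simp: pe exponents_def)
    have "keys (\<alpha> + pm_indicator B) \<subseteq> A"
      using \<alpha> B Poly_Mapping.keys_add[of \<alpha> "pm_indicator B"] by (auto simp: keys_pm_indicator fB)
    moreover have "weight (\<alpha> + pm_indicator B) = weight \<nu> + r"
      using \<alpha>(2) B weight_conjugate[of \<alpha>] by (simp add: weight_add weight_pm_indicator fB)
    ultimately show "(case p of (\<alpha>, B) \<Rightarrow> (\<alpha> + pm_indicator B, B)) \<in> Sigma ?D ?Q"
      using \<alpha> B fB by (auto simp: pe lookup_add)
    show "(case case p of (\<alpha>, B) \<Rightarrow> (\<alpha> + pm_indicator B, B) of (\<beta>, B) \<Rightarrow> (\<beta> - pm_indicator B, B)) = p"
      by (simp add: pe)
    show "(case case p of (\<alpha>, B) \<Rightarrow> (\<alpha> + pm_indicator B, B) of (\<beta>, B) \<Rightarrow> hl_weight A \<beta> * ?R \<beta> B)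
        = (case p of (\<alpha>, B) \<Rightarrow> hl_weight A (\<alpha> + pm_indicator B) * ?R (\<alpha> + pm_indicator B) B)"
      by (simp add: pe)
  next
    fix p assume p: "p \<in> Sigma ?D ?Q"
    obtain \<beta> B where pe: "p = (\<beta>, B)" by (cases p)
    have B: "B \<subseteq> A" "card B = r" "\<forall>i\<in>B. 1 \<le> lookup \<beta> i" "conjugate (\<beta> - pm_indicator B) = \<nu>"
      and \<beta>: "keys \<beta> \<subseteq> A" using p by (auto simp: pe)
    have "keys (\<beta> - pm_indicator B) \<subseteq> A"
      using \<beta> by (auto simp: in_keys_iff lookup_minus subset_iff)
    then show "(case p of (\<beta>, B) \<Rightarrow> (\<beta> - pm_indicator B, B)) \<in> exponents A \<nu> \<times> ?S"
      using B by (simp add: pe exponents_def)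
    show "(case case p of (\<beta>, B) \<Rightarrow> (\<beta> - pm_indicator B, B) of (\<alpha>, B) \<Rightarrow> (\<alpha> + pm_indicator B, B)) = p"
      using pm_indicator_diff_add[OF fB[OF B(1)] B(3)] by (simp add: pe)
  qed
  also have "\<dots> = (\<Sum>\<beta>\<in>?D. \<Sum>B\<in>?Q \<beta>. hl_weight A \<beta> * ?R \<beta> B)"
    using finD A by (intro sum.Sigma[symmetric]) (auto simp: finite_subsets_card)
  also have "\<dots> = (\<Sum>\<beta>\<in>?D. emb (pieri q (conjugate \<beta>) \<nu>) * hl_weight A \<beta>)"
  proof (rule sum.cong[OF refl])
    fix \<beta> assume "\<beta> \<in> ?D"
    then have "(\<Sum>B\<in>?Q \<beta>. ?R \<beta> B) = emb (pieri q (conjugate \<beta>) \<nu>)"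
      using pieri_sum_indicator[OF A] by simp
    then show "(\<Sum>B\<in>?Q \<beta>. hl_weight A \<beta> * ?R \<beta> B) = emb (pieri q (conjugate \<beta>) \<nu>) * hl_weight A \<beta>"
      by (simp add: mult.commute flip: sum_distrib_left)
  qed
  also have "\<dots> = (\<Sum>\<mu>\<in>partitions_of (weight \<nu> + r). \<Sum>\<beta> | \<beta> \<in> ?D \<and> conjugate \<beta> = \<mu>. emb (pieri q (conjugate \<beta>) \<nu>) * hl_weight A \<beta>)"
    by (rule sum.group[symmetric, OF finD finite_partitions_of]) (auto simp: partitions_of_def)
  also have "\<dots> = (\<Sum>\<mu>\<in>partitions_of (weight \<nu> + r). emb (pieri q \<mu> \<nu>) * hl_sum A \<mu>)"
  proof (rule sum.cong[OF refl])
    fix \<mu> assume \<mu>: "\<mu> \<in> partitions_of (weight \<nu> + r)"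
    have "weight \<beta> = weight \<nu> + r" if "conjugate \<beta> = \<mu>" for \<beta>
      using weight_conjugate[of \<beta>] that \<mu> by (simp add: partitions_of_def)
    then have "{\<beta>. \<beta> \<in> ?D \<and> conjugate \<beta> = \<mu>} = exponents A \<mu>"
      by (auto simp: exponents_def)
    then show "(\<Sum>\<beta> | \<beta> \<in> ?D \<and> conjugate \<beta> = \<mu>. emb (pieri q (conjugate \<beta>) \<nu>) * hl_weight A \<beta>)
        = emb (pieri q \<mu> \<nu>) * hl_sum A \<mu>"
      by (simp add: hl_sum_def sum_distrib_left) (simp add: exponents_def)
  qed
  finally show ?thesis .
qed

end

section \<open>From symmetrisation over permutations to a sum over rearrangements\<close>

lemma bij_betw_permutes_lists:
  "bij_betw (\<lambda>w. map w [0..<N]) {w. w permutes {..<N}} (permutations_of_set {..<N})"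
proof -
  let ?f = "\<lambda>w. map w [0..<N]"
  have inj: "inj_on ?f {w. w permutes {..<N}}"
  proof (rule inj_onI, rule ext)
    fix v w i assume "v \<in> {w. w permutes {..<N}}" "w \<in> {w. w permutes {..<N}}" and eq: "?f v = ?f w"
    then have vw: "v permutes {..<N}" "w permutes {..<N}" by auto
    show "v i = w i"
    proof (cases "i < N")
      case True
      then show ?thesis using arg_cong[OF eq, of "\<lambda>l. l ! i"] by simp
    qed (use vw in \<open>simp add: permutes_not_in\<close>)
  qed
  have sub: "?f ` {w. w permutes {..<N}} \<subseteq> permutations_of_set {..<N}"
  proof safe
    fix w assume w: "w permutes {..<N}"
    show "?f w \<in> permutations_of_set {..<N}"
      using permutes_image[OF w] permutes_inj_on[OF w]
      by (auto simp: permutations_of_set_def distinct_map atLeast0LessThan)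
  qed
  have "card (?f ` {w. w permutes {..<N}}) = card (permutations_of_set {..<N})"
    using inj by (simp add: card_image card_permutations)
  then have "?f ` {w. w permutes {..<N}} = permutations_of_set {..<N}"
    using sub by (intro card_subset_eq) auto
  with inj show ?thesis by (simp add: bij_betw_def)
qed

definition list_conjugate :: "nat list \<Rightarrow> (nat \<Rightarrow>\<^sub>0 nat)"
  where "list_conjugate es = Abs_poly_mapping (\<lambda>j. length (filter (\<lambda>e. j < e) es))"

lemma lookup_list_conjugate [simp]: "lookup (list_conjugate es) j = length (filter (\<lambda>e. j < e) es)"
proof -
  have "j < Max (set es)" if "length (filter (\<lambda>e. j < e) es) \<noteq> 0" for j
  proof -
    from that obtain e where "e \<in> set es" "j < e" by (auto simp: filter_empty_conv)
    then show ?thesis using Max_ge[of "set es" e] by (meson List.finite_set order_less_le_trans)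
  qed
  then have "{j. length (filter (\<lambda>e. j < e) es) \<noteq> 0} \<subseteq> {..<Max (set es)}" by blast
  then have "finite {j. length (filter (\<lambda>e. j < e) es) \<noteq> 0}" by (rule finite_subset) simp
  then show ?thesis by (simp add: list_conjugate_def Abs_poly_mapping_inverse)
qed

lemma list_conjugate_map_lookup:
  assumes "keys \<nu> \<subseteq> {..<N}"
  shows "list_conjugate (map (lookup \<nu>) [0..<N]) = conjugate \<nu>"
proof (rule poly_mapping_eqI)
  fix j
  have "{i. j < lookup \<nu> i} = {i. i < N \<and> j < lookup \<nu> i}"
    using assms by (auto simp: in_keys_iff subset_iff)
  moreover have "card {i. i < N \<and> j < map (lookup \<nu>) [0..<N] ! i} = card {i. i < N \<and> j < lookup \<nu> i}"
    by (rule arg_cong[of _ _ card]) auto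
  ultimately show "lookup (list_conjugate (map (lookup \<nu>) [0..<N])) j = lookup (conjugate \<nu>) j"
    by (simp add: lookup_conjugate length_filter_conv_card)
qed

lemma pairs_less_Suc:
  "{(i, j). i < j \<and> j < Suc n} = (\<lambda>j. (0, Suc j)) ` {..<n} \<union> map_prod Suc Suc ` {(i, j). i < j \<and> j < n}"
proof (rule set_eqI)
  fix p :: "nat \<times> nat"
  obtain i j where p: "p = (i, j)" by (cases p)
  show "p \<in> {(i, j). i < j \<and> j < Suc n} \<longleftrightarrow>
      p \<in> (\<lambda>j. (0, Suc j)) ` {..<n} \<union> map_prod Suc Suc ` {(i, j). i < j \<and> j < n}"
    unfolding p by (cases i; cases j) (auto simp: image_iff)
qed

lemma finite_pairs_less: "finite {(i, j). i < j \<and> j < (n::nat)}"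
  by (rule finite_subset[of _ "{..<n} \<times> {..<n}"]) auto

context hl_field
begin

text \<open>The symmetrisation term of the permutation with one-line notation \<open>ys\<close>,
  written as a recursion so that the sum over permutations can be evaluated by choosing the first
  entry.\<close>

fun list_weight :: "nat list \<Rightarrow> nat list \<Rightarrow> 'f"
  where "list_weight (e # es) (y # ys) = x y ^ e * (\<Prod>b\<in>set ys. hl_factor y b) * list_weight es ys"
  | "list_weight _ _ = 1"

lemma list_weight_eq:
  "length es = length ys \<Longrightarrow> distinct ys \<Longrightarrow> list_weight es ys
    = (\<Prod>i<length ys. x (ys ! i) ^ (es ! i)) * (\<Prod>(i, j) | i < j \<and> j < length ys. hl_factor (ys ! i) (ys ! j))"
proof (induction es ys rule: list_weight.induct)
  case (1 e es y ys)
  let ?n = "length ys"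
  let ?A = "(\<lambda>j. (0::nat, Suc j)) ` {..<?n}" and ?B = "map_prod Suc Suc ` {(i, j). i < j \<and> j < ?n}"
  let ?h = "\<lambda>(i, j). hl_factor ((y # ys) ! i) ((y # ys) ! j)"
  have "(\<Prod>p | fst p < snd p \<and> snd p < length (y # ys). ?h p) = (\<Prod>p\<in>?A \<union> ?B. ?h p)"
    using pairs_less_Suc[of ?n] by (simp add: case_prod_unfold)
  also have "\<dots> = (\<Prod>p\<in>?A. ?h p) * (\<Prod>p\<in>?B. ?h p)"
    using finite_pairs_less[of ?n] by (intro prod.union_disjoint) auto
  also have "(\<Prod>p\<in>?A. ?h p) = (\<Prod>j<?n. hl_factor y (ys ! j))"
    by (subst prod.reindex) (auto simp: inj_on_def)
  also have "\<dots> = (\<Prod>b\<in>set ys. hl_factor y b)"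
    using 1(3) by (intro prod.reindex_bij_betw bij_betw_nth) auto
  also have "(\<Prod>p\<in>?B. ?h p) = (\<Prod>(i, j) | i < j \<and> j < ?n. hl_factor (ys ! i) (ys ! j))"
    by (subst prod.reindex) (auto simp: inj_on_def case_prod_unfold)
  finally have P: "(\<Prod>(i, j) | i < j \<and> j < length (y # ys). hl_factor ((y # ys) ! i) ((y # ys) ! j))
      = (\<Prod>b\<in>set ys. hl_factor y b) * (\<Prod>(i, j) | i < j \<and> j < ?n. hl_factor (ys ! i) (ys ! j))"
    by (simp add: case_prod_unfold)
  have X: "(\<Prod>i<length (y # ys). x ((y # ys) ! i) ^ ((e # es) ! i)) = x y ^ e * (\<Prod>i<?n. x (ys ! i) ^ (es ! i))"
    unfolding length_Cons prod.lessThan_Suc_shift by simp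
  have "list_weight es ys = (\<Prod>i<?n. x (ys ! i) ^ (es ! i)) * (\<Prod>(i, j) | i < j \<and> j < ?n. hl_factor (ys ! i) (ys ! j))"
    using 1 by simp
  then show ?case unfolding P X by (simp add: mult_ac)
qed auto

definition parts_norm :: "nat list \<Rightarrow> real"
  where "parts_norm es = (\<Prod>v\<in>set es. q_fact q (count_list es v))"

lemma parts_norm_Cons: "parts_norm (e # es) = q_int q (count_list (e # es) e) * parts_norm es"
proof -
  have rest: "(\<Prod>v\<in>set es - {e}. q_fact q (count_list (e # es) v)) = (\<Prod>v\<in>set es - {e}. q_fact q (count_list es v))"
    by (rule prod.cong) auto
  have "parts_norm (e # es) = q_fact q (Suc (count_list es e)) * (\<Prod>v\<in>set es - {e}. q_fact q (count_list es v))"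
    unfolding parts_norm_def rest[symmetric] by (simp add: prod.insert_remove)
  also have "\<dots> = q_int q (Suc (count_list es e)) * (q_fact q (count_list es e) * (\<Prod>v\<in>set es - {e}. q_fact q (count_list es v)))"
    by (simp add: q_fact_Suc)
  also have "q_fact q (count_list es e) * (\<Prod>v\<in>set es - {e}. q_fact q (count_list es v)) = parts_norm es"
  proof (cases "e \<in> set es")
    case True
    then show ?thesis unfolding parts_norm_def by (simp add: prod.remove)
  qed (simp add: parts_norm_def count_notin)
  finally show ?thesis by simp
qed

text \<open>If a has maximal exponent, the factors from a to all other indices are those of the
  strict pairs, which belong to \<open>hl_weight A \<beta>\<close>, and those within the top level,
  which remain on the right.\<close>

lemma hl_weight_insert_max:
  assumes A: "finite A" "a \<in> A" and \<beta>: "\<And>b. b \<in> A \<Longrightarrow> lookup \<beta> b \<le> lookup \<beta> a"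
    and \<alpha>: "\<And>b. b \<noteq> a \<Longrightarrow> lookup \<alpha> b = lookup \<beta> b"
  shows "x a ^ lookup \<beta> a * (\<Prod>b\<in>A - {a}. hl_factor a b) * hl_weight (A - {a}) \<alpha>
    = hl_weight A \<beta> * (\<Prod>b\<in>{b \<in> A. lookup \<beta> b = lookup \<beta> a} - {a}. hl_factor a b)"
proof -
  let ?h = "\<lambda>i j. if lookup \<beta> j < lookup \<beta> i then hl_factor i j else 1"
  let ?A = "A - {a}"
  have split: "(\<Prod>i\<in>A. f i) = f a * (\<Prod>i\<in>?A. f i)" for f :: "nat \<Rightarrow> 'f"
    by (rule prod.remove[OF A])
  have w: "hl_weight ?A \<alpha> = (\<Prod>i\<in>?A. x i ^ lookup \<beta> i) * (\<Prod>i\<in>?A. \<Prod>j\<in>?A. ?h i j)"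
    unfolding hl_weight_def using \<alpha> by (intro arg_cong2[where f = "(*)"] prod.cong refl) auto
  have "(\<Prod>i\<in>A. \<Prod>j\<in>A. ?h i j) = (\<Prod>j\<in>A. ?h a j) * (\<Prod>i\<in>?A. \<Prod>j\<in>A. ?h i j)"
    by (rule split)
  also have "(\<Prod>j\<in>A. ?h a j) = (\<Prod>j\<in>?A. ?h a j)" by (subst split) simp
  also have "(\<Prod>i\<in>?A. \<Prod>j\<in>A. ?h i j) = (\<Prod>i\<in>?A. \<Prod>j\<in>?A. ?h i j)"
  proof (rule prod.cong[OF refl])
    fix i assume "i \<in> ?A"
    then have "?h i a = 1" using \<beta>[of i] by simp
    then show "(\<Prod>j\<in>A. ?h i j) = (\<Prod>j\<in>?A. ?h i j)" by (subst split) simp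
  qed
  finally have H: "(\<Prod>i\<in>A. \<Prod>j\<in>A. ?h i j) = (\<Prod>j\<in>?A. ?h a j) * (\<Prod>i\<in>?A. \<Prod>j\<in>?A. ?h i j)" .
  have "{b \<in> A. lookup \<beta> b = lookup \<beta> a} - {a} = {b \<in> ?A. \<not> lookup \<beta> b < lookup \<beta> a}"
    using \<beta> by (auto simp: not_less intro: antisym)
  then have L: "(\<Prod>b\<in>{b \<in> A. lookup \<beta> b = lookup \<beta> a} - {a}. hl_factor a b)
      = (\<Prod>b\<in>?A. if \<not> lookup \<beta> b < lookup \<beta> a then hl_factor a b else 1)"
    using A by (simp only: prod.inter_filter finite_Diff)
  have "(\<Prod>b\<in>?A. hl_factor a b) = (\<Prod>b\<in>?A. ?h a b) * (\<Prod>b\<in>?A. if \<not> lookup \<beta> b < lookup \<beta> a then hl_factor a b else 1)"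
    unfolding prod.distrib[symmetric] by (rule prod.cong) auto
  moreover have "hl_weight A \<beta> = (x a ^ lookup \<beta> a * (\<Prod>i\<in>?A. x i ^ lookup \<beta> i))
      * ((\<Prod>j\<in>?A. ?h a j) * (\<Prod>i\<in>?A. \<Prod>j\<in>?A. ?h i j))"
    unfolding hl_weight_def H by (subst split) simp
  ultimately show ?thesis unfolding w L by (simp add: mult_ac)
qed

text \<open>For a fixed exponent vector on A, the index that received the largest part can be any
  element of the top level. Summing the leftover factors over these choices gives, by
  \<open>sum_hl_factor\<close>, the q-integer of the size of that level.\<close>

lemma sum_insert_max_part:
  assumes A: "finite A" "length (e # es) = card A" and e: "\<And>v. v \<in> set es \<Longrightarrow> v \<le> e"
  shows "(\<Sum>a\<in>A. x a ^ e * (\<Prod>b\<in>A - {a}. hl_factor a b) * hl_sum (A - {a}) (list_conjugate es))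
    = emb (q_int q (count_list (e # es) e)) * hl_sum A (list_conjugate (e # es))"
proof -
  let ?E = "\<lambda>a. exponents (A - {a}) (list_conjugate es)" and ?F = "exponents A (list_conjugate (e # es))"
  let ?L = "\<lambda>\<beta>. {a \<in> A. lookup \<beta> a = e}"
  let ?ext = "\<lambda>a \<alpha>. \<alpha> + Poly_Mapping.single a e"
  let ?cut = "\<lambda>a \<beta>. \<beta> - Poly_Mapping.single a e"
  have max: "lookup \<beta> b \<le> e" if "\<beta> \<in> ?F" for \<beta> b
  proof -
    have "lookup (conjugate \<beta>) e = 0"
      using that e by (auto simp: exponents_def filter_empty_conv not_less)
    then have "{i. e < lookup \<beta> i} = {}"
      using finite_lookup_greater[of e \<beta>] by (simp add: lookup_conjugate)
    then show ?thesis by (metis (no_types, lifting) Collect_empty_eq not_le)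
  qed
  have conj: "conjugate \<beta> = list_conjugate (e # es) \<longleftrightarrow> conjugate \<alpha> = list_conjugate es"
    if "lookup \<alpha> a = 0" "\<beta> = ?ext a \<alpha>" for \<alpha> \<beta> a
  proof -
    have "lookup (conjugate \<beta>) j = lookup (conjugate \<alpha>) j + of_bool (j < e)" for j
    proof -
      have "{i. j < lookup \<beta> i} = {i. j < lookup \<alpha> i} \<union> (if j < e then {a} else {})"
        using that by (auto simp: lookup_add lookup_single when_def split: if_splits)
      moreover have "a \<notin> {i. j < lookup \<alpha> i}" using that by simp
      ultimately show ?thesis
        using finite_lookup_greater[of j \<alpha>] by (simp add: lookup_conjugate)
    qed
    then show ?thesis by (auto simp: poly_mapping_eq_iff fun_eq_iff)
  qed
  have "(\<Sum>a\<in>A. x a ^ e * (\<Prod>b\<in>A - {a}. hl_factor a b) * hl_sum (A - {a}) (list_conjugate es))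
      = (\<Sum>a\<in>A. \<Sum>\<alpha>\<in>?E a. x a ^ e * (\<Prod>b\<in>A - {a}. hl_factor a b) * hl_weight (A - {a}) \<alpha>)"
    by (simp add: hl_sum_def sum_distrib_left)
  also have "\<dots> = (\<Sum>(a, \<alpha>)\<in>Sigma A ?E. x a ^ e * (\<Prod>b\<in>A - {a}. hl_factor a b) * hl_weight (A - {a}) \<alpha>)"
    using A by (intro sum.Sigma) (auto simp: finite_exponents)
  also have "\<dots> = (\<Sum>(\<beta>, a)\<in>Sigma ?F ?L. hl_weight A \<beta> * (\<Prod>b\<in>?L \<beta> - {a}. hl_factor a b))"
  proof (rule sum.reindex_bij_witness[of _ "\<lambda>(\<beta>, a). (a, ?cut a \<beta>)" "\<lambda>(a, \<alpha>). (?ext a \<alpha>, a)"])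
    fix p assume p: "p \<in> Sigma A ?E"
    obtain a \<alpha> where pe: "p = (a, \<alpha>)" by (cases p)
    have a: "a \<in> A" and \<alpha>: "keys \<alpha> \<subseteq> A - {a}" "conjugate \<alpha> = list_conjugate es"
      using p by (auto simp: pe exponents_def)
    have z: "lookup \<alpha> a = 0" using \<alpha>(1) by (auto simp: in_keys_iff subset_iff)
    have F: "?ext a \<alpha> \<in> ?F"
      using conj[OF z refl] \<alpha> a Poly_Mapping.keys_add[of \<alpha> "Poly_Mapping.single a e"]
      by (auto simp: exponents_def split: if_splits)
    have l: "lookup (?ext a \<alpha>) a = e" using z by (simp add: lookup_add)
    show "(case p of (a, \<alpha>) \<Rightarrow> (?ext a \<alpha>, a)) \<in> Sigma ?F ?L" using F l a by (simp add: pe)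
    show "(case case p of (a, \<alpha>) \<Rightarrow> (?ext a \<alpha>, a) of (\<beta>, a) \<Rightarrow> (a, ?cut a \<beta>)) = p" by (simp add: pe)
    show "(case case p of (a, \<alpha>) \<Rightarrow> (?ext a \<alpha>, a) of (\<beta>, a) \<Rightarrow> hl_weight A \<beta> * (\<Prod>b\<in>?L \<beta> - {a}. hl_factor a b))
        = (case p of (a, \<alpha>) \<Rightarrow> x a ^ e * (\<Prod>b\<in>A - {a}. hl_factor a b) * hl_weight (A - {a}) \<alpha>)"
      unfolding pe prod.case
      using hl_weight_insert_max[OF A(1) a, of "?ext a \<alpha>" \<alpha>] max[OF F] l
      by (simp add: lookup_add lookup_single when_def)
  next
    fix p assume p: "p \<in> Sigma ?F ?L"
    obtain \<beta> a where pe: "p = (\<beta>, a)" by (cases p)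
    have a: "a \<in> A" "lookup \<beta> a = e" and \<beta>: "keys \<beta> \<subseteq> A" "conjugate \<beta> = list_conjugate (e # es)"
      using p by (auto simp: pe exponents_def)
    have restore: "?ext a (?cut a \<beta>) = \<beta>"
      using a by (intro poly_mapping_eqI) (auto simp: lookup_add lookup_minus lookup_single when_def)
    have z: "lookup (?cut a \<beta>) a = 0" using a by (simp add: lookup_minus)
    have "keys (?cut a \<beta>) \<subseteq> A - {a}"
      using \<beta>(1) a by (auto simp: in_keys_iff lookup_minus lookup_single when_def subset_iff split: if_splits)
    then show "(case p of (\<beta>, a) \<Rightarrow> (a, ?cut a \<beta>)) \<in> Sigma A ?E"
      using conj[OF z restore[symmetric]] \<beta>(2) a by (simp add: pe exponents_def)
    show "(case case p of (\<beta>, a) \<Rightarrow> (a, ?cut a \<beta>) of (a, \<alpha>) \<Rightarrow> (?ext a \<alpha>, a)) = p"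
      by (simp add: pe restore)
  qed
  also have "\<dots> = (\<Sum>\<beta>\<in>?F. \<Sum>a\<in>?L \<beta>. hl_weight A \<beta> * (\<Prod>b\<in>?L \<beta> - {a}. hl_factor a b))"
    using A by (intro sum.Sigma[symmetric]) (auto simp: finite_exponents)
  also have "\<dots> = (\<Sum>\<beta>\<in>?F. hl_weight A \<beta> * emb (q_int q (count_list (e # es) e)))"
  proof (rule sum.cong[OF refl])
    fix \<beta> assume \<beta>: "\<beta> \<in> ?F"
    have "card (?L \<beta>) = count_list (e # es) e"
    \<comment> \<open>For e = 0 the top level is all of A, which \<open>conjugate\<close> does not
      record; for e > 0 it is the level set above e - 1.\<close>
    proof (cases e)
      case 0
      then have "?L \<beta> = A" using max[OF \<beta>] by auto
      moreover have "count_list es 0 = length es" using e 0 by (induction es) auto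
      ultimately show ?thesis using A 0 by simp
    next
      case (Suc d)
      have "?L \<beta> = {i. d < lookup \<beta> i}"
        using max[OF \<beta>] \<beta> Suc by (auto simp: exponents_def in_keys_iff subset_iff intro: antisym)
      then have "card (?L \<beta>) = lookup (conjugate \<beta>) d" by (simp add: lookup_conjugate)
      also have "\<dots> = length (filter (\<lambda>v. d < v) (e # es))" using \<beta> by (simp add: exponents_def)
      also have "filter (\<lambda>v. d < v) (e # es) = filter ((=) e) (e # es)"
        using e Suc by (intro filter_cong refl) (auto intro: antisym)
      finally show ?thesis by (simp add: count_list_eq_length_filter)
    qed
    then show "(\<Sum>a\<in>?L \<beta>. hl_weight A \<beta> * (\<Prod>b\<in>?L \<beta> - {a}. hl_factor a b))
        = hl_weight A \<beta> * emb (q_int q (count_list (e # es) e))"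
      using sum_hl_factor[of "?L \<beta>"] A(1) by (simp flip: sum_distrib_left)
  qed
  finally show ?thesis by (simp add: hl_sum_def sum_distrib_left mult.commute)
qed

text \<open>Choosing the index of the largest part at each step contributes the q-integer of its
  multiplicity in the remaining list; together these form the q-factorials of all multiplicities,
  zeros included.\<close>

lemma sum_list_weight:
  assumes "finite A" "length es = card A" "sorted_wrt (\<ge>) es"
  shows "(\<Sum>ys\<in>permutations_of_set A. list_weight es ys) = emb (parts_norm es) * hl_sum A (list_conjugate es)"
  using assms
proof (induction es arbitrary: A)
  case Nil
  then have "A = {}" by simp
  have "conjugate 0 = list_conjugate []" by (rule poly_mapping_eqI) (simp add: lookup_conjugate)
  then have "exponents {} (list_conjugate []) = {0}" by (auto simp: exponents_def)
  then show ?case using \<open>A = {}\<close> by (simp add: parts_norm_def emb_1 hl_sum_def hl_weight_def)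
next
  case (Cons e es)
  then have A: "finite A" "A \<noteq> {}" by auto
  have "(\<Sum>ys\<in>permutations_of_set A. list_weight (e # es) ys)
      = (\<Sum>a\<in>A. \<Sum>ys\<in>(#) a ` permutations_of_set (A - {a}). list_weight (e # es) ys)"
    unfolding permutations_of_set_nonempty[OF A(2)]
    using A by (intro sum.UNION_disjoint) auto
  also have "\<dots> = (\<Sum>a\<in>A. x a ^ e * (\<Prod>b\<in>A - {a}. hl_factor a b) * (emb (parts_norm es) * hl_sum (A - {a}) (list_conjugate es)))"
  proof (rule sum.cong[OF refl])
    fix a assume a: "a \<in> A"
    have "(\<Sum>ys\<in>(#) a ` permutations_of_set (A - {a}). list_weight (e # es) ys)
        = (\<Sum>ys\<in>permutations_of_set (A - {a}). x a ^ e * (\<Prod>b\<in>A - {a}. hl_factor a b) * list_weight es ys)"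
      by (subst sum.reindex) (auto simp: permutations_of_set_def intro!: sum.cong)
    also have "\<dots> = x a ^ e * (\<Prod>b\<in>A - {a}. hl_factor a b) * (emb (parts_norm es) * hl_sum (A - {a}) (list_conjugate es))"
      using Cons a by (simp flip: sum_distrib_left)
    finally show "(\<Sum>ys\<in>(#) a ` permutations_of_set (A - {a}). list_weight (e # es) ys) = \<dots>" .
  qed
  also have "\<dots> = emb (parts_norm es) * (\<Sum>a\<in>A. x a ^ e * (\<Prod>b\<in>A - {a}. hl_factor a b) * hl_sum (A - {a}) (list_conjugate es))"
    by (simp add: sum_distrib_left mult_ac)
  also have "\<dots> = emb (parts_norm (e # es)) * hl_sum A (list_conjugate (e # es))"
    using Cons.prems by (subst sum_insert_max_part) (auto simp: parts_norm_Cons emb_mult mult_ac)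
  finally show ?case .
qed

text \<open>Summation over the stabiliser of \<nu> produces exactly the normalising factor
  \<open>hl_norm\<close>, which is positive and cancels; the coset form remains.\<close>

theorem symmetrization_eq_hl_sum:
  assumes \<nu>: "is_partition \<nu>" "num_parts \<nu> \<le> N"
  shows "emb (1 / hl_norm N \<nu> q) * (\<Sum>w | w permutes {..<N}. (\<Prod>i<N. x (w i) ^ lookup \<nu> i) *
      (\<Prod>(i, j) | i < j \<and> j < N. (x (w i) - emb q * x (w j)) / (x (w i) - x (w j))))
    = hl_sum {..<N} (conjugate \<nu>)"
proof -
  let ?es = "map (lookup \<nu>) [0..<N]"
  have count: "count_list ?es v = card {j. j < N \<and> lookup \<nu> j = v}" for v
    by (simp add: count_list_eq_length_filter length_filter_conv_card)
       (rule arg_cong[of _ _ card], auto)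
  have norm: "parts_norm ?es = hl_norm N \<nu> q"
    by (simp add: parts_norm_def hl_norm_def count atLeast0LessThan)
  have "hl_norm N \<nu> q > 0"
    unfolding hl_norm_def by (intro prod_pos) (simp add: q_fact_pos q_pos)
  have "(\<Sum>w | w permutes {..<N}. (\<Prod>i<N. x (w i) ^ lookup \<nu> i) *
      (\<Prod>(i, j) | i < j \<and> j < N. (x (w i) - emb q * x (w j)) / (x (w i) - x (w j))))
      = (\<Sum>w | w permutes {..<N}. list_weight ?es (map w [0..<N]))"
  proof (rule sum.cong[OF refl])
    fix w assume "w \<in> {w. w permutes {..<N}}"
    then have d: "distinct (map w [0..<N])" using permutes_inj_on by (auto simp: distinct_map)
    have "(\<Prod>(i, j) | i < j \<and> j < N. hl_factor (map w [0..<N] ! i) (map w [0..<N] ! j))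
        = (\<Prod>(i, j) | i < j \<and> j < N. (x (w i) - emb q * x (w j)) / (x (w i) - x (w j)))"
      by (rule prod.cong) (auto simp: hl_factor_def)
    then show "(\<Prod>i<N. x (w i) ^ lookup \<nu> i) *
        (\<Prod>(i, j) | i < j \<and> j < N. (x (w i) - emb q * x (w j)) / (x (w i) - x (w j)))
        = list_weight ?es (map w [0..<N])"
      by (subst list_weight_eq) (use d in auto)
  qed
  also have "\<dots> = (\<Sum>ys\<in>permutations_of_set {..<N}. list_weight ?es ys)"
    by (rule sum.reindex_bij_betw[OF bij_betw_permutes_lists])
  also have "\<dots> = emb (parts_norm ?es) * hl_sum {..<N} (list_conjugate ?es)"
  proof (rule sum_list_weight)
    show "sorted_wrt (\<ge>) ?es"
      using is_partitionD[OF \<nu>(1)] by (auto simp: sorted_wrt_iff_nth_less)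
  qed auto
  also have "list_conjugate ?es = conjugate \<nu>"
    using \<nu> by (intro list_conjugate_map_lookup) (auto simp: keys_partition)
  finally show ?thesis
    using \<open>hl_norm N \<nu> q > 0\<close> by (simp add: norm flip: emb_mult mult.assoc) (simp add: emb_1)
qed

end

section \<open>Bases of the ring of symmetric functions\<close>

lemmas sf_coeff_simps = zero_symfun.rep_eq plus_symfun.rep_eq uminus_symfun.rep_eq scaleR_symfun.rep_eq

lemma sf_coeff_sum: "sf_coeff (\<Sum>i\<in>I. f i) \<alpha> = (\<Sum>i\<in>I. sf_coeff (f i) \<alpha>)"
  by (induction I rule: infinite_finite_induct) (simp_all add: sf_coeff_simps)

lemma linear_sf_coeff: "linear (\<lambda>f. sf_coeff f \<alpha>)"
  by (rule linearI) (simp_all add: sf_coeff_simps)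

lemma conjugate_map_key: "bij \<pi> \<Longrightarrow> conjugate (Poly_Mapping.map_key \<pi> \<alpha>) = conjugate \<alpha>"
proof (rule poly_mapping_eqI)
  fix j assume \<pi>: "bij \<pi>"
  have "{i. j < lookup \<alpha> (\<pi> i)} = \<pi> -` {i. j < lookup \<alpha> i}" by auto
  then have "card {i. j < lookup \<alpha> (\<pi> i)} = card {i. j < lookup \<alpha> i}"
    using \<pi> card_vimage_inj[of \<pi> "{i. j < lookup \<alpha> i}"] by (simp add: bij_is_inj bij_is_surj)
  then show "lookup (conjugate (Poly_Mapping.map_key \<pi> \<alpha>)) j = lookup (conjugate \<alpha>) j"
    using \<pi> by (simp add: lookup_conjugate map_key.rep_eq bij_is_inj)
qed

text \<open>The level counts determine how often each positive value occurs. On the union of the two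
  supports the multiplicities of 0 agree as well, so the multisets of values coincide there and a
  permutation of this finite set matches them.\<close>

lemma conjugate_eq_imp_map_key:
  assumes "conjugate \<alpha> = conjugate \<beta>"
  obtains \<pi> where "bij \<pi>" "\<alpha> = Poly_Mapping.map_key \<pi> \<beta>"
proof -
  let ?A = "keys \<alpha> \<union> keys \<beta>"
  have level: "card {i \<in> ?A. c < lookup \<alpha> i} = card {i \<in> ?A. c < lookup \<beta> i}" for c
  proof -
    have "{i \<in> ?A. c < lookup \<gamma> i} = {i. c < lookup \<gamma> i}" if "keys \<gamma> \<subseteq> ?A" for \<gamma> :: "nat \<Rightarrow>\<^sub>0 nat"
    proof -
      have "i \<in> ?A" if "c < lookup \<gamma> i" for i
        using \<open>keys \<gamma> \<subseteq> ?A\<close> that by (metis in_keys_iff not_less_zero subsetD)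
      then show ?thesis by blast
    qed
    then show ?thesis using arg_cong[OF assms, of "\<lambda>\<mu>. lookup \<mu> c"] by (simp add: lookup_conjugate)
  qed
  have ge: "card {i \<in> ?A. lookup \<gamma> i \<ge> c} = (if c = 0 then card ?A else card {i \<in> ?A. c - 1 < lookup \<gamma> i})"
    for c and \<gamma> :: "nat \<Rightarrow>\<^sub>0 nat"
    by (cases c) (simp_all add: Suc_le_eq Un_def)
  have eq: "card {i \<in> ?A. lookup \<gamma> i = c} = card {i \<in> ?A. lookup \<gamma> i \<ge> c} - card {i \<in> ?A. c < lookup \<gamma> i}"
    for c and \<gamma> :: "nat \<Rightarrow>\<^sub>0 nat"
  proof -
    have "{i \<in> ?A. lookup \<gamma> i = c} = {i \<in> ?A. lookup \<gamma> i \<ge> c} - {i \<in> ?A. c < lookup \<gamma> i}" by auto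
    then show ?thesis by (simp add: card_Diff_subset subset_iff)
  qed
  have eqm: "image_mset (lookup \<alpha>) (mset_set ?A) = image_mset (lookup \<beta>) (mset_set ?A)"
  proof (rule multiset_eqI)
    fix c
    have "card {i \<in> ?A. lookup \<alpha> i = c} = card {i \<in> ?A. lookup \<beta> i = c}"
      unfolding eq ge level ..
    moreover have "count (image_mset (lookup \<gamma>) (mset_set ?A)) c = card {i \<in> ?A. lookup \<gamma> i = c}"
      for \<gamma> :: "nat \<Rightarrow>\<^sub>0 nat"
    proof -
      have "lookup \<gamma> -` {c} \<inter> ?A = {i \<in> ?A. lookup \<gamma> i = c}" by auto
      then show ?thesis by (simp add: count_image_mset)
    qed
    ultimately show "count (image_mset (lookup \<alpha>) (mset_set ?A)) c = count (image_mset (lookup \<beta>) (mset_set ?A)) c"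
      by simp
  qed
  obtain p where p: "p permutes ?A" "\<forall>i\<in>?A. lookup \<alpha> i = lookup \<beta> (p i)"
    using image_mset_eq_implies_permutes[OF finite_UnI[OF finite_keys finite_keys] eqm] by blast
  have "lookup \<alpha> i = lookup \<beta> (p i)" for i
  proof (cases "i \<in> ?A")
    case False
    then have "p i = i" by (rule permutes_not_in[OF p(1)])
    then show ?thesis using False by (simp add: in_keys_iff)
  qed (use p in blast)
  then have "\<alpha> = Poly_Mapping.map_key p \<beta>"
    using permutes_bij[OF p(1)] by (intro poly_mapping_eqI) (simp add: map_key.rep_eq bij_is_inj)
  then show ?thesis using that permutes_bij[OF p(1)] by blast
qed

lemma sf_coeff_conjugate_eq:
  assumes "conjugate \<alpha> = conjugate \<beta>"
  shows "sf_coeff f \<alpha> = sf_coeff f \<beta>"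
proof -
  obtain \<pi> where "bij \<pi>" "\<alpha> = Poly_Mapping.map_key \<pi> \<beta>" using conjugate_eq_imp_map_key[OF assms] .
  moreover have "symmetric_series (sf_coeff f)" using sf_coeff[of f] by simp
  ultimately show ?thesis by (simp add: symmetric_series_def)
qed

lemma sf_coeff_sorted: "sf_coeff f (conjugate (conjugate \<alpha>)) = sf_coeff f \<alpha>"
  by (rule sf_coeff_conjugate_eq) simp

lemma symfun_eqI_partitions:
  assumes "\<And>\<mu>. is_partition \<mu> \<Longrightarrow> sf_coeff f \<mu> = sf_coeff g \<mu>"
  shows "f = g"
  by (rule symfun_eqI) (metis assms is_partition_conjugate sf_coeff_sorted)

lemma conjugate_inject: "is_partition \<mu> \<Longrightarrow> is_partition \<nu> \<Longrightarrow> conjugate \<mu> = conjugate \<nu> \<Longrightarrow> \<mu> = \<nu>"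
  by (metis conjugate_conjugate)

lemma sf_coeff_m_basis: "is_partition \<mu> \<Longrightarrow> is_partition \<nu> \<Longrightarrow> sf_coeff (m_basis \<nu>) \<mu> = of_bool (\<nu> = \<mu>)"
proof -
  assume \<mu>\<nu>: "is_partition \<mu>" "is_partition \<nu>"
  have "(\<exists>\<pi>. bij \<pi> \<and> \<mu> = Poly_Mapping.map_key \<pi> \<nu>) \<longleftrightarrow> conjugate \<mu> = conjugate \<nu>"
    by (metis conjugate_map_key conjugate_eq_imp_map_key)
  also have "\<dots> \<longleftrightarrow> \<nu> = \<mu>" using conjugate_inject \<mu>\<nu> by metis
  finally show ?thesis by (simp add: m_basis.rep_eq)
qed

section \<open>Homogeneous elements and bases indexed by partitions\<close>

definition homogeneous :: "nat \<Rightarrow> symfun \<Rightarrow> bool"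
  where "homogeneous n f \<longleftrightarrow> (\<forall>\<alpha>. sf_coeff f \<alpha> \<noteq> 0 \<longrightarrow> weight \<alpha> = n)"

lemma homogeneous_m_basis: "homogeneous (weight \<mu>) (m_basis \<mu>)"
  by (auto simp: homogeneous_def m_basis.rep_eq weight_map_key)

lemma homogeneous_0: "homogeneous n 0"
  by (simp add: homogeneous_def sf_coeff_simps)

lemma homogeneous_add: "homogeneous n f \<Longrightarrow> homogeneous n g \<Longrightarrow> homogeneous n (f + g)"
  unfolding homogeneous_def sf_coeff_simps by (metis add.right_neutral)

lemma homogeneous_scaleR: "homogeneous n f \<Longrightarrow> homogeneous n (c *\<^sub>R f)"
  unfolding homogeneous_def sf_coeff_simps by auto

lemma homogeneous_sum: "(\<And>i. i \<in> I \<Longrightarrow> homogeneous n (f i)) \<Longrightarrow> homogeneous n (\<Sum>i\<in>I. f i)"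
  by (induction I rule: infinite_finite_induct) (auto simp: homogeneous_0 homogeneous_add)

lemma homogeneous_mult:
  assumes "homogeneous m f" "homogeneous n g"
  shows "homogeneous (m + n) (f * g)"
  unfolding homogeneous_def times_symfun.rep_eq
proof (intro allI impI)
  fix \<alpha> assume "(\<Sum>(\<beta>, \<gamma>)\<in>splits \<alpha>. sf_coeff f \<beta> * sf_coeff g \<gamma>) \<noteq> 0"
  then obtain p where "p \<in> splits \<alpha>" "(case p of (\<beta>, \<gamma>) \<Rightarrow> sf_coeff f \<beta> * sf_coeff g \<gamma>) \<noteq> 0"
    using sum.not_neutral_contains_not_neutral by blast
  then show "weight \<alpha> = m + n"
    using assms by (auto simp: splits_def homogeneous_def weight_add split: prod.splits)
qed

lemma homogeneous_complete: "homogeneous r (complete_sf r)"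
  by (simp add: homogeneous_def complete_sf.rep_eq)

lemma homogeneous_elementary: "homogeneous r (elementary_sf r)"
  by (simp add: homogeneous_def elementary_sf.rep_eq)

lemma homogeneous_prod: "(\<And>i. i \<in> I \<Longrightarrow> homogeneous (d i) (f i)) \<Longrightarrow> finite I \<Longrightarrow> homogeneous (\<Sum>i\<in>I. d i) (\<Prod>i\<in>I. f i)"
proof (induction I rule: infinite_finite_induct)
  case empty
  then show ?case by (simp add: homogeneous_def one_symfun.rep_eq)
qed (auto intro: homogeneous_mult)

lemma homogeneous_e_basis: "homogeneous (weight \<mu>) (e_basis \<mu>)"
  unfolding e_basis_def weight_def by (rule homogeneous_prod) (auto simp: homogeneous_elementary)

lemma homogeneous_h_basis: "homogeneous (weight \<mu>) (h_basis \<mu>)"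
  unfolding h_basis_def weight_def by (rule homogeneous_prod) (auto simp: homogeneous_complete)

lemma homogeneous_expansion:
  assumes "homogeneous n f"
  shows "f = (\<Sum>\<mu>\<in>partitions_of n. sf_coeff f \<mu> *\<^sub>R m_basis \<mu>)"
proof (rule symfun_eqI_partitions)
  fix \<nu> assume \<nu>: "is_partition \<nu>"
  have "sf_coeff (\<Sum>\<mu>\<in>partitions_of n. sf_coeff f \<mu> *\<^sub>R m_basis \<mu>) \<nu>
      = (\<Sum>\<mu>\<in>partitions_of n. if \<mu> = \<nu> then sf_coeff f \<mu> else 0)"
    unfolding sf_coeff_sum sf_coeff_simps
    by (rule sum.cong) (auto simp: sf_coeff_m_basis \<nu> partitions_of_def)
  also have "\<dots> = sf_coeff f \<nu>"
    using assms \<nu> finite_partitions_of[of n] by (auto simp: sum.delta' homogeneous_def partitions_of_def)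
  finally show "sf_coeff f \<nu> = sf_coeff (\<Sum>\<mu>\<in>partitions_of n. sf_coeff f \<mu> *\<^sub>R m_basis \<mu>) \<nu>" ..
qed

lemma m_basis_expansion:
  obtains n where "f = (\<Sum>\<mu> | is_partition \<mu> \<and> weight \<mu> \<le> n. sf_coeff f \<mu> *\<^sub>R m_basis \<mu>)"
proof -
  obtain n where n: "\<And>\<alpha>. sf_coeff f \<alpha> \<noteq> 0 \<Longrightarrow> weight \<alpha> \<le> n"
    using sf_coeff[of f] by (auto simp: bounded_degree_def)
  let ?A = "{\<mu>. is_partition \<mu> \<and> weight \<mu> \<le> n}"
  have "f = (\<Sum>\<mu>\<in>?A. sf_coeff f \<mu> *\<^sub>R m_basis \<mu>)"
  proof (rule symfun_eqI_partitions)
    fix \<nu> assume \<nu>: "is_partition \<nu>"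
    have "sf_coeff (\<Sum>\<mu>\<in>?A. sf_coeff f \<mu> *\<^sub>R m_basis \<mu>) \<nu> = (\<Sum>\<mu>\<in>?A. if \<mu> = \<nu> then sf_coeff f \<mu> else 0)"
      unfolding sf_coeff_sum sf_coeff_simps by (rule sum.cong) (auto simp: sf_coeff_m_basis \<nu>)
    also have "\<dots> = sf_coeff f \<nu>"
      using n[of \<nu>] \<nu> finite_partitions_le[of n] by (auto simp: sum.delta')
    finally show "sf_coeff f \<nu> = sf_coeff (\<Sum>\<mu>\<in>?A. sf_coeff f \<mu> *\<^sub>R m_basis \<mu>) \<nu>" ..
  qed
  then show ?thesis by (rule that)
qed

text \<open>Homogeneity is part of the notion because the existence of dual elements rests on
  projecting onto a single degree; injectivity lets functions of the label be extended
  linearly.\<close>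

definition graded_basis :: "((nat \<Rightarrow>\<^sub>0 nat) \<Rightarrow> symfun) \<Rightarrow> bool"
  where "graded_basis b \<longleftrightarrow> (\<forall>\<mu>. is_partition \<mu> \<longrightarrow> homogeneous (weight \<mu>) (b \<mu>))
    \<and> inj_on b (Collect is_partition) \<and> independent (b ` Collect is_partition)
    \<and> span (b ` Collect is_partition) = UNIV"

lemma graded_basis_homogeneous: "graded_basis b \<Longrightarrow> is_partition \<mu> \<Longrightarrow> homogeneous (weight \<mu>) (b \<mu>)"
  by (simp add: graded_basis_def)

lemma span_m_basis: "span (m_basis ` Collect is_partition) = UNIV"
proof -
  have "f \<in> span (m_basis ` Collect is_partition)" for f
  proof -
    obtain n where "f = (\<Sum>\<mu> | is_partition \<mu> \<and> weight \<mu> \<le> n. sf_coeff f \<mu> *\<^sub>R m_basis \<mu>)"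
      using m_basis_expansion .
    also have "\<dots> \<in> span (m_basis ` Collect is_partition)"
      by (intro span_sum span_scale span_base) auto
    finally show ?thesis .
  qed
  then show ?thesis by auto
qed

lemma sum_m_basis_eq_0:
  assumes S: "finite S" "S \<subseteq> Collect is_partition" and z: "(\<Sum>\<mu>\<in>S. c \<mu> *\<^sub>R m_basis \<mu>) = 0" and "\<nu> \<in> S"
  shows "c \<nu> = 0"
proof -
  have "0 = sf_coeff (\<Sum>\<mu>\<in>S. c \<mu> *\<^sub>R m_basis \<mu>) \<nu>" by (simp add: z sf_coeff_simps)
  also have "\<dots> = (\<Sum>\<mu>\<in>S. if \<mu> = \<nu> then c \<mu> else 0)"
    unfolding sf_coeff_sum sf_coeff_simps using S \<open>\<nu> \<in> S\<close>
    by (intro sum.cong) (auto simp: sf_coeff_m_basis subset_iff)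
  finally show ?thesis using S \<open>\<nu> \<in> S\<close> by simp
qed

lemma family_independentI:
  fixes b :: "'i \<Rightarrow> symfun"
  assumes z: "\<And>S c \<nu>. finite S \<Longrightarrow> S \<subseteq> I \<Longrightarrow> (\<Sum>\<mu>\<in>S. c \<mu> *\<^sub>R b \<mu>) = 0 \<Longrightarrow> \<nu> \<in> S \<Longrightarrow> c \<nu> = 0"
  shows "inj_on b I" "independent (b ` I)"
proof -
  show inj: "inj_on b I"
  proof (rule inj_onI, rule ccontr)
    fix \<mu> \<nu> assume *: "\<mu> \<in> I" "\<nu> \<in> I" "b \<mu> = b \<nu>" "\<mu> \<noteq> \<nu>"
    then have "(if \<mu> = \<mu> then 1 else -1 :: real) = 0"
      by (intro z[of "{\<mu>, \<nu>}" "\<lambda>\<kappa>. if \<kappa> = \<mu> then 1 else -1"]) auto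
    then show False by simp
  qed
  show "independent (b ` I)"
    unfolding independent_explicit_finite_subsets
  proof (intro allI impI ballI)
    fix T u v assume T: "T \<subseteq> b ` I" "finite T" and s: "(\<Sum>v\<in>T. u v *\<^sub>R v) = 0" and v: "v \<in> T"
    define S where "S = {\<mu> \<in> I. b \<mu> \<in> T}"
    have injS: "inj_on b S" using inj by (rule inj_on_subset) (auto simp: S_def)
    have bS: "b ` S = T" using T by (auto simp: S_def)
    then have finS: "finite S" using T injS finite_imageD by blast
    have "(\<Sum>\<mu>\<in>S. u (b \<mu>) *\<^sub>R b \<mu>) = 0"
      using s unfolding bS[symmetric] sum.reindex[OF injS] by simp
    moreover obtain \<nu> where "\<nu> \<in> S" "v = b \<nu>" using v bS by blast
    ultimately show "u v = 0" using z[OF finS, of "\<lambda>\<mu>. u (b \<mu>)" \<nu>] by (auto simp: S_def)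
  qed
qed

lemma inj_on_m_basis: "inj_on m_basis (Collect is_partition)"
  and independent_m_basis: "independent (m_basis ` Collect is_partition)"
  using family_independentI[of "Collect is_partition" m_basis] sum_m_basis_eq_0 by blast+

text \<open>
  In each degree a spanning family indexed by the partitions is a basis, since the monomial
  functions form a basis of the same size.
\<close>

lemma graded_basisI:
  assumes hom: "\<And>\<mu>. is_partition \<mu> \<Longrightarrow> homogeneous (weight \<mu>) (b \<mu>)"
    and span: "\<And>\<nu>. is_partition \<nu> \<Longrightarrow> m_basis \<nu> \<in> span (b ` partitions_of (weight \<nu>))"
  shows "graded_basis b"
proof -
  have sub: "partitions_of n \<subseteq> Collect is_partition" for n by (auto simp: partitions_of_def)
  have indep: "c \<nu> = 0"
    if z: "(\<Sum>\<mu>\<in>partitions_of n. c \<mu> *\<^sub>R b \<mu>) = 0" and \<nu>: "\<nu> \<in> partitions_of n" for n c \<nu>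
  proof (rule ccontr)
    assume "c \<nu> \<noteq> 0"
    let ?B = "b ` (partitions_of n - {\<nu>})"
    have "c \<nu> *\<^sub>R b \<nu> = - (\<Sum>\<mu>\<in>partitions_of n - {\<nu>}. c \<mu> *\<^sub>R b \<mu>)"
      using z \<nu> finite_partitions_of by (simp add: sum.remove[of _ \<nu>] add_eq_0_iff2)
    also have "\<dots> \<in> span ?B" by (intro span_neg span_sum span_scale span_base) auto
    finally have "(1 / c \<nu>) *\<^sub>R (c \<nu> *\<^sub>R b \<nu>) \<in> span ?B" by (rule span_scale)
    then have "b \<nu> \<in> span ?B" using \<open>c \<nu> \<noteq> 0\<close> by simp
    then have "b ` partitions_of n \<subseteq> span ?B" by (auto intro: span_base)
    then have "span (b ` partitions_of n) \<subseteq> span ?B" by (simp add: span_minimal)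
    then have "m_basis ` partitions_of n \<subseteq> span ?B" using span by (fastforce simp: partitions_of_def)
    moreover have "independent (m_basis ` partitions_of n)"
      using independent_m_basis sub by (meson image_mono independent_mono)
    moreover have "finite ?B" by (simp add: finite_partitions_of)
    ultimately have "card (m_basis ` partitions_of n) \<le> card ?B"
      using independent_span_bound by blast
    moreover have "card (m_basis ` partitions_of n) = card (partitions_of n)"
      by (rule card_image[OF inj_on_subset[OF inj_on_m_basis sub]])
    moreover have "card ?B \<le> card (partitions_of n - {\<nu>})"
      by (rule card_image_le) (simp add: finite_partitions_of)
    moreover have "card (partitions_of n - {\<nu>}) < card (partitions_of n)"
      using \<nu> finite_partitions_of by (intro psubset_card_mono) auto
    ultimately show False by linarith
  qed
  have "c \<nu> = 0" if S: "finite S" "S \<subseteq> Collect is_partition" and z: "(\<Sum>\<mu>\<in>S. c \<mu> *\<^sub>R b \<mu>) = 0" and \<nu>: "\<nu> \<in> S"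
    for S c \<nu>
  proof -
    let ?n = "weight \<nu>"
    \<comment> \<open>A relation may mix degrees. Its part in the degree of \<nu> is extended by
      zero to all partitions of that size; comparing coefficients at exponents of this weight sees
      no other terms.\<close>
    let ?c = "\<lambda>\<mu>. if \<mu> \<in> S then c \<mu> else 0"
    have bz: "sf_coeff (b \<mu>) \<alpha> = 0" if "is_partition \<mu>" "weight \<alpha> \<noteq> weight \<mu>" for \<alpha> \<mu>
      using hom[OF that(1)] that(2) by (auto simp: homogeneous_def)
    have "(\<Sum>\<mu>\<in>partitions_of ?n. ?c \<mu> *\<^sub>R b \<mu>) = 0"
    proof (rule symfun_eqI)
      fix \<alpha>
      have "sf_coeff (\<Sum>\<mu>\<in>partitions_of ?n. ?c \<mu> *\<^sub>R b \<mu>) \<alpha>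
          = (\<Sum>\<mu>\<in>partitions_of ?n. ?c \<mu> * sf_coeff (b \<mu>) \<alpha>)"
        by (simp only: sf_coeff_sum sf_coeff_simps)
      also have "\<dots> = 0"
      proof (cases "weight \<alpha> = ?n")
        case True
        have "(\<Sum>\<mu>\<in>partitions_of ?n. ?c \<mu> * sf_coeff (b \<mu>) \<alpha>)
            = (\<Sum>\<mu>\<in>partitions_of ?n \<union> S. ?c \<mu> * sf_coeff (b \<mu>) \<alpha>)"
        proof (rule sum.mono_neutral_left)
          show "\<forall>\<mu>\<in>partitions_of ?n \<union> S - partitions_of ?n. ?c \<mu> * sf_coeff (b \<mu>) \<alpha> = 0"
          proof
            fix \<mu> assume "\<mu> \<in> partitions_of ?n \<union> S - partitions_of ?n"
            then have "is_partition \<mu>" "weight \<mu> \<noteq> ?n" using S by (auto simp: partitions_of_def)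
            then show "?c \<mu> * sf_coeff (b \<mu>) \<alpha> = 0" using bz[of \<mu> \<alpha>] True by simp
          qed
        qed (use S finite_partitions_of in auto)
        also have "\<dots> = (\<Sum>\<mu>\<in>S. c \<mu> * sf_coeff (b \<mu>) \<alpha>)"
          using S finite_partitions_of by (intro sum.mono_neutral_cong_right) auto
        also have "\<dots> = sf_coeff (\<Sum>\<mu>\<in>S. c \<mu> *\<^sub>R b \<mu>) \<alpha>"
          by (simp only: sf_coeff_sum sf_coeff_simps)
        finally show ?thesis by (simp add: z sf_coeff_simps)
      qed (auto intro!: sum.neutral simp: bz partitions_of_def)
      finally show "sf_coeff (\<Sum>\<mu>\<in>partitions_of ?n. ?c \<mu> *\<^sub>R b \<mu>) \<alpha> = sf_coeff 0 \<alpha>"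
        by (simp add: sf_coeff_simps)
    qed
    then have "?c \<nu> = 0" by (rule indep) (use \<nu> S in \<open>auto simp: partitions_of_def\<close>)
    then show ?thesis using \<nu> by simp
  qed
  note family = this
  have "inj_on b (Collect is_partition)"
    by (rule family_independentI(1)) (erule (3) family)
  moreover have "independent (b ` Collect is_partition)"
    by (rule family_independentI(2)) (erule (3) family)
  moreover have "m_basis ` Collect is_partition \<subseteq> span (b ` Collect is_partition)"
  proof (rule image_subsetI)
    fix \<nu> assume "\<nu> \<in> Collect is_partition"
    then have "m_basis \<nu> \<in> span (b ` partitions_of (weight \<nu>))" using span by simp
    also have "\<dots> \<subseteq> span (b ` Collect is_partition)" by (rule span_mono[OF image_mono[OF sub]])
    finally show "m_basis \<nu> \<in> span (b ` Collect is_partition)" .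
  qed
  then have "span (b ` Collect is_partition) = UNIV"
    using span_m_basis span_minimal[OF _ subspace_span] by blast
  ultimately show ?thesis using hom by (simp add: graded_basis_def)
qed

lemma graded_basis_m: "graded_basis m_basis"
  by (rule graded_basisI) (auto intro: homogeneous_m_basis span_base simp: partitions_of_def)

lemma graded_basis_extend:
  fixes g :: "(nat \<Rightarrow>\<^sub>0 nat) \<Rightarrow> 'v::real_vector"
  assumes "graded_basis b"
  shows "\<exists>\<phi>. linear \<phi> \<and> (\<forall>\<mu>. is_partition \<mu> \<longrightarrow> \<phi> (b \<mu>) = g \<mu>)"
proof -
  have "independent (b ` Collect is_partition)" using assms by (simp add: graded_basis_def)
  then obtain \<phi> where \<phi>: "linear \<phi>"
    "\<forall>v\<in>b ` Collect is_partition. \<phi> v = g (inv_into (Collect is_partition) b v)"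
    using linear_independent_extend[of _ "\<lambda>v. g (inv_into (Collect is_partition) b v)"] by blast
  have "\<phi> (b \<mu>) = g \<mu>" if "is_partition \<mu>" for \<mu>
    using \<phi>(2) that assms by (simp add: graded_basis_def)
  with \<phi>(1) show ?thesis by blast
qed

lemma graded_basis_linear_eq:
  assumes b: "graded_basis b" and "linear \<phi>" "linear \<psi>" "\<And>\<mu>. is_partition \<mu> \<Longrightarrow> \<phi> (b \<mu>) = \<psi> (b \<mu>)"
  shows "\<phi> f = \<psi> f"
proof (rule linear_eq_on[OF assms(2,3)])
  show "f \<in> span (b ` Collect is_partition)" using b by (simp add: graded_basis_def)
qed (use assms(4) in auto)

lemma homogeneous_in_span:
  assumes b: "graded_basis b" and hom: "homogeneous n f"
    and span: "\<And>\<nu>. \<nu> \<in> partitions_of n \<Longrightarrow> m_basis \<nu> \<in> span (b ` partitions_of n)"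
  shows "f \<in> span (b ` partitions_of n)"
  by (subst homogeneous_expansion[OF hom]) (intro span_sum span_scale span)

subsection \<open>Elementary functions\<close>

text \<open>Exponent vectors are ordered lexicographically. This order is compatible with addition,
  so leading exponents add under multiplication.\<close>

definition leading :: "(nat \<Rightarrow>\<^sub>0 nat) \<Rightarrow> symfun \<Rightarrow> bool"
  where "leading a f \<longleftrightarrow> sf_coeff f a = 1 \<and> (\<forall>\<alpha>. sf_coeff f \<alpha> \<noteq> 0 \<longrightarrow> \<alpha> \<le> a)"

lemma leading_1: "leading 0 1"
  by (auto simp: leading_def one_symfun.rep_eq)

lemma leading_mult:
  assumes f: "leading a f" and g: "leading b g"
  shows "leading (a + b) (f * g)"
proof -
  have le: "\<alpha> \<le> a + b" if nz: "sf_coeff (f * g) \<alpha> \<noteq> 0" for \<alpha>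
  proof -
    obtain p where "p \<in> splits \<alpha>" "(case p of (\<beta>, \<gamma>) \<Rightarrow> sf_coeff f \<beta> * sf_coeff g \<gamma>) \<noteq> 0"
      using sum.not_neutral_contains_not_neutral[OF nz[unfolded times_symfun.rep_eq]] by blast
    then show ?thesis
      using f g by (auto simp: splits_def leading_def intro: add_mono split: prod.splits)
  qed
  have "sf_coeff (f * g) (a + b) = (\<Sum>(\<beta>, \<gamma>)\<in>{(a, b)}. sf_coeff f \<beta> * sf_coeff g \<gamma>)"
    unfolding times_symfun.rep_eq
  proof (rule sum.mono_neutral_right[OF finite_splits])
    show "{(a, b)} \<subseteq> splits (a + b)" by (simp add: splits_def)
    show "\<forall>p\<in>splits (a + b) - {(a, b)}. (case p of (\<beta>, \<gamma>) \<Rightarrow> sf_coeff f \<beta> * sf_coeff g \<gamma>) = 0"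
    proof (intro ballI)
      fix p assume p: "p \<in> splits (a + b) - {(a, b)}"
      obtain \<beta> \<gamma> where pe: "p = (\<beta>, \<gamma>)" by (cases p)
      have eq: "\<beta> + \<gamma> = a + b" using p by (simp add: pe splits_def)
      have "sf_coeff f \<beta> = 0 \<or> sf_coeff g \<gamma> = 0"
      proof (rule ccontr)
        assume "\<not> ?thesis"
        then have le: "\<beta> \<le> a" "\<gamma> \<le> b" using f g by (auto simp: leading_def)
        have "\<not> \<beta> < a" using eq le(2) add_less_le_mono[of \<beta> a \<gamma> b] by auto
        then have "\<beta> = a" using le(1) by simp
        then show False using eq p by (simp add: pe)
      qed
      then show "(case p of (\<beta>, \<gamma>) \<Rightarrow> sf_coeff f \<beta> * sf_coeff g \<gamma>) = 0" by (auto simp: pe)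
    qed
  qed
  then have "sf_coeff (f * g) (a + b) = 1" using f g by (simp add: leading_def)
  with le show ?thesis by (simp add: leading_def)
qed

lemma leading_elementary: "leading (Abs_poly_mapping (\<lambda>i. of_bool (i < r))) (elementary_sf r)"
proof -
  let ?a = "Abs_poly_mapping (\<lambda>i. of_bool (i < r)) :: nat \<Rightarrow>\<^sub>0 nat"
  have a: "lookup ?a i = of_bool (i < r)" for i
    by (subst Abs_poly_mapping_inverse) (auto intro: finite_subset[of _ "{..<r}"])
  have wa: "weight ?a = r"
  proof -
    have "weight ?a = (\<Sum>i<r. lookup ?a i)" by (rule weight_sum) (auto simp: in_keys_iff a)
    then show ?thesis by (simp add: a)
  qed
  have "\<alpha> \<le> ?a" if \<alpha>: "weight \<alpha> = r" "\<forall>i. lookup \<alpha> i \<le> 1" for \<alpha>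
  proof (rule ccontr)
    assume "\<not> \<alpha> \<le> ?a"
    then have "?a < \<alpha>" by simp
    then obtain k where k: "lookup ?a k < lookup \<alpha> k" "\<And>i. i < k \<Longrightarrow> lookup ?a i = lookup \<alpha> i"
      by (auto simp: less_poly_mapping.rep_eq less_fun_def)
    have "\<not> k < r" using k(1) \<alpha>(2)[rule_format, of k] by (auto simp: a)
    have "Suc r = (\<Sum>i\<in>insert k {..<r}. 1)" using \<open>\<not> k < r\<close> by simp
    also have "\<dots> \<le> (\<Sum>i\<in>insert k {..<r}. lookup \<alpha> i)"
    proof (rule sum_mono)
      fix i assume "i \<in> insert k {..<r}"
      then consider "i = k" | "i < r" by auto
      then show "1 \<le> lookup \<alpha> i"
      proof cases
        case 2
        then show ?thesis using k(2)[of i] \<open>\<not> k < r\<close> by (simp add: a)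
      qed (use k(1) in simp)
    qed
    also have "\<dots> \<le> (\<Sum>i\<in>insert k {..<r} \<union> keys \<alpha>. lookup \<alpha> i)" by (rule sum_mono2) auto
    also have "\<dots> = weight \<alpha>" by (rule weight_superset[symmetric]) auto
    finally show False using \<alpha>(1) by simp
  qed
  then show ?thesis by (auto simp: leading_def elementary_sf.rep_eq wa a)
qed

lemma leading_prod: "finite I \<Longrightarrow> (\<And>i. i \<in> I \<Longrightarrow> leading (a i) (f i)) \<Longrightarrow> leading (\<Sum>i\<in>I. a i) (\<Prod>i\<in>I. f i)"
  by (induction I rule: finite_induct) (auto intro: leading_mult leading_1)

lemma leading_e_basis: "leading (conjugate \<mu>) (e_basis \<mu>)"
proof -
  have "(\<Sum>i\<in>keys \<mu>. Abs_poly_mapping (\<lambda>j. of_bool (j < lookup \<mu> i))) = conjugate \<mu>"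
  proof (rule poly_mapping_eqI)
    fix j
    have "lookup (Abs_poly_mapping (\<lambda>j. of_bool (j < r)) :: nat \<Rightarrow>\<^sub>0 nat) j = of_bool (j < r)" for r
      by (subst Abs_poly_mapping_inverse) (auto intro: finite_subset[of _ "{..<r}"])
    then have "lookup (\<Sum>i\<in>keys \<mu>. Abs_poly_mapping (\<lambda>j. of_bool (j < lookup \<mu> i)) :: nat \<Rightarrow>\<^sub>0 nat) j
        = (\<Sum>i\<in>keys \<mu>. of_bool (j < lookup \<mu> i))"
      by (simp add: lookup_sum)
    also have "\<dots> = card (keys \<mu> \<inter> {i. j < lookup \<mu> i})" by simp
    also have "keys \<mu> \<inter> {i. j < lookup \<mu> i} = {i. j < lookup \<mu> i}" by (auto simp: in_keys_iff)
    finally show "lookup (\<Sum>i\<in>keys \<mu>. Abs_poly_mapping (\<lambda>j. of_bool (j < lookup \<mu> i))) j = lookup (conjugate \<mu>) j"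
      by (simp add: lookup_conjugate)
  qed
  then show ?thesis
    unfolding e_basis_def using leading_prod[of "keys \<mu>"] leading_elementary by (metis finite_keys)
qed

text \<open>The function e with label \<nu>' has leading exponent \<nu> with coefficient 1, so it
  equals m_\<nu> plus a combination of m_\<kappa> with \<kappa> < \<nu>. The induction is on the
  number of smaller partitions of n.\<close>

lemma m_basis_in_span_e:
  assumes "\<nu> \<in> partitions_of n"
  shows "m_basis \<nu> \<in> span (e_basis ` partitions_of n)"
  using assms
proof (induction "card {\<kappa> \<in> partitions_of n. \<kappa> < \<nu>}" arbitrary: \<nu> rule: less_induct)
  case less
  have fin: "finite {\<kappa> \<in> partitions_of n. \<kappa> < \<nu>}" using finite_partitions_of[of n] by simp
  let ?\<mu> = "conjugate \<nu>"
  have \<nu>: "is_partition \<nu>" "weight \<nu> = n" using less.prems by (auto simp: partitions_of_def)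
  have hom: "homogeneous n (e_basis ?\<mu>)" using homogeneous_e_basis[of ?\<mu>] \<nu> by simp
  have lead: "leading \<nu> (e_basis ?\<mu>)" using leading_e_basis[of ?\<mu>] \<nu> by simp
  let ?f = "\<lambda>\<kappa>. sf_coeff (e_basis ?\<mu>) \<kappa> *\<^sub>R m_basis \<kappa>"
  have "e_basis ?\<mu> = (\<Sum>\<kappa>\<in>partitions_of n. ?f \<kappa>)" by (rule homogeneous_expansion[OF hom])
  also have "\<dots> = ?f \<nu> + (\<Sum>\<kappa>\<in>partitions_of n - {\<nu>}. ?f \<kappa>)"
    using less.prems finite_partitions_of by (intro sum.remove) auto
  also have "?f \<nu> = m_basis \<nu>" using lead by (simp add: leading_def)
  finally have "m_basis \<nu> = e_basis ?\<mu> - (\<Sum>\<kappa>\<in>partitions_of n - {\<nu>}. ?f \<kappa>)"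
    by (metis add_diff_cancel_right')
  moreover have "e_basis ?\<mu> \<in> span (e_basis ` partitions_of n)"
    using \<nu> by (intro span_base imageI) (simp add: partitions_of_def)
  moreover have "(\<Sum>\<kappa>\<in>partitions_of n - {\<nu>}. ?f \<kappa>) \<in> span (e_basis ` partitions_of n)"
  proof (rule span_sum)
    fix \<kappa> assume \<kappa>: "\<kappa> \<in> partitions_of n - {\<nu>}"
    show "?f \<kappa> \<in> span (e_basis ` partitions_of n)"
    proof (cases "sf_coeff (e_basis ?\<mu>) \<kappa> = 0")
      case False
      then have "\<kappa> < \<nu>" using lead \<kappa> by (auto simp: leading_def)
      then have "{\<kappa>' \<in> partitions_of n. \<kappa>' < \<kappa>} \<subset> {\<kappa>' \<in> partitions_of n. \<kappa>' < \<nu>}"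
        using \<kappa> by auto
      then have "card {\<kappa>' \<in> partitions_of n. \<kappa>' < \<kappa>} < card {\<kappa>' \<in> partitions_of n. \<kappa>' < \<nu>}"
        by (rule psubset_card_mono[OF fin])
      then show ?thesis using less.hyps \<kappa> by (intro span_scale) auto
    qed (simp add: span_zero)
  qed
  ultimately show ?case by (metis span_diff)
qed

lemma graded_basis_e: "graded_basis e_basis"
  by (rule graded_basisI) (rule homogeneous_e_basis, rule m_basis_in_span_e, simp add: partitions_of_def)

subsection \<open>The involution\<close>

text \<open>Unsorted lists are used since concatenation corresponds to multiplication and since the
  type of a flag comes as a list; zeros are harmless because e_0 = h_0 = 1.\<close>

definition elem_list :: "nat list \<Rightarrow> symfun"
  where "elem_list rs = prod_list (map elementary_sf rs)"

definition compl_list :: "nat list \<Rightarrow> symfun"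
  where "compl_list rs = prod_list (map complete_sf rs)"

lemma elementary_0: "elementary_sf 0 = 1"
  by (rule symfun_eqI) (auto simp: elementary_sf.rep_eq one_symfun.rep_eq)

lemma complete_0: "complete_sf 0 = 1"
  by (rule symfun_eqI) (auto simp: complete_sf.rep_eq one_symfun.rep_eq)

lemma prod_keys_conjugate_eq:
  fixes f :: "nat \<Rightarrow> 'c::comm_monoid_mult"
  assumes "conjugate \<alpha> = conjugate \<beta>"
  shows "(\<Prod>i\<in>keys \<alpha>. f (lookup \<alpha> i)) = (\<Prod>i\<in>keys \<beta>. f (lookup \<beta> i))"
proof -
  obtain \<pi> where \<pi>: "bij \<pi>" "\<alpha> = Poly_Mapping.map_key \<pi> \<beta>" using conjugate_eq_imp_map_key[OF assms] .
  have "bij_betw \<pi> (keys \<alpha>) (keys \<beta>)"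
    unfolding \<pi>(2) keys_map_key[OF bij_is_inj[OF \<pi>(1)]] bij_betw_def
    using inj_on_subset[OF bij_is_inj[OF \<pi>(1)] subset_UNIV] surj_image_vimage_eq[OF bij_is_surj[OF \<pi>(1)]]
    by simp
  moreover have "lookup \<alpha> i = lookup \<beta> (\<pi> i)" for i
    using \<pi> by (simp add: map_key.rep_eq bij_is_inj)
  ultimately show ?thesis
    using prod.reindex_bij_betw[of \<pi> "keys \<alpha>" "keys \<beta>" "\<lambda>i. f (lookup \<beta> i)"] by simp
qed

lemma list_as_partition:
  obtains \<mu> where "is_partition \<mu>" "weight \<mu> = sum_list rs" "elem_list rs = e_basis \<mu>" "compl_list rs = h_basis \<mu>"
proof -
  define \<alpha> where "\<alpha> = Abs_poly_mapping (\<lambda>i. if i < length rs then rs ! i else 0)"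
  have \<alpha>: "lookup \<alpha> i = (if i < length rs then rs ! i else 0)" for i
  proof -
    have "finite {i. (if i < length rs then rs ! i else 0) \<noteq> 0}"
      by (rule finite_subset[of _ "{..<length rs}"]) (auto split: if_splits)
    then show ?thesis by (simp add: \<alpha>_def Abs_poly_mapping_inverse)
  qed
  have K: "keys \<alpha> \<subseteq> {..<length rs}" by (auto simp: in_keys_iff \<alpha> split: if_splits)
  let ?\<mu> = "conjugate (conjugate \<alpha>)"
  have conj: "conjugate ?\<mu> = conjugate \<alpha>" by simp
  have prod: "prod_list (map f rs) = (\<Prod>i\<in>keys ?\<mu>. f (lookup ?\<mu> i))" if "f 0 = 1" for f :: "nat \<Rightarrow> symfun"
  proof -
    have "prod_list (map f rs) = (\<Prod>i<length rs. f (rs ! i))"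
      by (simp add: prod.list_conv_set_nth atLeast0LessThan)
    also have "\<dots> = (\<Prod>i<length rs. f (lookup \<alpha> i))" by (rule prod.cong) (auto simp: \<alpha>)
    also have "\<dots> = (\<Prod>i\<in>keys \<alpha>. f (lookup \<alpha> i))"
      using K that by (intro prod.mono_neutral_right) (auto simp: in_keys_iff)
    also have "\<dots> = (\<Prod>i\<in>keys ?\<mu>. f (lookup ?\<mu> i))" by (rule prod_keys_conjugate_eq[OF conj[symmetric]])
    finally show ?thesis .
  qed
  have "weight \<alpha> = (\<Sum>i<length rs. rs ! i)" using weight_sum[OF K] by (simp add: \<alpha>)
  then have "weight ?\<mu> = sum_list rs" by (simp add: sum_list_sum_nth atLeast0LessThan)
  then show ?thesis
    using that[of ?\<mu>] prod[of elementary_sf, OF elementary_0] prod[of complete_sf, OF complete_0]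
    by (simp add: elem_list_def compl_list_def e_basis_def h_basis_def)
qed

lemma partition_as_list:
  obtains rs where "sum_list rs = weight \<mu>" "elem_list rs = e_basis \<mu>" "compl_list rs = h_basis \<mu>"
proof -
  define rs where "rs = map (lookup \<mu>) (sorted_list_of_set (keys \<mu>))"
  have "prod_list (map f rs) = (\<Prod>i\<in>keys \<mu>. f (lookup \<mu> i))" for f :: "nat \<Rightarrow> symfun"
    using prod.distinct_set_conv_list[of "sorted_list_of_set (keys \<mu>)" "\<lambda>i. f (lookup \<mu> i)"]
    by (simp add: rs_def comp_def)
  moreover have "sum_list rs = weight \<mu>"
    using sum.distinct_set_conv_list[of "sorted_list_of_set (keys \<mu>)" "lookup \<mu>"]
    by (simp add: rs_def weight_def)
  ultimately show ?thesis
    using that[of rs] by (simp add: elem_list_def compl_list_def e_basis_def h_basis_def)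
qed

lemma omega_exists: "linear omega \<and> (\<forall>\<mu>. is_partition \<mu> \<longrightarrow> omega (e_basis \<mu>) = h_basis \<mu>)"
proof -
  obtain w :: "symfun \<Rightarrow> symfun"
    where w: "linear w" "\<And>\<mu>. is_partition \<mu> \<Longrightarrow> w (e_basis \<mu>) = h_basis \<mu>"
    using graded_basis_extend[OF graded_basis_e, of h_basis] by blast
  have "\<exists>!w. linear w \<and> (\<forall>\<mu>. is_partition \<mu> \<longrightarrow> w (e_basis \<mu>) = h_basis \<mu>)"
  proof (rule ex1I[of _ w])
    fix w' assume w': "linear w' \<and> (\<forall>\<mu>. is_partition \<mu> \<longrightarrow> w' (e_basis \<mu>) = h_basis \<mu>)"
    show "w' = w"
    proof
      fix f show "w' f = w f" by (rule graded_basis_linear_eq[OF graded_basis_e]) (use w w' in auto)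
    qed
  qed (use w in auto)
  then show ?thesis unfolding omega_def by (rule theI')
qed

lemma linear_omega: "linear omega"
  using omega_exists by blast

lemma omega_elem_list: "omega (elem_list rs) = compl_list rs"
  using list_as_partition[of rs] omega_exists by metis

lemma elem_list_append: "elem_list (rs @ ss) = elem_list rs * elem_list ss"
  by (simp add: elem_list_def)

lemma compl_list_append: "compl_list (rs @ ss) = compl_list rs * compl_list ss"
  by (simp add: compl_list_def)

lemma linear_eq_elem_list:
  assumes "linear \<phi>" "linear \<psi>" "\<And>rs. \<phi> (elem_list rs) = \<psi> (elem_list rs)"
  shows "\<phi> f = \<psi> f"
proof (rule graded_basis_linear_eq[OF graded_basis_e assms(1,2)])
  fix \<mu>
  obtain rs where "elem_list rs = e_basis \<mu>" using partition_as_list by metis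
  then show "\<phi> (e_basis \<mu>) = \<psi> (e_basis \<mu>)" using assms(3) by metis
qed

lemma linear_mult_left_symfun: "linear (\<lambda>f :: symfun. g * f)"
  by (rule linearI) (simp_all add: distrib_left)

lemma linear_mult_right_symfun: "linear (\<lambda>f :: symfun. f * g)"
  by (rule linearI) (simp_all add: distrib_right)

text \<open>Both sides are linear in each argument, and products of elementary functions are again
  such products, by concatenation of lists.\<close>

lemma omega_mult: "omega (f * g) = omega f * omega g"
proof -
  have 1: "omega (elem_list rs * g) = omega (elem_list rs) * omega g" for rs g
  proof (rule linear_eq_elem_list[of "\<lambda>g. omega (elem_list rs * g)" "\<lambda>g. omega (elem_list rs) * omega g"])
    show "linear (\<lambda>g. omega (elem_list rs * g))"
      using linear_compose[OF linear_mult_left_symfun linear_omega] by (simp add: comp_def)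
    show "linear (\<lambda>g. omega (elem_list rs) * omega g)"
      using linear_compose[OF linear_omega linear_mult_left_symfun] by (simp add: comp_def)
    show "omega (elem_list rs * elem_list ss) = omega (elem_list rs) * omega (elem_list ss)" for ss
      using omega_elem_list[of "rs @ ss"]
      by (simp add: elem_list_append compl_list_append omega_elem_list)
  qed
  show ?thesis
  proof (rule linear_eq_elem_list[of "\<lambda>f. omega (f * g)" "\<lambda>f. omega f * omega g"])
    show "linear (\<lambda>f. omega (f * g))"
      using linear_compose[OF linear_mult_right_symfun linear_omega] by (simp add: comp_def)
    show "linear (\<lambda>f. omega f * omega g)"
      using linear_compose[OF linear_omega linear_mult_right_symfun] by (simp add: comp_def)
  qed (rule 1)
qed

lemma omega_elementary: "omega (elementary_sf r) = complete_sf r"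
  using omega_elem_list[of "[r]"] by (simp add: elem_list_def compl_list_def)

lemma omega_1: "omega 1 = 1"
  using omega_elem_list[of "[]"] by (simp add: elem_list_def compl_list_def)

lemma alternating_subsets: "finite K \<Longrightarrow> K \<noteq> {} \<Longrightarrow> (\<Sum>B\<in>Pow K. (-1::real) ^ card B) = 0"
  using prod_add[of K "\<lambda>_. -1::real" "\<lambda>_. 1"] by (simp add: card_gt_0_iff power_0_left)

text \<open>The identity E(-t) H(t) = 1. At x^\<alpha> the contributing splittings take a squarefree
  monomial from e, that is a subset of the support of \<alpha>, with sign given by its size; these
  signs cancel since the support is nonempty.\<close>

lemma sum_elementary_complete:
  assumes "n > 0"
  shows "(\<Sum>i\<le>n. (-1) ^ i *\<^sub>R (elementary_sf i * complete_sf (n - i))) = 0"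
proof (rule symfun_eqI)
  fix \<alpha>
  let ?P = "\<lambda>\<beta> :: nat \<Rightarrow>\<^sub>0 nat. \<forall>i. lookup \<beta> i \<le> 1"
  have "sf_coeff (\<Sum>i\<le>n. (-1) ^ i *\<^sub>R (elementary_sf i * complete_sf (n - i))) \<alpha>
      = (\<Sum>i\<le>n. \<Sum>(\<beta>, \<gamma>)\<in>splits \<alpha>. (-1) ^ i * (of_bool (weight \<beta> = i \<and> ?P \<beta>) * of_bool (weight \<gamma> = n - i)))"
    by (simp add: sf_coeff_sum sf_coeff_simps times_symfun.rep_eq elementary_sf.rep_eq
        complete_sf.rep_eq sum_distrib_left case_prod_unfold)
  also have "\<dots> = (\<Sum>(\<beta>, \<gamma>)\<in>splits \<alpha>. \<Sum>i\<le>n. (-1) ^ i * (of_bool (weight \<beta> = i \<and> ?P \<beta>) * of_bool (weight \<gamma> = n - i)))"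
    unfolding case_prod_unfold by (rule sum.swap)
  also have "\<dots> = (\<Sum>(\<beta>, \<gamma>)\<in>splits \<alpha>. of_bool (weight \<alpha> = n \<and> ?P \<beta>) * (-1) ^ weight \<beta>)"
  proof (rule sum.cong[OF refl], clarify)
    fix \<beta> \<gamma> assume "(\<beta>, \<gamma>) \<in> splits \<alpha>"
    then have w: "weight \<alpha> = weight \<beta> + weight \<gamma>" by (auto simp: splits_def weight_add)
    have "(\<Sum>i\<le>n. (-1) ^ i * (of_bool (weight \<beta> = i \<and> ?P \<beta>) * of_bool (weight \<gamma> = n - i)))
        = (\<Sum>i\<le>n. if i = weight \<beta> then (-1) ^ weight \<beta> * of_bool (?P \<beta> \<and> weight \<gamma> = n - weight \<beta>) else (0::real))"
      by (rule sum.cong) auto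
    also have "\<dots> = of_bool (weight \<alpha> = n \<and> ?P \<beta>) * (-1) ^ weight \<beta>"
      using w by (auto simp: sum.delta)
    finally show "(\<Sum>i\<le>n. (-1) ^ i * (of_bool (weight \<beta> = i \<and> ?P \<beta>) * of_bool (weight \<gamma> = n - i)))
        = of_bool (weight \<alpha> = n \<and> ?P \<beta>) * (-1::real) ^ weight \<beta>" .
  qed
  also have "\<dots> = 0"
  proof (cases "weight \<alpha> = n")
    case True
    let ?ind = "\<lambda>B. Abs_poly_mapping (\<lambda>i. of_bool (i \<in> B)) :: nat \<Rightarrow>\<^sub>0 nat"
    have ind: "lookup (?ind B) i = of_bool (i \<in> B)" if "B \<subseteq> keys \<alpha>" for B i
      using that by (subst Abs_poly_mapping_inverse) (auto intro: finite_subset[of _ "keys \<alpha>"])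
    have "keys \<alpha> \<noteq> {}" using True assms by (auto simp: weight_def)
    have "(\<Sum>(\<beta>, \<gamma>)\<in>splits \<alpha>. of_bool (weight \<alpha> = n \<and> ?P \<beta>) * (-1::real) ^ weight \<beta>)
        = (\<Sum>p\<in>{p \<in> splits \<alpha>. ?P (fst p)}. (-1) ^ weight (fst p))"
      using finite_splits[of \<alpha>] True
      by (intro sum.mono_neutral_cong_right) (auto simp: case_prod_unfold)
    also have "\<dots> = (\<Sum>B\<in>Pow (keys \<alpha>). (-1) ^ card B)"
    proof (rule sum.reindex_bij_witness[of _ "\<lambda>B. (?ind B, \<alpha> - ?ind B)" "\<lambda>p. keys (fst p)"])
      fix p assume p: "p \<in> {p \<in> splits \<alpha>. ?P (fst p)}"
      obtain \<beta> \<gamma> where pe: "p = (\<beta>, \<gamma>)" by (cases p)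
      have \<beta>: "\<beta> + \<gamma> = \<alpha>" "?P \<beta>" using p by (auto simp: pe splits_def)
      have K: "keys \<beta> \<subseteq> keys \<alpha>" using \<beta>(1) by (auto simp: in_keys_iff lookup_add)
      then show "keys (fst p) \<in> Pow (keys \<alpha>)" by (simp add: pe)
      have v: "lookup \<beta> i = of_bool (i \<in> keys \<beta>)" for i
        using \<beta>(2)[rule_format, of i] by (auto simp: in_keys_iff)
      have "?ind (keys \<beta>) = \<beta>" by (rule poly_mapping_eqI) (rule trans[OF ind[OF K] v[symmetric]])
      then show "(?ind (keys (fst p)), \<alpha> - ?ind (keys (fst p))) = p"
        using \<beta>(1) by (auto simp: pe)
      have "weight \<beta> = (\<Sum>i\<in>keys \<beta>. 1)" unfolding weight_def
        by (rule sum.cong) (use v in auto)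
      then show "(-1::real) ^ card (keys (fst p)) = (-1) ^ weight (fst p)" by (simp add: pe)
    next
      fix B assume "B \<in> Pow (keys \<alpha>)"
      then have B: "B \<subseteq> keys \<alpha>" by simp
      have "?ind B + (\<alpha> - ?ind B) = \<alpha>"
        using B by (intro poly_mapping_eqI) (auto simp: lookup_add lookup_minus ind in_keys_iff subset_iff)
      then show "(?ind B, \<alpha> - ?ind B) \<in> {p \<in> splits \<alpha>. ?P (fst p)}"
        using B by (simp add: splits_def ind)
      show "keys (fst (?ind B, \<alpha> - ?ind B)) = B" using B by (auto simp: in_keys_iff ind)
    qed
    also have "\<dots> = 0" using \<open>keys \<alpha> \<noteq> {}\<close> by (intro alternating_subsets) auto
    finally show ?thesis .
  qed (auto intro!: sum.neutral)
  finally show "sf_coeff (\<Sum>i\<le>n. (-1) ^ i *\<^sub>R (elementary_sf i * complete_sf (n - i))) \<alpha> = sf_coeff 0 \<alpha>"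
    by (simp add: sf_coeff_simps)
qed

text \<open>Applying \<omega> to the relation between e and h yields a recursion for \<omega>(h_n)
  with coefficients h_i. The same relation read in reverse order shows that e_n satisfies this
  recursion.\<close>

lemma omega_complete: "omega (complete_sf n) = elementary_sf n"
proof (induction n rule: less_induct)
  case (less n)
  show ?case
  proof (cases "n = 0")
    case False
    let ?f = "\<lambda>i. (-1) ^ i *\<^sub>R (complete_sf i * elementary_sf (n - i))"
    have "0 = omega (\<Sum>i\<le>n. (-1) ^ i *\<^sub>R (elementary_sf i * complete_sf (n - i)))"
      using sum_elementary_complete[of n] False linear_0[OF linear_omega] by simp
    also have "\<dots> = (\<Sum>i\<le>n. (-1) ^ i *\<^sub>R (complete_sf i * omega (complete_sf (n - i))))"
      by (simp add: linear_sum[OF linear_omega] linear_scale[OF linear_omega] omega_mult omega_elementary)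
    also have "\<dots> = omega (complete_sf n) + (\<Sum>i\<in>{..n} - {0}. (-1) ^ i *\<^sub>R (complete_sf i * omega (complete_sf (n - i))))"
      by (subst sum.remove[of _ 0]) (auto simp: complete_0)
    also have "(\<Sum>i\<in>{..n} - {0}. (-1) ^ i *\<^sub>R (complete_sf i * omega (complete_sf (n - i)))) = (\<Sum>i\<in>{..n} - {0}. ?f i)"
      using less False by (intro sum.cong) auto
    finally have 1: "omega (complete_sf n) + (\<Sum>i\<in>{..n} - {0}. ?f i) = 0" by simp
    have "0 = (-1) ^ n *\<^sub>R (\<Sum>i\<le>n. (-1) ^ i *\<^sub>R (elementary_sf i * complete_sf (n - i)))"
      using sum_elementary_complete[of n] False by simp
    also have "\<dots> = (\<Sum>i\<le>n. ?f i)"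
      unfolding scaleR_sum_right
    proof (rule sum.reindex_bij_witness[of _ "\<lambda>i. n - i" "\<lambda>i. n - i"])
      fix i assume i: "i \<in> {..n}"
      then obtain d where n: "n = i + d" using le_Suc_ex by auto
      have "(-1::real) ^ n * (-1) ^ i = (-1) ^ d * ((-1) * (-1)) ^ i"
        unfolding n power_add power_mult_distrib by simp
      then show "?f (n - i) = (-1) ^ n *\<^sub>R (-1) ^ i *\<^sub>R (elementary_sf i * complete_sf (n - i))"
        by (simp add: n mult.commute)
    qed auto
    also have "\<dots> = elementary_sf n + (\<Sum>i\<in>{..n} - {0}. ?f i)"
      by (subst sum.remove[of _ 0]) (auto simp: complete_0)
    finally have 2: "elementary_sf n + (\<Sum>i\<in>{..n} - {0}. ?f i) = 0" by simp
    show ?thesis using 1 2 by (metis add_right_cancel)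
  qed (simp add: complete_0 elementary_0 omega_1)
qed

lemma omega_compl_list: "omega (compl_list rs) = elem_list rs"
  by (induction rs) (simp_all add: compl_list_def elem_list_def omega_1 omega_mult omega_complete)

lemma omega_omega: "omega (omega f) = f"
proof (rule linear_eq_elem_list[of "\<lambda>f. omega (omega f)" "\<lambda>f. f"])
  show "linear (\<lambda>f. omega (omega f))"
    using linear_compose[OF linear_omega linear_omega] by (simp add: comp_def)
  show "linear (\<lambda>f :: symfun. f)" by (simp add: linear_iff)
qed (simp add: omega_elem_list omega_compl_list)

lemma omega_h_basis: "omega (h_basis \<mu>) = e_basis \<mu>"
  by (metis partition_as_list omega_compl_list)

lemma omega_e_basis: "omega (e_basis \<mu>) = h_basis \<mu>"
  by (metis partition_as_list omega_elem_list)

text \<open>In each degree \<omega> maps the span of the e-functions onto that of the h-functions,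
  and the latter is contained in the former. Hence \<omega>(m_\<nu>) lies in the span of the
  h-functions, and applying \<omega> once more brings m_\<nu> itself into it.\<close>

lemma graded_basis_h: "graded_basis h_basis"
proof (rule graded_basisI)
  fix \<nu> assume \<nu>: "is_partition \<nu>"
  let ?n = "weight \<nu>" and ?P = "partitions_of (weight \<nu>)"
  have im: "omega f \<in> span (h_basis ` ?P)" if "f \<in> span (e_basis ` ?P)" for f
  proof -
    have "omega f \<in> omega ` span (e_basis ` ?P)" using that by simp
    also have "\<dots> = span (omega ` e_basis ` ?P)" by (rule linear_span_image[OF linear_omega, symmetric])
    finally show ?thesis by (simp add: image_image omega_e_basis)
  qed
  have m: "m_basis \<kappa> \<in> span (e_basis ` ?P)" if "\<kappa> \<in> ?P" for \<kappa> by (rule m_basis_in_span_e[OF that])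
  have "omega (m_basis \<nu>) \<in> span (h_basis ` ?P)"
    using \<nu> m by (intro im) (simp add: partitions_of_def)
  moreover have "span (h_basis ` ?P) \<subseteq> span (e_basis ` ?P)"
  proof (rule span_minimal)
    show "h_basis ` ?P \<subseteq> span (e_basis ` ?P)"
    proof (rule image_subsetI)
      fix \<kappa> assume "\<kappa> \<in> ?P"
      then have "homogeneous ?n (h_basis \<kappa>)" using homogeneous_h_basis[of \<kappa>] by (simp add: partitions_of_def)
      then show "h_basis \<kappa> \<in> span (e_basis ` ?P)" by (rule homogeneous_in_span[OF graded_basis_e _ m])
    qed
  qed simp
  ultimately have "omega (omega (m_basis \<nu>)) \<in> span (h_basis ` ?P)" by (intro im) blast
  then show "m_basis \<nu> \<in> span (h_basis ` ?P)" by (simp add: omega_omega)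
qed (rule homogeneous_h_basis)

subsection \<open>The Hall scalar product\<close>

text \<open>For fixed f, the functional that sends h_\<mu> to the coefficient of f at \<mu> exists
  because the h-functions form a basis. It is linear in f since coefficients are, and it is unique
  since both the m- and the h-functions span.\<close>

lemma hall_exists: "bilinear hall \<and>
    (\<forall>\<nu> \<mu>. is_partition \<nu> \<longrightarrow> is_partition \<mu> \<longrightarrow> hall (m_basis \<nu>) (h_basis \<mu>) = of_bool (\<nu> = \<mu>))"
proof -
  have "\<exists>\<phi>. linear \<phi> \<and> (\<forall>\<mu>. is_partition \<mu> \<longrightarrow> \<phi> (h_basis \<mu>) = sf_coeff f \<mu>)" for f
    by (rule graded_basis_extend[OF graded_basis_h])
  then obtain B where B: "\<And>f. linear (B f)" "\<And>f \<mu>. is_partition \<mu> \<Longrightarrow> B f (h_basis \<mu>) = sf_coeff f \<mu>"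
    by metis
  have "linear (\<lambda>f. B f g)" for g
  proof (rule linearI)
    fix f f' :: symfun and c :: real
    have l: "linear (\<lambda>g. B f g + B f' g)" "linear (\<lambda>g. c *\<^sub>R B f g)"
      using linear_compose_add[OF B(1) B(1)] linear_compose_scale_right[OF B(1)] by blast+
    show "B (f + f') g = B f g + B f' g"
      by (rule graded_basis_linear_eq[OF graded_basis_h B(1) l(1)]) (simp add: B(2) sf_coeff_simps)
    show "B (c *\<^sub>R f) g = c *\<^sub>R B f g"
      by (rule graded_basis_linear_eq[OF graded_basis_h B(1) l(2)]) (simp add: B(2) sf_coeff_simps)
  qed
  then have bil: "bilinear B" using B(1) by (simp add: bilinear_def)
  have "\<exists>!B :: symfun \<Rightarrow> symfun \<Rightarrow> real. bilinear B \<and>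
    (\<forall>\<nu> \<mu>. is_partition \<nu> \<longrightarrow> is_partition \<mu> \<longrightarrow> B (m_basis \<nu>) (h_basis \<mu>) = of_bool (\<nu> = \<mu>))"
  proof (rule ex1I)
    show "bilinear B \<and> (\<forall>\<nu> \<mu>. is_partition \<nu> \<longrightarrow> is_partition \<mu> \<longrightarrow> B (m_basis \<nu>) (h_basis \<mu>) = of_bool (\<nu> = \<mu>))"
      using bil by (simp add: B(2) sf_coeff_m_basis)
    fix B' :: "symfun \<Rightarrow> symfun \<Rightarrow> real" assume B': "bilinear B' \<and>
      (\<forall>\<nu> \<mu>. is_partition \<nu> \<longrightarrow> is_partition \<mu> \<longrightarrow> B' (m_basis \<nu>) (h_basis \<mu>) = of_bool (\<nu> = \<mu>))"
    have "B' f g = B f g" for f g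
    proof (rule bilinear_eq[of B' B UNIV "m_basis ` Collect is_partition" UNIV "h_basis ` Collect is_partition"])
      show "UNIV \<subseteq> span (h_basis ` Collect is_partition)"
        using graded_basis_h by (simp add: graded_basis_def)
    qed (use B' bil in \<open>auto simp: span_m_basis B(2) sf_coeff_m_basis\<close>)
    then show "B' = B" by (intro ext)
  qed
  then show ?thesis unfolding hall_def by (rule theI')
qed

lemma bilinear_hall: "bilinear hall"
  using hall_exists by blast

lemma linear_hall_left: "linear (\<lambda>f. hall f g)"
  using bilinear_hall by (simp add: bilinear_def)

lemma linear_hall_right: "linear (hall f)"
  using bilinear_hall by (simp add: bilinear_def)

lemma hall_h_basis: "is_partition \<mu> \<Longrightarrow> hall f (h_basis \<mu>) = sf_coeff f \<mu>"
  by (rule graded_basis_linear_eq[where \<phi> = "\<lambda>f. hall f (h_basis \<mu>)" and \<psi> = "\<lambda>f. sf_coeff f \<mu>",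
        OF graded_basis_m linear_hall_left linear_sf_coeff])
     (use hall_exists in \<open>simp add: sf_coeff_m_basis\<close>)

section \<open>Coefficients of products as numbers of integer matrices\<close>

definition families :: "nat set \<Rightarrow> (nat \<Rightarrow>\<^sub>0 nat) \<Rightarrow> (nat \<Rightarrow> nat \<Rightarrow>\<^sub>0 nat) set"
  where "families I \<alpha> = {\<beta>. (\<forall>i. i \<notin> I \<longrightarrow> \<beta> i = 0) \<and> (\<Sum>i\<in>I. \<beta> i) = \<alpha>}"

lemma sf_coeff_prod_families:
  assumes "finite I"
  shows "finite (families I \<alpha>) \<and>
    sf_coeff (\<Prod>i\<in>I. g i) \<alpha> = (\<Sum>\<beta>\<in>families I \<alpha>. \<Prod>i\<in>I. sf_coeff (g i) (\<beta> i))"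
  using assms
proof (induction I arbitrary: \<alpha> rule: finite_induct)
  case empty
  have "families {} \<alpha> = (if \<alpha> = 0 then {\<lambda>_. 0} else {})" by (auto simp: families_def)
  then show ?case by (simp add: one_symfun.rep_eq)
next
  case (insert a I)
  let ?S = "Sigma (splits \<alpha>) (\<lambda>p. families I (snd p))"
  let ?h = "\<lambda>((\<beta>, \<gamma>), \<delta>). \<delta>(a := \<beta>)"
  have fin: "finite ?S" using insert.IH finite_splits by (intro finite_SigmaI) auto
  have bij: "bij_betw ?h ?S (families (insert a I) \<alpha>)"
  proof (rule bij_betw_byWitness[where f' = "\<lambda>\<delta>. ((\<delta> a, \<Sum>i\<in>I. \<delta> i), \<delta>(a := 0))"])
    have upd: "(\<Sum>i\<in>I. (\<delta>(a := \<beta>)) i) = (\<Sum>i\<in>I. \<delta> i)" for \<delta> :: "nat \<Rightarrow> nat \<Rightarrow>\<^sub>0 nat" and \<beta>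
      by (rule sum.cong) (use insert.hyps in auto)
    show "\<forall>p\<in>?S. ((?h p a, \<Sum>i\<in>I. ?h p i), (?h p)(a := 0)) = p"
    proof
      fix p assume p: "p \<in> ?S"
      obtain \<beta> \<gamma> \<delta> where pe: "p = ((\<beta>, \<gamma>), \<delta>)" by (metis surj_pair)
      have \<delta>: "\<delta> a = 0" "(\<Sum>i\<in>I. \<delta> i) = \<gamma>" using p insert.hyps by (auto simp: pe families_def)
      have "\<delta>(a := 0) = \<delta>" using \<delta>(1) by auto
      then show "((?h p a, \<Sum>i\<in>I. ?h p i), (?h p)(a := 0)) = p" using \<delta>(2) upd by (simp add: pe)
    qed
    show "\<forall>\<delta>\<in>families (insert a I) \<alpha>. ?h ((\<delta> a, \<Sum>i\<in>I. \<delta> i), \<delta>(a := 0)) = \<delta>" by auto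
    show "?h ` ?S \<subseteq> families (insert a I) \<alpha>"
      using insert.hyps upd by (auto simp: families_def splits_def)
    show "(\<lambda>\<delta>. ((\<delta> a, \<Sum>i\<in>I. \<delta> i), \<delta>(a := 0))) ` families (insert a I) \<alpha> \<subseteq> ?S"
      using insert.hyps upd by (auto simp: families_def splits_def)
  qed
  have "sf_coeff (\<Prod>i\<in>insert a I. g i) \<alpha>
      = (\<Sum>p\<in>splits \<alpha>. \<Sum>\<delta>\<in>families I (snd p). sf_coeff (g a) (fst p) * (\<Prod>i\<in>I. sf_coeff (g i) (\<delta> i)))"
    using insert by (simp add: times_symfun.rep_eq case_prod_unfold sum_distrib_left)
  also have "\<dots> = (\<Sum>(p, \<delta>)\<in>?S. sf_coeff (g a) (fst p) * (\<Prod>i\<in>I. sf_coeff (g i) (\<delta> i)))"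
    using insert.IH finite_splits by (intro sum.Sigma) auto
  also have "\<dots> = (\<Sum>p\<in>?S. \<Prod>i\<in>insert a I. sf_coeff (g i) (?h p i))"
  proof (rule sum.cong[OF refl])
    fix p assume "p \<in> ?S"
    obtain \<beta> \<gamma> \<delta> where pe: "p = ((\<beta>, \<gamma>), \<delta>)" by (metis surj_pair)
    have "(\<Prod>i\<in>I. sf_coeff (g i) (\<delta> i)) = (\<Prod>i\<in>I. sf_coeff (g i) ((\<delta>(a := \<beta>)) i))"
      by (rule prod.cong) (use insert.hyps in auto)
    then show "(case p of (p, \<delta>) \<Rightarrow> sf_coeff (g a) (fst p) * (\<Prod>i\<in>I. sf_coeff (g i) (\<delta> i)))
        = (\<Prod>i\<in>insert a I. sf_coeff (g i) (?h p i))"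
      using insert.hyps by (simp add: pe)
  qed
  also have "\<dots> = (\<Sum>\<beta>\<in>families (insert a I) \<alpha>. \<Prod>i\<in>insert a I. sf_coeff (g i) (\<beta> i))"
    by (rule sum.reindex_bij_betw[OF bij])
  finally show ?case using fin bij bij_betw_finite by blast
qed

text \<open>Matrices with row sums \<mu> and column sums \<nu>; row i is the exponent vector taken
  from the i-th factor of a product. All entries are allowed for h and only 0 and 1 for e, and
  transposition gives the symmetry of both families of coefficients.\<close>

definition matrices :: "(nat \<Rightarrow> bool) \<Rightarrow> (nat \<Rightarrow>\<^sub>0 nat) \<Rightarrow> (nat \<Rightarrow>\<^sub>0 nat) \<Rightarrow> (nat \<Rightarrow> nat \<Rightarrow> nat) set"
  where "matrices P \<mu> \<nu> = {M. (\<forall>i j. i \<notin> keys \<mu> \<or> j \<notin> keys \<nu> \<longrightarrow> M i j = 0)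
    \<and> (\<forall>i\<in>keys \<mu>. (\<Sum>j\<in>keys \<nu>. M i j) = lookup \<mu> i) \<and> (\<forall>j\<in>keys \<nu>. (\<Sum>i\<in>keys \<mu>. M i j) = lookup \<nu> j)
    \<and> (\<forall>i j. P (M i j))}"

lemma card_matrices_transpose: "card (matrices P \<mu> \<nu>) = card (matrices P \<nu> \<mu>)"
  by (rule bij_betw_same_card[OF bij_betw_byWitness[of _ "\<lambda>M i j. M j i" "\<lambda>M i j. M j i"]])
     (auto simp: matrices_def)

lemma sf_coeff_prod_matrices:
  assumes g: "\<And>r \<alpha>. sf_coeff (g r) \<alpha> = of_bool (weight \<alpha> = r \<and> (\<forall>i. P (lookup \<alpha> i)))" and P0: "P 0"
  shows "sf_coeff (\<Prod>i\<in>keys \<mu>. g (lookup \<mu> i)) \<nu> = real (card (matrices P \<mu> \<nu>))"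
proof -
  let ?I = "keys \<mu>" and ?F = "families (keys \<mu>) \<nu>"
  let ?C = "\<lambda>\<beta>. \<forall>i\<in>?I. weight (\<beta> i) = lookup \<mu> i \<and> (\<forall>j. P (lookup (\<beta> i) j))"
  have fin: "finite ?F" by (rule conjunct1[OF sf_coeff_prod_families]) simp
  have "sf_coeff (\<Prod>i\<in>?I. g (lookup \<mu> i)) \<nu> = (\<Sum>\<beta>\<in>?F. of_bool (?C \<beta>))"
  proof -
    have "(\<Prod>i\<in>?I. of_bool (Q i)) = (of_bool (\<forall>i\<in>?I. Q i) :: real)" for Q
      by (cases "\<forall>i\<in>?I. Q i") auto
    then show ?thesis using sf_coeff_prod_families[where I = ?I and g = "\<lambda>i. g (lookup \<mu> i)" and \<alpha> = \<nu>] by (simp add: g)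
  qed
  also have "\<dots> = real (card {\<beta> \<in> ?F. ?C \<beta>})"
    using fin by (simp add: Collect_conj_eq)
  also have "card {\<beta> \<in> ?F. ?C \<beta>} = card (matrices P \<mu> \<nu>)"
  proof (rule bij_betw_same_card[OF bij_betw_byWitness[of _
        "\<lambda>M i. Abs_poly_mapping (M i)" "\<lambda>\<beta> i j. lookup (\<beta> i) j"]])
    have keys: "keys (\<beta> i) \<subseteq> keys \<nu>" if "\<beta> \<in> ?F" for \<beta> i
    proof (cases "i \<in> ?I")
      case True
      have "lookup (\<beta> i) j \<le> (\<Sum>i\<in>?I. lookup (\<beta> i) j)" for j
        using True by (intro member_le_sum) auto
      moreover have "(\<Sum>i\<in>?I. lookup (\<beta> i) j) = lookup \<nu> j" for j
        using that by (auto simp: families_def simp flip: lookup_sum)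
      ultimately show ?thesis by (auto simp: in_keys_iff) (metis le_zero_eq neq0_conv)
    qed (use that in \<open>auto simp: families_def\<close>)
    have look: "lookup (Abs_poly_mapping (M i)) = M i" if "M \<in> matrices P \<mu> \<nu>" for M i
    proof -
      have z: "M i j = 0" if "j \<notin> keys \<nu>" for j
        using \<open>M \<in> matrices P \<mu> \<nu>\<close> that by (simp add: matrices_def)
      have "{j. M i j \<noteq> 0} \<subseteq> keys \<nu>"
      proof
        fix j assume "j \<in> {j. M i j \<noteq> 0}"
        then show "j \<in> keys \<nu>" using z[of j] by (cases "j \<in> keys \<nu>") simp_all
      qed
      then have "finite {j. M i j \<noteq> 0}" by (rule finite_subset) simp
      then show ?thesis by (simp add: Abs_poly_mapping_inverse)
    qed
    show "\<forall>\<beta>\<in>{\<beta> \<in> ?F. ?C \<beta>}. (\<lambda>i. Abs_poly_mapping (\<lambda>j. lookup (\<beta> i) j)) = \<beta>"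
      by (simp add: lookup_inverse)
    show "\<forall>M\<in>matrices P \<mu> \<nu>. (\<lambda>i j. lookup (Abs_poly_mapping (M i)) j) = M"
      by (simp add: look)
    show "(\<lambda>\<beta> i j. lookup (\<beta> i) j) ` {\<beta> \<in> ?F. ?C \<beta>} \<subseteq> matrices P \<mu> \<nu>"
    proof (rule image_subsetI)
      fix \<beta> assume \<beta>: "\<beta> \<in> {\<beta> \<in> ?F. ?C \<beta>}"
      have out: "\<beta> i = 0" if "i \<notin> ?I" for i using \<beta> that by (auto simp: families_def)
      have out2: "lookup (\<beta> i) j = 0" if "j \<notin> keys \<nu>" for i j
        using keys[of \<beta> i] \<beta> that by (auto simp: in_keys_iff subset_iff)
      have row: "(\<Sum>j\<in>keys \<nu>. lookup (\<beta> i) j) = lookup \<mu> i" if "i \<in> ?I" for i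
        using \<beta> that keys[of \<beta> i] weight_superset[of "keys \<nu>" "\<beta> i"] by auto
      have col: "(\<Sum>i\<in>?I. lookup (\<beta> i) j) = lookup \<nu> j" for j
        using \<beta> by (auto simp: families_def simp flip: lookup_sum)
      have "P (lookup (\<beta> i) j)" for i j
        using \<beta> out[of i] P0 by (cases "i \<in> ?I") auto
      then show "(\<lambda>i j. lookup (\<beta> i) j) \<in> matrices P \<mu> \<nu>"
        using out out2 row col by (auto simp: matrices_def)
    qed
    show "(\<lambda>M i. Abs_poly_mapping (M i)) ` matrices P \<mu> \<nu> \<subseteq> {\<beta> \<in> ?F. ?C \<beta>}"
    proof (rule image_subsetI)
      fix M assume M: "M \<in> matrices P \<mu> \<nu>"
      let ?\<beta> = "\<lambda>i. Abs_poly_mapping (M i)"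
      have "?\<beta> i = 0" if "i \<notin> ?I" for i
        using M that by (intro poly_mapping_eqI) (auto simp: look[OF M] matrices_def)
      moreover have "(\<Sum>i\<in>?I. ?\<beta> i) = \<nu>"
      proof (rule poly_mapping_eqI)
        fix j
        have "(\<Sum>i\<in>?I. M i j) = lookup \<nu> j"
          using M by (cases "j \<in> keys \<nu>") (auto simp: matrices_def in_keys_iff)
        then show "lookup (\<Sum>i\<in>?I. ?\<beta> i) j = lookup \<nu> j" by (simp add: lookup_sum look[OF M])
      qed
      moreover have "?C ?\<beta>"
      proof
        fix i assume i: "i \<in> ?I"
        have "M i j = 0" if "j \<notin> keys \<nu>" for j using M that by (auto simp: matrices_def)
        then have "keys (?\<beta> i) \<subseteq> keys \<nu>" by (metis in_keys_iff look[OF M] subsetI)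
        then have "weight (?\<beta> i) = (\<Sum>j\<in>keys \<nu>. M i j)"
          by (simp add: weight_superset[of "keys \<nu>"] look[OF M])
        then show "weight (?\<beta> i) = lookup \<mu> i \<and> (\<forall>j. P (lookup (?\<beta> i) j))"
          using M i by (auto simp: matrices_def look[OF M])
      qed
      ultimately show "?\<beta> \<in> {\<beta> \<in> ?F. ?C \<beta>}" by (auto simp: families_def)
    qed
  qed
  finally show ?thesis .
qed

lemma sf_coeff_h_basis_symmetric: "sf_coeff (h_basis \<mu>) \<nu> = sf_coeff (h_basis \<nu>) \<mu>"
  unfolding h_basis_def
  using sf_coeff_prod_matrices[of complete_sf "\<lambda>_. True"] card_matrices_transpose
  by (simp add: complete_sf.rep_eq)

lemma sf_coeff_e_basis_symmetric: "sf_coeff (e_basis \<mu>) \<nu> = sf_coeff (e_basis \<nu>) \<mu>"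
  unfolding e_basis_def
  using sf_coeff_prod_matrices[of elementary_sf "\<lambda>m. m \<le> 1"] card_matrices_transpose
  by (simp add: elementary_sf.rep_eq)

lemma bilinear_eq_h_basis:
  assumes "bilinear B" "bilinear B'"
    and "\<And>\<mu> \<nu>. is_partition \<mu> \<Longrightarrow> is_partition \<nu> \<Longrightarrow> B (h_basis \<mu>) (h_basis \<nu>) = B' (h_basis \<mu>) (h_basis \<nu>)"
  shows "B f g = B' f g"
proof -
  have h: "UNIV \<subseteq> span (h_basis ` Collect is_partition)"
    using graded_basis_h by (simp add: graded_basis_def)
  show ?thesis by (rule bilinear_eq[OF assms(1,2) h h]) (use assms(3) in auto)
qed

lemma hall_commute: "hall f g = hall g f"
proof (rule bilinear_eq_h_basis[of hall "\<lambda>f g. hall g f"])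
  show "bilinear (\<lambda>f g. hall g f)" using bilinear_hall by (simp add: bilinear_def)
qed (simp_all add: bilinear_hall hall_h_basis sf_coeff_h_basis_symmetric)

text \<open>On the h-functions both sides are coefficients of e-functions, and these are symmetric
  in the two labels as numbers of 0-1 matrices with given margins.\<close>

lemma hall_omega_left: "hall (omega f) g = hall f (omega g)"
proof (rule bilinear_eq_h_basis[of "\<lambda>f g. hall (omega f) g" "\<lambda>f g. hall f (omega g)"])
  show "bilinear (\<lambda>f g. hall (omega f) g)"
    using linear_compose[OF linear_omega linear_hall_left] linear_hall_right
    by (simp add: bilinear_def comp_def)
  show "bilinear (\<lambda>f g. hall f (omega g))"
    using linear_compose[OF linear_omega linear_hall_right] linear_hall_left
    by (simp add: bilinear_def comp_def)
  fix \<mu> \<nu> assume p: "is_partition \<mu>" "is_partition \<nu>"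
  have "hall (omega (h_basis \<mu>)) (h_basis \<nu>) = sf_coeff (e_basis \<nu>) \<mu>"
    using p by (simp add: omega_h_basis hall_h_basis sf_coeff_e_basis_symmetric)
  also have "\<dots> = hall (h_basis \<mu>) (omega (h_basis \<nu>))"
    using p hall_commute[of "h_basis \<mu>"] by (simp add: omega_h_basis hall_h_basis)
  finally show "hall (omega (h_basis \<mu>)) (h_basis \<nu>) = hall (h_basis \<mu>) (omega (h_basis \<nu>))" .
qed

lemma hall_omega_omega: "hall (omega f) (omega g) = hall f g"
  by (simp add: hall_omega_left omega_omega)

text \<open>The representing element has coefficient \<phi>(h_\<mu>) at m_\<mu>; confinement to one
  degree makes this a finite sum.\<close>

lemma hall_represent:
  assumes \<phi>: "linear \<phi>" and zero: "\<And>\<mu>. is_partition \<mu> \<Longrightarrow> weight \<mu> \<noteq> n \<Longrightarrow> \<phi> (h_basis \<mu>) = 0"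
  obtains f where "\<And>g. hall f g = \<phi> g"
proof -
  define f where "f = (\<Sum>\<mu>\<in>partitions_of n. \<phi> (h_basis \<mu>) *\<^sub>R m_basis \<mu>)"
  have "hall f g = \<phi> g" for g
  proof (rule graded_basis_linear_eq[OF graded_basis_h linear_hall_right \<phi>])
    fix \<nu> assume \<nu>: "is_partition \<nu>"
    have "hall f (h_basis \<nu>) = (\<Sum>\<mu>\<in>partitions_of n. if \<mu> = \<nu> then \<phi> (h_basis \<mu>) else 0)"
      unfolding hall_h_basis[OF \<nu>] f_def sf_coeff_sum sf_coeff_simps
      by (rule sum.cong) (auto simp: sf_coeff_m_basis \<nu> partitions_of_def)
    also have "\<dots> = \<phi> (h_basis \<nu>)"
      using zero[OF \<nu>] \<nu> finite_partitions_of[of n] by (auto simp: sum.delta' partitions_of_def)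
    finally show "hall f (h_basis \<nu>) = \<phi> (h_basis \<nu>)" .
  qed
  then show ?thesis by (rule that)
qed

lemma hall_nondegenerate:
  assumes b: "graded_basis b" and eq: "\<And>\<mu>. is_partition \<mu> \<Longrightarrow> hall f (b \<mu>) = hall g (b \<mu>)"
  shows "f = g"
proof (rule symfun_eqI_partitions)
  fix \<mu> assume "is_partition \<mu>"
  have "hall f h = hall g h" for h
    by (rule graded_basis_linear_eq[OF b linear_hall_right linear_hall_right eq])
  then show "sf_coeff f \<mu> = sf_coeff g \<mu>" using \<open>is_partition \<mu>\<close> by (metis hall_h_basis)
qed

text \<open>The coordinate functional of b_\<nu> is represented by an element through
  \<open>hall_represent\<close>, once it is known to vanish on h-functions of other degrees;
  nondegeneracy gives the uniqueness demanded by the definite description.\<close>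

lemma hall_dual_basis:
  assumes b: "graded_basis b" and \<nu>: "is_partition \<nu>" and \<mu>: "is_partition \<mu>"
  shows "hall (dual_basis b \<nu>) (b \<mu>) = of_bool (\<nu> = \<mu>)"
proof -
  obtain \<phi> :: "symfun \<Rightarrow> real" where \<phi>: "linear \<phi>" "\<And>\<mu>. is_partition \<mu> \<Longrightarrow> \<phi> (b \<mu>) = of_bool (\<nu> = \<mu>)"
    using graded_basis_extend[OF b, of "\<lambda>\<mu>. of_bool (\<nu> = \<mu>)"] by blast
  have "\<phi> (h_basis \<kappa>) = 0" if \<kappa>: "is_partition \<kappa>" "weight \<kappa> \<noteq> weight \<nu>" for \<kappa>
  proof -
    \<comment> \<open>Projection onto the degree of \<nu>. By homogeneity of the basis, composing
      \<phi> with it does not change \<phi>, while it kills h_\<kappa> of any other degree.\<close>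
    let ?p = "\<lambda>g. \<Sum>\<mu>\<in>partitions_of (weight \<nu>). sf_coeff g \<mu> *\<^sub>R m_basis \<mu>"
    have lin: "linear ?p"
      by (rule linearI) (simp_all add: sf_coeff_simps scaleR_left_distrib sum.distrib scaleR_sum_right)
    have "(\<lambda>g. \<phi> (?p g)) g = \<phi> g" for g
    proof (rule graded_basis_linear_eq[OF b])
      show "linear (\<lambda>g. \<phi> (?p g))" using linear_compose[OF lin \<phi>(1)] by (simp add: comp_def)
      show "linear \<phi>" by (rule \<phi>(1))
      fix \<mu> assume \<mu>: "is_partition \<mu>"
      note hom = graded_basis_homogeneous[OF b \<mu>]
      show "\<phi> (?p (b \<mu>)) = \<phi> (b \<mu>)"
      proof (cases "weight \<mu> = weight \<nu>")
        case True
        then show ?thesis using homogeneous_expansion[OF hom] by simp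
      next
        case False
        then have "?p (b \<mu>) = 0"
          using hom by (intro sum.neutral) (auto simp: homogeneous_def partitions_of_def)
        moreover have "\<phi> (b \<mu>) = 0" using False \<phi>(2)[OF \<mu>] by auto
        ultimately show ?thesis using linear_0[OF \<phi>(1)] by simp
      qed
    qed
    moreover have "?p (h_basis \<kappa>) = 0"
      using homogeneous_h_basis[of \<kappa>] \<kappa> by (intro sum.neutral) (auto simp: homogeneous_def partitions_of_def)
    ultimately show ?thesis using linear_0[OF \<phi>(1)] by metis
  qed
  then obtain f where f: "\<And>g. hall f g = \<phi> g" using hall_represent[OF \<phi>(1)] by blast
  have "\<exists>!f. \<forall>\<mu>. is_partition \<mu> \<longrightarrow> hall f (b \<mu>) = of_bool (\<nu> = \<mu>)"
    using f \<phi>(2) hall_nondegenerate[OF b] by (intro ex1I[of _ f]) auto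
  then have "\<forall>\<mu>. is_partition \<mu> \<longrightarrow> hall (dual_basis b \<nu>) (b \<mu>) = of_bool (\<nu> = \<mu>)"
    unfolding dual_basis_def by (rule theI')
  then show ?thesis using \<mu> by blast
qed

lemma dual_basis_eqI:
  assumes b: "\<And>f g. (\<And>\<mu>. is_partition \<mu> \<Longrightarrow> hall f (b \<mu>) = hall g (b \<mu>)) \<Longrightarrow> f = g"
    and f: "\<And>\<mu>. is_partition \<mu> \<Longrightarrow> hall f (b \<mu>) = of_bool (\<nu> = \<mu>)"
  shows "dual_basis b \<nu> = f"
  unfolding dual_basis_def by (rule the_equality) (use b f in auto)

section \<open>Hall--Littlewood symmetric functions\<close>

lemma to_frac_add: "to_frac (p + r) = to_frac p + to_frac r"
  by (simp add: to_frac_def)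

lemma to_frac_mult: "to_frac (p * r) = to_frac p * to_frac r"
  by (simp add: to_frac_def)

lemma to_frac_0 [simp]: "to_frac 0 = 0"
  by (simp add: to_frac_def Zero_fract_def)

lemma to_frac_1 [simp]: "to_frac 1 = 1"
  by (simp add: to_frac_def One_fract_def)

lemma to_frac_eq_iff [simp]: "to_frac p = to_frac r \<longleftrightarrow> p = r"
  by (simp add: to_frac_def eq_fract)

lemma to_frac_sum: "to_frac (\<Sum>i\<in>I. f i) = (\<Sum>i\<in>I. to_frac (f i))"
  by (induction I rule: infinite_finite_induct) (simp_all add: to_frac_add)

lemma hl_field_frac:
  assumes "q > 1"
  shows "hl_field var_frac const_frac q"
proof
  show "inj var_frac"
  proof (rule injI)
    fix i j assume "var_frac i = var_frac j"
    then have "Poly_Mapping.single (Poly_Mapping.single i (1::nat)) (1::real)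
        = Poly_Mapping.single (Poly_Mapping.single j 1) 1" by (simp add: var_frac_def)
    then have "Poly_Mapping.single i (1::nat) = Poly_Mapping.single j 1"
      by (metis keys_single singleton_inject zero_neq_one)
    then show "i = j" by (metis keys_single singleton_inject zero_neq_one)
  qed
  show "var_frac i \<noteq> 0" for i
    unfolding var_frac_def to_frac_0[symmetric] to_frac_eq_iff by (metis lookup_single_eq lookup_zero zero_neq_one)
  show "const_frac (a + b) = const_frac a + const_frac b" for a b
    by (simp add: const_frac_def single_add to_frac_add)
  show "const_frac (a * b) = const_frac a * const_frac b" for a b
    by (simp add: const_frac_def mult_single flip: to_frac_mult)
  show "const_frac 1 = 1"
    unfolding const_frac_def by (metis single_one to_frac_1)
qed (rule assms)

lemma lookup_mult_splits:
  fixes p r :: mpoly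
  shows "lookup (p * r) \<alpha> = (\<Sum>(\<beta>, \<gamma>)\<in>splits \<alpha>. lookup p \<beta> * lookup r \<gamma>)"
proof -
  let ?A = "fst ` splits \<alpha>"
  have fin: "finite ?A" by (simp add: finite_splits)
  have inner: "(\<Sum>\<gamma>. lookup r \<gamma> when \<alpha> = \<beta> + \<gamma>) = (if \<beta> \<in> ?A then lookup r (\<alpha> - \<beta>) else 0)" for \<beta>
  proof (cases "\<beta> \<in> ?A")
    case True
    then obtain \<gamma>0 where g: "\<alpha> = \<beta> + \<gamma>0" by (auto simp: splits_def)
    have "(\<Sum>\<gamma>. lookup r \<gamma> when \<alpha> = \<beta> + \<gamma>) = (\<Sum>\<gamma>. lookup r \<gamma> when \<gamma> = \<gamma>0)"
      using g by (intro Sum_any.cong) (auto simp: when_def)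
    then show ?thesis using True g by simp
  next
    case False
    then have z: "(\<lambda>\<gamma>. lookup r \<gamma> when \<alpha> = \<beta> + \<gamma>) = (\<lambda>_. 0)"
      by (force simp: when_def splits_def image_iff)
    show ?thesis unfolding z using False by simp
  qed
  have "lookup (p * r) \<alpha> = (\<Sum>\<beta>. lookup p \<beta> * (if \<beta> \<in> ?A then lookup r (\<alpha> - \<beta>) else 0))"
    by (simp add: lookup_mult inner)
  also have "\<dots> = (\<Sum>\<beta>\<in>?A. lookup p \<beta> * (if \<beta> \<in> ?A then lookup r (\<alpha> - \<beta>) else 0))"
    by (rule Sum_any.expand_superset[OF fin]) (auto split: if_splits)
  also have "\<dots> = (\<Sum>(\<beta>, \<gamma>)\<in>splits \<alpha>. lookup p \<beta> * lookup r \<gamma>)"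
    by (rule sum.reindex_bij_witness[of _ fst "\<lambda>\<beta>. (\<beta>, \<alpha> - \<beta>)"]) (auto simp: splits_def)
  finally show ?thesis .
qed

lemma restrict_vars_mult: "restrict_vars N (f * g) = restrict_vars N f * restrict_vars N g"
proof (rule poly_mapping_eqI)
  fix \<alpha>
  have "lookup (restrict_vars N f * restrict_vars N g) \<alpha> = (\<Sum>p\<in>splits \<alpha>.
      if keys \<alpha> \<subseteq> {..<N} then sf_coeff f (fst p) * sf_coeff g (snd p) else 0)"
    unfolding lookup_mult_splits
  proof (rule sum.cong[OF refl])
    fix p assume "p \<in> splits \<alpha>"
    then have "fst p + snd p = \<alpha>" by (auto simp: splits_def)
    then have "keys \<alpha> = keys (fst p) \<union> keys (snd p)"
      by (auto simp: in_keys_iff lookup_add)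
    then show "(case p of (\<beta>, \<gamma>) \<Rightarrow> lookup (restrict_vars N f) \<beta> * lookup (restrict_vars N g) \<gamma>)
        = (if keys \<alpha> \<subseteq> {..<N} then sf_coeff f (fst p) * sf_coeff g (snd p) else 0)"
      by (simp add: case_prod_unfold restrict_vars.rep_eq)
  qed
  then show "lookup (restrict_vars N (f * g)) \<alpha> = lookup (restrict_vars N f * restrict_vars N g) \<alpha>"
    by (simp add: restrict_vars.rep_eq times_symfun.rep_eq case_prod_unfold)
qed

lemma restrict_vars_add: "restrict_vars N (f + g) = restrict_vars N f + restrict_vars N g"
  by (rule poly_mapping_eqI) (simp add: restrict_vars.rep_eq lookup_add sf_coeff_simps)

lemma restrict_vars_0: "restrict_vars N 0 = 0"
  by (rule poly_mapping_eqI) (simp add: restrict_vars.rep_eq sf_coeff_simps)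

lemma restrict_vars_1: "restrict_vars N 1 = 1"
  by (rule poly_mapping_eqI)
     (auto simp: restrict_vars.rep_eq one_symfun.rep_eq lookup_one when_def)

lemma restrict_vars_sum: "restrict_vars N (\<Sum>i\<in>I. f i) = (\<Sum>i\<in>I. restrict_vars N (f i))"
  by (induction I rule: infinite_finite_induct) (simp_all add: restrict_vars_add restrict_vars_0)

lemma to_frac_restrict_scaleR: "to_frac (restrict_vars N (c *\<^sub>R f)) = const_frac c * to_frac (restrict_vars N f)"
proof -
  have "restrict_vars N (c *\<^sub>R f) = Poly_Mapping.single 0 c * restrict_vars N f"
  proof (rule poly_mapping_eqI)
    fix \<alpha>
    have "lookup (Poly_Mapping.single 0 c * restrict_vars N f) \<alpha>
        = (\<Sum>(\<beta>, \<gamma>)\<in>{(0 :: nat \<Rightarrow>\<^sub>0 nat, \<alpha>)}. lookup (Poly_Mapping.single 0 c) \<beta> * lookup (restrict_vars N f) \<gamma>)"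
      unfolding lookup_mult_splits
      by (rule sum.mono_neutral_right[OF finite_splits])
         (auto simp: splits_def lookup_single when_def split: if_splits)
    then show "lookup (restrict_vars N (c *\<^sub>R f)) \<alpha> = lookup (Poly_Mapping.single 0 c * restrict_vars N f) \<alpha>"
      by (simp add: restrict_vars.rep_eq sf_coeff_simps)
  qed
  then show ?thesis by (simp add: const_frac_def to_frac_mult)
qed

lemma to_frac_single_indicator:
  "finite B \<Longrightarrow> to_frac (Poly_Mapping.single (pm_indicator B) 1) = (\<Prod>i\<in>B. var_frac i)"
proof (induction B rule: finite_induct)
  case empty
  have "pm_indicator {} = 0" by (rule poly_mapping_eqI) simp
  then show ?case by simp
next
  case (insert a B)
  have "pm_indicator (insert a B) = Poly_Mapping.single a 1 + pm_indicator B"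
    using insert by (intro poly_mapping_eqI) (auto simp: lookup_add lookup_single when_def)
  then have "Poly_Mapping.single (pm_indicator (insert a B)) (1::real)
      = Poly_Mapping.single (Poly_Mapping.single a 1) 1 * Poly_Mapping.single (pm_indicator B) 1"
    by (simp add: mult_single)
  then show ?case using insert by (simp add: to_frac_mult var_frac_def)
qed

lemma to_frac_restrict_elementary:
  "to_frac (restrict_vars N (elementary_sf r)) = elem_sum var_frac {..<N} r"
proof -
  let ?S = "{B. B \<subseteq> {..<N} \<and> card B = r}"
  have finB: "finite B" if "B \<in> ?S" for B using that finite_subset by auto
  have finS: "finite ?S" by (rule finite_subsets_card) simp
  have "restrict_vars N (elementary_sf r) = (\<Sum>B\<in>?S. Poly_Mapping.single (pm_indicator B) 1)"
  proof (rule poly_mapping_eqI)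
    fix \<alpha>
    have iff: "pm_indicator B = \<alpha> \<longleftrightarrow> B = keys \<alpha> \<and> (\<forall>i. lookup \<alpha> i \<le> 1)" if "finite B" for B
    proof
      assume "pm_indicator B = \<alpha>"
      then show "B = keys \<alpha> \<and> (\<forall>i. lookup \<alpha> i \<le> 1)"
        using keys_pm_indicator[OF that] lookup_pm_indicator[OF that] by auto
    next
      assume *: "B = keys \<alpha> \<and> (\<forall>i. lookup \<alpha> i \<le> 1)"
      show "pm_indicator B = \<alpha>"
      proof (rule poly_mapping_eqI)
        fix i
        have "lookup \<alpha> i \<le> 1" using * by blast
        then show "lookup (pm_indicator B) i = lookup \<alpha> i"
          using * that by (cases "lookup \<alpha> i") (auto simp: in_keys_iff)
      qed
    qed
    have "lookup (\<Sum>B\<in>?S. Poly_Mapping.single (pm_indicator B) (1::real)) \<alpha>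
        = (\<Sum>B\<in>?S. if B = keys \<alpha> then of_bool (\<forall>i. lookup \<alpha> i \<le> 1) else 0)"
      unfolding lookup_sum using finB iff by (intro sum.cong) (auto simp: lookup_single when_def)
    also have "\<dots> = of_bool (keys \<alpha> \<in> ?S \<and> (\<forall>i. lookup \<alpha> i \<le> 1))"
      by (simp only: sum.delta[OF finS] of_bool_conj mult_1 mult_zero_left split: if_split) auto
    also have "\<dots> = of_bool (keys \<alpha> \<subseteq> {..<N} \<and> weight \<alpha> = r \<and> (\<forall>i. lookup \<alpha> i \<le> 1))"
    proof (cases "\<forall>i. lookup \<alpha> i \<le> 1")
      case True
      have "weight \<alpha> = (\<Sum>i\<in>keys \<alpha>. 1)"
        unfolding weight_def
      proof (rule sum.cong[OF refl])
        fix i assume "i \<in> keys \<alpha>"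
        then show "lookup \<alpha> i = 1" using True[rule_format, of i] by (auto simp: in_keys_iff)
      qed
      then have "weight \<alpha> = card (keys \<alpha>)" by simp
      then show ?thesis by (simp only: mem_Collect_eq conj_assoc)
    next
      case False
      then show ?thesis by (simp only: simp_thms)
    qed
    also have "\<dots> = lookup (restrict_vars N (elementary_sf r)) \<alpha>"
      by (simp add: restrict_vars.rep_eq elementary_sf.rep_eq)
    finally show "lookup (restrict_vars N (elementary_sf r)) \<alpha>
        = lookup (\<Sum>B\<in>?S. Poly_Mapping.single (pm_indicator B) 1) \<alpha>" ..
  qed
  then have "to_frac (restrict_vars N (elementary_sf r)) = (\<Sum>B\<in>?S. to_frac (Poly_Mapping.single (pm_indicator B) 1))"
    by (simp only: to_frac_sum)
  also have "\<dots> = elem_sum var_frac {..<N} r"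
    unfolding elem_sum_def by (rule sum.cong[OF refl]) (rule to_frac_single_indicator[OF finB])
  finally show ?thesis .
qed

lemma restrict_vars_eqI:
  assumes "\<And>N. m \<le> N \<Longrightarrow> restrict_vars N f = restrict_vars N g"
  shows "f = g"
proof (rule symfun_eqI)
  fix \<alpha> :: "nat \<Rightarrow>\<^sub>0 nat"
  obtain n where n: "keys \<alpha> \<subseteq> {..<n}" using finite_nat_bounded[OF finite_keys[of \<alpha>]] by blast
  then have "keys \<alpha> \<subseteq> {..<max m n}" by auto
  then show "sf_coeff f \<alpha> = sf_coeff g \<alpha>"
    using arg_cong[OF assms[of "max m n"], of "\<lambda>p. lookup p \<alpha>"] by (simp add: restrict_vars.rep_eq)
qed

section \<open>Lifting Hall--Littlewood polynomials to symmetric functions\<close>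

definition hl_poly :: "real \<Rightarrow> nat \<Rightarrow> (nat \<Rightarrow>\<^sub>0 nat) \<Rightarrow> mpoly fract"
  where "hl_poly q N \<mu> = hl_field.hl_sum var_frac const_frac q {..<N} \<mu>"

lemma hl_poly_pieri:
  assumes "q > 1"
  shows "to_frac (restrict_vars N (elementary_sf r)) * hl_poly q N \<nu>
    = (\<Sum>\<mu>\<in>partitions_of (weight \<nu> + r). const_frac (pieri q \<mu> \<nu>) * hl_poly q N \<mu>)"
  unfolding to_frac_restrict_elementary hl_poly_def
  by (rule hl_field.hl_sum_pieri[OF hl_field_frac[OF assms]]) simp

lemma hl_poly_0:
  assumes "q > 1"
  shows "hl_poly q N 0 = 1"
proof -
  interpret hl_field var_frac const_frac q by (rule hl_field_frac[OF assms])
  have "\<alpha> = 0" if "conjugate \<alpha> = 0" for \<alpha>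
    using that weight_conjugate[of \<alpha>] by simp
  moreover have "conjugate 0 = 0" using weight_conjugate[of 0] by (metis weight_eq_0)
  ultimately have "exponents {..<N} 0 = {0}" by (auto simp: exponents_def)
  then show ?thesis by (simp add: hl_poly_def hl_sum_def hl_weight_def)
qed

text \<open>The condition ranges over all N, also below the number of parts, where
  \<open>hl_poly\<close> is an empty sum. This uniformity lets the Pieri rule be used for every
  number of variables at once.\<close>

definition represents_hl :: "real \<Rightarrow> symfun \<Rightarrow> (nat \<Rightarrow>\<^sub>0 nat) \<Rightarrow> bool"
  where "represents_hl q f \<mu> \<longleftrightarrow> homogeneous (weight \<mu>) f \<and> (\<forall>N. to_frac (restrict_vars N f) = hl_poly q N \<mu>)"

text \<open>
  The Pieri rule for \<open>e_r P_\<nu>\<close> with \<open>r = \<mu>_0\<close> and \<open>\<nu> = (\<mu>_1, \<mu>_2, ...)\<close> expresses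
  \<open>P_\<mu>\<close> through \<open>P_\<nu>\<close> and functions \<open>P_\<kappa>\<close> with \<open>\<kappa>_0 > \<mu>_0\<close>.
\<close>

lemma represents_hl_exists:
  assumes q: "q > 1"
  shows "is_partition \<mu> \<Longrightarrow> \<exists>f. represents_hl q f \<mu>"
proof (induction \<mu> rule: wf_induct_rule[OF wf_inv_image[OF wf_lex_prod[OF wf_less_than wf_less_than],
        of "\<lambda>\<mu>. (weight \<mu>, weight \<mu> - lookup \<mu> 0)"]])
  case (1 \<mu>)
  show ?case
  proof (cases "\<mu> = 0")
    case True
    have "represents_hl q 1 0"
      using hl_poly_0[OF q] by (simp add: represents_hl_def restrict_vars_1 homogeneous_def one_symfun.rep_eq)
    then show ?thesis using True by blast
  next
    case False
    let ?r = "lookup \<mu> 0" and ?\<nu> = "pm_tail \<mu>"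
    let ?P = "partitions_of (weight ?\<nu> + ?r)"
    have pos: "?r > 0"
    proof (rule ccontr)
      assume "\<not> ?r > 0"
      then have "lookup \<mu> i = 0" for i using is_partitionD[OF 1(2), of 0 i] by simp
      then have "\<mu> = 0" by (intro poly_mapping_eqI) simp
      then show False using False by simp
    qed
    have w: "weight ?\<nu> + ?r = weight \<mu>" using weight_pm_tail[of \<mu>] by simp
    let ?less = "inv_image (less_than <*lex*> less_than) (\<lambda>\<mu>. (weight \<mu>, weight \<mu> - lookup \<mu> 0))"
    have "weight ?\<nu> < weight \<mu>" using w pos by linarith
    then have "(?\<nu>, \<mu>) \<in> ?less" by (simp only: in_inv_image in_lex_prod less_than_iff simp_thms)
    then obtain g where g: "represents_hl q g ?\<nu>"
      using 1(1)[OF _ is_partition_pm_tail[OF 1(2)]] by blast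
    have "\<exists>f. represents_hl q f \<kappa>" if \<kappa>: "\<kappa> \<in> ?P - {\<mu>}" "pieri q \<kappa> ?\<nu> \<noteq> 0" for \<kappa>
    proof -
      have i: "interlaces \<kappa> ?\<nu>" using \<kappa>(2) by (auto simp: pieri_def split: if_splits)
      have wk: "weight \<kappa> = weight \<mu>" "is_partition \<kappa>" using \<kappa>(1) w by (auto simp: partitions_of_def)
      have "?r \<le> lookup \<kappa> 0" "lookup \<kappa> 0 \<noteq> ?r"
        using interlaces_pm_tail_first[OF i wk(1)] \<kappa>(1) by auto
      then have "weight \<kappa> - lookup \<kappa> 0 < weight \<mu> - ?r"
        using lookup_le_weight[of \<kappa> 0] wk(1) by linarith
      then have "(\<kappa>, \<mu>) \<in> ?less" using wk(1) by (simp only: in_inv_image in_lex_prod less_than_iff simp_thms)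
      then show ?thesis using 1(1)[OF _ wk(2)] by blast
    qed
    then obtain h where h: "\<And>\<kappa>. \<kappa> \<in> ?P - {\<mu>} \<Longrightarrow> pieri q \<kappa> ?\<nu> \<noteq> 0 \<Longrightarrow> represents_hl q (h \<kappa>) \<kappa>"
      by metis
    \<comment> \<open>The induction provides representatives only for labels whose Pieri coefficient
      is nonzero; the others get the value 0, which that coefficient multiplies away.\<close>
    define h' where "h' \<kappa> = (if pieri q \<kappa> ?\<nu> = 0 then 0 else h \<kappa>)" for \<kappa>
    let ?f = "elementary_sf ?r * g + (\<Sum>\<kappa>\<in>?P - {\<mu>}. (- pieri q \<kappa> ?\<nu>) *\<^sub>R h' \<kappa>)"
    have "represents_hl q ?f \<mu>"
      unfolding represents_hl_def
    proof
      have "homogeneous (?r + weight ?\<nu>) (elementary_sf ?r * g)"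
        using g by (intro homogeneous_mult homogeneous_elementary) (simp add: represents_hl_def)
      moreover have "homogeneous (weight \<mu>) (h' \<kappa>)" if "\<kappa> \<in> ?P - {\<mu>}" for \<kappa>
        using h[OF that] that w by (auto simp: h'_def homogeneous_0 represents_hl_def partitions_of_def)
      ultimately show "homogeneous (weight \<mu>) ?f"
        using w by (intro homogeneous_add homogeneous_sum homogeneous_scaleR) (auto simp: add.commute)
      show "\<forall>N. to_frac (restrict_vars N ?f) = hl_poly q N \<mu>"
      proof
        fix N
        have inter: "const_frac (pieri q \<mu> ?\<nu>) = 1"
          using pieri_pm_tail[of q \<mu>] q 1(2) hl_field.emb_1[OF hl_field_frac[OF q]] by simp
        have neg: "const_frac (- c) = - const_frac c" for c
          using hl_field.emb_diff[OF hl_field_frac[OF q], of 0 c] hl_field.emb_0[OF hl_field_frac[OF q]] by simp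
        have "to_frac (restrict_vars N (elementary_sf ?r)) * hl_poly q N ?\<nu>
            = hl_poly q N \<mu> + (\<Sum>\<kappa>\<in>?P - {\<mu>}. const_frac (pieri q \<kappa> ?\<nu>) * hl_poly q N \<kappa>)"
          unfolding hl_poly_pieri[OF q]
          using finite_partitions_of 1(2) w inter
          by (subst sum.remove[of _ \<mu>]) (auto simp: partitions_of_def)
        moreover have "to_frac (restrict_vars N ((- pieri q \<kappa> ?\<nu>) *\<^sub>R h' \<kappa>))
            = - (const_frac (pieri q \<kappa> ?\<nu>) * hl_poly q N \<kappa>)" if "\<kappa> \<in> ?P - {\<mu>}" for \<kappa>
          unfolding to_frac_restrict_scaleR neg
          using h[OF that] hl_field.emb_0[OF hl_field_frac[OF q]]
          by (auto simp: h'_def represents_hl_def)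
        then have "(\<Sum>\<kappa>\<in>?P - {\<mu>}. to_frac (restrict_vars N ((- pieri q \<kappa> ?\<nu>) *\<^sub>R h' \<kappa>)))
            = - (\<Sum>\<kappa>\<in>?P - {\<mu>}. const_frac (pieri q \<kappa> ?\<nu>) * hl_poly q N \<kappa>)"
          unfolding sum_negf[symmetric] by (rule sum.cong[OF refl])
        moreover have "to_frac (restrict_vars N g) = hl_poly q N ?\<nu>"
          using g by (simp add: represents_hl_def)
        ultimately show "to_frac (restrict_vars N ?f) = hl_poly q N \<mu>"
          by (simp only: restrict_vars_add restrict_vars_mult restrict_vars_sum to_frac_add
              to_frac_mult to_frac_sum) simp
      qed
    qed
    then show ?thesis by blast
  qed
qed

text \<open>The function \<open>P_\<kappa>(x;q)\<close>, where \<open>\<mu>\<close> is the conjugate of \<open>\<kappa>\<close>.\<close>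

definition hl_symfun :: "real \<Rightarrow> (nat \<Rightarrow>\<^sub>0 nat) \<Rightarrow> symfun"
  where "hl_symfun q \<mu> = (SOME f. represents_hl q f \<mu>)"

lemma represents_hl_symfun: "q > 1 \<Longrightarrow> is_partition \<mu> \<Longrightarrow> represents_hl q (hl_symfun q \<mu>) \<mu>"
  unfolding hl_symfun_def by (rule someI_ex) (rule represents_hl_exists)

lemma hl_finite_eq_hl_poly:
  assumes "q > 1" "is_partition \<kappa>" "num_parts \<kappa> \<le> N"
  shows "hl_finite N \<kappa> q = hl_poly q N (conjugate \<kappa>)"
  unfolding hl_finite_def hl_poly_def
  by (rule hl_field.symmetrization_eq_hl_sum[OF hl_field_frac[OF assms(1)] assms(2,3)])

text \<open>Uniqueness holds because every exponent vector has finite support: its coefficient is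
  visible in all sufficiently large numbers of variables.\<close>

lemma hall_littlewood_P_eq:
  assumes q: "q > 1" and \<kappa>: "is_partition \<kappa>"
  shows "hall_littlewood_P \<kappa> q = hl_symfun q (conjugate \<kappa>)"
  unfolding hall_littlewood_P_def
proof (rule the_equality)
  have rep: "to_frac (restrict_vars N (hl_symfun q (conjugate \<kappa>))) = hl_finite N \<kappa> q"
    if "num_parts \<kappa> \<le> N" for N
    using represents_hl_symfun[OF q, of "conjugate \<kappa>"] hl_finite_eq_hl_poly[OF q \<kappa> that]
    by (simp add: represents_hl_def)
  then show "\<forall>N\<ge>num_parts \<kappa>. to_frac (restrict_vars N (hl_symfun q (conjugate \<kappa>))) = hl_finite N \<kappa> q"
    by blast
  fix f assume f: "\<forall>N\<ge>num_parts \<kappa>. to_frac (restrict_vars N f) = hl_finite N \<kappa> q"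
  show "f = hl_symfun q (conjugate \<kappa>)"
  proof (rule restrict_vars_eqI)
    fix N assume "num_parts \<kappa> \<le> N"
    then show "restrict_vars N f = restrict_vars N (hl_symfun q (conjugate \<kappa>))"
      using f rep[of N] to_frac_eq_iff by metis
  qed
qed

lemma hl_symfun_0: "q > 1 \<Longrightarrow> hl_symfun q 0 = 1"
proof (rule restrict_vars_eqI[of 0])
  fix N assume q: "q > 1"
  have "to_frac (restrict_vars N (hl_symfun q 0)) = to_frac (restrict_vars N 1)"
    using represents_hl_symfun[OF q is_partition_0] hl_poly_0[OF q] by (simp add: represents_hl_def restrict_vars_1)
  then show "restrict_vars N (hl_symfun q 0) = restrict_vars N 1" by simp
qed

lemma hl_symfun_pieri:
  assumes q: "q > 1" and \<nu>: "is_partition \<nu>"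
  shows "elementary_sf r * hl_symfun q \<nu>
    = (\<Sum>\<mu>\<in>partitions_of (weight \<nu> + r). pieri q \<mu> \<nu> *\<^sub>R hl_symfun q \<mu>)"
proof (rule restrict_vars_eqI[of 0])
  fix N
  have rep: "to_frac (restrict_vars N (hl_symfun q \<mu>)) = hl_poly q N \<mu>" if "is_partition \<mu>" for \<mu>
    using represents_hl_symfun[OF q that] by (simp add: represents_hl_def)
  have "to_frac (restrict_vars N (elementary_sf r * hl_symfun q \<nu>))
      = (\<Sum>\<mu>\<in>partitions_of (weight \<nu> + r). const_frac (pieri q \<mu> \<nu>) * hl_poly q N \<mu>)"
    by (simp add: restrict_vars_mult to_frac_mult rep[OF \<nu>] hl_poly_pieri[OF q])
  also have "\<dots> = to_frac (restrict_vars N (\<Sum>\<mu>\<in>partitions_of (weight \<nu> + r). pieri q \<mu> \<nu> *\<^sub>R hl_symfun q \<mu>))"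
    unfolding restrict_vars_sum to_frac_sum to_frac_restrict_scaleR
    by (rule sum.cong) (auto simp: rep partitions_of_def)
  finally show "restrict_vars N (elementary_sf r * hl_symfun q \<nu>)
      = restrict_vars N (\<Sum>\<mu>\<in>partitions_of (weight \<nu> + r). pieri q \<mu> \<nu> *\<^sub>R hl_symfun q \<mu>)"
    by simp
qed

text \<open>Repeated application of the Pieri rule to the function 1. This transfers the spanning
  property from the e-functions to the Hall--Littlewood functions, degree by degree.\<close>

lemma elem_list_in_span_hl:
  assumes q: "q > 1"
  shows "elem_list rs \<in> span (hl_symfun q ` partitions_of (sum_list rs))"
proof (induction rs)
  case Nil
  have "hl_symfun q 0 \<in> span (hl_symfun q ` partitions_of 0)"
    by (intro span_base imageI) (simp add: partitions_of_def)
  then show ?case by (simp add: elem_list_def hl_symfun_0[OF q])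
next
  case (Cons r rs)
  let ?e = "\<lambda>f. elementary_sf r * f"
  have "?e (elem_list rs) \<in> ?e ` span (hl_symfun q ` partitions_of (sum_list rs))"
    using Cons by blast
  also have "\<dots> = span (?e ` hl_symfun q ` partitions_of (sum_list rs))"
    by (rule linear_span_image[OF linear_mult_left_symfun, symmetric])
  also have "\<dots> \<subseteq> span (hl_symfun q ` partitions_of (sum_list (r # rs)))"
  proof (rule span_minimal)
    show "?e ` hl_symfun q ` partitions_of (sum_list rs) \<subseteq> span (hl_symfun q ` partitions_of (sum_list (r # rs)))"
    proof (clarify)
      fix \<nu> assume "\<nu> \<in> partitions_of (sum_list rs)"
      then have \<nu>: "is_partition \<nu>" "weight \<nu> + r = sum_list (r # rs)" by (auto simp: partitions_of_def)
      show "?e (hl_symfun q \<nu>) \<in> span (hl_symfun q ` partitions_of (sum_list (r # rs)))"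
        unfolding hl_symfun_pieri[OF q \<nu>(1)] \<nu>(2) by (intro span_sum span_scale span_base) auto
    qed
  qed simp
  finally show ?case by (simp add: elem_list_def)
qed

lemma m_basis_in_span_hl:
  assumes q: "q > 1" and \<nu>: "is_partition \<nu>"
  shows "m_basis \<nu> \<in> span (hl_symfun q ` partitions_of (weight \<nu>))"
proof -
  have "e_basis ` partitions_of (weight \<nu>) \<subseteq> span (hl_symfun q ` partitions_of (weight \<nu>))"
  proof (rule image_subsetI)
    fix \<mu> assume "\<mu> \<in> partitions_of (weight \<nu>)"
    moreover obtain rs where "sum_list rs = weight \<mu>" "elem_list rs = e_basis \<mu>"
      using partition_as_list by metis
    ultimately show "e_basis \<mu> \<in> span (hl_symfun q ` partitions_of (weight \<nu>))"
      using elem_list_in_span_hl[OF q, of rs] by (simp add: partitions_of_def)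
  qed
  then have "span (e_basis ` partitions_of (weight \<nu>)) \<subseteq> span (hl_symfun q ` partitions_of (weight \<nu>))"
    by (simp add: span_minimal)
  then show ?thesis using m_basis_in_span_e[of \<nu> "weight \<nu>"] \<nu> by (auto simp: partitions_of_def)
qed

lemma graded_basis_hl_symfun: "q > 1 \<Longrightarrow> graded_basis (hl_symfun q)"
  by (rule graded_basisI) (use represents_hl_symfun m_basis_in_span_hl in \<open>auto simp: represents_hl_def\<close>)

lemma graded_basis_hall_littlewood_P:
  assumes q: "q > 1"
  shows "graded_basis (\<lambda>\<mu>. hall_littlewood_P \<mu> q)"
proof (rule graded_basisI)
  fix \<mu> assume \<mu>: "is_partition \<mu>"
  show "homogeneous (weight \<mu>) (hall_littlewood_P \<mu> q)"
    using represents_hl_symfun[OF q, of "conjugate \<mu>"] by (simp add: hall_littlewood_P_eq[OF q \<mu>] represents_hl_def)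
  have "hl_symfun q ` partitions_of (weight \<mu>) \<subseteq> (\<lambda>\<mu>. hall_littlewood_P \<mu> q) ` partitions_of (weight \<mu>)"
  proof (rule image_subsetI)
    fix \<nu> assume \<nu>: "\<nu> \<in> partitions_of (weight \<mu>)"
    then have "hl_symfun q \<nu> = hall_littlewood_P (conjugate \<nu>) q"
      by (simp add: hall_littlewood_P_eq[OF q] partitions_of_def)
    then show "hl_symfun q \<nu> \<in> (\<lambda>\<mu>. hall_littlewood_P \<mu> q) ` partitions_of (weight \<mu>)"
      using conjugate_in_partitions_of[OF \<nu>] by blast
  qed
  then show "m_basis \<mu> \<in> span ((\<lambda>\<mu>. hall_littlewood_P \<mu> q) ` partitions_of (weight \<mu>))"
    using m_basis_in_span_hl[OF q \<mu>] span_mono by blast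
qed

text \<open>As \<omega> is an isometry and W_\<nu> is \<omega> H with the conjugate label, the dual
  element is \<omega> P with the conjugate label; in the labelling of \<open>hl_symfun\<close> the
  two conjugations cancel.\<close>

lemma dual_q_whittaker_eq:
  assumes q: "q > 1" and \<mu>: "is_partition \<mu>"
  shows "dual_q_whittaker \<mu> q = omega (hl_symfun q \<mu>)"
  unfolding dual_q_whittaker_def
proof (rule dual_basis_eqI)
  note P = graded_basis_hall_littlewood_P[OF q]
  have W: "hall (omega g) (q_whittaker \<nu> q) = hall (hall_littlewood_H (conjugate \<nu>) q) g" for \<nu> g
    by (simp add: q_whittaker_def hall_omega_omega hall_commute)
  have dual: "hall (hall_littlewood_H (conjugate \<nu>) q) (hall_littlewood_P \<kappa> q) = of_bool (conjugate \<nu> = \<kappa>)"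
    if "is_partition \<kappa>" for \<nu> \<kappa>
    unfolding hall_littlewood_H_def by (rule hall_dual_basis[OF P _ that]) simp
  show "hall (omega (hl_symfun q \<mu>)) (q_whittaker \<nu> q) = of_bool (\<mu> = \<nu>)" if \<nu>: "is_partition \<nu>" for \<nu>
  proof -
    have "hl_symfun q \<mu> = hall_littlewood_P (conjugate \<mu>) q" using \<mu> by (simp add: hall_littlewood_P_eq[OF q])
    then have "hall (omega (hl_symfun q \<mu>)) (q_whittaker \<nu> q) = of_bool (conjugate \<nu> = conjugate \<mu>)"
      by (simp add: W dual)
    then show ?thesis using conjugate_inject[OF \<nu> \<mu>] by auto
  qed
  fix f g assume eq: "\<And>\<nu>. is_partition \<nu> \<Longrightarrow> hall f (q_whittaker \<nu> q) = hall g (q_whittaker \<nu> q)"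
  have eq': "hall (hall_littlewood_H \<kappa> q) (omega f) = hall (hall_littlewood_H \<kappa> q) (omega g)"
    if "is_partition \<kappa>" for \<kappa>
    using eq[of "conjugate \<kappa>"] W[of "omega f" "conjugate \<kappa>"] W[of "omega g" "conjugate \<kappa>"] that
    by (simp add: omega_omega)
  \<comment> \<open>Pairing with H_\<kappa> extracts the coordinate at P_\<kappa>. All coordinates
    of the difference vanish, so f is determined by its pairings with the q-Whittaker
    functions.\<close>
  have "omega f - omega g = 0"
  proof (rule ccontr)
    let ?b = "\<lambda>\<mu>. hall_littlewood_P \<mu> q"
    assume nz: "omega f - omega g \<noteq> 0"
    have "omega f - omega g \<in> span (?b ` Collect is_partition)" using P by (simp add: graded_basis_def)
    then obtain T c where T: "finite T" "T \<subseteq> ?b ` Collect is_partition" "omega f - omega g = (\<Sum>v\<in>T. c v *\<^sub>R v)"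
      unfolding span_explicit by blast
    have "c v = 0" if v: "v \<in> T" for v
    proof -
      obtain \<kappa> where \<kappa>: "is_partition \<kappa>" "v = ?b \<kappa>" using T(2) v by blast
      have H: "hall (hall_littlewood_H \<kappa> q) w = of_bool (w = v)" if w: "w \<in> T" for w
      proof -
        obtain \<rho> where \<rho>: "is_partition \<rho>" "w = ?b \<rho>" using T(2) w by blast
        have "inj_on ?b (Collect is_partition)" using P by (simp add: graded_basis_def)
        then have "w = v \<longleftrightarrow> \<rho> = \<kappa>" using \<kappa> \<rho> by (auto dest: inj_onD)
        then show ?thesis
          using dual[OF \<rho>(1), of "conjugate \<kappa>"] \<kappa>(1) \<rho>(2) by auto
      qed
      have "0 = hall (hall_littlewood_H \<kappa> q) (omega f - omega g)"
        using eq'[OF \<kappa>(1)] by (simp add: linear_diff[OF linear_hall_right])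
      also have "\<dots> = (\<Sum>w\<in>T. if w = v then c w else 0)"
        unfolding T(3) linear_sum[OF linear_hall_right] linear_scale[OF linear_hall_right]
        by (rule sum.cong) (auto simp: H)
      also have "\<dots> = c v" using T(1) v by simp
      finally show ?thesis by simp
    qed
    then show False using nz T(3) by simp
  qed
  then show "f = g" by (metis eq_iff_diff_eq_0 omega_omega)
qed

section \<open>The flag generating function\<close>

lemma flag_functional_exists:
  fixes \<Delta> :: "'a::{field,finite}^'n^'n"
  shows "\<exists>\<phi>. linear \<phi> \<and> (\<forall>\<mu>. is_partition \<mu> \<longrightarrow> \<phi> (hl_symfun (real CARD('a)) \<mu>)
    = (if weight \<mu> = vec.dim U then whittaker_coeff \<Delta> \<mu> U else 0))"
  by (rule graded_basis_extend[OF graded_basis_hl_symfun[OF card_field_gt_1]])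

text \<open>The functional \<open>f \<mapsto> \<langle>F_U, \<omega> f\<rangle>\<close>, where \<open>F_U\<close> is the flag generating function of \<open>\<Delta>\<close> on \<open>U\<close>.\<close>

definition flag_functional :: "'a::{field,finite}^'n^'n \<Rightarrow> ('a^'n) set \<Rightarrow> symfun \<Rightarrow> real"
  where "flag_functional \<Delta> U = (SOME \<phi>. linear \<phi> \<and>
    (\<forall>\<mu>. is_partition \<mu> \<longrightarrow> \<phi> (hl_symfun (real CARD('a)) \<mu>)
      = (if weight \<mu> = vec.dim U then whittaker_coeff \<Delta> \<mu> U else 0)))"

lemma linear_flag_functional: "linear (flag_functional \<Delta> U)"
  and flag_functional_hl: "is_partition \<mu> \<Longrightarrow> flag_functional (\<Delta> :: 'a::{field,finite}^'n^'n) U (hl_symfun (real CARD('a)) \<mu>)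
    = (if weight \<mu> = vec.dim U then whittaker_coeff \<Delta> \<mu> U else 0)"
  using someI_ex[OF flag_functional_exists[of U \<Delta>], folded flag_functional_def] by blast+

text \<open>Tested on Hall--Littlewood functions: the Pieri rule expands the left side,
  \<open>whittaker_coeff_pieri\<close> sums it to one coefficient of U, and
  \<open>whittaker_coeff_split\<close> distributes that over the invariant subspaces. Both sides
  vanish unless |\<nu>| + r = dim U.\<close>

lemma flag_functional_mult_elementary:
  fixes \<Delta> :: "'a::{field,finite}^'n^'n"
  assumes U: "invariant_subspace \<Delta> U"
  shows "flag_functional \<Delta> U (elementary_sf r * f)
    = (\<Sum>U' | invariant_subspace \<Delta> U' \<and> U' \<subseteq> U \<and> vec.dim U = vec.dim U' + r. flag_functional \<Delta> U' f)"
proof -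
  let ?q = "real CARD('a)"
  let ?I = "{U'. invariant_subspace \<Delta> U' \<and> U' \<subseteq> U \<and> vec.dim U = vec.dim U' + r}"
  let ?\<phi> = "\<lambda>f. flag_functional \<Delta> U (elementary_sf r * f)" and ?\<psi> = "\<lambda>f. \<Sum>U'\<in>?I. flag_functional \<Delta> U' f"
  note q = card_field_gt_1[where 'a='a]
  show ?thesis
  proof (rule graded_basis_linear_eq[OF graded_basis_hl_symfun[OF q], of ?\<phi> ?\<psi>])
    show "linear ?\<phi>"
      using linear_compose[OF linear_mult_left_symfun linear_flag_functional] by (simp add: comp_def)
    show "linear ?\<psi>" by (intro linear_compose_sum ballI linear_flag_functional)
    fix \<nu> assume \<nu>: "is_partition \<nu>"
    have lhs: "?\<phi> (hl_symfun ?q \<nu>) = (\<Sum>\<mu>\<in>partitions_of (weight \<nu> + r). pieri ?q \<mu> \<nu> *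
        (if weight \<nu> + r = vec.dim U then whittaker_coeff \<Delta> \<mu> U else 0))"
      unfolding hl_symfun_pieri[OF q \<nu>] linear_sum[OF linear_flag_functional] linear_scale[OF linear_flag_functional]
      by (rule sum.cong) (auto simp: flag_functional_hl partitions_of_def)
    show "?\<phi> (hl_symfun ?q \<nu>) = ?\<psi> (hl_symfun ?q \<nu>)"
    proof (cases "weight \<nu> + r = vec.dim U")
      case True
      have I: "?I = invariant_subspaces \<Delta> U (weight \<nu>)"
        using True by (auto simp: invariant_subspaces_def)
      have "?\<phi> (hl_symfun ?q \<nu>) = whittaker_coeff \<Delta> \<nu> U"
        using whittaker_coeff_pieri[OF U \<nu>] True unfolding lhs by simp
      also have "\<dots> = (\<Sum>U'\<in>?I. whittaker_coeff \<Delta> \<nu> U')"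
        unfolding I by (rule whittaker_coeff_split[OF U, symmetric])
      also have "\<dots> = ?\<psi> (hl_symfun ?q \<nu>)"
        by (rule sum.cong) (use True in \<open>auto simp: flag_functional_hl[OF \<nu>]\<close>)
      finally show ?thesis .
    next
      case False
      then show ?thesis unfolding lhs by (auto simp: flag_functional_hl[OF \<nu>] intro!: sum.neutral[symmetric])
    qed
  qed
qed

lemma whittaker_coeff_0_zero: "whittaker_coeff \<Delta> 0 {0} = 1"
proof -
  have "vec.subspace W \<and> W \<subseteq> {0} \<longleftrightarrow> W = {0}" for W :: "('a^'b) set"
    using vec.subspace_0 by auto
  moreover have "weight (profile \<Delta> {0}) \<le> 0"
    using weight_profile_le[OF invariant_subspace_zero, of "{0}" \<Delta>] by simp
  then have "profile \<Delta> {0} = 0" by simp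
  ultimately have "{W \<in> subspaces {0}. profile \<Delta> W = 0} = {{0}}"
    by (auto simp: subspaces_def)
  moreover have "pm_tail 0 = 0" by (rule poly_mapping_eqI) simp
  ultimately show ?thesis by (simp add: whittaker_coeff_def profile_count_def choose_weight_def)
qed

text \<open>Multiplication by e_r satisfies the same recursion as appending a last step of dimension
  r to a flag; the empty list reduces to the value at the constant 1.\<close>

lemma flag_functional_elem_list:
  fixes \<Delta> :: "'a::{field,finite}^'n^'n"
  assumes "invariant_subspace \<Delta> U"
  shows "flag_functional \<Delta> U (elem_list \<alpha>) = real (card (flags_to \<Delta> U \<alpha>))"
  using assms
proof (induction \<alpha> arbitrary: U rule: rev_induct)
  case Nil
  have "flag_functional \<Delta> U (elem_list []) = flag_functional \<Delta> U (hl_symfun (real CARD('a)) 0)"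
    by (simp add: elem_list_def hl_symfun_0[OF card_field_gt_1])
  also have "\<dots> = of_bool (U = {0})"
  proof (cases "U = {0}")
    case False
    moreover have "0 \<in> U" using Nil by (simp add: invariant_subspace_def vec.subspace_0)
    ultimately have "vec.dim U \<noteq> 0" using vec.dim_eq_0 by blast
    then show ?thesis using False by (simp add: flag_functional_hl)
  qed (simp add: flag_functional_hl whittaker_coeff_0_zero)
  finally show ?case by (simp add: card_flags_to_Nil)
next
  case (snoc r \<alpha>)
  have "elem_list (\<alpha> @ [r]) = elementary_sf r * elem_list \<alpha>"
    by (simp add: elem_list_def mult.commute)
  then have "flag_functional \<Delta> U (elem_list (\<alpha> @ [r]))
      = (\<Sum>U' | invariant_subspace \<Delta> U' \<and> U' \<subseteq> U \<and> vec.dim U = vec.dim U' + r. flag_functional \<Delta> U' (elem_list \<alpha>))"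
    using flag_functional_mult_elementary[OF snoc.prems] by simp
  also have "\<dots> = real (card (flags_to \<Delta> U (\<alpha> @ [r])))"
    unfolding card_flags_to_snoc[OF snoc.prems] of_nat_sum by (rule sum.cong) (use snoc.IH in auto)
  finally show ?case .
qed

lemma elem_list_lookup: "elem_list (map (lookup \<alpha>) [0..<Poly_Mapping.degree \<alpha>]) = e_basis \<alpha>"
proof -
  let ?d = "Poly_Mapping.degree \<alpha>"
  have K: "keys \<alpha> \<subseteq> {..<?d}"
    using beyond_degree_lookup_zero[of \<alpha>] by (metis in_keys_iff lessThan_iff not_less subsetI)
  have "elem_list (map (lookup \<alpha>) [0..<?d]) = (\<Prod>i<?d. elementary_sf (lookup \<alpha> i))"
    using prod.distinct_set_conv_list[of "[0..<?d]" "\<lambda>i. elementary_sf (lookup \<alpha> i)"]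
    by (simp add: elem_list_def comp_def atLeast0LessThan)
  also have "\<dots> = e_basis \<alpha>"
    unfolding e_basis_def using K by (intro prod.mono_neutral_right) (auto simp: in_keys_iff elementary_0)
  finally show ?thesis .
qed

lemma sf_coeff_flag_gf:
  fixes \<Delta> :: "'a::{field,finite}^'n^'n"
  shows "sf_coeff (flag_gf \<Delta>) \<alpha> = (if weight \<alpha> = CARD('n) then flag_functional \<Delta> UNIV (e_basis \<alpha>) else 0)"
proof -
  let ?F = "\<lambda>\<alpha>. if weight \<alpha> = CARD('n) then flag_functional \<Delta> UNIV (e_basis \<alpha>) else 0"
  have inv: "invariant_subspace \<Delta> UNIV" by (simp add: invariant_subspace_def)
  have X: "(if weight \<alpha> = CARD('n) then real (X_flags \<Delta> (map (lookup \<alpha>) [0..<Poly_Mapping.degree \<alpha>])) else 0) = ?F \<alpha>"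
    for \<alpha>
    using flag_functional_elem_list[OF inv] by (simp add: X_flags_eq elem_list_lookup[symmetric])
  have "bounded_degree ?F" by (auto simp: bounded_degree_def)
  moreover have "e_basis (Poly_Mapping.map_key \<pi> \<alpha>) = e_basis \<alpha>" if "bij \<pi>" for \<pi> \<alpha>
    unfolding e_basis_def by (rule prod_keys_conjugate_eq) (rule conjugate_map_key[OF that])
  then have "symmetric_series ?F" by (simp add: symmetric_series_def weight_map_key)
  ultimately show ?thesis unfolding flag_gf_def X by (simp add: Abs_symfun_inverse)
qed

text \<open>On e_\<mu> the left side is the pairing with h_\<mu>, hence the coefficient of F at
  \<mu>. In a degree other than n both sides are zero, the right one because e_\<mu> lies in the
  span of Hall--Littlewood functions of that degree.\<close>

lemma hall_flag_gf_omega: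
  fixes \<Delta> :: "'a::{field,finite}^'n^'n"
  shows "hall (flag_gf \<Delta>) (omega f) = flag_functional \<Delta> UNIV f"
proof (rule graded_basis_linear_eq[OF graded_basis_e, of "\<lambda>f. hall (flag_gf \<Delta>) (omega f)"])
  show "linear (\<lambda>f. hall (flag_gf \<Delta>) (omega f))"
    using linear_compose[OF linear_omega linear_hall_right] by (simp add: comp_def)
  show "linear (flag_functional \<Delta> UNIV)" by (rule linear_flag_functional)
  fix \<mu> assume \<mu>: "is_partition \<mu>"
  show "hall (flag_gf \<Delta>) (omega (e_basis \<mu>)) = flag_functional \<Delta> UNIV (e_basis \<mu>)"
  proof (cases "weight \<mu> = CARD('n)")
    case False
    let ?q = "real CARD('a)"
    have "e_basis \<mu> \<in> span (hl_symfun ?q ` partitions_of (weight \<mu>))"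
    proof (rule homogeneous_in_span[OF graded_basis_hl_symfun[OF card_field_gt_1] homogeneous_e_basis])
      fix \<nu> assume "\<nu> \<in> partitions_of (weight \<mu>)"
      then show "m_basis \<nu> \<in> span (hl_symfun ?q ` partitions_of (weight \<mu>))"
        using m_basis_in_span_hl[OF card_field_gt_1, of \<nu>] by (simp add: partitions_of_def)
    qed
    moreover have "flag_functional \<Delta> UNIV v = 0" if "v \<in> hl_symfun ?q ` partitions_of (weight \<mu>)" for v
      using that False by (auto simp: flag_functional_hl partitions_of_def vec_dim_card simp del: vec.dim_UNIV)
    ultimately have "flag_functional \<Delta> UNIV (e_basis \<mu>) = 0"
      using linear_eq_0_on_span[OF linear_flag_functional] by blast
    then show ?thesis using False \<mu> by (simp add: omega_e_basis hall_h_basis sf_coeff_flag_gf)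
  qed (use \<mu> in \<open>simp add: omega_e_basis hall_h_basis sf_coeff_flag_gf\<close>)
qed

lemma hall_flag_gf_dual_q_whittaker:
  fixes \<Delta> :: "'a::{field,finite}^'n^'n"
  assumes "\<mu> \<in> partitions_of CARD('n)"
  shows "hall (flag_gf \<Delta>) (dual_q_whittaker \<mu> (real CARD('a))) = whittaker_coeff \<Delta> \<mu> UNIV"
proof -
  have \<mu>: "is_partition \<mu>" "weight \<mu> = CARD('n)" using assms by (auto simp: partitions_of_def)
  show ?thesis
    unfolding dual_q_whittaker_eq[OF card_field_gt_1 \<mu>(1)] hall_flag_gf_omega flag_functional_hl[OF \<mu>(1)]
    using \<mu>(2) by (simp add: vec_dim_card del: vec.dim_UNIV)
qed

theorem theorem7p1:
  fixes \<Delta> :: "'a::{field,finite}^'n^'n"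
    and k l :: nat
  assumes "k > 0" and "l > 0"
  shows "krylov_prob k l \<Delta> = hall (flag_gf \<Delta>) (krylov_G (real CARD('a)) CARD('n) k l)"
proof -
  let ?q = "real CARD('a)" and ?M = "{\<mu>. \<mu> \<in> partitions_of CARD('n) \<and> num_parts \<mu> \<le> l}"
  let ?c = "\<lambda>\<mu>. (-1) ^ (CARD('n) - lookup \<mu> 0) * (?q - 1) ^ lookup \<mu> 0
        * ?q ^ (\<Sum>j\<in>keys \<mu>. lookup \<mu> j choose 2) * q_binomial ?q k (lookup \<mu> 0) * q_fact ?q (lookup \<mu> 0)"
  have q: "?q > 0" using card_field_gt_1[where 'a='a] by linarith
  have "hall (flag_gf \<Delta>) (krylov_G ?q CARD('n) k l)
      = 1 / ?q ^ (CARD('n) * k) * (\<Sum>\<mu>\<in>?M. ?c \<mu> * hall (flag_gf \<Delta>) (dual_q_whittaker \<mu> ?q))"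
    unfolding krylov_G_def linear_scale[OF linear_hall_right] linear_sum[OF linear_hall_right] by simp
  also have "(\<Sum>\<mu>\<in>?M. ?c \<mu> * hall (flag_gf \<Delta>) (dual_q_whittaker \<mu> ?q))
      = (\<Sum>\<mu>\<in>?M. real (profile_count \<Delta> \<mu> UNIV) * (\<Prod>i<lookup \<mu> 0. ?q ^ k - ?q ^ i))"
  proof (rule sum.cong[OF refl])
    fix \<mu> assume "\<mu> \<in> ?M"
    then have \<mu>: "\<mu> \<in> partitions_of CARD('n)" "weight \<mu> = CARD('n)" by (auto simp: partitions_of_def)
    \<comment> \<open>Separating the first part shows the cancellation: the power of q from the
      later parts meets its inverse in \<open>whittaker_coeff\<close>, the two equal signs multiply
      to 1, and the rest is the right side of \<open>prod_power_diff\<close> for n = k and d =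
      \<mu>_1.\<close>
    have "(\<Sum>j\<in>keys \<mu>. lookup \<mu> j choose 2) = (lookup \<mu> 0 choose 2) + choose_weight (pm_tail \<mu>)"
      using choose_weight_pm_tail[of \<mu>] by (simp add: choose_weight_def)
    then show "?c \<mu> * hall (flag_gf \<Delta>) (dual_q_whittaker \<mu> ?q)
        = real (profile_count \<Delta> \<mu> UNIV) * (\<Prod>i<lookup \<mu> 0. ?q ^ k - ?q ^ i)"
      unfolding hall_flag_gf_dual_q_whittaker[OF \<mu>(1)] prod_power_diff[OF q] whittaker_coeff_def \<mu>(2)
      using q by (simp add: power_add mult_ac flip: power_mult_distrib)
  qed
  finally show ?thesis unfolding krylov_prob_eq[OF \<open>l > 0\<close>] by simp
qed

end
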